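(* Let $W$ be a weight on $\mathbb{R}$. Polynomials are not dense in $C_W$ if and only if there exists a balanced sequence $\Lambda=\{\lambda_n\}$ of zero density such that $\Lambda$ and its characteristic sequence $P=\{p_n\}$ satisfy $$\sum_n W(\lambda_n)\exp(p_n)<\infty .$$
   Context: **Weights and $C_W$.** A weight is a lower semi-continuous function $W:\mathbb{R}\to[1,\infty]$ (the value $+\infty$ is allowed, with the convention $c/\infty=0$ for finite $c$) such that for every $n\in\mathbb{N}$, $x^n=o(W(x))$ as $|x|\to\infty$. For continuous $f:\mathbb{R}\to\mathbb{C}$ with $f(x)/W(x)\to0$ as $x\to\pm\infty$ put $\|f\|_W=\sup_{\mathbb{R}}|f|/W$; this is a semi-norm. $C_W$ is the space obtained by identifying $f\sim g$ when $\|f-g\|_W=0$ and then completing. Polynomials are not dense in $C_W$ if and only if there are a continuous $g$ with $g/W\to0$ at $\pm\infty$ and $\varepsilon>0$ with $\|g-p\|_W>\varepsilon$ for every polynomial $p$. **Sequences.** A discrete sequence is an infinite sequence of distinct real numbers without finite accumulation points. It is always enumerated in the natural order: $\lambda_n<\lambda_{n+1}$, non-negative elements have non-negative integer indices and negative elements have negative indices. So a sequence unbounded in both directions is indexed by $\mathbb{Z}$ with $\lambda_{-1}<0\le\lambda_0$; a sequence bounded from below is indexed by $n\ge -N$, where $N$ is the number of its negative elements; a sequence bounded from above is indexed by $n<N$, where $N$ is the number of its non-negative elements. Sums over $n$ or $k$ run only over indices that occur. $\Lambda$ has upper density $d$ if $\limsup_{A\to\infty}\#[\Lambda\cap(-A,A)]/(2A)=d$;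 it has zero density if $d=0$. A discrete sequence $\Lambda=\{\lambda_n\}$ is balanced if the limit $\lim_{N\to\infty}\sum_{|n|<N}\frac{\lambda_n}{1+\lambda_n^2}$ exists (as a finite number). If $\Lambda$ is balanced and of finite upper density, its characteristic sequence $P=\{p_n\}$ is $$p_n=\frac12\left[\log(1+\lambda_n^2)+\lim_{N\to\infty}\sum_{0<|n-k|<N}\log\frac{1+\lambda_k^2}{(\lambda_k-\lambda_n)^2}\right].$$ (The limit exists for balanced sequences of finite upper density.) *)

theory Defs
  imports "HOL-Analysis.Analysis" "HOL-Computational_Algebra.Polynomial"
begin

section \<open>Completion of a metric space by classes of Cauchy sequences\<close>

context Metric_space
begin

definition cauchy_rel :: "((nat \<Rightarrow> 'a) \<times> (nat \<Rightarrow> 'a)) set" where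
  "cauchy_rel = {(s, t). MCauchy s \<and> MCauchy t \<and> (\<lambda>n. d (s n) (t n)) \<longlonglongrightarrow> 0}"

definition compl_space :: "(nat \<Rightarrow> 'a) set set" where
  "compl_space = {s. MCauchy s} // cauchy_rel"

text \<open>The value outside the space is irrelevant; the locale \<^locale>\<open>Metric_space\<close>
  asks for symmetry and non-negativity there too.\<close>
definition compl_dist :: "(nat \<Rightarrow> 'a) set \<Rightarrow> (nat \<Rightarrow> 'a) set \<Rightarrow> real" where
  "compl_dist S T =
     (if S \<in> compl_space \<and> T \<in> compl_space
      then lim (\<lambda>n. d ((SOME s. s \<in> S) n) ((SOME t. t \<in> T) n)) else 0)"

definition compl_embed :: "'a \<Rightarrow> (nat \<Rightarrow> 'a) set" where
  "compl_embed x = cauchy_rel `` {\<lambda>_. x}"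

lemma MCauchy_in: "MCauchy s \<Longrightarrow> s n \<in> M"
  by (auto simp: MCauchy_def)

lemma dist_diff_le:
  assumes "a \<in> M" "b \<in> M" "a' \<in> M" "b' \<in> M"
  shows "\<bar>d a b - d a' b'\<bar> \<le> d a a' + d b b'"
  using assms triangle[of a a' b] triangle[of a' b' b] triangle[of a' a b'] triangle[of a b b']
    commute[of a a'] commute[of b b']
  by (smt (verit))

lemma MCauchy_dist_convergent:
  assumes "MCauchy s" "MCauchy t"
  shows "convergent (\<lambda>n. d (s n) (t n))"
proof -
  have "Cauchy (\<lambda>n. d (s n) (t n))"
    unfolding Cauchy_def dist_real_def
  proof (intro allI impI)
    fix e :: real assume e: "e > 0"
    obtain N1 where N1: "\<And>n n'. N1 \<le> n \<Longrightarrow> N1 \<le> n' \<Longrightarrow> d (s n) (s n') < e/2"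
      using assms(1) e unfolding MCauchy_def by (meson half_gt_zero)
    obtain N2 where N2: "\<And>n n'. N2 \<le> n \<Longrightarrow> N2 \<le> n' \<Longrightarrow> d (t n) (t n') < e/2"
      using assms(2) e unfolding MCauchy_def by (meson half_gt_zero)
    show "\<exists>K. \<forall>m\<ge>K. \<forall>n\<ge>K. \<bar>d (s m) (t m) - d (s n) (t n)\<bar> < e"
    proof (intro exI allI impI)
      fix m n assume "m \<ge> max N1 N2" "n \<ge> max N1 N2"
      then show "\<bar>d (s m) (t m) - d (s n) (t n)\<bar> < e"
        using N1[of m n] N2[of m n] dist_diff_le[of "s m" "t m" "s n" "t n"]
          MCauchy_in[OF assms(1)] MCauchy_in[OF assms(2)] by force
    qed
  qed
  then show ?thesis by (simp add: Cauchy_convergent_iff)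
qed

lemma equiv_cauchy_rel: "equiv {s. MCauchy s} cauchy_rel"
proof (rule equivI)
  show "cauchy_rel \<subseteq> {s. MCauchy s} \<times> {s. MCauchy s}" by (auto simp: cauchy_rel_def)
  show "refl_on {s. MCauchy s} cauchy_rel"
    by (auto simp: refl_on_def cauchy_rel_def MCauchy_in)
  show "sym cauchy_rel"
    by (auto simp: sym_def cauchy_rel_def commute)
  show "trans cauchy_rel"
  proof (rule transI)
    fix s t u assume *: "(s, t) \<in> cauchy_rel" "(t, u) \<in> cauchy_rel"
    then have "(\<lambda>n. d (s n) (t n) + d (t n) (u n)) \<longlonglongrightarrow> 0"
      using tendsto_add[of "\<lambda>n. d (s n) (t n)" 0 sequentially "\<lambda>n. d (t n) (u n)" 0]
      by (auto simp: cauchy_rel_def)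
    then have "(\<lambda>n. d (s n) (u n)) \<longlonglongrightarrow> 0"
      by (rule tendsto_sandwich[OF _ _ tendsto_const, rotated 2])
         (use * in \<open>auto simp: cauchy_rel_def MCauchy_in intro!: always_eventually triangle\<close>)
    with * show "(s, u) \<in> cauchy_rel" by (auto simp: cauchy_rel_def)
  qed
qed

lemma compl_spaceE:
  assumes "S \<in> compl_space"
  obtains s where "MCauchy s" "S = cauchy_rel `` {s}"
  using assms by (auto simp: compl_space_def elim: quotientE)

lemma compl_spaceI: "MCauchy s \<Longrightarrow> cauchy_rel `` {s} \<in> compl_space"
  by (auto simp: compl_space_def intro: quotientI)

lemma compl_dist_tendsto:
  assumes "MCauchy s" "MCauchy t"
  shows "(\<lambda>n. d (s n) (t n)) \<longlonglongrightarrow> compl_dist (cauchy_rel `` {s}) (cauchy_rel `` {t})"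
proof -
  define s' where "s' = (SOME s'. s' \<in> cauchy_rel `` {s})"
  define t' where "t' = (SOME t'. t' \<in> cauchy_rel `` {t})"
  have "s \<in> cauchy_rel `` {s}" "t \<in> cauchy_rel `` {t}"
    using assms equiv_class_self[OF equiv_cauchy_rel] by auto
  then have "s' \<in> cauchy_rel `` {s}" "t' \<in> cauchy_rel `` {t}"
    unfolding s'_def t'_def by (metis someI)+
  then have st: "MCauchy s'" "MCauchy t'" "(\<lambda>n. d (s n) (s' n)) \<longlonglongrightarrow> 0" "(\<lambda>n. d (t n) (t' n)) \<longlonglongrightarrow> 0"
    by (auto simp: cauchy_rel_def)
  have eq: "compl_dist (cauchy_rel `` {s}) (cauchy_rel `` {t}) = lim (\<lambda>n. d (s' n) (t' n))"
    using assms by (simp add: compl_dist_def compl_spaceI s'_def t'_def)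
  have lim': "(\<lambda>n. d (s' n) (t' n)) \<longlonglongrightarrow> lim (\<lambda>n. d (s' n) (t' n))"
    using MCauchy_dist_convergent[OF st(1,2)] by (simp add: convergent_LIMSEQ_iff)
  have "(\<lambda>n. d (s n) (s' n) + d (t n) (t' n)) \<longlonglongrightarrow> 0"
    using tendsto_add[OF st(3,4)] by simp
  then have "(\<lambda>n. d (s n) (t n) - d (s' n) (t' n)) \<longlonglongrightarrow> 0"
    by (rule Lim_null_comparison[rotated])
       (use assms st in \<open>auto intro!: always_eventually dist_diff_le simp: MCauchy_in\<close>)
  from tendsto_add[OF this lim'] show ?thesis by (simp add: eq)
qed

lemma Metric_space_completion: "Metric_space compl_space compl_dist"
proof
  show "0 \<le> compl_dist S T" for S T
  proof (cases "S \<in> compl_space \<and> T \<in> compl_space")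
    case True
    then obtain s t where st: "MCauchy s" "MCauchy t" "S = cauchy_rel `` {s}" "T = cauchy_rel `` {t}"
      by (meson compl_spaceE)
    show ?thesis unfolding st
      by (rule LIMSEQ_le_const[OF compl_dist_tendsto[OF st(1,2)]]) auto
  qed (auto simp: compl_dist_def)
  show "compl_dist S T = compl_dist T S" for S T
    unfolding compl_dist_def by (simp add: commute conj_commute)
next
  fix S T assume "S \<in> compl_space" "T \<in> compl_space"
  then obtain s t where st: "MCauchy s" "MCauchy t" "S = cauchy_rel `` {s}" "T = cauchy_rel `` {t}"
    by (meson compl_spaceE)
  note lim = compl_dist_tendsto[OF st(1,2)]
  have "compl_dist S T = 0 \<longleftrightarrow> (\<lambda>n. d (s n) (t n)) \<longlonglongrightarrow> 0"
    unfolding st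
  proof
    assume "compl_dist (cauchy_rel `` {s}) (cauchy_rel `` {t}) = 0"
    with lim show "(\<lambda>n. d (s n) (t n)) \<longlonglongrightarrow> 0" unfolding st by simp
  next
    assume "(\<lambda>n. d (s n) (t n)) \<longlonglongrightarrow> 0"
    with lim show "compl_dist (cauchy_rel `` {s}) (cauchy_rel `` {t}) = 0"
      by (rule LIMSEQ_unique)
  qed
  also have "\<dots> \<longleftrightarrow> (s, t) \<in> cauchy_rel" using st by (simp add: cauchy_rel_def)
  also have "\<dots> \<longleftrightarrow> S = T"
    using eq_equiv_class_iff[OF equiv_cauchy_rel] st by simp
  finally show "compl_dist S T = 0 \<longleftrightarrow> S = T" .
next
  fix S T U assume "S \<in> compl_space" "T \<in> compl_space" "U \<in> compl_space"
  then obtain s t u where st: "MCauchy s" "MCauchy t" "MCauchy u"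
      "S = cauchy_rel `` {s}" "T = cauchy_rel `` {t}" "U = cauchy_rel `` {u}"
    by (meson compl_spaceE)
  show "compl_dist S U \<le> compl_dist S T + compl_dist T U" unfolding st
    by (rule LIMSEQ_le[OF compl_dist_tendsto[OF st(1,3)]
          tendsto_add[OF compl_dist_tendsto[OF st(1,2)] compl_dist_tendsto[OF st(2,3)]]])
       (use st in \<open>auto intro!: exI[of _ 0] triangle simp: MCauchy_in\<close>)
qed

lemma compl_embed_in: "x \<in> M \<Longrightarrow> compl_embed x \<in> compl_space"
  by (simp add: compl_embed_def compl_spaceI)

lemma compl_dist_embed:
  assumes "x \<in> M" "y \<in> M"
  shows "compl_dist (compl_embed x) (compl_embed y) = d x y"
proof -
  have "(\<lambda>_::nat. d x y) \<longlonglongrightarrow> compl_dist (compl_embed x) (compl_embed y)"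
    unfolding compl_embed_def using compl_dist_tendsto[of "\<lambda>_. x" "\<lambda>_. y"] assms by simp
  then show ?thesis by (simp add: LIMSEQ_const_iff)
qed

lemma compl_dist_embed_tail:
  assumes s: "MCauchy s" and e: "e > 0"
  shows "\<exists>N. \<forall>n\<ge>N. compl_dist (cauchy_rel `` {s}) (compl_embed (s n)) < e"
proof -
  obtain N where N: "\<And>n n'. N \<le> n \<Longrightarrow> N \<le> n' \<Longrightarrow> d (s n) (s n') < e/2"
    using s e unfolding MCauchy_def by (meson half_gt_zero)
  have "compl_dist (cauchy_rel `` {s}) (compl_embed (s n)) \<le> e/2" if "n \<ge> N" for n
    unfolding compl_embed_def
    by (rule LIMSEQ_le_const2[OF compl_dist_tendsto])
       (use s N that in \<open>auto simp: MCauchy_in intro!: exI[of _ N] less_imp_le\<close>)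
  then show ?thesis using e by (intro exI[of _ N]) force
qed

lemma compl_embed_dense:
  assumes "S \<in> compl_space" "e > 0"
  obtains x where "x \<in> M" "compl_dist S (compl_embed x) < e"
proof -
  obtain s where s: "MCauchy s" "S = cauchy_rel `` {s}" using assms(1) by (rule compl_spaceE)
  then obtain N where "\<forall>n\<ge>N. compl_dist S (compl_embed (s n)) < e"
    using compl_dist_embed_tail assms(2) by blast
  then show ?thesis using that[of "s N"] MCauchy_in s(1) by blast
qed

lemma mcomplete_completion: "Metric_space.mcomplete compl_space compl_dist"
proof -
  interpret C: Metric_space compl_space compl_dist by (rule Metric_space_completion)
  show ?thesis unfolding C.mcomplete_def
  proof (intro allI impI)
    fix F assume F: "C.MCauchy F"
    then have Fin: "F k \<in> compl_space" for k by (rule C.MCauchy_in)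
    have "\<exists>x. x \<in> M \<and> compl_dist (F k) (compl_embed x) < inverse (real (Suc k))" for k
      by (rule compl_embed_dense[OF Fin, of "inverse (real (Suc k))" k]) auto
    then have "\<forall>k. \<exists>x. x \<in> M \<and> compl_dist (F k) (compl_embed x) < inverse (real (Suc k))" by blast
    from choice[OF this] obtain x where x: "\<And>k. x k \<in> M"
        "\<And>k. compl_dist (F k) (compl_embed (x k)) < inverse (real (Suc k))" by blast
    have small: "\<exists>K. \<forall>k\<ge>K. compl_dist (F k) (compl_embed (x k)) < e" if "e > 0" for e :: real
    proof -
      obtain K where K: "inverse (real (Suc K)) < e" using reals_Archimedean[OF \<open>e > 0\<close>] by blast
      have "compl_dist (F k) (compl_embed (x k)) < e" if "k \<ge> K" for k
      proof -
        have "inverse (real (Suc k)) \<le> inverse (real (Suc K))"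
          using that by (intro le_imp_inverse_le) auto
        with x(2)[of k] K show ?thesis by linarith
      qed
      then show ?thesis by blast
    qed
    have xin: "compl_embed (x k) \<in> compl_space" for k by (simp add: compl_embed_in x)
    have xC: "MCauchy x" unfolding MCauchy_def
    proof (intro conjI allI impI)
      show "range x \<subseteq> M" using x by auto
      fix e :: real assume "e > 0"
      then have e3: "e/3 > 0" by simp
      obtain K where K: "\<And>k. k \<ge> K \<Longrightarrow> compl_dist (F k) (compl_embed (x k)) < e/3"
        using small[OF e3] by blast
      obtain N where N: "\<And>m n. N \<le> m \<Longrightarrow> N \<le> n \<Longrightarrow> compl_dist (F m) (F n) < e/3"
        using F e3 unfolding C.MCauchy_def by meson
      have "d (x m) (x n) < e" if "max K N \<le> m" "max K N \<le> n" for m n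
      proof -
        have "d (x m) (x n) = compl_dist (compl_embed (x m)) (compl_embed (x n))"
          by (simp add: compl_dist_embed x)
        also have "\<dots> \<le> compl_dist (compl_embed (x m)) (F m) + compl_dist (F m) (compl_embed (x n))"
          by (intro C.triangle xin Fin)
        also have "\<dots> \<le> compl_dist (compl_embed (x m)) (F m) +
             (compl_dist (F m) (F n) + compl_dist (F n) (compl_embed (x n)))"
          by (intro add_left_mono C.triangle xin Fin)
        also have "\<dots> < e"
          using K[of m] K[of n] N[of m n] that C.commute[of "compl_embed (x m)" "F m"] by simp
        finally show ?thesis .
      qed
      then show "\<exists>N. \<forall>n n'. N \<le> n \<longrightarrow> N \<le> n' \<longrightarrow> d (x n) (x n') < e" by blast
    qed
    let ?X = "cauchy_rel `` {x}"
    have X: "?X \<in> compl_space" using xC by (rule compl_spaceI)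
    have "\<exists>N. \<forall>n\<ge>N. F n \<in> compl_space \<and> compl_dist (F n) ?X < e" if "e > 0" for e :: real
    proof -
      have e2: "e/2 > 0" using that by simp
      obtain K where K: "\<And>k. k \<ge> K \<Longrightarrow> compl_dist (F k) (compl_embed (x k)) < e/2"
        using small[OF e2] by blast
      obtain N where N: "\<And>k. k \<ge> N \<Longrightarrow> compl_dist ?X (compl_embed (x k)) < e/2"
        using compl_dist_embed_tail[OF xC e2] by blast
      have "compl_dist (F n) ?X < e" if "n \<ge> max K N" for n
        using C.triangle[OF Fin xin X, of n n] K[of n] N[of n] that
          C.commute[of ?X "compl_embed (x n)"] by simp
      then show ?thesis using Fin by blast
    qed
    then have "limitin C.mtopology F ?X sequentially"
      using X by (simp add: C.limit_metric_sequentially)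
    then show "\<exists>X. limitin C.mtopology F X sequentially" by blast
  qed
qed

lemma dense_completion_iff:
  assumes A: "A \<subseteq> M"
  shows "Metric_space.mtopology compl_space compl_dist closure_of (compl_embed ` A) = compl_space
     \<longleftrightarrow> (\<forall>x\<in>M. \<forall>e>0. \<exists>a\<in>A. d x a < e)" (is "?L \<longleftrightarrow> ?R")
proof -
  interpret C: Metric_space compl_space compl_dist by (rule Metric_space_completion)
  have Ain: "compl_embed a \<in> compl_space" if "a \<in> A" for a
    using compl_embed_in[OF subsetD[OF A that]] .
  have "?L \<longleftrightarrow> (\<forall>S\<in>compl_space. \<forall>e>0. \<exists>a\<in>A. compl_dist S (compl_embed a) < e)"
  proof -
    have "C.mtopology closure_of (compl_embed ` A) =
        {S \<in> compl_space. \<forall>e>0. \<exists>a\<in>A. compl_dist S (compl_embed a) < e}"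
      unfolding C.metric_closure_of
      by (rule Collect_cong, rule conj_cong[OF refl]) (simp add: Ain)
    then show ?thesis by (simp only: set_eq_iff mem_Collect_eq) blast
  qed
  also have "\<dots> \<longleftrightarrow> ?R"
  proof (intro iffI ballI allI impI)
    fix x and e :: real
    assume *: "\<forall>S\<in>compl_space. \<forall>e>0. \<exists>a\<in>A. compl_dist S (compl_embed a) < e" "x \<in> M" "e > 0"
    then obtain a where "a \<in> A" "compl_dist (compl_embed x) (compl_embed a) < e"
      using compl_embed_in by blast
    moreover have "compl_dist (compl_embed x) (compl_embed a) = d x a"
      using compl_dist_embed *(2) \<open>a \<in> A\<close> A by blast
    ultimately show "\<exists>a\<in>A. d x a < e" by metis
  next
    fix S and e :: real
    assume *: "?R" "S \<in> compl_space" "e > 0"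
    then obtain x where x: "x \<in> M" "compl_dist S (compl_embed x) < e/2"
      using compl_embed_dense[of S "e/2"] by auto
    obtain a where a: "a \<in> A" "d x a < e/2" using *(1,3) x(1) by (meson half_gt_zero)
    have "compl_dist S (compl_embed a) < e"
      using C.triangle[OF *(2) compl_embed_in[OF x(1)] Ain[OF a(1)]] x a A
        compl_dist_embed[of x a] by auto
    with a show "\<exists>a\<in>A. compl_dist S (compl_embed a) < e" by blast
  qed
  finally show ?thesis .
qed

end


section \<open>Weights and the space \<open>C\<^sub>W\<close>\<close>

text \<open>On \<^typ>\<open>ennreal\<close> we have \<open>c / \<infinity> = 0\<close>. The filter \<^term>\<open>at_infinity :: real filter\<close>
  covers both ends of the line.\<close>

definition weight :: "(real \<Rightarrow> ennreal) \<Rightarrow> bool" where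
  "weight W \<longleftrightarrow>
     (\<forall>a. open {x. a < W x}) \<and>
     (\<forall>x. 1 \<le> W x) \<and>
     (\<forall>n::nat. ((\<lambda>x. ennreal (\<bar>x\<bar> ^ n) / W x) \<longlongrightarrow> 0) at_infinity)"

definition CW_fun :: "(real \<Rightarrow> ennreal) \<Rightarrow> (real \<Rightarrow> complex) set" where
  "CW_fun W = {f. continuous_on UNIV f \<and>
                  ((\<lambda>x. ennreal (cmod (f x)) / W x) \<longlongrightarrow> 0) at_infinity}"

definition Wnorm :: "(real \<Rightarrow> ennreal) \<Rightarrow> (real \<Rightarrow> complex) \<Rightarrow> ennreal" where
  "Wnorm W f = (SUP x. ennreal (cmod (f x)) / W x)"

definition CW_rel :: "(real \<Rightarrow> ennreal) \<Rightarrow> ((real \<Rightarrow> complex) \<times> (real \<Rightarrow> complex)) set" where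
  "CW_rel W = {(f, g). f \<in> CW_fun W \<and> g \<in> CW_fun W \<and> Wnorm W (\<lambda>x. f x - g x) = 0}"

text \<open>The seminormed space modulo \<open>f \<sim> g\<close>, before completion.\<close>

definition CW_quot :: "(real \<Rightarrow> ennreal) \<Rightarrow> (real \<Rightarrow> complex) set set" where
  "CW_quot W = CW_fun W // CW_rel W"

definition CW_quot_dist ::
    "(real \<Rightarrow> ennreal) \<Rightarrow> (real \<Rightarrow> complex) set \<Rightarrow> (real \<Rightarrow> complex) set \<Rightarrow> real" where
  "CW_quot_dist W F G = enn2real (Wnorm W (\<lambda>x. (SOME f. f \<in> F) x - (SOME g. g \<in> G) x))"

definition CW :: "(real \<Rightarrow> ennreal) \<Rightarrow> (nat \<Rightarrow> (real \<Rightarrow> complex) set) set set" where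
  "CW W = Metric_space.compl_space (CW_quot W) (CW_quot_dist W)"

definition CW_topology :: "(real \<Rightarrow> ennreal) \<Rightarrow> (nat \<Rightarrow> (real \<Rightarrow> complex) set) set topology" where
  "CW_topology W =
     Metric_space.mtopology (CW W) (Metric_space.compl_dist (CW_quot W) (CW_quot_dist W))"

definition CW_embed ::
    "(real \<Rightarrow> ennreal) \<Rightarrow> (real \<Rightarrow> complex) \<Rightarrow> (nat \<Rightarrow> (real \<Rightarrow> complex) set) set" where
  "CW_embed W f = Metric_space.compl_embed (CW_quot W) (CW_quot_dist W) (CW_rel W `` {f})"

definition poly_fun :: "complex poly \<Rightarrow> real \<Rightarrow> complex" where
  "poly_fun p = (\<lambda>x. poly p (complex_of_real x))"

definition polys_dense :: "(real \<Rightarrow> ennreal) \<Rightarrow> bool" where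
  "polys_dense W \<longleftrightarrow> CW_topology W closure_of (CW_embed W ` range poly_fun) = CW W"

subsection \<open>The construction is sound, and density is approximation in the seminorm\<close>

lemma CW_fun_diff:
  assumes "f \<in> CW_fun W" "g \<in> CW_fun W"
  shows "(\<lambda>x. f x - g x) \<in> CW_fun W"
proof -
  have up: "((\<lambda>x. ennreal (cmod (f x)) / W x + ennreal (cmod (g x)) / W x) \<longlongrightarrow> 0) at_infinity"
    using assms tendsto_add[of "\<lambda>x. ennreal (cmod (f x)) / W x" 0 at_infinity
        "\<lambda>x. ennreal (cmod (g x)) / W x" 0] by (simp add: CW_fun_def)
  have le: "ennreal (cmod (f x - g x)) / W x
      \<le> ennreal (cmod (f x)) / W x + ennreal (cmod (g x)) / W x" for x
    unfolding divide_ennreal_def distrib_right[symmetric]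
    by (intro mult_right_mono) (auto simp flip: ennreal_plus intro!: ennreal_leI norm_triangle_ineq4)
  have "((\<lambda>x. ennreal (cmod (f x - g x)) / W x) \<longlongrightarrow> 0) at_infinity"
    by (rule tendsto_sandwich[OF _ _ tendsto_const up]) (simp_all add: le)
  with assms show ?thesis by (auto simp: CW_fun_def intro: continuous_on_diff)
qed

lemma Wnorm_finite:
  assumes W: "weight W" and f: "f \<in> CW_fun W"
  shows "Wnorm W f < \<infinity>"
proof -
  have "eventually (\<lambda>x. ennreal (cmod (f x)) / W x < 1) at_infinity"
    using f unfolding CW_fun_def by (auto intro: order_tendstoD)
  then obtain b where b: "\<And>x. b \<le> norm x \<Longrightarrow> ennreal (cmod (f x)) / W x < 1"
    unfolding eventually_at_infinity by blast
  have "compact (f ` cbox (-\<bar>b\<bar>) \<bar>b\<bar>)"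
    using f by (intro compact_continuous_image) (auto simp: CW_fun_def intro: continuous_on_subset)
  then obtain B where B: "\<And>x. x \<in> cbox (-\<bar>b\<bar>) \<bar>b\<bar> \<Longrightarrow> cmod (f x) \<le> B"
    by (metis bounded_iff compact_imp_bounded imageI)
  have "ennreal (cmod (f x)) / W x \<le> max 1 (ennreal B)" for x
  proof (cases "b \<le> norm x")
    case True
    then show ?thesis using b[of x] by (auto intro: less_imp_le max.coboundedI1)
  next
    case False
    have W1: "1 \<le> W x" using W by (simp add: weight_def)
    have "ennreal (cmod (f x)) * 1 \<le> ennreal (cmod (f x)) * W x"
      using W1 by (intro mult_left_mono) auto
    then have "ennreal (cmod (f x)) / W x \<le> ennreal (cmod (f x))"
      using less_le_trans[OF zero_less_one W1]
      by (intro divide_le_posI_ennreal) (simp_all add: mult.commute)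
    also have "\<dots> \<le> ennreal B"
    proof (rule ennreal_leI, rule B)
      show "x \<in> cbox (-\<bar>b\<bar>) \<bar>b\<bar>" using False by (simp add: abs_le_iff abs_if split: if_splits)
    qed
    finally show ?thesis by (rule max.coboundedI2)
  qed
  then have "Wnorm W f \<le> max 1 (ennreal B)"
    unfolding Wnorm_def by (intro SUP_least)
  also have "\<dots> < \<infinity>" by (auto simp: max_def)
  finally show ?thesis .
qed

lemma Wnorm_triangle: "Wnorm W (\<lambda>x. f x - h x) \<le> Wnorm W (\<lambda>x. f x - g x) + Wnorm W (\<lambda>x. g x - h x)"
  unfolding Wnorm_def
proof (rule SUP_least)
  fix x :: real
  have "cmod (f x - h x) \<le> cmod (f x - g x) + cmod (g x - h x)"
    using norm_triangle_ineq[of "f x - g x" "g x - h x"] by simp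
  then have "ennreal (cmod (f x - h x)) / W x
      \<le> ennreal (cmod (f x - g x)) / W x + ennreal (cmod (g x - h x)) / W x"
    unfolding divide_ennreal_def distrib_right[symmetric]
    by (intro mult_right_mono) (auto simp flip: ennreal_plus intro!: ennreal_leI)
  also have "\<dots> \<le> (SUP x. ennreal (cmod (f x - g x)) / W x) + (SUP x. ennreal (cmod (g x - h x)) / W x)"
    by (intro add_mono SUP_upper) auto
  finally show "ennreal (cmod (f x - h x)) / W x \<le> \<dots>" .
qed

lemma Wnorm_commute: "Wnorm W (\<lambda>x. f x - g x) = Wnorm W (\<lambda>x. g x - f x)"
  unfolding Wnorm_def by (simp add: norm_minus_commute)

lemma Wnorm_zero: "Wnorm W (\<lambda>x. f x - f x) = 0"
  unfolding Wnorm_def by (simp add: divide_ennreal_def)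

lemma equiv_CW_rel: "equiv (CW_fun W) (CW_rel W)"
proof (rule equivI)
  show "CW_rel W \<subseteq> CW_fun W \<times> CW_fun W" by (auto simp: CW_rel_def)
  show "refl_on (CW_fun W) (CW_rel W)"
    using Wnorm_zero by (auto simp: refl_on_def CW_rel_def)
  show "sym (CW_rel W)"
  proof (rule symI)
    fix f g assume "(f, g) \<in> CW_rel W"
    then show "(g, f) \<in> CW_rel W"
      using Wnorm_commute[of W f g] by (simp add: CW_rel_def)
  qed
  show "trans (CW_rel W)"
  proof (rule transI)
    fix f g h assume "(f, g) \<in> CW_rel W" "(g, h) \<in> CW_rel W"
    then show "(f, h) \<in> CW_rel W"
      using Wnorm_triangle[of W f h g] by (auto simp: CW_rel_def)
  qed
qed

lemma CW_quot_dist_eq: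
  assumes "f \<in> CW_fun W" "g \<in> CW_fun W"
  shows "CW_quot_dist W (CW_rel W `` {f}) (CW_rel W `` {g}) = enn2real (Wnorm W (\<lambda>x. f x - g x))"
proof -
  define f' where "f' = (SOME f'. f' \<in> CW_rel W `` {f})"
  define g' where "g' = (SOME g'. g' \<in> CW_rel W `` {g})"
  have "f \<in> CW_rel W `` {f}" "g \<in> CW_rel W `` {g}"
    using assms equiv_class_self[OF equiv_CW_rel] by auto
  then have "f' \<in> CW_rel W `` {f}" "g' \<in> CW_rel W `` {g}"
    unfolding f'_def g'_def by (metis someI)+
  then have 0: "Wnorm W (\<lambda>x. f x - f' x) = 0" "Wnorm W (\<lambda>x. g x - g' x) = 0"
    by (auto simp: CW_rel_def)
  have "Wnorm W (\<lambda>x. f' x - g' x) = Wnorm W (\<lambda>x. f x - g x)"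
  proof (rule antisym)
    show "Wnorm W (\<lambda>x. f' x - g' x) \<le> Wnorm W (\<lambda>x. f x - g x)"
      using Wnorm_triangle[of W f' g' f] Wnorm_triangle[of W f g' g] 0 Wnorm_commute[of W f f']
      by simp
    show "Wnorm W (\<lambda>x. f x - g x) \<le> Wnorm W (\<lambda>x. f' x - g' x)"
      using Wnorm_triangle[of W f g f'] Wnorm_triangle[of W f' g g'] 0 Wnorm_commute[of W g g']
      by simp
  qed
  then show ?thesis by (simp add: CW_quot_dist_def f'_def g'_def)
qed

lemma Metric_space_CW_quot:
  assumes W: "weight W"
  shows "Metric_space (CW_quot W) (CW_quot_dist W)"
proof
  show "0 \<le> CW_quot_dist W F G" for F G by (simp add: CW_quot_dist_def)
  show "CW_quot_dist W F G = CW_quot_dist W G F" for F G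
    unfolding CW_quot_dist_def using Wnorm_commute by metis
next
  fix F G assume "F \<in> CW_quot W" "G \<in> CW_quot W"
  then obtain f g where fg: "f \<in> CW_fun W" "g \<in> CW_fun W" "F = CW_rel W `` {f}" "G = CW_rel W `` {g}"
    by (auto simp: CW_quot_def elim!: quotientE)
  have "CW_quot_dist W F G = 0 \<longleftrightarrow> Wnorm W (\<lambda>x. f x - g x) = 0"
    using CW_quot_dist_eq[OF fg(1,2)] Wnorm_finite[OF W CW_fun_diff[OF fg(1,2)]]
    by (auto simp: fg(3,4) enn2real_eq_0_iff)
  also have "\<dots> \<longleftrightarrow> F = G"
    using eq_equiv_class_iff[OF equiv_CW_rel] fg by (simp add: CW_rel_def)
  finally show "CW_quot_dist W F G = 0 \<longleftrightarrow> F = G" .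
next
  fix F G H assume "F \<in> CW_quot W" "G \<in> CW_quot W" "H \<in> CW_quot W"
  then obtain f g h where fg: "f \<in> CW_fun W" "g \<in> CW_fun W" "h \<in> CW_fun W"
      "F = CW_rel W `` {f}" "G = CW_rel W `` {g}" "H = CW_rel W `` {h}"
    by (auto simp: CW_quot_def elim!: quotientE)
  have fin: "Wnorm W (\<lambda>x. f x - g x) < \<infinity>" "Wnorm W (\<lambda>x. g x - h x) < \<infinity>"
    by (intro Wnorm_finite[OF W] CW_fun_diff fg)+
  have "enn2real (Wnorm W (\<lambda>x. f x - h x))
      \<le> enn2real (Wnorm W (\<lambda>x. f x - g x) + Wnorm W (\<lambda>x. g x - h x))"
    using fin by (intro enn2real_mono Wnorm_triangle) auto
  also have "\<dots> = enn2real (Wnorm W (\<lambda>x. f x - g x)) + enn2real (Wnorm W (\<lambda>x. g x - h x))"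
    using fin by (intro enn2real_plus) auto
  finally show "CW_quot_dist W F H \<le> CW_quot_dist W F G + CW_quot_dist W G H"
    using fg by (simp add: CW_quot_dist_eq)
qed

lemma poly_fun_in_CW_fun:
  assumes W: "weight W"
  shows "poly_fun p \<in> CW_fun W"
proof -
  have le: "ennreal (cmod (poly_fun p x)) / W x
      \<le> (\<Sum>i\<le>degree p. ennreal (cmod (coeff p i)) * (ennreal (\<bar>x\<bar> ^ i) / W x))" for x
  proof -
    have "cmod (poly_fun p x) \<le> (\<Sum>i\<le>degree p. cmod (coeff p i) * \<bar>x\<bar> ^ i)"
      unfolding poly_fun_def poly_altdef
      by (rule order.trans[OF norm_sum]) (simp add: norm_mult norm_power)
    then have "ennreal (cmod (poly_fun p x)) \<le> ennreal (\<Sum>i\<le>degree p. cmod (coeff p i) * \<bar>x\<bar> ^ i)"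
      by (rule ennreal_leI)
    also have "\<dots> = (\<Sum>i\<le>degree p. ennreal (cmod (coeff p i)) * ennreal (\<bar>x\<bar> ^ i))"
      by (subst sum_ennreal[symmetric]) (auto simp: ennreal_mult)
    finally have "ennreal (cmod (poly_fun p x)) / W x
        \<le> (\<Sum>i\<le>degree p. ennreal (cmod (coeff p i)) * ennreal (\<bar>x\<bar> ^ i)) / W x"
      by (rule divide_right_mono_ennreal)
    then show ?thesis
      by (simp add: divide_ennreal_def sum_distrib_right mult.assoc)
  qed
  have up: "((\<lambda>x. \<Sum>i\<le>degree p. ennreal (cmod (coeff p i)) * (ennreal (\<bar>x\<bar> ^ i) / W x))
      \<longlongrightarrow> (\<Sum>i\<le>degree p. ennreal (cmod (coeff p i)) * 0)) at_infinity"
    using W by (intro tendsto_sum ennreal_tendsto_cmult) (auto simp: weight_def)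
  have "((\<lambda>x. ennreal (cmod (poly_fun p x)) / W x) \<longlongrightarrow> 0) at_infinity"
    by (rule tendsto_sandwich[OF _ _ tendsto_const up[simplified]]) (simp_all add: le)
  moreover have "continuous_on UNIV (poly_fun p)"
    unfolding poly_fun_def by (intro continuous_intros)
  ultimately show ?thesis by (simp add: CW_fun_def)
qed

lemma polys_dense_iff:
  assumes W: "weight W"
  shows "polys_dense W \<longleftrightarrow>
    (\<forall>g\<in>CW_fun W. \<forall>e>0. \<exists>p. Wnorm W (\<lambda>x. g x - poly_fun p x) < ennreal e)"
proof -
  interpret Q: Metric_space "CW_quot W" "CW_quot_dist W" by (rule Metric_space_CW_quot[OF W])
  let ?c = "\<lambda>f. CW_rel W `` {f}"
  have cin: "f \<in> CW_fun W \<Longrightarrow> ?c f \<in> CW_quot W" for f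
    by (simp add: CW_quot_def quotientI)
  have im: "CW_embed W ` range poly_fun = Q.compl_embed ` (\<lambda>p. ?c (poly_fun p)) ` UNIV"
    by (simp add: CW_embed_def image_image)
  have "polys_dense W \<longleftrightarrow>
      (\<forall>F\<in>CW_quot W. \<forall>e>0. \<exists>G\<in>(\<lambda>p. ?c (poly_fun p)) ` UNIV. CW_quot_dist W F G < e)"
    unfolding polys_dense_def CW_topology_def CW_def im
    by (rule Q.dense_completion_iff) (use poly_fun_in_CW_fun[OF W] cin in auto)
  also have "\<dots> \<longleftrightarrow> (\<forall>g\<in>CW_fun W. \<forall>e>0. \<exists>p. CW_quot_dist W (?c g) (?c (poly_fun p)) < e)"
    using cin by (auto simp: CW_quot_def elim!: quotientE)
  also have "\<dots> \<longleftrightarrow> (\<forall>g\<in>CW_fun W. \<forall>e>0. \<exists>p. Wnorm W (\<lambda>x. g x - poly_fun p x) < ennreal e)"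
  proof -
    have "CW_quot_dist W (?c g) (?c (poly_fun p)) < e
        \<longleftrightarrow> Wnorm W (\<lambda>x. g x - poly_fun p x) < ennreal e" if "g \<in> CW_fun W" "e > 0" for g p e
    proof -
      have "Wnorm W (\<lambda>x. g x - poly_fun p x) < \<infinity>"
        using that poly_fun_in_CW_fun[OF W] by (intro Wnorm_finite[OF W] CW_fun_diff)
      then show ?thesis
        using that CW_quot_dist_eq[OF that(1) poly_fun_in_CW_fun[OF W]]
        by (cases "Wnorm W (\<lambda>x. g x - poly_fun p x)") (auto simp: ennreal_less_iff)
    qed
    then show ?thesis by simp
  qed
  finally show ?thesis .
qed


section \<open>Discrete sequences\<close>

text \<open>A sequence is a set \<open>I\<close> of integer indices together with \<open>lam\<close>, whose values outside
  \<open>I\<close> are irrelevant. The sign condition forces \<open>N\<close> to be the number of negative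
  (for \<open>I = {- int N..}\<close>), respectively non-negative (for \<open>I = {..<int N}\<close>), elements.\<close>

definition discrete_seq :: "int set \<Rightarrow> (int \<Rightarrow> real) \<Rightarrow> bool" where
  "discrete_seq I lam \<longleftrightarrow>
     (I = UNIV \<or> (\<exists>N::nat. I = {- int N..}) \<or> (\<exists>N::nat. I = {..<int N})) \<and>
     strict_mono_on I lam \<and>
     (\<forall>n\<in>I. 0 \<le> lam n \<longleftrightarrow> 0 \<le> n) \<and>
     (\<forall>x. \<not> x islimpt lam ` I)"

definition upper_density :: "real set \<Rightarrow> ereal" where
  "upper_density L =
     Limsup at_top (\<lambda>A::real. ereal (real (card (L \<inter> {-A<..<A})) / (2 * A)))"

definition balanced :: "int set \<Rightarrow> (int \<Rightarrow> real) \<Rightarrow> bool" where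
  "balanced I lam \<longleftrightarrow>
     convergent (\<lambda>N::nat. \<Sum>n\<in>{n\<in>I. \<bar>n\<bar> < int N}. lam n / (1 + (lam n)\<^sup>2))"

definition char_seq :: "int set \<Rightarrow> (int \<Rightarrow> real) \<Rightarrow> int \<Rightarrow> real" where
  "char_seq I lam n =
     1/2 * (ln (1 + (lam n)\<^sup>2) +
       lim (\<lambda>N::nat. \<Sum>k\<in>{k\<in>I. 0 < \<bar>n - k\<bar> \<and> \<bar>n - k\<bar> < int N}.
                         ln ((1 + (lam k)\<^sup>2) / (lam k - lam n)\<^sup>2)))"

end

theory Submission
  imports Defs "HOL-Complex_Analysis.Complex_Analysis" "HOL-Real_Asymp.Real_Asymp"
begin

text \<open>If the sum converges, choose finite \<open>T \<subseteq> \<Lambda>\<close> exhausting \<open>\<Lambda>\<close> such that each \<open>y\<close> carries weight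
  \<open>O(exp p\<^sub>y)\<close> in the divided difference over \<open>T\<close>, normalized by \<open>\<Prod> sqrt (1 + y\<^sup>2)\<close>. These divided
  differences annihilate all polynomials of low degree and are uniformly bounded functionals on the
  weighted space, yet they do not tend to zero on a bump at a fixed point of \<open>\<Lambda>\<close>.

  Conversely, if polynomials are not dense, a Stone-Weierstrass argument shows that one of
  \<open>1 / (1 + x\<^sup>2)\<close> and \<open>x / (1 + x\<^sup>2)\<close> is not approximable. Near-best approximations of it by
  polynomials of degree \<open>n\<close> alternate on \<open>n + 2\<close> nodes \<open>Y\<^sub>n\<close>. With \<open>\<kappa>\<^sub>n = \<Sum> W(y) / \<bar>Q'(y)\<bar>\<close>, where
  \<open>Q\<close> has zeros \<open>Y\<^sub>n\<close>, the polynomial \<open>F\<^sub>n = \<kappa>\<^sub>n Q\<close> stays bounded at \<open>\<i>\<close> because the approximation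
  error does not vanish, while \<open>\<bar>F\<^sub>n(z)\<bar> \<ge> \<bar>Im z\<bar>\<close> by partial fractions, and
  \<open>\<Sum> W(y) / \<bar>F\<^sub>n'(y)\<bar> = 1\<close>. A normal families argument for \<open>1 / F\<^sub>n\<close> in the upper half-plane bounds
  the number of nodes in \<open>(-r, r)\<close> by \<open>o(r)\<close> uniformly in \<open>n\<close>, and the two bounds on \<open>F\<^sub>n\<close> then control
  the tails of \<open>\<Sum> y / (1 + y\<^sup>2)\<close>. The nodes therefore converge along a subsequence to a balanced
  sequence of zero density with \<open>exp p\<^sub>k \<le> C lim 1 / \<bar>F\<^sub>n'\<bar>\<close>, and lower semi-continuity of \<open>W\<close> carries
  the summability over to the limit.\<close>

section \<open>Lagrange interpolation and divided differences\<close>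

text \<open>\<open>W\<close> may jump and be infinite, so extremal problems are solved on finite
  sets and carried over to \<open>{x. W x < \<infinity>}\<close> with a small loss. The two
  resolvents are chosen because their divided differences are, up to sign, the imaginary and real
  parts of \<open>1 / Q(\<i>)\<close>, which turns the approximation error into a bound for
  \<open>F n\<close> at \<open>\<i>\<close>, and because \<open>1 + z^2\<close> times the error is a
  polynomial of modulus 1 at \<open>\<i>\<close>. For the node count, an approximant is compared not
  with its own \<open>F n\<close> but with the zero-free limit \<open>G\<close> of the reciprocals:
  a polynomial bounded by \<open>3 * w\<close> is dominated by \<open>F m\<close> for all large
  \<open>m\<close>, so \<open>\<bar>p G\<bar> \<le> 3 / Im z\<close> holds for all approximants at
  once. On \<open>Im z \<ge> 1\<close>, \<open>- ln \<bar>G\<bar>\<close> is nonnegative and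
  harmonic, hence linear in \<open>Im z\<close> up to \<open>o(y)\<close> along the imaginary axis.
  The linear part is divided out, and a Blaschke argument leaves \<open>o(r)\<close> zeros of the
  error, which separate the nodes.\<close>

definition nodal_deriv :: "'a::field set \<Rightarrow> 'a \<Rightarrow> 'a" where
  "nodal_deriv Y x = (\<Prod>y\<in>Y - {x}. x - y)"

text \<open>For \<open>x \<in> Y\<close> and \<open>Q\<close> the monic polynomial with zero set
  \<open>Y\<close>, this is \<open>Q / (X - x)\<close>, and \<open>nodal_deriv Y x\<close> is its
  value \<open>Q'(x)\<close> at \<open>x\<close>: the Lagrange basis before normalization.\<close>

definition nodal_basis :: "'a::field set \<Rightarrow> 'a \<Rightarrow> 'a poly" where
  "nodal_basis Y x = (\<Prod>y\<in>Y - {x}. [:-y, 1:])"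

lemma nodal_deriv_nonzero: "finite Y \<Longrightarrow> nodal_deriv Y x \<noteq> 0"
  by (auto simp: nodal_deriv_def)

lemma poly_nodal_basis: "poly (nodal_basis Y x) z = (\<Prod>y\<in>Y - {x}. z - y)"
  by (simp add: nodal_basis_def poly_prod)

lemma degree_nodal_basis: "degree (nodal_basis Y x) = card (Y - {x})"
  by (simp add: nodal_basis_def degree_prod_eq_sum_degree)

lemma coeff_nodal_basis: "coeff (nodal_basis Y x) (card (Y - {x})) = 1"
  using lead_coeff_prod[of "\<lambda>y. [:-y, 1:]" "Y - {x}"] degree_nodal_basis[of Y x]
  by (simp add: nodal_basis_def)

lemma poly_nodal_basis_eq:
  assumes "finite Y" "x \<in> Y" "z \<in> Y"
  shows "poly (nodal_basis Y x) z = (if z = x then nodal_deriv Y x else 0)"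
  using assms by (auto simp: poly_nodal_basis nodal_deriv_def)

lemma lagrange_interpolation:
  assumes Y: "finite Y" and p: "degree p < card Y"
  shows "p = (\<Sum>x\<in>Y. smult (poly p x / nodal_deriv Y x) (nodal_basis Y x))" (is "_ = ?q")
proof (rule poly_eqI_degree[of Y])
  fix z assume z: "z \<in> Y"
  have "poly ?q z = (\<Sum>x\<in>Y. if x = z then poly p z else 0)"
    unfolding poly_sum
    by (rule sum.cong) (use Y z in \<open>auto simp: poly_nodal_basis_eq nodal_deriv_nonzero\<close>)
  then show "poly p z = poly ?q z" using Y z by simp
next
  have "card Y > 0" using p by simp
  then have "degree ?q \<le> card Y - 1"
    by (intro degree_sum_le)
      (use Y in \<open>auto intro!: order.trans[OF degree_smult_le] simp: degree_nodal_basis\<close>)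
  then show "degree ?q < card Y" using \<open>card Y > 0\<close> by simp
qed (use p in simp)

text \<open>Compare coefficients of degree \<open>card Y - 1\<close> in the Lagrange formula: every
  basis polynomial is monic of that degree, and \<open>p\<close> has smaller degree. Both directions
  rest on this annihilation property.\<close>

lemma divided_difference_eq_0:
  assumes Y: "finite Y" and p: "degree p + 2 \<le> card Y"
  shows "(\<Sum>x\<in>Y. poly p x / nodal_deriv Y x) = 0"
proof -
  have "coeff p (card Y - 1) = (\<Sum>x\<in>Y. poly p x / nodal_deriv Y x * coeff (nodal_basis Y x) (card Y - 1))"
    using p by (subst lagrange_interpolation[OF Y]) (simp_all add: coeff_sum)
  also have "\<dots> = (\<Sum>x\<in>Y. poly p x / nodal_deriv Y x)"
  proof (rule sum.cong[OF refl])
    fix x assume "x \<in> Y"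
    then have "card Y - 1 = card (Y - {x})" using Y by simp
    then show "poly p x / nodal_deriv Y x * coeff (nodal_basis Y x) (card Y - 1) = poly p x / nodal_deriv Y x"
      by (simp only: coeff_nodal_basis) simp
  qed
  finally show ?thesis using p by (simp add: coeff_eq_0)
qed

lemma lagrange_partial_fractions:
  assumes Y: "finite Y" and p: "degree p < card Y" and z: "z \<notin> Y"
  shows "poly p z / (\<Prod>y\<in>Y. z - y) = (\<Sum>x\<in>Y. poly p x / (nodal_deriv Y x * (z - x)))"
proof -
  have nz: "(\<Prod>y\<in>Y. z - y) \<noteq> 0" using Y z by auto
  have "poly p z = (\<Sum>x\<in>Y. poly p x / nodal_deriv Y x * (\<Prod>y\<in>Y - {x}. z - y))"
    by (subst lagrange_interpolation[OF Y p]) (simp add: poly_sum poly_nodal_basis)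
  also have "\<dots> = (\<Sum>x\<in>Y. poly p x / (nodal_deriv Y x * (z - x))) * (\<Prod>y\<in>Y. z - y)"
    unfolding sum_distrib_right
  proof (rule sum.cong[OF refl])
    fix x assume x: "x \<in> Y"
    then have "(\<Prod>y\<in>Y. z - y) = (z - x) * (\<Prod>y\<in>Y - {x}. z - y)" using Y by (simp add: prod.remove)
    moreover have "z - x \<noteq> 0" using x z by auto
    ultimately show "poly p x / nodal_deriv Y x * (\<Prod>y\<in>Y - {x}. z - y)
      = poly p x / (nodal_deriv Y x * (z - x)) * (\<Prod>y\<in>Y. z - y)" by simp
  qed
  finally show ?thesis using nz by (simp add: field_simps)
qed

text \<open>Interpolation at \<open>n + 2\<close> points gives degree at most \<open>n + 1\<close>,
  and the coefficient there is the divided difference, which is assumed to vanish.\<close>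

lemma interpolation_exists:
  fixes f :: "'a::field \<Rightarrow> 'a"
  assumes Y: "finite Y" "card Y = n + 2" and 0: "(\<Sum>x\<in>Y. f x / nodal_deriv Y x) = 0"
  obtains p where "degree p \<le> n" "\<And>x. x \<in> Y \<Longrightarrow> poly p x = f x"
proof
  define p where "p = (\<Sum>x\<in>Y. smult (f x / nodal_deriv Y x) (nodal_basis Y x))"
  show "poly p z = f z" if z: "z \<in> Y" for z
  proof -
    have "poly p z = (\<Sum>x\<in>Y. if x = z then f z else 0)"
      unfolding p_def poly_sum
      by (rule sum.cong) (use Y z in \<open>auto simp: poly_nodal_basis_eq nodal_deriv_nonzero\<close>)
    then show ?thesis using Y z by simp
  qed
  have le: "degree p \<le> n + 1" unfolding p_def
    by (intro degree_sum_le)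
      (use Y in \<open>auto intro!: order.trans[OF degree_smult_le] simp: degree_nodal_basis\<close>)
  have "coeff p (n + 1) = (\<Sum>x\<in>Y. f x / nodal_deriv Y x)"
    unfolding p_def coeff_sum
  proof (rule sum.cong[OF refl])
    fix x assume "x \<in> Y"
    then have "n + 1 = card (Y - {x})" using Y by simp
    then show "coeff (smult (f x / nodal_deriv Y x) (nodal_basis Y x)) (n + 1) = f x / nodal_deriv Y x"
      by (simp only: coeff_smult coeff_nodal_basis) simp
  qed
  then have "coeff p (n + 1) = 0" using 0 by simp
  with le show "degree p \<le> n"
    by (metis Suc_eq_plus1 coeff_0 eq_zero_or_degree_less le_SucE le_degree leading_coeff_0_iff not_less_eq_eq le_Suc_eq le0 degree_0)
qed

lemma nodal_deriv_remove:
  assumes "finite Z" "y \<in> Z" "x \<in> Z" "x \<noteq> y"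
  shows "nodal_deriv Z x = nodal_deriv (Z - {y}) x * (x - y)"
proof -
  have "Z - {x} = insert y (Z - {y} - {x})" using assms by auto
  then show ?thesis unfolding nodal_deriv_def using assms by (simp add: mult.commute)
qed

section \<open>Weighted Chebyshev alternation\<close>

text \<open>The exchange step: the annihilators of the polynomials of degree at most \<open>card Z - 3\<close> on
  \<open>Z\<close> are the functions \<open>x \<mapsto> (x - y) / nodal_deriv Z x\<close>, so dropping \<open>x0\<close> or \<open>y\<close> only changes
  the factor in front. The node next to \<open>x0\<close> on the correct side, or else the farthest node on
  the other side, keeps all the signs.\<close>
lemma exchange_node:
  fixes x0 :: real and Y :: "real set"
  assumes Y: "finite Y" "Y \<noteq> {}" "x0 \<notin> Y" and \<theta>: "\<theta> \<noteq> 0"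
  obtains y s where "y \<in> Y" "s \<in> {1, -1::real}" "\<And>x. x \<in> Y \<Longrightarrow> 0 \<le> s * ((x - y) / (x - x0))"
    "0 < s * ((x0 - y) * \<theta>)"
proof -
  have *: thesis if Y: "finite Y" "Y \<noteq> {}" "x0 \<notin> Y" and \<theta>: "\<theta> > 0"
    and ex: "\<And>y s. y \<in> Y \<Longrightarrow> s \<in> {1, -1::real} \<Longrightarrow> (\<And>x. x \<in> Y \<Longrightarrow> 0 \<le> s * ((x - y) / (x - x0)))
      \<Longrightarrow> 0 < s * ((x0 - y) * \<theta>) \<Longrightarrow> thesis" for Y x0 \<theta> thesis
  proof (cases "{y\<in>Y. y < x0} = {}")
    case False
    define y where "y = Max {y\<in>Y. y < x0}"
    have "y \<in> {y\<in>Y. y < x0}" unfolding y_def using False Y by (intro Max_in) auto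
    then have y: "y \<in> Y" "y < x0" by auto
    have m: "x \<le> y" if "x \<in> Y" "x < x0" for x
      unfolding y_def using that Y by (intro Max_ge) auto
    show thesis
    proof (rule ex[OF y(1), of 1])
      show "0 \<le> 1 * ((x - y) / (x - x0))" if "x \<in> Y" for x
      proof (cases "x < x0")
        case True
        then show ?thesis using m[OF that] by (simp add: divide_nonpos_nonpos)
      next
        case False
        then have "x0 < x" using that Y by (metis not_less_iff_gr_or_eq)
        then show ?thesis using y by (simp add: divide_nonneg_nonneg)
      qed
    qed (use y \<theta> in auto)
  next
    case True
    define y where "y = Max Y"
    have y: "y \<in> Y" "\<And>x. x \<in> Y \<Longrightarrow> x \<le> y" unfolding y_def using Y by auto
    moreover have "x0 < y" using True y(1) Y(3) by (metis (mono_tags, lifting) empty_Collect_eq linorder_neqE)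
    ultimately have y: "y \<in> Y" "\<And>x. x \<in> Y \<Longrightarrow> x \<le> y" "x0 < y" by auto
    show thesis
    proof (rule ex[OF y(1), of "-1"])
      show "0 \<le> -1 * ((x - y) / (x - x0))" if "x \<in> Y" for x
        using y(2)[OF that] True that by (auto intro!: divide_nonpos_nonneg simp: not_less)
      show "0 < -1 * ((x0 - y) * \<theta>)" using y(3) \<theta> by (simp add: mult_neg_pos)
    qed simp
  qed
  show thesis
  proof (cases "\<theta> > 0")
    case True
    show ?thesis by (rule *[OF Y True]) (rule that)
  next
    case False
    then have n: "-\<theta> > 0" using \<theta> by simp
    show ?thesis
    \<comment> \<open>Reflection of the line reverses the sign of \<open>x0 - y\<close> and
      preserves the quotients, so a negative \<open>\<theta>\<close> becomes positive.\<close>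
    proof (rule *[of "uminus ` Y" "-x0" "-\<theta>"])
      fix y s assume y: "y \<in> uminus ` Y" and s: "s \<in> {1, -1::real}"
        and le: "\<And>x. x \<in> uminus ` Y \<Longrightarrow> 0 \<le> s * ((x - y) / (x - - x0))"
        and lt: "0 < s * ((- x0 - y) * - \<theta>)"
      show thesis
      proof (rule that[of "-y" s])
        show "0 \<le> s * ((x - - y) / (x - x0))" if "x \<in> Y" for x
        proof -
          have "(- x - y) / (- x - - x0) = (x - - y) / (x - x0)"
            using minus_divide_divide[of "x + y" "x - x0"] by (simp add: algebra_simps)
          then show ?thesis using le[of "-x"] that by simp
        qed
      qed (use y s lt in \<open>auto simp: algebra_simps\<close>)
    qed (use Y n in auto)
  qed
qed


text \<open>By duality \<open>\<bar>N g Y\<bar> / S Y\<close> is the least weighted error attainable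
  on the \<open>n + 2\<close> points \<open>Y\<close>, and a polynomial with equioscillating error
  attains it. For the \<open>Y\<close> that maximizes this value, that polynomial is optimal on all
  of \<open>X\<close>: a point \<open>x0\<close> with larger error could be exchanged for a node of
  \<open>Y\<close>, giving a set with a larger value.\<close>

lemma alternation_on_finite_set:
  fixes g w :: "real \<Rightarrow> real"
  assumes X: "finite X" "n + 2 \<le> card X" and w: "\<And>x. x \<in> X \<Longrightarrow> 0 < w x"
  obtains Y p \<rho> \<tau> where "Y \<subseteq> X" "card Y = n + 2" "degree p \<le> n" "0 \<le> \<rho>" "\<tau> \<in> {1, -1}"
    "\<And>x. x \<in> Y \<Longrightarrow> g x - poly p x = \<tau> * \<rho> * sgn (nodal_deriv Y x) * w x"
    "\<And>x. x \<in> X \<Longrightarrow> \<bar>g x - poly p x\<bar> \<le> \<rho> * w x"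
    "\<bar>\<Sum>x\<in>Y. g x / nodal_deriv Y x\<bar> = \<rho> * (\<Sum>x\<in>Y. w x / \<bar>nodal_deriv Y x\<bar>)"
proof -
  define N where "N f Y = (\<Sum>x\<in>Y. f x / nodal_deriv Y x)" for f :: "real \<Rightarrow> real" and Y
  define S where "S Y = (\<Sum>x\<in>Y. w x / \<bar>nodal_deriv Y x\<bar>)" for Y
  define \<Y> where "\<Y> = {Y. Y \<subseteq> X \<and> card Y = n + 2}"
  have \<Y>: "finite \<Y>" "\<Y> \<noteq> {}"
    unfolding \<Y>_def using X obtain_subset_with_card_n[OF X(2)] by auto
  define L where "L Y = \<bar>N g Y\<bar> / S Y" for Y
  have "Max (L ` \<Y>) \<in> L ` \<Y>" using \<Y> by (intro Max_in) auto
  then obtain Y where "Y \<in> \<Y>" "L Y = Max (L ` \<Y>)" by auto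
  then have Y: "Y \<in> \<Y>" "\<And>Z. Z \<in> \<Y> \<Longrightarrow> L Z \<le> L Y" using \<Y> by auto
  have fin: "finite Z" "card Z = n + 2" "Z \<subseteq> X" if "Z \<in> \<Y>" for Z
    using that X unfolding \<Y>_def by (auto intro: finite_subset)
  have Spos: "S Z > 0" if "Z \<in> \<Y>" for Z
    unfolding S_def using fin[OF that] w
    by (intro sum_pos divide_pos_pos) (auto simp: nodal_deriv_nonzero)
  define \<rho> where "\<rho> = L Y"
  have \<rho>: "\<rho> \<ge> 0" unfolding \<rho>_def L_def using Spos[OF Y(1)] by simp
  define \<tau> where "\<tau> = (if N g Y \<ge> 0 then 1 else -1::real)"
  have \<tau>: "\<tau> \<in> {1, -1}" "\<tau> * N g Y = \<bar>N g Y\<bar>" by (auto simp: \<tau>_def)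
  have eq: "\<bar>N g Y\<bar> = \<rho> * S Y" unfolding \<rho>_def L_def using Spos[OF Y(1)] by simp
  have "(\<Sum>x\<in>Y. (g x - \<tau> * \<rho> * sgn (nodal_deriv Y x) * w x) / nodal_deriv Y x) = N g Y - \<tau> * \<rho> * S Y"
    unfolding N_def S_def diff_divide_distrib sum_subtractf sum_distrib_left
    by (intro arg_cong2[where f = "(-)"] refl sum.cong) (auto simp: sgn_if abs_if)
  also have "\<dots> = \<tau> * (\<tau> * N g Y - \<rho> * S Y)" using \<tau>(1) by (auto simp: algebra_simps)
  also have "\<dots> = 0" using \<tau>(2) eq by simp
  finally obtain p where p: "degree p \<le> n"
      "\<And>x. x \<in> Y \<Longrightarrow> poly p x = g x - \<tau> * \<rho> * sgn (nodal_deriv Y x) * w x"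
    using interpolation_exists[OF fin(1,2)[OF Y(1)], of "\<lambda>x. g x - \<tau> * \<rho> * sgn (nodal_deriv Y x) * w x"]
    by blast
  define h where "h x = g x - poly p x" for x
  have Np: "N h Z = N g Z" if "Z \<in> \<Y>" for Z
  proof -
    have "(\<Sum>x\<in>Z. poly p x / nodal_deriv Z x) = 0"
      using divided_difference_eq_0[OF fin(1)[OF that], of p] fin(2)[OF that] p(1) by simp
    then show ?thesis unfolding N_def h_def by (simp add: diff_divide_distrib sum_subtractf)
  qed
  have "\<bar>h x0\<bar> \<le> \<rho> * w x0" if x0: "x0 \<in> X" for x0
  proof (rule ccontr)
    assume "\<not> ?thesis"
    then have big: "\<rho> * w x0 < \<bar>h x0\<bar>" by simp
    have hY: "h x = \<tau> * \<rho> * sgn (nodal_deriv Y x) * w x" if "x \<in> Y" for x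
      using p(2)[OF that] by (simp add: h_def)
    have habs: "\<bar>h x\<bar> = \<rho> * w x" if "x \<in> Y" for x
      using hY[OF that] \<tau>(1) \<rho> w[of x] fin[OF Y(1)] that nodal_deriv_nonzero[of Y x]
      by (auto simp: abs_mult sgn_if)
    have x0Y: "x0 \<notin> Y" using habs big by fastforce
    define Z where "Z = insert x0 Y"
    have Z: "finite Z" "x0 \<in> Z" "Z \<subseteq> X" using fin[OF Y(1)] x0 by (auto simp: Z_def)
    define \<theta> where "\<theta> = \<tau> * h x0 / nodal_deriv Z x0"
    have "h x0 \<noteq> 0" using big \<rho> w[OF x0] by (auto simp: mult_less_0_iff)
    then have \<theta>: "\<theta> \<noteq> 0" using \<tau>(1) nodal_deriv_nonzero[OF Z(1), of x0] by (auto simp: \<theta>_def)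
    have "Y \<noteq> {}" using fin(2)[OF Y(1)] by auto
    then obtain y s where ys: "y \<in> Y" "s \<in> {1, -1::real}" "\<And>x. x \<in> Y \<Longrightarrow> 0 \<le> s * ((x - y) / (x - x0))"
       "0 < s * ((x0 - y) * \<theta>)"
      using exchange_node[OF fin(1)[OF Y(1)] _ x0Y \<theta>] by blast
    define Y' where "Y' = Z - {y}"
    have Y'in: "Y' \<in> \<Y>" unfolding \<Y>_def Y'_def using Z fin[OF Y(1)] ys(1) x0Y by (auto simp: Z_def)
    have yx0: "y \<noteq> x0" using ys(1) x0Y by auto
    have nd: "nodal_deriv Y' x = nodal_deriv Z x / (x - y)" if "x \<in> Y'" for x
      using nodal_deriv_remove[OF Z(1), of y x] that ys(1) by (auto simp: Y'_def Z_def)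
    have ndY: "nodal_deriv Y x = nodal_deriv Z x / (x - x0)" if "x \<in> Y" for x
    proof -
      have "x \<noteq> x0" using that x0Y by auto
      then have "nodal_deriv Z x = nodal_deriv Y x * (x - x0)"
        using nodal_deriv_remove[OF Z(1), of x0 x] that x0Y by (simp add: Z_def)
      then show ?thesis using \<open>x \<noteq> x0\<close> by simp
    qed
    \<comment> \<open>The exchange keeps the signs of \<open>h\<close> and
      \<open>nodal_deriv\<close> in step: up to the global sign \<open>s * \<tau>\<close> every term
      of \<open>N h Y'\<close> is nonnegative, so nothing cancels in the sum.\<close>
    have sign: "s * \<tau> * h x / nodal_deriv Y' x = \<bar>h x\<bar> / \<bar>nodal_deriv Y' x\<bar>" if x: "x \<in> Y'" for x
    proof -
      have "0 \<le> s * \<tau> * h x / nodal_deriv Y' x"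
      proof (cases "x = x0")
        case True
        have "s * \<tau> * h x / nodal_deriv Y' x = s * ((x0 - y) * \<theta>)"
          using nd[OF x] by (simp add: True \<theta>_def)
        then show ?thesis using ys(4) by simp
      next
        case False
        then have xY: "x \<in> Y" using x by (auto simp: Y'_def Z_def)
        have nz: "nodal_deriv Z x \<noteq> 0" "x \<noteq> x0" using nodal_deriv_nonzero[OF Z(1)] False by auto
        have "\<tau> * h x / nodal_deriv Y x = \<rho> * w x / \<bar>nodal_deriv Y x\<bar>"
          using hY[OF xY] \<tau>(1) by (auto simp: sgn_if abs_if)
        then have c: "0 \<le> \<tau> * h x / nodal_deriv Y x"
          using \<rho> w[of x] fin(3)[OF Y(1)] xY by auto
        have "s * \<tau> * h x / nodal_deriv Y' x = (s * ((x - y) / (x - x0))) * (\<tau> * h x / nodal_deriv Y x)"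
          unfolding nd[OF x] ndY[OF xY] using nz by simp
        then show ?thesis using mult_nonneg_nonneg[OF ys(3)[OF xY] c] by simp
      qed
      moreover have "\<bar>s * \<tau> * h x / nodal_deriv Y' x\<bar> = \<bar>h x\<bar> / \<bar>nodal_deriv Y' x\<bar>"
        using ys(2) \<tau>(1) by (auto simp: abs_mult)
      ultimately show ?thesis by linarith
    qed
    have "\<rho> * S Y' = (\<Sum>x\<in>Y'. \<rho> * w x / \<bar>nodal_deriv Y' x\<bar>)" by (simp add: S_def sum_distrib_left)
    also have "\<dots> < (\<Sum>x\<in>Y'. \<bar>h x\<bar> / \<bar>nodal_deriv Y' x\<bar>)"
    proof (rule sum_strict_mono_ex1)
      show "\<forall>x\<in>Y'. \<rho> * w x / \<bar>nodal_deriv Y' x\<bar> \<le> \<bar>h x\<bar> / \<bar>nodal_deriv Y' x\<bar>"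
      proof
        fix x assume "x \<in> Y'"
        then have "\<rho> * w x \<le> \<bar>h x\<bar>" using habs[of x] big by (cases "x = x0") (simp_all add: Y'_def Z_def)
        then show "\<rho> * w x / \<bar>nodal_deriv Y' x\<bar> \<le> \<bar>h x\<bar> / \<bar>nodal_deriv Y' x\<bar>" by (simp add: divide_right_mono)
      qed
      show "\<exists>x\<in>Y'. \<rho> * w x / \<bar>nodal_deriv Y' x\<bar> < \<bar>h x\<bar> / \<bar>nodal_deriv Y' x\<bar>"
        using big yx0 nodal_deriv_nonzero[OF fin(1)[OF Y'in], of x0]
        by (intro bexI[of _ x0]) (auto simp: Y'_def Z_def divide_strict_right_mono)
    qed (use fin[OF Y'in] in auto)
    also have "\<dots> = (\<Sum>x\<in>Y'. s * \<tau> * h x / nodal_deriv Y' x)" using sign by simp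
    also have "\<dots> = s * \<tau> * N h Y'" by (simp add: N_def sum_distrib_left)
    also have "\<dots> \<le> \<bar>N h Y'\<bar>" using ys(2) \<tau>(1) by auto
    also have "\<dots> = L Y' * S Y'" using Np[OF Y'in] Spos[OF Y'in] by (simp add: L_def)
    finally have "\<rho> < L Y'" using Spos[OF Y'in] by simp
    then show False using Y(2)[OF Y'in] by (simp add: \<rho>_def)
  qed
  then have le: "\<bar>g x - poly p x\<bar> \<le> \<rho> * w x" if "x \<in> X" for x
    using that by (simp add: h_def)
  show thesis
  proof (rule that[of Y p \<rho> \<tau>])
    show "g x - poly p x = \<tau> * \<rho> * sgn (nodal_deriv Y x) * w x" if "x \<in> Y" for x
      by (simp add: p(2)[OF that])
  qed (use fin[OF Y(1)] p(1) \<rho> \<tau>(1) eq le in \<open>simp_all add: N_def S_def\<close>)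
qed

section \<open>Reduction of the weighted problem on an infinite set to finite sets\<close>

lemma interpolation_finite:
  fixes f :: "'a::field \<Rightarrow> 'a"
  assumes "finite Y"
  shows "\<exists>p. \<forall>x\<in>Y. poly p x = f x"
  using assms
proof induction
  case (insert a Y)
  then obtain p where p: "\<forall>x\<in>Y. poly p x = f x" by blast
  define q where "q = (\<Prod>y\<in>Y. [:-y, 1:])"
  have q: "poly q x = (\<Prod>y\<in>Y. x - y)" for x by (simp add: q_def poly_prod)
  have "poly q a \<noteq> 0" "\<And>x. x \<in> Y \<Longrightarrow> poly q x = 0" using insert by (auto simp: q)
  then have "\<forall>x\<in>insert a Y. poly (p + smult ((f a - poly p a) / poly q a) q) x = f x"
    using p by auto
  then show ?case by blast
qed simp

text \<open>The moment bound of order \<open>i + 1\<close> controls the term of degree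
  \<open>i\<close> times \<open>\<bar>x\<bar>\<close>, so \<open>\<bar>poly q x\<bar>\<close> is at
  most \<open>K / \<bar>x\<bar>\<close> times the weight.\<close>

lemma poly_small_weight:
  fixes w :: "real \<Rightarrow> real"
  assumes w: "\<And>x. x \<in> D \<Longrightarrow> 1 \<le> w x" and mom: "\<And>k::nat. \<exists>C. \<forall>x\<in>D. \<bar>x\<bar> ^ k \<le> C * w x"
    and e: "e > 0"
  shows "\<exists>R>0. \<forall>x\<in>D. R < \<bar>x\<bar> \<longrightarrow> \<bar>poly q x\<bar> \<le> e * w x"
proof -
  obtain C where C: "\<And>k x. x \<in> D \<Longrightarrow> \<bar>x\<bar> ^ k \<le> C k * w x" using mom by metis
  define K where "K = (\<Sum>i\<le>degree q. \<bar>coeff q i\<bar> * \<bar>C (Suc i)\<bar>)"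
  have K: "0 \<le> K" unfolding K_def by (intro sum_nonneg) auto
  have "\<bar>poly q x\<bar> \<le> e * w x" if x: "x \<in> D" "(K + 1) / e < \<bar>x\<bar>" for x
  proof -
    have x0: "0 < \<bar>x\<bar>" using x(2) e K by (meson add_nonneg_pos divide_pos_pos less_trans zero_less_one)
    have "\<bar>poly q x\<bar> * \<bar>x\<bar> \<le> (\<Sum>i\<le>degree q. \<bar>coeff q i * x ^ i\<bar>) * \<bar>x\<bar>"
      unfolding poly_altdef by (intro mult_right_mono sum_abs) auto
    also have "\<dots> = (\<Sum>i\<le>degree q. \<bar>coeff q i\<bar> * \<bar>x\<bar> ^ Suc i)"
      unfolding sum_distrib_right by (intro sum.cong) (auto simp: abs_mult power_abs mult_ac)
    also have "\<dots> \<le> (\<Sum>i\<le>degree q. \<bar>coeff q i\<bar> * (\<bar>C (Suc i)\<bar> * w x))"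
    proof (intro sum_mono mult_left_mono)
      fix i
      have "\<bar>x\<bar> ^ Suc i \<le> C (Suc i) * w x" using C[OF x(1)] by blast
      also have "\<dots> \<le> \<bar>C (Suc i)\<bar> * w x" using w[OF x(1)] by (intro mult_right_mono) auto
      finally show "\<bar>x\<bar> ^ Suc i \<le> \<bar>C (Suc i)\<bar> * w x" .
    qed auto
    also have "\<dots> = K * w x" by (simp add: K_def sum_distrib_right mult.assoc)
    also have "\<dots> \<le> (e * \<bar>x\<bar>) * w x"
    proof (rule mult_right_mono)
      have "K + 1 < e * \<bar>x\<bar>" using x(2) e by (simp add: field_simps)
      then show "K \<le> e * \<bar>x\<bar>" by simp
    qed (use w[OF x(1)] in auto)
    finally have "\<bar>poly q x\<bar> * \<bar>x\<bar> \<le> (e * w x) * \<bar>x\<bar>" by (simp add: mult_ac)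
    then show ?thesis using x0 by simp
  qed
  moreover have "(K + 1) / e > 0" using K e by simp
  ultimately show ?thesis by blast
qed

lemma almost_minimizer:
  fixes w :: "real \<Rightarrow> real"
  assumes "J \<noteq> {}" "\<And>x. x \<in> J \<Longrightarrow> 1 \<le> w x" "0 < e"
  shows "\<exists>y\<in>J. \<forall>x\<in>J. w y \<le> w x + e"
proof -
  have bdd: "bdd_below (w ` J)" using assms(2) by (auto intro!: bdd_belowI)
  have "Inf (w ` J) < Inf (w ` J) + e" using assms(3) by simp
  then obtain y where y: "y \<in> J" "w y < Inf (w ` J) + e"
    using cInf_lessD[of "w ` J" "Inf (w ` J) + e"] assms(1) by blast
  have "w y \<le> w x + e" if "x \<in> J" for x
    using y(2) cInf_lower[OF imageI[OF that] bdd] by linarith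
  then show ?thesis using y(1) by blast
qed

text \<open>The \<open>n + 1\<close> points of \<open>B\<close> belong to the net and tame all
  admissible polynomials at once: there \<open>\<bar>p\<bar> \<le> 1 + w\<close>, so the Lagrange
  formula gives a common majorant \<open>H\<close> and a common modulus of continuity
  \<open>E\<close>. Far out \<open>H\<close> is negligible against \<open>w\<close>; on the rest,
  short cells suffice. As \<open>w\<close> need not be continuous or attain a minimum, each cell is
  represented by a point where \<open>w\<close> is almost minimal.\<close>

lemma finite_net:
  fixes g w :: "real \<Rightarrow> real"
  assumes w: "\<And>x. x \<in> D \<Longrightarrow> 1 \<le> w x" and mom: "\<And>k::nat. \<exists>C. \<forall>x\<in>D. \<bar>x\<bar> ^ k \<le> C * w x"
    and g: "continuous_on UNIV g" "\<And>x. \<bar>g x\<bar> \<le> 1"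
    and B: "finite B" "B \<subseteq> D" "card B = n + 1" and \<eta>: "0 < \<eta>"
  shows "\<exists>X. finite X \<and> B \<subseteq> X \<and> X \<subseteq> D \<and>
    (\<forall>X' p \<rho>. X \<subseteq> X' \<longrightarrow> degree p \<le> n \<longrightarrow> 0 \<le> \<rho> \<longrightarrow> \<rho> \<le> 1 \<longrightarrow>
       (\<forall>x\<in>X'. \<bar>g x - poly p x\<bar> \<le> \<rho> * w x) \<longrightarrow> (\<forall>x\<in>D. \<bar>g x - poly p x\<bar> \<le> (\<rho> + \<eta>) * w x))"
proof -
  define c where "c b = (1 + w b) / \<bar>nodal_deriv B b\<bar>" for b
  define H where "H x = (\<Sum>b\<in>B. c b * \<bar>poly (nodal_basis B b) x\<bar>)" for x
  define E where "E z = \<bar>g (fst z) - g (snd z)\<bar>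
    + (\<Sum>b\<in>B. c b * \<bar>poly (nodal_basis B b) (fst z) - poly (nodal_basis B b) (snd z)\<bar>)" for z
  have c0: "0 \<le> c b" if "b \<in> B" for b using that B w[of b] by (auto simp: c_def)
  have tail: "\<exists>R>0. \<forall>x\<in>D. R < \<bar>x\<bar> \<longrightarrow> 1 + H x \<le> \<eta> * w x"
  proof -
    define m where "m = \<eta> / (real (card B) + 1)"
    have m: "m > 0" using \<eta> by (simp add: m_def)
    have "\<exists>R>0. \<forall>x\<in>D. R < \<bar>x\<bar> \<longrightarrow> \<bar>poly (smult (c b) (nodal_basis B b)) x\<bar> \<le> m * w x" for b
      by (rule poly_small_weight[OF w mom m])
    then obtain R where R: "\<And>b x. x \<in> D \<Longrightarrow> R b < \<bar>x\<bar> \<Longrightarrow> \<bar>poly (smult (c b) (nodal_basis B b)) x\<bar> \<le> m * w x"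
      by metis
    obtain R1 where R1: "R1 > 0" "\<And>x. x \<in> D \<Longrightarrow> R1 < \<bar>x\<bar> \<Longrightarrow> \<bar>poly 1 x\<bar> \<le> m * w x"
      using poly_small_weight[OF w mom m, of 1] by blast
    define R2 where "R2 = Max (insert R1 (R ` B))"
    have R2: "R1 \<le> R2" "\<And>b. b \<in> B \<Longrightarrow> R b \<le> R2" unfolding R2_def using B by auto
    have "1 + H x \<le> \<eta> * w x" if x: "x \<in> D" "R2 < \<bar>x\<bar>" for x
    proof -
      have "H x \<le> (\<Sum>b\<in>B. m * w x)" unfolding H_def
      proof (rule sum_mono)
        fix b assume b: "b \<in> B"
        have "\<bar>poly (smult (c b) (nodal_basis B b)) x\<bar> \<le> m * w x"
          by (rule R[OF x(1)]) (use R2(2)[OF b] x in linarith)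
        then show "c b * \<bar>poly (nodal_basis B b) x\<bar> \<le> m * w x" using c0[OF b] by (simp add: abs_mult)
      qed
      moreover have "1 \<le> m * w x" using R1(2)[OF x(1)] R2(1) x by simp
      ultimately have "1 + H x \<le> (real (card B) + 1) * m * w x" by (simp add: algebra_simps)
      then show ?thesis by (simp add: m_def)
    qed
    then show ?thesis using R1(1) R2(1) by (intro exI[of _ R2]) auto
  qed
  then obtain R where R: "R > 0" "\<And>x. x \<in> D \<Longrightarrow> R < \<bar>x\<bar> \<Longrightarrow> 1 + H x \<le> \<eta> * w x" by blast
  define S where "S = {-(R+1)..R+1} \<times> {-(R+1)..R+1::real}"
  have "continuous_on UNIV E" unfolding E_def
    by (intro continuous_intros continuous_on_compose2[OF g(1)]) auto
  then have "uniformly_continuous_on S E"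
    by (intro compact_uniformly_continuous) (auto simp: S_def intro: continuous_on_subset compact_Times)
  moreover have "\<eta> / 2 > 0" using \<eta> by simp
  ultimately obtain \<delta> where \<delta>: "\<delta> > 0" "\<And>z z'. z \<in> S \<Longrightarrow> z' \<in> S \<Longrightarrow> dist z' z < \<delta> \<Longrightarrow> dist (E z') (E z) < \<eta> / 2"
    unfolding uniformly_continuous_on_def by metis
  \<comment> \<open>\<open>d < \<delta>\<close> serves the uniform continuity of \<open>E\<close>;
    \<open>d < 1\<close> keeps the representative of a cell that meets \<open>[-R, R]\<close> inside
    \<open>[-(R + 1), R + 1]\<close>.\<close>
  define d where "d = min \<delta> 1 / 2"
  have d: "d > 0" "d < \<delta>" "d < 1" using \<delta>(1) by (auto simp: d_def)
  define J where "J k = {x\<in>D. \<lfloor>x / d\<rfloor> = k}" for k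
  define \<K> where "\<K> = {k \<in> {\<lfloor>-R / d\<rfloor>..\<lfloor>R / d\<rfloor>}. J k \<noteq> {}}"
  have "\<exists>y\<in>J k. \<forall>x\<in>J k. w y \<le> w x + \<eta> / 2" if "k \<in> \<K>" for k
    by (rule almost_minimizer) (use that w \<eta> in \<open>auto simp: \<K>_def J_def\<close>)
  then obtain y where y: "\<And>k. k \<in> \<K> \<Longrightarrow> y k \<in> J k" "\<And>k x. k \<in> \<K> \<Longrightarrow> x \<in> J k \<Longrightarrow> w (y k) \<le> w x + \<eta> / 2"
    by metis
  show ?thesis
  proof (intro exI[of _ "B \<union> y ` \<K>"] conjI allI impI ballI)
    have "finite \<K>" unfolding \<K>_def by (rule finite_subset[of _ "{\<lfloor>-R / d\<rfloor>..\<lfloor>R / d\<rfloor>}"]) auto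
    then show "finite (B \<union> y ` \<K>)" using B by blast
    show "B \<subseteq> B \<union> y ` \<K>" by auto
    show "B \<union> y ` \<K> \<subseteq> D" using B y(1) by (auto simp: J_def)
    fix X' p \<rho> x
    assume X': "B \<union> y ` \<K> \<subseteq> X'" and p: "degree p \<le> n" and \<rho>: "0 \<le> \<rho>" "\<rho> \<le> 1"
      and le: "\<forall>x\<in>X'. \<bar>g x - poly p x\<bar> \<le> \<rho> * w x" and x: "x \<in> D"
    have pb: "\<bar>poly p b / nodal_deriv B b\<bar> \<le> c b" if b: "b \<in> B" for b
    proof -
      have "\<bar>g b - poly p b\<bar> \<le> \<rho> * w b" using le b X' by auto
      also have "\<dots> \<le> 1 * w b" using \<rho> w[of b] b B by (intro mult_right_mono) auto
      finally have "\<bar>poly p b\<bar> \<le> 1 + w b" using g(2)[of b] by simp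
      then show ?thesis unfolding c_def abs_divide by (intro divide_right_mono) auto
    qed
    have p_eq: "p = (\<Sum>b\<in>B. smult (poly p b / nodal_deriv B b) (nodal_basis B b))"
      by (rule lagrange_interpolation) (use B p in auto)
    have px: "poly p t = (\<Sum>b\<in>B. poly p b / nodal_deriv B b * poly (nodal_basis B b) t)" for t
      by (subst p_eq) (simp add: poly_sum)
    have pH: "\<bar>poly p x\<bar> \<le> H x"
      unfolding px[of x] H_def
    proof (rule order.trans[OF sum_abs sum_mono])
      fix b assume "b \<in> B"
      then show "\<bar>poly p b / nodal_deriv B b * poly (nodal_basis B b) x\<bar> \<le> c b * \<bar>poly (nodal_basis B b) x\<bar>"
        unfolding abs_mult by (intro mult_right_mono pb) auto
    qed
    show "\<bar>g x - poly p x\<bar> \<le> (\<rho> + \<eta>) * w x"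
    proof (cases "R < \<bar>x\<bar>")
      case True
      have "\<bar>g x - poly p x\<bar> \<le> 1 + H x" using g(2)[of x] pH by linarith
      also have "\<dots> \<le> \<eta> * w x" by (rule R(2)[OF x True])
      also have "\<dots> \<le> (\<rho> + \<eta>) * w x" using \<rho> w[OF x] by (intro mult_right_mono) auto
      finally show ?thesis .
    next
      case False
      define k where "k = \<lfloor>x / d\<rfloor>"
      have "-R / d \<le> x / d" "x / d \<le> R / d" using divide_right_mono[of "-R" x d] divide_right_mono[of x R d] False d by auto
      then have "k \<in> {\<lfloor>-R / d\<rfloor>..\<lfloor>R / d\<rfloor>}" by (auto simp: k_def intro!: floor_mono)
      then have k: "k \<in> \<K>" "x \<in> J k" using x by (auto simp: \<K>_def J_def k_def)
      have yk: "y k \<in> D" "\<lfloor>y k / d\<rfloor> = k" using y(1)[OF k(1)] by (auto simp: J_def)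
      have "real_of_int k \<le> x / d" "x / d < real_of_int k + 1" unfolding k_def by linarith+
      moreover have "real_of_int k \<le> y k / d" "y k / d < real_of_int k + 1" using yk(2) by linarith+
      ultimately have "\<bar>x / d - y k / d\<bar> < 1" by linarith
      then have xy: "\<bar>x - y k\<bar> < d" using d by (simp add: diff_divide_distrib[symmetric])
      have "dist (E (x, y k)) (E (x, x)) < \<eta> / 2"
        by (rule \<delta>(2)) (use False xy d R(1) in \<open>auto simp: S_def dist_Pair_Pair dist_real_def\<close>)
      moreover have "E (x, x) = 0" by (simp add: E_def)
      ultimately have E: "E (x, y k) < \<eta> / 2" by (simp add: dist_real_def abs_less_iff)
      have "poly p x - poly p (y k) = (\<Sum>b\<in>B. poly p b / nodal_deriv B b *
         (poly (nodal_basis B b) x - poly (nodal_basis B b) (y k)))"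
        unfolding px[of x] px[of "y k"] by (simp add: sum_subtractf right_diff_distrib)
      also have "\<bar>\<dots>\<bar> \<le> (\<Sum>b\<in>B. c b * \<bar>poly (nodal_basis B b) x - poly (nodal_basis B b) (y k)\<bar>)"
      proof (rule order.trans[OF sum_abs sum_mono])
        fix b assume "b \<in> B"
        then show "\<bar>poly p b / nodal_deriv B b * (poly (nodal_basis B b) x - poly (nodal_basis B b) (y k))\<bar>
            \<le> c b * \<bar>poly (nodal_basis B b) x - poly (nodal_basis B b) (y k)\<bar>"
          unfolding abs_mult by (intro mult_right_mono pb) auto
      qed
      finally have "\<bar>poly p x - poly p (y k)\<bar> \<le> (\<Sum>b\<in>B. c b *
         \<bar>poly (nodal_basis B b) x - poly (nodal_basis B b) (y k)\<bar>)" .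
      then have "\<bar>g x - poly p x\<bar> \<le> \<bar>g (y k) - poly p (y k)\<bar> + E (x, y k)" by (simp add: E_def)
      also have "\<dots> \<le> \<rho> * w (y k) + \<eta> / 2"
        using le X' k(1) E by (intro add_mono) auto
      also have "\<dots> \<le> \<rho> * (w x + \<eta> / 2) + \<eta> / 2"
        using y(2)[OF k] \<rho> by (intro add_mono mult_left_mono) auto
      also have "\<dots> \<le> \<rho> * w x + \<eta>"
      proof -
        have "\<rho> * (\<eta> / 2) \<le> 1 * (\<eta> / 2)" using \<rho>(2) \<eta> by (intro mult_right_mono) auto
        then show ?thesis by (simp only: distrib_left)
      qed
      also have "\<dots> \<le> (\<rho> + \<eta>) * w x"
        using mult_left_mono[OF w[OF x], of \<eta>] \<eta> by (simp add: algebra_simps)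
      finally show ?thesis .
    qed
  qed
qed

text \<open>Optimality holds only on a finite net, with a loss of
  \<open>\<eta> \<le> \<epsilon> / 2\<close> on \<open>D\<close>; since no polynomial is within
  \<open>\<epsilon>\<close> on \<open>D\<close>, the level satisfies
  \<open>\<rho> \<ge> \<epsilon> / 2\<close>. The last inequality is this lower bound in dual form.
  The net lemma needs \<open>\<rho> \<le> 1\<close>, which holds because
  \<open>\<bar>g\<bar> \<le> 1 \<le> w\<close>.\<close>

lemma alternation_sequence:
  fixes g w :: "real \<Rightarrow> real"
  assumes w: "\<And>x. x \<in> D \<Longrightarrow> 1 \<le> w x" and mom: "\<And>k::nat. \<exists>C. \<forall>x\<in>D. \<bar>x\<bar> ^ k \<le> C * w x"
    and g: "continuous_on UNIV g" "\<And>x. \<bar>g x\<bar> \<le> 1"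
    and \<epsilon>: "0 < \<epsilon>" and far: "\<And>p. \<exists>x\<in>D. \<epsilon> * w x < \<bar>g x - poly p x\<bar>"
  shows "\<exists>Y p \<rho> \<tau>. finite Y \<and> Y \<subseteq> D \<and> card Y = n + 2 \<and> degree p \<le> n \<and> 0 < \<rho> \<and> \<tau> \<in> {1, -1} \<and>
    (\<forall>x\<in>Y. g x - poly p x = \<tau> * \<rho> * sgn (nodal_deriv Y x) * w x) \<and>
    (\<forall>x\<in>D. \<bar>g x - poly p x\<bar> \<le> 2 * w x) \<and>
    \<epsilon> / 2 * (\<Sum>x\<in>Y. w x / \<bar>nodal_deriv Y x\<bar>) \<le> \<bar>\<Sum>x\<in>Y. g x / nodal_deriv Y x\<bar>"
proof -
  have D: "infinite D"
  proof
    assume "finite D"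
    then obtain p where "\<forall>x\<in>D. poly p x = g x" using interpolation_finite by blast
    moreover obtain x where "x \<in> D" "\<epsilon> * w x < \<bar>g x - poly p x\<bar>" using far by blast
    ultimately show False using w[of x] \<epsilon> by (simp add: mult_less_0_iff)
  qed
  \<comment> \<open>\<open>n + 2\<close> points make the finite problem solvable;
    \<open>n + 1\<close> of them determine polynomials of degree \<open>n\<close> in the
    net.\<close>
  obtain B' where B': "finite B'" "card B' = n + 2" "B' \<subseteq> D" using infinite_arbitrarily_large[OF D, of "n + 2"] by blast
  have "n + 1 \<le> card B'" using B' by simp
  then obtain B where B: "B \<subseteq> B'" "card B = n + 1" by (rule obtain_subset_with_card_n)
  define \<eta> where "\<eta> = min (\<epsilon> / 2) 1"
  have \<eta>: "0 < \<eta>" "\<eta> \<le> \<epsilon> / 2" "\<eta> \<le> 1" using \<epsilon> by (auto simp: \<eta>_def)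
  have fB: "finite B" "B \<subseteq> D" using B B' by (auto intro: finite_subset)
  from finite_net[OF w mom g fB B(2) \<eta>(1)] obtain X where X: "finite X" "X \<subseteq> D"
    and net: "\<forall>X' p \<rho>. X \<subseteq> X' \<longrightarrow> degree p \<le> n \<longrightarrow> 0 \<le> \<rho> \<longrightarrow> \<rho> \<le> 1 \<longrightarrow>
       (\<forall>x\<in>X'. \<bar>g x - poly p x\<bar> \<le> \<rho> * w x) \<longrightarrow> (\<forall>x\<in>D. \<bar>g x - poly p x\<bar> \<le> (\<rho> + \<eta>) * w x)"
    by blast
  define X' where "X' = X \<union> B'"
  have X': "finite X'" "n + 2 \<le> card X'" "X \<subseteq> X'" "X' \<subseteq> D"
    using X B' card_mono[of X' B'] by (auto simp: X'_def)
  have wpos: "0 < w x" if "x \<in> X'" for x using w[of x] that X'(4) by force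
  obtain Y p \<rho> \<tau> where Y: "Y \<subseteq> X'" "card Y = n + 2" "degree p \<le> n" "0 \<le> \<rho>" "\<tau> \<in> {1, -1}"
    "\<And>x. x \<in> Y \<Longrightarrow> g x - poly p x = \<tau> * \<rho> * sgn (nodal_deriv Y x) * w x"
    "\<And>x. x \<in> X' \<Longrightarrow> \<bar>g x - poly p x\<bar> \<le> \<rho> * w x"
    "\<bar>\<Sum>x\<in>Y. g x / nodal_deriv Y x\<bar> = \<rho> * (\<Sum>x\<in>Y. w x / \<bar>nodal_deriv Y x\<bar>)"
    by (rule alternation_on_finite_set[OF X'(1,2), of w g, OF wpos]) (assumption, blast)
  have fY: "finite Y" using Y(1) X'(1) by (rule finite_subset)
  have YD: "Y \<subseteq> D" using Y(1) X'(4) by auto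
  define S where "S = (\<Sum>x\<in>Y. w x / \<bar>nodal_deriv Y x\<bar>)"
  have "Y \<noteq> {}" using Y(2) by auto
  then have S: "S > 0" unfolding S_def using fY Y(1) wpos
    by (intro sum_pos divide_pos_pos) (auto simp: nodal_deriv_nonzero)
  have "\<rho> * S \<le> (\<Sum>x\<in>Y. \<bar>g x / nodal_deriv Y x\<bar>)" using Y(8) sum_abs[of "\<lambda>x. g x / nodal_deriv Y x" Y] by (simp add: S_def)
  also have "\<dots> \<le> S" unfolding S_def
  proof (rule sum_mono)
    fix x assume "x \<in> Y"
    then have "\<bar>g x\<bar> \<le> w x" using g(2)[of x] w[of x] YD by force
    then show "\<bar>g x / nodal_deriv Y x\<bar> \<le> w x / \<bar>nodal_deriv Y x\<bar>" by (simp add: divide_right_mono)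
  qed
  finally have \<rho>1: "\<rho> \<le> 1" using S by simp
  have "\<forall>x\<in>X'. \<bar>g x - poly p x\<bar> \<le> \<rho> * w x" using Y(7) by blast
  then have le: "\<bar>g x - poly p x\<bar> \<le> (\<rho> + \<eta>) * w x" if "x \<in> D" for x
    using net X'(3) Y(3,4) \<rho>1 that by blast
  obtain x where x: "x \<in> D" "\<epsilon> * w x < \<bar>g x - poly p x\<bar>" using far by blast
  then have "\<epsilon> * w x < (\<rho> + \<eta>) * w x" using le[OF x(1)] by linarith
  then have "\<epsilon> < \<rho> + \<eta>" using w[OF x(1)] by simp
  then have \<rho>2: "\<epsilon> / 2 \<le> \<rho>" using \<eta>(2) by simp
  have "\<forall>x\<in>D. \<bar>g x - poly p x\<bar> \<le> 2 * w x"
  proof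
    fix x assume "x \<in> D"
    moreover have "(\<rho> + \<eta>) * w x \<le> 2 * w x"
      using \<rho>1 \<eta>(3) w[OF \<open>x \<in> D\<close>] by (intro mult_right_mono) auto
    ultimately show "\<bar>g x - poly p x\<bar> \<le> 2 * w x" using le[of x] by linarith
  qed
  moreover have "\<epsilon> / 2 * S \<le> \<bar>\<Sum>x\<in>Y. g x / nodal_deriv Y x\<bar>"
    unfolding Y(8) S_def[symmetric] using \<rho>2 S by (intro mult_right_mono) auto
  ultimately show ?thesis
    using fY YD Y(2,3,5,6) \<rho>2 \<epsilon> unfolding S_def by (intro exI[of _ Y] exI[of _ p] exI[of _ \<rho>] exI[of _ \<tau>]) simp
qed

text \<open>Apart from the two factors \<open>a - b\<close> and \<open>b - a\<close>, each node
  contributes factors of equal sign at \<open>a\<close> and \<open>b\<close>, because none lies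
  between them.\<close>

lemma nodal_deriv_sign_change:
  fixes Y :: "real set"
  assumes Y: "finite Y" "a \<in> Y" "b \<in> Y" "a < b" and gap: "\<And>y. y \<in> Y \<Longrightarrow> y \<le> a \<or> b \<le> y"
  shows "nodal_deriv Y a * nodal_deriv Y b < 0"
proof -
  define Z where "Z = Y - {a, b}"
  have "nodal_deriv Y a = nodal_deriv (Y - {b}) a * (a - b)" "nodal_deriv Y b = nodal_deriv (Y - {a}) b * (b - a)"
    using nodal_deriv_remove[of Y] Y by auto
  moreover have "Y - {b} - {a} = Z" "Y - {a} - {b} = Z" by (auto simp: Z_def)
  then have "nodal_deriv (Y - {b}) a = (\<Prod>y\<in>Z. a - y)" "nodal_deriv (Y - {a}) b = (\<Prod>y\<in>Z. b - y)"
    by (simp_all only: nodal_deriv_def)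
  ultimately have "nodal_deriv Y a * nodal_deriv Y b = - ((b - a)\<^sup>2 * (\<Prod>y\<in>Z. (a - y) * (b - y)))"
    by (simp only: prod.distrib) (simp add: power2_eq_square algebra_simps)
  moreover have "(\<Prod>y\<in>Z. (a - y) * (b - y)) > 0"
  proof (rule prod_pos)
    fix y assume "y \<in> Z"
    then have "y < a \<or> b < y" using gap[of y] by (auto simp: Z_def)
    then show "0 < (a - y) * (b - y)" using Y(4) by (auto intro: mult_pos_pos mult_neg_neg)
  qed
  ultimately show ?thesis using Y(4) by simp
qed

text \<open>Consecutive nodes carry values of \<open>h\<close> with opposite signs, so the
  intermediate value theorem puts a zero between them. Zeros from different gaps differ; the last
  node has no gap to its right, whence the \<open>+ 1\<close>.\<close>

lemma card_alternation_le_zeros: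
  fixes h w :: "real \<Rightarrow> real"
  assumes Y: "finite Y" and \<rho>: "0 < \<rho>" "\<tau> \<in> {1, -1}" and w: "\<And>x. x \<in> Y \<Longrightarrow> 0 < w x"
    and h: "continuous_on UNIV h" "\<And>x. x \<in> Y \<Longrightarrow> h x = \<tau> * \<rho> * sgn (nodal_deriv Y x) * w x"
    and fin: "finite {z. \<bar>z\<bar> < r \<and> h z = 0}"
  shows "card {y\<in>Y. \<bar>y\<bar> < r} \<le> card {z. \<bar>z\<bar> < r \<and> h z = 0} + 1"
proof -
  define Y' where "Y' = {y\<in>Y. \<bar>y\<bar> < r}"
  have Y': "finite Y'" using Y by (simp add: Y'_def)
  show ?thesis
  proof (cases "Y' = {}")
    case False
    define m where "m = Max Y'"
    have m: "m \<in> Y'" "\<And>y. y \<in> Y' \<Longrightarrow> y \<le> m" using False Y' by (auto simp: m_def)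
    have "\<exists>z. y < z \<and> \<bar>z\<bar> < r \<and> h z = 0 \<and> (\<forall>x\<in>Y'. y < x \<longrightarrow> z < x)" if y: "y \<in> Y' - {m}" for y
    proof -
      define b where "b = Min {x\<in>Y'. y < x}"
      have "m \<in> {x\<in>Y'. y < x}" using m(1) m(2)[of y] y by auto
      then have "b \<in> {x\<in>Y'. y < x}" unfolding b_def using Y' by (intro Min_in) auto
      then have b: "b \<in> Y'" "y < b" by auto
      have bm: "b \<le> x" if "x \<in> Y'" "y < x" for x unfolding b_def using Y' that by (intro Min_le) auto
      have yY: "y \<in> Y" "b \<in> Y" using y b by (auto simp: Y'_def)
      have "nodal_deriv Y y * nodal_deriv Y b < 0"
      proof (rule nodal_deriv_sign_change[OF Y yY b(2)])
        fix x assume "x \<in> Y"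
        then show "x \<le> y \<or> b \<le> x" using bm[of x] y b by (cases "x \<in> Y'"; cases "y < x") (auto simp: Y'_def)
      qed
      then have s: "sgn (nodal_deriv Y y) * sgn (nodal_deriv Y b) < 0" by (simp add: sgn_mult[symmetric])
      have "h y * h b = (\<rho>\<^sup>2 * (w y * w b)) * (sgn (nodal_deriv Y y) * sgn (nodal_deriv Y b))"
        using \<rho>(2) by (auto simp: h(2)[OF yY(1)] h(2)[OF yY(2)] power2_eq_square)
      also have "\<dots> < 0" using \<rho>(1) w[OF yY(1)] w[OF yY(2)] by (intro mult_pos_neg[OF _ s]) simp
      finally have "h y * h b < 0" .
      moreover have c: "continuous_on {y..b} h" by (rule continuous_on_subset[OF h(1)]) simp
      ultimately have "\<exists>z. y \<le> z \<and> z \<le> b \<and> h z = 0"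
      proof (cases "h y \<le> 0")
        case True
        then have "0 \<le> h b" using \<open>h y * h b < 0\<close> by (smt (verit) mult_nonpos_nonpos)
        then show ?thesis using IVT'[OF True _ _ c] b(2) by auto
      next
        case False
        then have "h b \<le> 0" using \<open>h y * h b < 0\<close> by (smt (verit) mult_nonneg_nonneg)
        then show ?thesis using IVT2'[of h b 0 y, OF _ _ _ c] b(2) False by auto
      qed
      then obtain z where z: "y \<le> z" "z \<le> b" "h z = 0" by blast
      have "z \<noteq> y" "z \<noteq> b" using z(3) \<open>h y * h b < 0\<close> by auto
      then have yzb: "y < z" "z < b" using z by auto
      have "\<bar>y\<bar> < r" "\<bar>b\<bar> < r" using y b(1) by (auto simp: Y'_def)
      then have "\<bar>z\<bar> < r" using yzb by linarith
      moreover have "\<forall>x\<in>Y'. y < x \<longrightarrow> z < x" using bm yzb(2) by fastforce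
      ultimately show ?thesis using yzb(1) z(3) by blast
    qed
    then have "\<forall>y\<in>Y' - {m}. \<exists>z. y < z \<and> \<bar>z\<bar> < r \<and> h z = 0 \<and> (\<forall>x\<in>Y'. y < x \<longrightarrow> z < x)" by blast
    from bchoice[OF this] obtain z where zz: "\<forall>y\<in>Y' - {m}. y < z y \<and> \<bar>z y\<bar> < r \<and> h (z y) = 0 \<and> (\<forall>x\<in>Y'. y < x \<longrightarrow> z y < x)"
      by blast
    then have z: "\<And>y. y \<in> Y' - {m} \<Longrightarrow> y < z y" "\<And>y. y \<in> Y' - {m} \<Longrightarrow> \<bar>z y\<bar> < r \<and> h (z y) = 0"
      "\<And>y x. y \<in> Y' - {m} \<Longrightarrow> x \<in> Y' \<Longrightarrow> y < x \<Longrightarrow> z y < x"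
      by blast+
    have lt: "z x < z y" if "x \<in> Y' - {m}" "y \<in> Y' - {m}" "x < y" for x y
      using z(3)[OF that(1), of y] z(1)[OF that(2)] that by auto
    have "inj_on z (Y' - {m})"
    proof (rule inj_onI)
      fix x y assume xy: "x \<in> Y' - {m}" "y \<in> Y' - {m}" and eq: "z x = z y"
      show "x = y"
        by (rule linorder_cases[of x y]) (use lt[OF xy] lt[OF xy(2,1)] eq in auto)
    qed
    then have "card (Y' - {m}) \<le> card {z. \<bar>z\<bar> < r \<and> h z = 0}"
      by (rule card_inj_on_le) (use z(2) fin in auto)
    then show ?thesis using m(1) Y' by (simp add: Y'_def[symmetric])
  qed (simp add: Y'_def[symmetric])
qed

section \<open>Holomorphic functions in the upper half-plane\<close>

lemma poly_growth:
  fixes p :: "complex poly"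
  shows "\<exists>K m. 0 \<le> K \<and> (\<forall>z. cmod (poly p z) \<le> K * (1 + cmod z) ^ m)"
proof (intro exI conjI allI)
  define K where "K = (\<Sum>i\<le>degree p. cmod (coeff p i))"
  show "0 \<le> K" unfolding K_def by (intro sum_nonneg) auto
  fix z
  have "cmod (poly p z) \<le> (\<Sum>i\<le>degree p. cmod (coeff p i * z ^ i))"
    unfolding poly_altdef by (rule norm_sum)
  also have "\<dots> \<le> (\<Sum>i\<le>degree p. cmod (coeff p i) * (1 + cmod z) ^ degree p)"
    unfolding norm_mult norm_power
  proof (intro sum_mono mult_left_mono)
    fix i assume "i \<in> {..degree p}"
    have "cmod z ^ i \<le> (1 + cmod z) ^ i" by (intro power_mono) auto
    also have "\<dots> \<le> (1 + cmod z) ^ degree p" using \<open>i \<in> _\<close> by (intro power_increasing) auto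
    finally show "cmod z ^ i \<le> (1 + cmod z) ^ degree p" .
  qed auto
  finally show "cmod (poly p z) \<le> K * (1 + cmod z) ^ degree p" by (simp add: K_def sum_distrib_right)
qed

lemma interior_upper_halfplane: "interior {z. 0 \<le> Im z} = {z. 0 < Im z}"
proof -
  have "interior {z. 0 \<le> \<i> \<bullet> z} = {z. 0 < \<i> \<bullet> z}"
    using interior_halfspace_ge[of \<i> 0] by simp
  then show ?thesis by (simp add: inner_complex_def)
qed

lemma open_upper_halfplane: "open {z. 0 < Im z}"
  by (simp add: open_halfspace_Im_gt)

text \<open>Phragmen-Lindelof for functions of polynomial growth: divide by a power of
  \<open>1 - \<i> \<delta> z\<close>, whose modulus is at least 1 in the half-plane.\<close>
lemma halfplane_max_modulus:
  assumes hol: "f holomorphic_on {z. 0 < Im z}" and cont: "continuous_on {z. 0 \<le> Im z} f"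
    and grow: "\<And>z. 0 \<le> Im z \<Longrightarrow> cmod (f z) \<le> K * (1 + cmod z) ^ m"
    and bd: "\<And>x. cmod (f (complex_of_real x)) \<le> C"
    and z0: "0 \<le> Im z0"
  shows "cmod (f z0) \<le> C"
proof -
  have C: "0 \<le> C" using bd[of 0] norm_ge_zero order.trans by blast
  have "0 \<le> K * (1 + cmod 0) ^ m" using grow[of 0] norm_ge_zero[of "f 0"] by (simp del: norm_ge_zero)
  then have K: "0 \<le> K" by simp
  have ge1: "1 \<le> cmod (1 - \<i> * of_real \<delta> * z)" and ge2: "\<delta> * cmod z \<le> cmod (1 - \<i> * of_real \<delta> * z)"
    if "0 < \<delta>" "0 \<le> Im z" for \<delta> z
  proof -
    have sq: "(cmod (1 - \<i> * of_real \<delta> * z))\<^sup>2 = (1 + \<delta> * Im z)\<^sup>2 + (\<delta> * Re z)\<^sup>2"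
      by (simp add: cmod_power2)
    have "1\<^sup>2 \<le> (1 + \<delta> * Im z)\<^sup>2" using that by (intro power_mono) auto
    then show "1 \<le> cmod (1 - \<i> * of_real \<delta> * z)"
      using sq by (intro power2_le_imp_le[of 1]) (auto simp: add_increasing2)
    have "(\<delta> * cmod z)\<^sup>2 = (\<delta> * Re z)\<^sup>2 + (\<delta> * Im z)\<^sup>2"
      by (simp add: power_mult_distrib cmod_power2 algebra_simps)
    also have "\<dots> \<le> (cmod (1 - \<i> * of_real \<delta> * z))\<^sup>2"
      unfolding sq using that by (simp add: power2_eq_square algebra_simps)
    finally show "\<delta> * cmod z \<le> cmod (1 - \<i> * of_real \<delta> * z)" by (rule power2_le_imp_le) simp
  qed
  have key: "cmod (f z0) \<le> C * cmod (1 - \<i> * of_real \<delta> * z0) ^ Suc m" if \<delta>: "0 < \<delta>" for \<delta>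
  proof -
    define h where "h z = f z / (1 - \<i> * of_real \<delta> * z) ^ Suc m" for z
    have nz: "1 - \<i> * of_real \<delta> * z \<noteq> 0" if "0 \<le> Im z" for z using ge1[OF \<delta> that] by auto
    have "cmod (h z0) \<le> C + e" if e: "0 < e" for e
    proof -
      \<comment> \<open>On the arc of radius \<open>r\<close> the quotient is at most
        \<open>K * (2 * r)^m / (\<delta> * r)^(m + 1)\<close>, which this choice pushes below
        \<open>e\<close>.\<close>
      define r where "r = max (cmod z0 + 1) (K * 2 ^ m / (\<delta> ^ Suc m * e))"
      have "r \<ge> cmod z0 + 1" "K * 2 ^ m / (\<delta> ^ Suc m * e) \<le> r" unfolding r_def by (rule max.cobounded1 max.cobounded2)+
      moreover from this(1) have "r \<ge> 1" "cmod z0 \<le> r" using norm_ge_zero[of z0] by linarith+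
      ultimately have r: "r \<ge> 1" "cmod z0 \<le> r" "K * 2 ^ m / (\<delta> ^ Suc m * e) \<le> r" by blast+
      define S where "S = {z. 0 \<le> Im z} \<inter> cball 0 r"
      have "closed S" unfolding S_def by (intro closed_Int closed_halfspace_Im_ge) auto
      have "interior S \<subseteq> {z. 0 < Im z}"
        unfolding S_def interior_Int interior_upper_halfplane by blast
      have "open ({z. 0 < Im z} \<inter> ball 0 r)" by (intro open_Int open_upper_halfplane) auto
      then have int: "{z. 0 < Im z} \<inter> ball 0 r \<subseteq> interior S" by (intro interior_maximal) (auto simp: S_def)
      show ?thesis
      proof (rule maximum_modulus_frontier[of h S])
        show "h holomorphic_on interior S"
          unfolding h_def using \<open>interior S \<subseteq> _\<close> nz
          by (intro holomorphic_intros holomorphic_on_subset[OF hol]) auto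
        show "continuous_on (closure S) h"
          unfolding h_def closure_closed[OF \<open>closed S\<close>] using nz
          by (intro continuous_intros continuous_on_subset[OF cont]) (auto simp: S_def)
        show "bounded S" unfolding S_def by auto
        show "z0 \<in> S" using z0 r by (simp add: S_def)
        fix z assume "z \<in> frontier S"
        then have z: "z \<in> S" "z \<notin> interior S"
          using \<open>closed S\<close> by (auto simp: frontier_def)
        then have "Im z = 0 \<or> cmod z = r" using int by (force simp: S_def)
        then show "cmod (h z) \<le> C + e"
        proof
          assume "Im z = 0"
          then have "z = of_real (Re z)" by (simp add: complex_eq_iff)
          then have "cmod (f z) \<le> C" using bd by metis
          moreover have "1 \<le> cmod (1 - \<i> * of_real \<delta> * z) ^ Suc m"
            using ge1[OF \<delta>, of z] \<open>Im z = 0\<close> by (intro one_le_power) auto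
          ultimately have "cmod (h z) \<le> C / 1"
            unfolding h_def norm_divide norm_power using C by (intro frac_le) auto
          then show ?thesis using e by simp
        next
          assume zr: "cmod z = r"
          have Imz: "0 \<le> Im z" using z by (simp add: S_def)
          have "cmod (h z) \<le> K * (1 + r) ^ m / (\<delta> * r) ^ Suc m"
            unfolding h_def norm_divide norm_power
            using grow[OF Imz] ge2[OF \<delta> Imz] \<delta> r(1) K
            by (intro frac_le power_mono) (auto simp: zr)
          also have "\<dots> \<le> K * (2 * r) ^ m / (\<delta> * r) ^ Suc m"
            using r(1) K \<delta> by (intro divide_right_mono mult_left_mono power_mono) auto
          also have "\<dots> = (K * 2 ^ m / (\<delta> ^ Suc m * e)) * e / r"
            using r(1) \<delta> e by (simp add: power_mult_distrib)
          also have "\<dots> \<le> r * e / r" using r e by (intro divide_right_mono mult_right_mono) auto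
          also have "\<dots> = e" using r by simp
          finally show ?thesis using C by simp
        qed
      qed
    qed
    then have "cmod (h z0) \<le> C" by (rule field_le_epsilon)
    then show ?thesis
      using nz[OF z0] by (simp add: h_def norm_divide norm_power divide_le_eq del: power_Suc)
  qed
  have "((\<lambda>\<delta>. C * cmod (1 - \<i> * of_real \<delta> * z0) ^ Suc m) \<longlongrightarrow> C * cmod (1 - \<i> * of_real 0 * z0) ^ Suc m) (at_right 0)"
    by (intro tendsto_intros)
  then have "((\<lambda>\<delta>. C * cmod (1 - \<i> * of_real \<delta> * z0) ^ Suc m) \<longlongrightarrow> C) (at_right 0)" by simp
  then show ?thesis
    by (rule tendsto_lowerbound)
      (use key in \<open>auto simp: eventually_at_right_field intro!: exI[of _ 1]\<close>)
qed

text \<open>Harnack's inequality for the positive harmonic function \<open>Re g\<close>, from the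
  Schwarz lemma: \<open>\<phi>\<close> maps the disc to the half-plane with
  \<open>\<phi> 0 = w\<close>, and \<open>\<psi>\<close> is \<open>g\<close> after
  \<open>\<phi>\<close>, followed by the Cayley transform of the right half-plane that sends
  \<open>g w\<close> to 0. The constant is not sharp; what matters is at most linear growth along
  the imaginary axis.\<close>

lemma halfplane_harnack:
  assumes hol: "g holomorphic_on {z. 0 < Im z}" and pos: "\<And>z. 0 < Im z \<Longrightarrow> 0 < Re (g z)"
    and z: "0 < Im z" and w: "0 < Im w"
  shows "Re (g z) * (Im z * Im w) \<le> Re (g w) * (cmod (z - cnj w))\<^sup>2"
proof -
  define a where "a = g w"
  define \<phi> where "\<phi> \<zeta> = (w - cnj w * \<zeta>) / (1 - \<zeta>)" for \<zeta>
  have \<phi>pos: "0 < Im (\<phi> \<zeta>)" if "cmod \<zeta> < 1" for \<zeta>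
  proof -
    have n1: "1 - \<zeta> \<noteq> 0" using that by auto
    have "\<phi> \<zeta> = (w - cnj w * \<zeta>) * cnj (1 - \<zeta>) / of_real ((cmod (1 - \<zeta>))\<^sup>2)"
      unfolding \<phi>_def by (subst complex_div_cnj) simp
    then have "Im (\<phi> \<zeta>) = Im ((w - cnj w * \<zeta>) * cnj (1 - \<zeta>)) / (cmod (1 - \<zeta>))\<^sup>2"
      by (simp only: Im_divide_of_real)
    also have "Im ((w - cnj w * \<zeta>) * cnj (1 - \<zeta>)) = Im w * (1 - (cmod \<zeta>)\<^sup>2)"
      unfolding cmod_power2 by (simp add: algebra_simps power2_eq_square)
    finally show ?thesis
      using w n1 that by (simp add: power_less_one_iff abs_square_less_1)
  qed
  define \<psi> where "\<psi> \<zeta> = (g (\<phi> \<zeta>) - a) / (g (\<phi> \<zeta>) + cnj a)" for \<zeta>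
  have apos: "0 < Re a" using pos[OF w] by (simp add: a_def)
  have den: "g v + cnj a \<noteq> 0" if "0 < Im v" for v
    using pos[OF that] apos by (auto simp: complex_eq_iff)
  have norm_eq: "(cmod (g v - a))\<^sup>2 = (cmod (g v + cnj a))\<^sup>2 - 4 * Re (g v) * Re a" for v
    unfolding cmod_power2 by (simp add: algebra_simps power2_eq_square)
  have Schw: "cmod (\<psi> \<xi>) \<le> cmod \<xi>" if "cmod \<xi> < 1" for \<xi>
  proof (rule Schwarz_Lemma(1))
    have "\<phi> holomorphic_on ball 0 1" unfolding \<phi>_def by (intro holomorphic_intros) auto
    moreover have "\<phi> ` ball 0 1 \<subseteq> {z. 0 < Im z}" using \<phi>pos by auto
    ultimately have "(g \<circ> \<phi>) holomorphic_on ball 0 1"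
      using hol holomorphic_on_compose_gen by blast
    then have "(\<lambda>\<zeta>. g (\<phi> \<zeta>)) holomorphic_on ball 0 1" by (simp add: o_def)
    then show "\<psi> holomorphic_on ball 0 1" unfolding \<psi>_def
      using den \<phi>pos by (intro holomorphic_intros) auto
    show "\<psi> 0 = 0" by (simp add: \<psi>_def \<phi>_def a_def)
    show "cmod (\<psi> \<zeta>) < 1" if "cmod \<zeta> < 1" for \<zeta>
    proof -
      have "(cmod (g (\<phi> \<zeta>) - a))\<^sup>2 < (cmod (g (\<phi> \<zeta>) + cnj a))\<^sup>2"
        using norm_eq[of "\<phi> \<zeta>"] pos[OF \<phi>pos[OF that]] apos by simp
      then have "cmod (g (\<phi> \<zeta>) - a) < cmod (g (\<phi> \<zeta>) + cnj a)" by (rule power2_less_imp_less) simp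
      then show ?thesis using den[OF \<phi>pos[OF that]] by (simp add: \<psi>_def norm_divide)
    qed
  qed (rule that)
  define N where "N = (cmod (z - cnj w))\<^sup>2"
  have N: "(cmod (z - w))\<^sup>2 = N - 4 * Im z * Im w"
    unfolding N_def cmod_power2 by (simp add: algebra_simps power2_eq_square)
  have zw: "z - cnj w \<noteq> 0" using z w by (auto simp: complex_eq_iff)
  then have Npos: "0 < N" by (simp add: N_def)
  define \<xi> where "\<xi> = (z - w) / (z - cnj w)"
  have \<xi>2: "(cmod \<xi>)\<^sup>2 = (N - 4 * Im z * Im w) / N"
    unfolding \<xi>_def by (simp add: norm_divide power_divide N N_def[symmetric])
  then have "(cmod \<xi>)\<^sup>2 < 1\<^sup>2" using Npos z w by simp
  then have \<xi>1: "cmod \<xi> < 1" by (rule power2_less_imp_less) simp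
  have wc: "w - cnj w \<noteq> 0" using w by (auto simp: complex_eq_iff)
  have "1 - \<xi> = (w - cnj w) / (z - cnj w)" unfolding \<xi>_def using zw by (simp add: field_simps)
  moreover have "w - cnj w * \<xi> = z * (w - cnj w) / (z - cnj w)"
    unfolding \<xi>_def using zw by (simp add: field_simps)
  ultimately have \<phi>\<xi>: "\<phi> \<xi> = z" unfolding \<phi>_def using zw wc by simp
  define V where "V = Re (g z)"
  have V: "0 < V" using pos[OF z] by (simp add: V_def)
  define T where "T = (cmod (g z + cnj a))\<^sup>2"
  have T: "(V + Re a)\<^sup>2 \<le> T" unfolding T_def V_def by (simp add: cmod_power2)
  then have Tpos: "0 < T" using V apos by (smt (verit) zero_less_power)
  have "(cmod (\<psi> \<xi>))\<^sup>2 \<le> (cmod \<xi>)\<^sup>2" using Schw[OF \<xi>1] by (intro power_mono) auto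
  then have "(T - 4 * V * Re a) / T \<le> (N - 4 * Im z * Im w) / N"
    unfolding \<xi>2 \<psi>_def \<phi>\<xi> norm_divide power_divide norm_eq T_def[symmetric] V_def[symmetric] .
  then have "4 * Im z * Im w / N \<le> 4 * V * Re a / T"
    using Npos Tpos by (simp add: diff_divide_distrib)
  then have "Im z * Im w * T \<le> V * Re a * N"
    using Npos Tpos by (simp add: divide_le_eq le_divide_eq field_simps)
  moreover have "V\<^sup>2 \<le> (V + Re a)\<^sup>2" using V apos by (intro power_mono) auto
  then have "V\<^sup>2 \<le> T" using T by linarith
  then have "Im z * Im w * V\<^sup>2 \<le> Im z * Im w * T" using z w by (intro mult_left_mono) auto
  ultimately have "V * (V * (Im z * Im w)) \<le> V * (Re a * N)" by (simp add: power2_eq_square algebra_simps)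
  then show ?thesis using V by (simp add: V_def a_def N_def)
qed

text \<open>Dividing out the exponential type: \<open>c\<close> is the infimum of \<open>- ln \<bar>G (z + \<i>)\<bar> / Im z\<close>.\<close>
lemma remove_exponential_type:
  assumes hol: "G holomorphic_on {z. 0 < Im z}" and nz: "\<And>z. 0 < Im z \<Longrightarrow> G z \<noteq> 0"
    and bd: "\<And>z. 0 < Im z \<Longrightarrow> cmod (G z) \<le> 1 / Im z"
  obtains E where "E holomorphic_on {z. -1 < Im z}" "\<And>z. 0 \<le> Im z \<Longrightarrow> cmod (E z) \<le> 1"
    "\<And>x. cmod (E (complex_of_real x)) = cmod (G (complex_of_real x + \<i>))"
    "\<And>\<epsilon>. 0 < \<epsilon> \<Longrightarrow> \<exists>R. \<forall>y\<ge>R. 0 < y \<longrightarrow> exp (- \<epsilon> * y) \<le> cmod (E (\<i> * complex_of_real y))"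
proof -
  define u where "u z = - ln (cmod (G (z + \<i>)))" for z
  have u: "cmod (G (z + \<i>)) = exp (- u z)" if "- 1 < Im z" for z
    using nz[of "z + \<i>"] that by (simp add: u_def)
  have u0: "0 \<le> u z" if "0 \<le> Im z" for z
  proof -
    have "cmod (G (z + \<i>)) \<le> 1 / Im (z + \<i>)" using that by (intro bd) auto
    also have "\<dots> \<le> 1" using that by simp
    finally show ?thesis using u[of z] that by simp
  qed
  define A where "A = (\<lambda>z. u z / Im z) ` {z. 0 < Im z}"
  have A: "A \<noteq> {}" "bdd_below A" unfolding A_def
  proof -
    have "\<i> \<in> {z. 0 < Im z}" by simp
    then show "(\<lambda>z. u z / Im z) ` {z. 0 < Im z} \<noteq> {}" by blast
    show "bdd_below ((\<lambda>z. u z / Im z) ` {z. 0 < Im z})"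
      by (rule bdd_belowI[of _ 0]) (use u0 in auto)
  qed
  define c where "c = Inf A"
  have cle: "c * Im z \<le> u z" if "0 < Im z" for z
  proof -
    have "c \<le> u z / Im z" unfolding c_def by (rule cInf_lower[OF _ A(2)]) (use that in \<open>auto simp: A_def\<close>)
    then show ?thesis using that by (simp add: le_divide_eq)
  qed
  \<comment> \<open>The exponential has modulus \<open>exp (c * Im z)\<close>, hence 1 on the real
    axis. The shift of \<open>G\<close> by \<open>\<i>\<close> keeps away from the boundary, where
    \<open>1 / Im z\<close> is unbounded.\<close>
  define E where "E z = G (z + \<i>) * exp (- \<i> * of_real c * z)" for z
  have cE: "cmod (E z) = exp (- (u z - c * Im z))" if "- 1 < Im z" for z
    unfolding E_def norm_mult u[OF that] by (simp add: exp_add[symmetric])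
  show thesis
  proof (rule that[of E])
    have "(G \<circ> (\<lambda>z. z + \<i>)) holomorphic_on {z. -1 < Im z}"
      by (rule holomorphic_on_compose_gen[OF _ hol]) (auto intro!: holomorphic_intros)
    then have "(\<lambda>z. G (z + \<i>)) holomorphic_on {z. -1 < Im z}" by (simp add: o_def)
    then show holE: "E holomorphic_on {z. -1 < Im z}" unfolding E_def by (intro holomorphic_intros) auto
    show "cmod (E z) \<le> 1" if "0 \<le> Im z" for z
    proof -
      have "0 \<le> u z - c * Im z" using cle[of z] u0[of z] that by (cases "Im z = 0") auto
      then show ?thesis using that by (simp add: cE)
    qed
    show "cmod (E (complex_of_real x)) = cmod (G (complex_of_real x + \<i>))" for x
      by (simp add: cE u)
    fix \<epsilon> :: real assume \<epsilon>: "0 < \<epsilon>"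
    \<comment> \<open>At a point \<open>w\<close> that nearly attains the infimum,
      \<open>v w < \<epsilon> / 8 * Im w\<close>; Harnack carries this to the imaginary axis. The
      constants fit because \<open>d + v w \<le> \<epsilon> / 4 * Im w\<close>, and the squared
      distance from \<open>z = \<i> * y\<close> to \<open>cnj w\<close> is at most
      \<open>4 * y^2\<close> for \<open>y \<ge> \<bar>w\<bar>\<close>.\<close>
    have "Inf A < c + \<epsilon> / 8" using \<epsilon> by (simp add: c_def)
    then obtain t where "t \<in> A" "t < c + \<epsilon> / 8" using cInf_lessD[OF A(1)] by blast
    then obtain w where w: "0 < Im w" "u w / Im w < c + \<epsilon> / 8" by (auto simp: A_def)
    define v where "v z = u z - c * Im z" for z
    have vw: "v w < \<epsilon> / 8 * Im w" using w by (simp add: v_def divide_less_eq algebra_simps)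
    define U where "U = {z. 0 < Im z}"
    have "convex U" unfolding U_def by (rule convex_halfspace_Im_gt)
    then have "contractible U" by (rule convex_imp_contractible)
    moreover have "E holomorphic_on U" using holE by (rule holomorphic_on_subset) (auto simp: U_def)
    moreover have "E z \<noteq> 0" if "z \<in> U" for z using nz[of "z + \<i>"] that by (simp add: E_def U_def)
    ultimately obtain g where g: "g holomorphic_on U" "\<And>z. z \<in> U \<Longrightarrow> E z = exp (g z)"
      using contractible_imp_holomorphic_log[of E U] by blast
    \<comment> \<open>\<open>v\<close> is only known to be nonnegative; adding \<open>d\<close>
      makes it strictly positive, as Harnack demands.\<close>
    define d where "d = \<epsilon> * Im w / 8"
    have d: "0 < d" using \<epsilon> w by (simp add: d_def)
    have Reg: "Re (of_real d - g z) = d + v z" if "0 < Im z" for z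
    proof -
      have "exp (Re (g z)) = exp (- v z)"
        using cE[of z] g(2)[of z] that by (simp add: U_def v_def)
      then show ?thesis by simp
    qed
    show "\<exists>R. \<forall>y\<ge>R. 0 < y \<longrightarrow> exp (- \<epsilon> * y) \<le> cmod (E (\<i> * complex_of_real y))"
    proof (intro exI[of _ "cmod w"] allI impI)
      fix y assume y: "cmod w \<le> y" "0 < y"
      define z where "z = \<i> * complex_of_real y"
      have z: "0 < Im z" "Im z = y" "Re z = 0" using y by (auto simp: z_def)
      have "Re (of_real d - g z) * (Im z * Im w) \<le> Re (of_real d - g w) * (cmod (z - cnj w))\<^sup>2"
      proof (rule halfplane_harnack[of "\<lambda>z. of_real d - g z"])
        show "(\<lambda>z. of_real d - g z) holomorphic_on {z. 0 < Im z}"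
          using g(1) unfolding U_def by (intro holomorphic_intros)
        show "0 < Re (of_real d - g z)" if "0 < Im z" for z
          using Reg[OF that] d cle[OF that] by (simp add: v_def)
      qed (use z w in auto)
      then have "(d + v z) * (y * Im w) \<le> (d + v w) * (cmod (z - cnj w))\<^sup>2"
        unfolding Reg[OF z(1)] Reg[OF w(1)] z(2) .
      also have "\<dots> \<le> (\<epsilon> / 4 * Im w) * (4 * y\<^sup>2)"
      proof (rule mult_mono)
        show "d + v w \<le> \<epsilon> / 4 * Im w" using vw by (simp add: d_def)
        have "(cmod w)\<^sup>2 \<le> y\<^sup>2" using y by (intro power_mono) auto
        then have "(Re w)\<^sup>2 + (Im w)\<^sup>2 \<le> y\<^sup>2" by (simp add: cmod_power2)
        moreover have "(cmod (z - cnj w))\<^sup>2 = (Re w)\<^sup>2 + (y + Im w)\<^sup>2"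
          by (simp add: cmod_power2 z)
        moreover have "(y + Im w)\<^sup>2 \<le> 2 * y\<^sup>2 + 2 * (Im w)\<^sup>2"
          using zero_le_power2[of "y - Im w"] by (simp add: power2_eq_square algebra_simps)
        moreover have "0 \<le> (Re w)\<^sup>2" by simp
        ultimately show "(cmod (z - cnj w))\<^sup>2 \<le> 4 * y\<^sup>2" by linarith
      qed (use \<epsilon> w in auto)
      also have "\<dots> = (\<epsilon> * y) * (y * Im w)" by (simp add: power2_eq_square)
      finally have "d + v z \<le> \<epsilon> * y" using y w by simp
      then have "v z \<le> \<epsilon> * y" using d by simp
      then show "exp (- \<epsilon> * y) \<le> cmod (E (\<i> * complex_of_real y))"
        using cE[of z] z unfolding z_def[symmetric] v_def by simp
    qed
  qed
qed


section \<open>Real zeros of polynomials under a growth bound in the half-plane\<close>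

lemma poly_factor_roots:
  fixes q :: "'a::field poly"
  assumes "finite Z" "\<And>x. x \<in> Z \<Longrightarrow> poly q x = 0"
  shows "\<exists>r. q = r * (\<Prod>x\<in>Z. [:-x, 1:])"
  using assms
proof (induction Z rule: finite_induct)
  case (insert a Z)
  then obtain r where r: "q = r * (\<Prod>x\<in>Z. [:-x, 1:])" by auto
  have "poly (\<Prod>x\<in>Z. [:-x, 1:]) a \<noteq> 0" using insert by (auto simp: poly_prod)
  moreover have "poly q a = 0" using insert by simp
  ultimately have "poly r a = 0" using r by simp
  then obtain s where "r = [:-a, 1:] * s" by (auto simp: poly_eq_0_iff_dvd)
  then have "q = s * ([:-a, 1:] * (\<Prod>x\<in>Z. [:-x, 1:]))" using r by (simp only: mult_ac)
  then have "q = s * (\<Prod>x\<in>insert a Z. [:-x, 1:])" by (simp only: prod.insert[OF insert.hyps(1,2)])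
  then show ?case by blast
qed (auto intro: exI[of _ q])

text \<open>A Blaschke product argument in the half-plane \<open>Im z > - R\<close>, whose boundary stays at
  distance \<open>R\<close> from the zeros.\<close>
lemma real_zeros_bound:
  fixes q P :: "complex poly"
  assumes E: "E holomorphic_on {z. -1 < Im z}" "\<And>z. 0 \<le> Im z \<Longrightarrow> cmod (E z) \<le> 1"
    and PE: "\<And>z. 0 \<le> Im z \<Longrightarrow> cmod (poly P (z + \<i>)) * cmod (E z) \<le> C" and C: "0 \<le> C"
    and qP: "\<And>z. cmod (poly q z) \<le> (1 + cmod z)\<^sup>2 * (1 + cmod (poly P z))"
    and q_cnj: "\<And>z. cmod (poly q (cnj z)) = cmod (poly q z)" and qi: "cmod (poly q \<i>) = 1"
    and Z: "finite Z" "\<And>x. x \<in> Z \<Longrightarrow> \<bar>x\<bar> < R \<and> poly q (complex_of_real x) = 0" and R: "1 \<le> R"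
  shows "sqrt 2 ^ card Z * cmod (E (\<i> * complex_of_real (2 * R))) \<le> 4 * (1 + C) * (2 * R + 1)\<^sup>2"
proof -
  have "\<exists>r. q = r * (\<Prod>x\<in>complex_of_real ` Z. [:-x, 1:])"
    by (rule poly_factor_roots) (use Z in auto)
  then obtain r where "q = r * (\<Prod>x\<in>complex_of_real ` Z. [:-x, 1:])" by blast
  then have r: "poly q z = poly r z * (\<Prod>x\<in>Z. z - complex_of_real x)" for z
    by (simp add: prod.reindex inj_on_def poly_prod)
  \<comment> \<open>In coordinates where the half-plane \<open>Im z > - R\<close> becomes
    \<open>Im z > 0\<close>, \<open>h\<close> is \<open>q\<close> with every zero in
    \<open>Z\<close> moved to its mirror image: the factor \<open>z - \<i> * R - x\<close> becomes
    \<open>z + \<i> * R - x\<close>, of the same modulus for real \<open>z\<close>.\<close>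
  define h where "h = (r \<circ>\<^sub>p [:- \<i> * complex_of_real R, 1:]) * (\<Prod>x\<in>Z. [:\<i> * complex_of_real R - complex_of_real x, 1:])"
  have h: "poly h z = poly r (z - \<i> * of_real R) * (\<Prod>x\<in>Z. z + \<i> * of_real R - of_real x)" for z
    by (simp add: h_def poly_pcompose poly_prod algebra_simps)
  obtain K m where K: "0 \<le> K" "\<And>z. cmod (poly h z) \<le> K * (1 + cmod z) ^ m" using poly_growth[of h] by blast
  \<comment> \<open>The square compensates the factor \<open>(1 + \<bar>z\<bar>)^2\<close> in the
    bound for \<open>q\<close>; the shift of \<open>E\<close> by \<open>R - 1\<close> matches the
    shift of \<open>P\<close> by \<open>\<i>\<close> in the bound for their product.\<close>
  define f where "f z = poly h z * E (z + \<i> * of_real (R - 1)) / (z + \<i> * of_real R)\<^sup>2" for z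
  have den: "R \<le> cmod (z + \<i> * of_real R)" if "0 \<le> Im z" for z
  proof -
    have "R \<le> \<bar>Im (z + \<i> * of_real R)\<bar>" using that R by simp
    then show ?thesis using abs_Im_le_cmod order.trans by blast
  qed
  have den0: "z + \<i> * of_real R \<noteq> 0" if "0 \<le> Im z" for z using den[OF that] R by auto
  have "(E \<circ> (\<lambda>z. z + \<i> * of_real (R - 1))) holomorphic_on {z. -1 < Im z}"
    by (rule holomorphic_on_compose_gen[OF _ E(1)]) (use R in \<open>auto intro!: holomorphic_intros\<close>)
  then have EhR: "(\<lambda>z. E (z + \<i> * of_real (R - 1))) holomorphic_on {z. -1 < Im z}" by (simp add: o_def)
  \<comment> \<open>The point \<open>\<i>\<close> of the original coordinates, where
    \<open>\<bar>q\<bar> = 1\<close>.\<close>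
  define z0 where "z0 = \<i> * complex_of_real (R + 1)"
  have "cmod (f z0) \<le> 4 * (1 + C)"
  proof (rule halfplane_max_modulus[of f K m])
    show "f holomorphic_on {z. 0 < Im z}" unfolding f_def
      using den0 by (intro holomorphic_intros holomorphic_on_subset[OF EhR]) auto
    show "continuous_on {z. 0 \<le> Im z} f" unfolding f_def
      using den0 by (intro continuous_intros continuous_on_subset[OF holomorphic_on_imp_continuous_on[OF EhR]]) auto
    show "0 \<le> Im z0" using R by (simp add: z0_def)
    show "cmod (f z) \<le> K * (1 + cmod z) ^ m" if z: "0 \<le> Im z" for z
    proof -
      have "1 \<le> (cmod (z + \<i> * of_real R))\<^sup>2" using den[OF z] R by (intro one_le_power) auto
      moreover have "cmod (poly h z) * cmod (E (z + \<i> * of_real (R - 1))) \<le> K * (1 + cmod z) ^ m * 1"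
        using K R z by (intro mult_mono E(2)) auto
      ultimately have "cmod (f z) \<le> (K * (1 + cmod z) ^ m) / 1"
        unfolding f_def norm_divide norm_mult norm_power using K by (intro frac_le) auto
      then show ?thesis by simp
    qed
    show "cmod (f (of_real t)) \<le> 4 * (1 + C)" for t
    proof -
      define s where "s = complex_of_real t + \<i> * of_real R"
      define e where "e = E (of_real t + \<i> * of_real (R - 1))"
      have s1: "1 \<le> cmod s" using den[of "of_real t"] R by (simp add: s_def)
      have "cmod (of_real t + \<i> * of_real R - of_real x) = cmod (of_real t - \<i> * of_real R - of_real x)" for x
        by (simp add: cmod_def)
      then have "cmod (poly h (of_real t)) = cmod (poly q (of_real t - \<i> * of_real R))"
        unfolding h r norm_mult prod_norm[symmetric] by simp
      also have "of_real t - \<i> * of_real R = cnj s" by (simp add: s_def)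
      also have "cmod (poly q (cnj s)) \<le> (1 + cmod s)\<^sup>2 * (1 + cmod (poly P s))"
        using q_cnj qP by simp
      finally have "cmod (poly h (of_real t)) * cmod e \<le> (1 + cmod s)\<^sup>2 * (1 + cmod (poly P s)) * cmod e"
        by (intro mult_right_mono) auto
      also have "\<dots> = (1 + cmod s)\<^sup>2 * (cmod e + cmod (poly P s) * cmod e)" by (simp add: algebra_simps)
      also have "\<dots> \<le> (2 * cmod s)\<^sup>2 * (1 + C)"
      proof (intro mult_mono power_mono add_mono)
        show "cmod e \<le> 1" unfolding e_def using R by (intro E(2)) auto
        have "s = (of_real t + \<i> * of_real (R - 1)) + \<i>" by (simp add: s_def algebra_simps)
        then show "cmod (poly P s) * cmod e \<le> C"
          unfolding e_def using R by (simp only:) (intro PE, simp)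
      qed (use s1 C in auto)
      also have "\<dots> = (4 * (1 + C)) * (cmod s)\<^sup>2" by (simp add: power_mult_distrib algebra_simps)
      finally have "cmod (poly h (of_real t)) * cmod e \<le> (4 * (1 + C)) * (cmod s)\<^sup>2" .
      moreover have "0 < (cmod s)\<^sup>2" using s1 by (intro zero_less_power) linarith
      ultimately show ?thesis
        unfolding f_def norm_divide norm_mult norm_power s_def[symmetric] e_def[symmetric]
        by (simp add: divide_le_eq)
    qed
  qed
  moreover have "poly h z0 = poly r \<i> * (\<Prod>x\<in>Z. \<i> * of_real (2 * R + 1) - of_real x)"
    unfolding h z0_def by (simp add: algebra_simps)
  moreover have "z0 + \<i> * of_real (R - 1) = \<i> * of_real (2 * R)" "z0 + \<i> * of_real R = \<i> * of_real (2 * R + 1)"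
    by (simp_all add: z0_def algebra_simps)
  ultimately have main: "cmod (poly r \<i>) * (\<Prod>x\<in>Z. cmod (\<i> * of_real (2 * R + 1) - of_real x))
      * cmod (E (\<i> * of_real (2 * R))) / (2 * R + 1)\<^sup>2 \<le> 4 * (1 + C)"
    unfolding f_def using R norm_of_real[of "2 * R + 1", where 'a = complex]
    by (simp add: norm_divide norm_mult norm_power prod_norm)
  \<comment> \<open>Every zero gains a factor of at least \<open>sqrt 2\<close> by the reflection:
    its mirror image is that much farther from \<open>\<i>\<close>.\<close>
  have "sqrt 2 ^ card Z * (\<Prod>x\<in>Z. cmod (\<i> - of_real x)) = (\<Prod>x\<in>Z. sqrt 2 * cmod (\<i> - of_real x))"
    by (simp add: prod.distrib)
  also have "\<dots> \<le> (\<Prod>x\<in>Z. cmod (\<i> * of_real (2 * R + 1) - of_real x))"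
  proof (rule prod_mono, safe)
    fix x assume "x \<in> Z"
    then have "x\<^sup>2 \<le> R\<^sup>2" using Z(2) by (metis abs_le_square_iff abs_of_nonneg less_imp_le order_trans abs_ge_zero)
    moreover have "1\<^sup>2 \<le> R\<^sup>2" using R by (intro power_mono) auto
    ultimately have "2 * (1 + x\<^sup>2) \<le> (2 * R + 1)\<^sup>2 + x\<^sup>2" using R by (simp add: power2_eq_square algebra_simps)
    then have "(sqrt 2 * cmod (\<i> - of_real x))\<^sup>2 \<le> (cmod (\<i> * of_real (2 * R + 1) - of_real x))\<^sup>2"
      by (simp add: power_mult_distrib cmod_power2)
    then show "sqrt 2 * cmod (\<i> - of_real x) \<le> cmod (\<i> * of_real (2 * R + 1) - of_real x)"
      by (rule power2_le_imp_le) simp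
  qed auto
  finally have "cmod (poly r \<i>) * (sqrt 2 ^ card Z * (\<Prod>x\<in>Z. cmod (\<i> - of_real x)))
     \<le> cmod (poly r \<i>) * (\<Prod>x\<in>Z. cmod (\<i> * of_real (2 * R + 1) - of_real x))"
    by (intro mult_left_mono) auto
  moreover have "cmod (poly r \<i>) * (\<Prod>x\<in>Z. cmod (\<i> - of_real x)) = 1"
    using qi unfolding r norm_mult prod_norm[symmetric] .
  moreover have "cmod (poly r \<i>) * (sqrt 2 ^ card Z * (\<Prod>x\<in>Z. cmod (\<i> - of_real x)))
      = sqrt 2 ^ card Z * (cmod (poly r \<i>) * (\<Prod>x\<in>Z. cmod (\<i> - of_real x)))"
    by (rule mult.left_commute)
  ultimately have "sqrt 2 ^ card Z \<le> cmod (poly r \<i>) * (\<Prod>x\<in>Z. cmod (\<i> * of_real (2 * R + 1) - of_real x))"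
    by (simp only: mult_1_right)
  then have "sqrt 2 ^ card Z * cmod (E (\<i> * of_real (2 * R)))
     \<le> cmod (poly r \<i>) * (\<Prod>x\<in>Z. cmod (\<i> * of_real (2 * R + 1) - of_real x)) * cmod (E (\<i> * of_real (2 * R)))"
    by (rule mult_right_mono) simp
  also have "\<dots> \<le> 4 * (1 + C) * (2 * R + 1)\<^sup>2"
    using main R by (simp add: divide_le_eq)
  finally show ?thesis .
qed


text \<open>Take logarithms in \<open>real_zeros_bound\<close>: each zero counts
  \<open>ln 2 / 2\<close>, while \<open>E\<close> at \<open>2 * R\<close> on the imaginary axis and
  the polynomial factor allow at most \<open>4 * e * R\<close> for large \<open>R\<close>. How large
  depends only on \<open>E\<close>, \<open>C\<close> and \<open>\<epsilon>\<close>, so one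
  \<open>K\<close> serves the whole family.\<close>

lemma real_zeros_sublinear:
  fixes \<P> :: "(complex poly \<times> complex poly) set"
  assumes E: "E holomorphic_on {z. -1 < Im z}" "\<And>z. 0 \<le> Im z \<Longrightarrow> cmod (E z) \<le> 1"
    "\<And>\<epsilon>. 0 < \<epsilon> \<Longrightarrow> \<exists>R. \<forall>y\<ge>R. 0 < y \<longrightarrow> exp (- \<epsilon> * y) \<le> cmod (E (\<i> * complex_of_real y))"
    and C: "0 \<le> C" and \<epsilon>: "0 < \<epsilon>"
    and PE: "\<And>P q z. (P, q) \<in> \<P> \<Longrightarrow> 0 \<le> Im z \<Longrightarrow> cmod (poly P (z + \<i>)) * cmod (E z) \<le> C"
    and qP: "\<And>P q z. (P, q) \<in> \<P> \<Longrightarrow> cmod (poly q z) \<le> (1 + cmod z)\<^sup>2 * (1 + cmod (poly P z))"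
    and q_cnj: "\<And>P q z. (P, q) \<in> \<P> \<Longrightarrow> cmod (poly q (cnj z)) = cmod (poly q z)"
    and qi: "\<And>P q. (P, q) \<in> \<P> \<Longrightarrow> cmod (poly q \<i>) = 1"
  shows "\<exists>K. \<forall>(P, q)\<in>\<P>. \<forall>r\<ge>0. real (card {x. \<bar>x\<bar> < r \<and> poly q (complex_of_real x) = 0}) \<le> \<epsilon> * r + K"
proof -
  define e where "e = \<epsilon> * ln 2 / 8"
  have e: "0 < e" using \<epsilon> by (simp add: e_def)
  obtain R1 where R1: "\<And>y. R1 \<le> y \<Longrightarrow> 0 < y \<Longrightarrow> exp (- e * y) \<le> cmod (E (\<i> * complex_of_real y))"
    using E(3)[OF e] by blast
  have "eventually (\<lambda>R. ln (4 * (1 + C)) + 2 * ln (2 * R + 1) \<le> 2 * e * R) at_top"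
    using e by real_asymp
  then obtain R2 where R2: "\<And>R. R2 \<le> R \<Longrightarrow> ln (4 * (1 + C)) + 2 * ln (2 * R + 1) \<le> 2 * e * R"
    unfolding eventually_at_top_linorder by blast
  define R0 where "R0 = max 1 (max R1 R2)"
  have R0: "1 \<le> R0" "R1 \<le> R0" "R2 \<le> R0" by (auto simp: R0_def)
  define zs where "zs q r = {x. \<bar>x\<bar> < r \<and> poly q (complex_of_real x) = 0}" for q r
  have fin: "finite (zs q r)" if "(P, q) \<in> \<P>" for P q r
  proof -
    have "q \<noteq> 0" using qi[OF that] by auto
    then have "finite {z. poly q z = 0}" by (rule poly_roots_finite)
    then have "finite (complex_of_real -` {z. poly q z = 0})"
      by (rule finite_vimageI) (simp add: inj_on_def)
    then show ?thesis by (rule rev_finite_subset) (auto simp: zs_def)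
  qed
  have big: "real (card (zs q R)) \<le> \<epsilon> * R" if Pq: "(P, q) \<in> \<P>" and R: "R0 \<le> R" for P q R
  proof -
    define n where "n = card (zs q R)"
    have R': "1 \<le> R" "R1 \<le> 2 * R" "R2 \<le> R" using R R0 by linarith+
    have "sqrt 2 ^ n * cmod (E (\<i> * complex_of_real (2 * R))) \<le> 4 * (1 + C) * (2 * R + 1)\<^sup>2"
      unfolding n_def
      by (rule real_zeros_bound[OF E(1,2) PE[OF Pq] C qP[OF Pq] q_cnj[OF Pq] qi[OF Pq] fin[OF Pq] _ R'(1)])
        (auto simp: zs_def)
    moreover have "sqrt 2 ^ n * exp (- e * (2 * R)) \<le> sqrt 2 ^ n * cmod (E (\<i> * complex_of_real (2 * R)))"
      using R' by (intro mult_left_mono R1) auto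
    ultimately have "sqrt 2 ^ n * exp (- e * (2 * R)) \<le> 4 * (1 + C) * (2 * R + 1)\<^sup>2" by linarith
    moreover have "0 < sqrt 2 ^ n * exp (- e * (2 * R))" by simp
    ultimately have "ln (sqrt 2 ^ n * exp (- e * (2 * R))) \<le> ln (4 * (1 + C) * (2 * R + 1)\<^sup>2)"
      using ln_mono by blast
    moreover have "ln (sqrt 2 ^ n * exp (- e * (2 * R))) = real n * (ln 2 / 2) - e * (2 * R)"
      by (simp add: ln_mult ln_realpow ln_sqrt)
    moreover have "ln (4 * (1 + C) * (2 * R + 1)\<^sup>2) = ln (4 * (1 + C)) + 2 * ln (2 * R + 1)"
    proof -
      have "0 < 4 * (1 + C)" "0 < 2 * R + 1" using C R' by auto
      then show ?thesis by (subst ln_mult) (auto simp: ln_realpow)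
    qed
    ultimately have "real n * (ln 2 / 2) \<le> 4 * e * R" using R2[OF R'(3)] by linarith
    then have "real n * ln 2 \<le> (\<epsilon> * R) * ln 2" by (simp add: e_def)
    then show ?thesis by (simp add: n_def)
  qed
  have "real (card (zs q r)) \<le> \<epsilon> * r + \<epsilon> * R0" if Pq: "(P, q) \<in> \<P>" and r: "0 \<le> r" for P q r
  proof -
    have "zs q r \<subseteq> zs q (max r R0)" by (auto simp: zs_def)
    then have "card (zs q r) \<le> card (zs q (max r R0))" by (rule card_mono[OF fin[OF Pq]])
    also have "real \<dots> \<le> \<epsilon> * max r R0" by (rule big[OF Pq]) simp
    also have "\<dots> \<le> \<epsilon> * (r + R0)" using r R0 \<epsilon> by (intro mult_left_mono) auto
    finally show ?thesis by (simp add: algebra_simps)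
  qed
  then show ?thesis unfolding zs_def by (intro exI[of _ "\<epsilon> * R0"]) auto
qed

section \<open>The extremal polynomials\<close>

definition cpoly :: "real poly \<Rightarrow> complex poly" where
  "cpoly p = map_poly complex_of_real p"

lemma poly_cpoly_of_real: "poly (cpoly p) (of_real x) = of_real (poly p x)"
  unfolding cpoly_def by (induction p) (auto simp: map_poly_pCons)

lemma poly_cpoly_cnj: "poly (cpoly p) (cnj z) = cnj (poly (cpoly p) z)"
  unfolding cpoly_def by (induction p) (auto simp: map_poly_pCons)

lemma degree_cpoly: "degree (cpoly p) = degree p"
  unfolding cpoly_def by (simp add: degree_map_poly)

lemma nodal_deriv_of_real: "nodal_deriv (of_real ` Y) (of_real x :: complex) = of_real (nodal_deriv Y x)"
proof -
  have "of_real ` Y - {of_real x :: complex} = of_real ` (Y - {x})" by auto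
  then show ?thesis unfolding nodal_deriv_def by (simp add: prod.reindex inj_on_def)
qed

lemma partial_fractions_real_nodes:
  fixes Y :: "real set"
  assumes Y: "finite Y" and p: "degree p < card Y" and z: "Im z \<noteq> 0"
  shows "poly (cpoly p) z / (\<Prod>y\<in>Y. z - of_real y)
     = (\<Sum>x\<in>Y. of_real (poly p x / nodal_deriv Y x) / (z - of_real x))"
proof -
  have inj: "inj_on complex_of_real Y" by (simp add: inj_on_def)
  have "poly (cpoly p) z / (\<Prod>y\<in>complex_of_real ` Y. z - y)
      = (\<Sum>x\<in>complex_of_real ` Y. poly (cpoly p) x / (nodal_deriv (complex_of_real ` Y) x * (z - x)))"
    by (rule lagrange_partial_fractions) (use Y p z in \<open>auto simp: degree_cpoly card_image[OF inj]\<close>)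
  then show ?thesis
    by (simp add: prod.reindex[OF inj] sum.reindex[OF inj] poly_cpoly_of_real nodal_deriv_of_real)
qed

text \<open>Each partial fraction is estimated with
  \<open>\<bar>Im z\<bar> \<le> \<bar>z - x\<bar>\<close>. So \<open>\<kappa> * Q\<close>, with
  \<open>\<kappa>\<close> the sum on the right and \<open>Q\<close> the monic polynomial with zero
  set \<open>Y\<close>, dominates off the real line every polynomial that the weight dominates at
  the nodes.\<close>

lemma node_poly_lower_bound:
  fixes Y :: "real set"
  assumes Y: "finite Y" and p: "degree p < card Y" and z: "Im z \<noteq> 0"
    and le: "\<And>x. x \<in> Y \<Longrightarrow> \<bar>poly p x\<bar> \<le> A * w x"
  shows "cmod (poly (cpoly p) z) * \<bar>Im z\<bar>
    \<le> A * (\<Sum>x\<in>Y. w x / \<bar>nodal_deriv Y x\<bar>) * (\<Prod>y\<in>Y. cmod (z - of_real y))"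
proof -
  have nz: "z - of_real y \<noteq> 0" for y using z by (auto simp: complex_eq_iff)
  have pos: "0 < (\<Prod>y\<in>Y. cmod (z - of_real y))" using nz by (intro prod_pos) auto
  have "cmod (poly (cpoly p) z) / (\<Prod>y\<in>Y. cmod (z - of_real y))
      = cmod (\<Sum>x\<in>Y. of_real (poly p x / nodal_deriv Y x) / (z - of_real x))"
    unfolding partial_fractions_real_nodes[OF Y p z, symmetric] by (simp add: norm_divide prod_norm)
  also have "\<dots> \<le> (\<Sum>x\<in>Y. \<bar>poly p x\<bar> / \<bar>nodal_deriv Y x\<bar> / cmod (z - of_real x))"
    by (rule order.trans[OF norm_sum]) (simp add: norm_divide norm_mult)
  also have "\<dots> \<le> (\<Sum>x\<in>Y. (A * w x) / \<bar>nodal_deriv Y x\<bar> / \<bar>Im z\<bar>)"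
  proof (rule sum_mono)
    fix x assume x: "x \<in> Y"
    have "\<bar>Im z\<bar> \<le> cmod (z - of_real x)" using abs_Im_le_cmod[of "z - of_real x"] by simp
    then show "\<bar>poly p x\<bar> / \<bar>nodal_deriv Y x\<bar> / cmod (z - of_real x) \<le> (A * w x) / \<bar>nodal_deriv Y x\<bar> / \<bar>Im z\<bar>"
      using le[OF x] z order.trans[OF abs_ge_zero le[OF x]] by (intro frac_le divide_right_mono divide_nonneg_nonneg) auto
  qed
  also have "\<dots> = A * (\<Sum>x\<in>Y. w x / \<bar>nodal_deriv Y x\<bar>) / \<bar>Im z\<bar>"
    by (simp add: sum_distrib_left sum_divide_distrib)
  finally show ?thesis using pos z by (simp add: divide_le_eq le_divide_eq mult_ac)
qed

lemma cmod_sq_minus_real: "cmod (z - of_real y) = sqrt ((Re z - y)\<^sup>2 + (Im z)\<^sup>2)"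
  by (simp add: cmod_def)

text \<open>Both sums are read off from the partial fractions of \<open>1 / Q\<close> at
  \<open>\<i>\<close>: since \<open>1 / (\<i> - x) = - (x + \<i>) / (1 + x^2)\<close>, they are the
  imaginary and real parts of \<open>1 / Q(\<i>)\<close> up to sign, and the product is
  \<open>\<bar>Q(\<i>)\<bar>\<close>.\<close>

lemma divided_difference_resolvent:
  fixes Y :: "real set"
  assumes Y: "finite Y" "Y \<noteq> {}"
  shows "\<bar>\<Sum>x\<in>Y. 1 / (1 + x\<^sup>2) / nodal_deriv Y x\<bar> * (\<Prod>y\<in>Y. sqrt (1 + y\<^sup>2)) \<le> 1"
    "\<bar>\<Sum>x\<in>Y. x / (1 + x\<^sup>2) / nodal_deriv Y x\<bar> * (\<Prod>y\<in>Y. sqrt (1 + y\<^sup>2)) \<le> 1"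
proof -
  define S where "S = (\<Sum>x\<in>Y. of_real (1 / nodal_deriv Y x) / (\<i> - complex_of_real x))"
  define D where "D = (\<Prod>y\<in>Y. sqrt (1 + y\<^sup>2))"
  have D: "0 < D" unfolding D_def by (intro prod_pos) (auto simp: add_pos_nonneg)
  have "card Y > 0" using Y by (simp add: card_gt_0_iff)
  then have "1 / (\<Prod>y\<in>Y. \<i> - complex_of_real y) = S"
    using partial_fractions_real_nodes[OF Y(1), of 1 \<i>] by (simp add: S_def cpoly_def)
  then have "cmod S = 1 / (\<Prod>y\<in>Y. cmod (\<i> - complex_of_real y))" by (auto simp: norm_divide prod_norm)
  also have "(\<Prod>y\<in>Y. cmod (\<i> - complex_of_real y)) = D"
    unfolding D_def cmod_sq_minus_real by (simp add: add.commute)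
  finally have S: "cmod S = 1 / D" .
  have inv: "of_real c / (\<i> - complex_of_real x) = of_real (- (x / (1 + x\<^sup>2) * c)) + \<i> * of_real (- (1 / (1 + x\<^sup>2) * c))" for x c
  proof -
    have d: "1 + x\<^sup>2 \<noteq> 0" by (smt (verit) zero_le_power2)
    have "c = c * (x * x + 1) / (1 + x\<^sup>2)" using d by (simp add: power2_eq_square add.commute)
    then have "of_real c = (of_real (- (x / (1 + x\<^sup>2) * c)) + \<i> * of_real (- (1 / (1 + x\<^sup>2) * c))) * (\<i> - complex_of_real x)"
      by (simp add: complex_eq_iff distrib_left distrib_right add_divide_distrib mult_ac)
    moreover have "\<i> - complex_of_real x \<noteq> 0" by (simp add: complex_eq_iff)
    ultimately show ?thesis using nonzero_divide_eq_eq by blast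
  qed
  have "Re S = - (\<Sum>x\<in>Y. x / (1 + x\<^sup>2) / nodal_deriv Y x)" "Im S = - (\<Sum>x\<in>Y. 1 / (1 + x\<^sup>2) / nodal_deriv Y x)"
    unfolding S_def inv by (simp_all add: sum_negf)
  then have "\<bar>\<Sum>x\<in>Y. x / (1 + x\<^sup>2) / nodal_deriv Y x\<bar> \<le> 1 / D" "\<bar>\<Sum>x\<in>Y. 1 / (1 + x\<^sup>2) / nodal_deriv Y x\<bar> \<le> 1 / D"
    using abs_Re_le_cmod[of S] abs_Im_le_cmod[of S] S by simp_all
  then show "\<bar>\<Sum>x\<in>Y. 1 / (1 + x\<^sup>2) / nodal_deriv Y x\<bar> * (\<Prod>y\<in>Y. sqrt (1 + y\<^sup>2)) \<le> 1"
    "\<bar>\<Sum>x\<in>Y. x / (1 + x\<^sup>2) / nodal_deriv Y x\<bar> * (\<Prod>y\<in>Y. sqrt (1 + y\<^sup>2)) \<le> 1"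
    using D unfolding D_def[symmetric] by (simp_all add: le_divide_eq)
qed

text \<open>The reciprocals \<open>1 / F n\<close> of the normalized node polynomials form a normal family whose limit
  dominates all polynomials bounded by \<open>w\<close> at once.\<close>
lemma node_polys_limit:
  fixes Y :: "nat \<Rightarrow> real set" and w :: "real \<Rightarrow> real"
  assumes Y: "\<And>n. finite (Y n)" "\<And>n. card (Y n) = n + 2" "\<And>n. Y n \<subseteq> D"
    and w: "\<And>x. x \<in> D \<Longrightarrow> 1 \<le> w x"
    and \<kappa>: "\<And>n. \<kappa> n = (\<Sum>x\<in>Y n. w x / \<bar>nodal_deriv (Y n) x\<bar>)"
    and M: "\<And>n. \<kappa> n * (\<Prod>y\<in>Y n. sqrt (1 + y\<^sup>2)) \<le> M"
  obtains G where "G holomorphic_on {z. 0 < Im z}" "\<And>z. 0 < Im z \<Longrightarrow> G z \<noteq> 0"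
    "\<And>z. 0 < Im z \<Longrightarrow> cmod (G z) \<le> 1 / Im z"
    "\<And>p A z. (\<And>x. x \<in> D \<Longrightarrow> \<bar>poly p x\<bar> \<le> A * w x) \<Longrightarrow> 0 < Im z \<Longrightarrow> cmod (poly (cpoly p) z) * cmod (G z) \<le> A / Im z"
proof -
  define U where "U = {z. 0 < Im z}"
  define F where "F n z = of_real (\<kappa> n) * (\<Prod>y\<in>Y n. z - complex_of_real y)" for n z
  have \<kappa>pos: "0 < \<kappa> n" for n
  proof -
    have "Y n \<noteq> {}" using Y(2)[of n] by auto
    moreover have "0 < w x" if "x \<in> Y n" for x using w[of x] Y(3)[of n] that by force
    ultimately show ?thesis unfolding \<kappa> using Y(1)[of n]
      by (intro sum_pos divide_pos_pos) (auto simp: nodal_deriv_nonzero)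
  qed
  have cF: "cmod (F n z) = \<kappa> n * (\<Prod>y\<in>Y n. cmod (z - of_real y))" for n z
    using \<kappa>pos[of n] by (simp add: F_def norm_mult prod_norm)
  have lower: "cmod (poly (cpoly p) z) * Im z \<le> A * cmod (F n z)"
    if deg: "degree p \<le> n" and pD: "\<And>x. x \<in> D \<Longrightarrow> \<bar>poly p x\<bar> \<le> A * w x" and zU: "z \<in> U" for p n A z
  proof -
    have "cmod (poly (cpoly p) z) * \<bar>Im z\<bar> \<le> A * \<kappa> n * (\<Prod>y\<in>Y n. cmod (z - of_real y))"
      unfolding \<kappa>
    proof (rule node_poly_lower_bound)
      show "\<bar>poly p x\<bar> \<le> A * w x" if "x \<in> Y n" for x
        using Y(3)[of n] that by (intro pD) auto
    qed (use deg zU Y in \<open>auto simp: U_def\<close>)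
    then show ?thesis using zU by (simp add: cF U_def mult.assoc)
  qed
  \<comment> \<open>Taking \<open>p = 1\<close>, which \<open>w\<close> dominates, bounds
    \<open>F n\<close> from below and makes the reciprocals a normal family.\<close>
  have F1: "Im z \<le> cmod (F n z)" if "z \<in> U" for z n
    using lower[of 1 n 1 z] that w by (simp add: cpoly_def)
  have F0: "F n z \<noteq> 0" if "z \<in> U" for n z using F1[OF that, of n] that by (auto simp: U_def)
  define H where "H n z = 1 / F n z" for n z
  have Hol: "H n holomorphic_on U" for n
  proof -
    have "F n holomorphic_on U" unfolding F_def by (intro holomorphic_intros)
    then show ?thesis unfolding H_def using F0 by (intro holomorphic_intros) auto
  qed
  have Hle: "cmod (H n z) \<le> 1 / Im z" if "z \<in> U" for n z
    unfolding H_def norm_divide using F1[OF that, of n] that by (auto simp: U_def intro!: divide_left_mono mult_pos_pos)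
  have U: "open U" "connected U" unfolding U_def
    by (auto simp: open_upper_halfplane intro!: convex_connected convex_halfspace_Im_gt)
  obtain G r where G: "G holomorphic_on U" "strict_mono (r :: nat \<Rightarrow> nat)"
      "\<And>z. z \<in> U \<Longrightarrow> (\<lambda>n. H (r n) z) \<longlonglongrightarrow> G z"
      "\<And>K. compact K \<Longrightarrow> K \<subseteq> U \<Longrightarrow> uniform_limit K (H \<circ> r) G sequentially"
  proof (rule Montel[of U "range H" H])
    fix K assume K: "compact K" "K \<subseteq> U"
    show "\<exists>B. \<forall>h\<in>range H. \<forall>z\<in>K. cmod (h z) \<le> B"
    proof (cases "K = {}")
      case False
      have "continuous_on K Im" by (intro continuous_intros)
      then obtain z0 where z0: "z0 \<in> K" "\<And>z. z \<in> K \<Longrightarrow> Im z0 \<le> Im z"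
        using continuous_attains_inf[OF K(1) False] by metis
      have "cmod (H n z) \<le> 1 / Im z0" if "z \<in> K" for n z
      proof -
        have "cmod (H n z) \<le> 1 / Im z" using that K(2) by (intro Hle) auto
        also have "\<dots> \<le> 1 / Im z0" using z0 that K(2) by (intro divide_left_mono mult_pos_pos) (auto simp: U_def)
        finally show ?thesis .
      qed
      then show ?thesis by (intro exI[of _ "1 / Im z0"]) auto
    qed auto
  qed (use U Hol in auto)
  have iU: "\<i> \<in> U" by (simp add: U_def)
  have "M > 0"
  proof -
    have "0 < \<kappa> 0 * (\<Prod>y\<in>Y 0. sqrt (1 + y\<^sup>2))"
      using \<kappa>pos by (intro mult_pos_pos prod_pos) (auto simp: add_pos_nonneg)
    then show ?thesis using M[of 0] by linarith
  qed
  \<comment> \<open>The upper bound for \<open>F n\<close> at \<open>\<i>\<close> keeps the limit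
    from vanishing identically; Hurwitz' theorem then excludes all zeros.\<close>
  have "1 / M \<le> cmod (H n \<i>)" for n
  proof -
    have "cmod (F n \<i>) \<le> M" using M[of n] unfolding cF cmod_sq_minus_real by (simp add: add.commute)
    then show ?thesis using F0[OF iU, of n] \<open>M > 0\<close> unfolding H_def norm_divide by (auto intro!: divide_left_mono)
  qed
  then have "1 / M \<le> cmod (G \<i>)"
    by (intro tendsto_lowerbound[OF tendsto_norm[OF G(3)[OF iU]]]) auto
  then have Gi: "G \<i> \<noteq> 0" using \<open>M > 0\<close> by auto
  show thesis
  proof (rule that)
    show "G holomorphic_on {z. 0 < Im z}" using G(1) by (simp add: U_def)
    show "G z \<noteq> 0" if "0 < Im z" for z
    proof (cases "G constant_on U")
      case True
      then show ?thesis using Gi iU that by (auto simp: constant_on_def U_def)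
    next
      case False
      show ?thesis
        by (rule Hurwitz_no_zeros[OF U _ G(1) G(4) False])
          (use Hol F0 that in \<open>auto simp: H_def U_def\<close>)
    qed
    show "cmod (G z) \<le> 1 / Im z" if "0 < Im z" for z
      by (rule tendsto_upperbound[OF tendsto_norm[OF G(3)]]) (use that Hle in \<open>auto simp: U_def\<close>)
    fix p A z
    assume p: "\<And>x. x \<in> D \<Longrightarrow> \<bar>poly p x\<bar> \<le> A * w x" and z: "0 < Im z"
    have zU: "z \<in> U" using z by (simp add: U_def)
    have "((\<lambda>n. cmod (poly (cpoly p) z) * cmod (H (r n) z)) \<longlonglongrightarrow> cmod (poly (cpoly p) z) * cmod (G z))"
      by (intro tendsto_intros G(3) zU)
    moreover have "eventually (\<lambda>n. cmod (poly (cpoly p) z) * cmod (H (r n) z) \<le> A / Im z) sequentially"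
    proof (rule eventually_sequentiallyI)
      \<comment> \<open>\<open>lower\<close> needs as many nodes as the degree of \<open>p\<close>
        demands, which fails for finitely many \<open>n\<close> only and is not felt in the
        limit.\<close>
      fix n assume "degree p \<le> n"
      then have "degree p \<le> r n" using seq_suble[OF G(2), of n] by linarith
      then have "cmod (poly (cpoly p) z) * Im z \<le> A * cmod (F (r n) z)" by (rule lower[OF _ p zU])
      then show "cmod (poly (cpoly p) z) * cmod (H (r n) z) \<le> A / Im z"
        using F0[OF zU, of "r n"] z unfolding H_def norm_divide by (simp add: divide_le_eq le_divide_eq)
    qed
    ultimately show "cmod (poly (cpoly p) z) * cmod (G z) \<le> A / Im z"
      by (rule tendsto_upperbound) simp
  qed
qed


lemma extremal_nodes:
  fixes w :: "real \<Rightarrow> real" and a :: "real poly"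
  assumes w: "\<And>x. x \<in> D \<Longrightarrow> 1 \<le> w x" and mom: "\<And>k::nat. \<exists>C. \<forall>x\<in>D. \<bar>x\<bar> ^ k \<le> C * w x"
    and a: "a = 1 \<or> a = [:0, 1:]"
    and \<epsilon>: "0 < \<epsilon>" and far: "\<And>p. \<exists>x\<in>D. \<epsilon> * w x < \<bar>poly a x / (1 + x\<^sup>2) - poly p x\<bar>"
  obtains Y \<kappa> where "\<And>n::nat. finite (Y n)" "\<And>n. card (Y n) = n + 2" "\<And>n. Y n \<subseteq> D"
    "\<And>n. \<kappa> n = (\<Sum>x\<in>Y n. w x / \<bar>nodal_deriv (Y n) x\<bar>)"
    "\<And>n. \<kappa> n * (\<Prod>y\<in>Y n. sqrt (1 + y\<^sup>2)) \<le> 2 / \<epsilon>"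
    "\<And>e. 0 < e \<Longrightarrow> \<exists>K. \<forall>n. \<forall>r\<ge>0. real (card {y\<in>Y n. \<bar>y\<bar> < r}) \<le> e * r + K"
proof -
  define g where "g x = poly a x / (1 + x\<^sup>2)" for x
  have pos: "0 < 1 + x\<^sup>2" for x :: real by (simp add: add_pos_nonneg)
  have gcont: "continuous_on UNIV g"
    unfolding g_def using pos by (intro continuous_intros) (metis less_irrefl)
  have g1: "\<bar>g x\<bar> \<le> 1" for x
  proof -
    have "\<bar>x\<bar> \<le> 1 + x\<^sup>2" using zero_le_power2[of "\<bar>x\<bar> - 1"] by (simp add: power2_diff)
    then have "\<bar>poly a x\<bar> \<le> 1 + x\<^sup>2" using a by auto
    then show ?thesis using pos[of x] by (simp add: g_def divide_le_eq)
  qed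
  have "\<forall>n. \<exists>Y p \<rho> \<tau>. finite Y \<and> Y \<subseteq> D \<and> card Y = n + 2 \<and> degree p \<le> n \<and> 0 < \<rho> \<and> \<tau> \<in> {1, -1} \<and>
    (\<forall>x\<in>Y. g x - poly p x = \<tau> * \<rho> * sgn (nodal_deriv Y x) * w x) \<and>
    (\<forall>x\<in>D. \<bar>g x - poly p x\<bar> \<le> 2 * w x) \<and>
    \<epsilon> / 2 * (\<Sum>x\<in>Y. w x / \<bar>nodal_deriv Y x\<bar>) \<le> \<bar>\<Sum>x\<in>Y. g x / nodal_deriv Y x\<bar>"
    using alternation_sequence[OF w mom gcont g1 \<epsilon> far[folded g_def]] by blast
  then obtain Y p \<rho> \<tau> where Y: "\<And>n. finite (Y n)" "\<And>n. Y n \<subseteq> D" "\<And>n. card (Y n) = n + 2"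
    and alt: "\<And>n. 0 < \<rho> n" "\<And>n. \<tau> n \<in> {1, -1}"
      "\<And>n x. x \<in> Y n \<Longrightarrow> g x - poly (p n) x = \<tau> n * \<rho> n * sgn (nodal_deriv (Y n) x) * w x"
    and near: "\<And>n x. x \<in> D \<Longrightarrow> \<bar>g x - poly (p n) x\<bar> \<le> 2 * w x"
    and dual: "\<And>n. \<epsilon> / 2 * (\<Sum>x\<in>Y n. w x / \<bar>nodal_deriv (Y n) x\<bar>) \<le> \<bar>\<Sum>x\<in>Y n. g x / nodal_deriv (Y n) x\<bar>"
    unfolding choice_iff by blast
  define \<kappa> where "\<kappa> n = (\<Sum>x\<in>Y n. w x / \<bar>nodal_deriv (Y n) x\<bar>)" for n
  have M: "\<kappa> n * (\<Prod>y\<in>Y n. sqrt (1 + y\<^sup>2)) \<le> 2 / \<epsilon>" for n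
  proof -
    have ne: "Y n \<noteq> {}" using Y(3)[of n] by auto
    have "\<epsilon> / 2 * \<kappa> n * (\<Prod>y\<in>Y n. sqrt (1 + y\<^sup>2))
        \<le> \<bar>\<Sum>x\<in>Y n. g x / nodal_deriv (Y n) x\<bar> * (\<Prod>y\<in>Y n. sqrt (1 + y\<^sup>2))"
      using dual[of n] by (intro mult_right_mono prod_nonneg) (auto simp: \<kappa>_def)
    also have "\<dots> \<le> 1"
      using divided_difference_resolvent[OF Y(1) ne] a by (auto simp: g_def)
    finally show ?thesis using \<epsilon> by (simp add: le_divide_eq mult_ac)
  qed
  obtain G where G: "G holomorphic_on {z. 0 < Im z}" "\<And>z. 0 < Im z \<Longrightarrow> G z \<noteq> 0"
    "\<And>z. 0 < Im z \<Longrightarrow> cmod (G z) \<le> 1 / Im z"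
    and PG: "\<And>p A z. (\<And>x. x \<in> D \<Longrightarrow> \<bar>poly p x\<bar> \<le> A * w x) \<Longrightarrow> 0 < Im z \<Longrightarrow> cmod (poly (cpoly p) z) * cmod (G z) \<le> A / Im z"
    using node_polys_limit[OF Y(1,3,2) w \<kappa>_def M] by blast
  obtain E where E: "E holomorphic_on {z. -1 < Im z}" "\<And>z. 0 \<le> Im z \<Longrightarrow> cmod (E z) \<le> 1"
    and EG: "\<And>x. cmod (E (complex_of_real x)) = cmod (G (complex_of_real x + \<i>))"
    and Elow: "\<And>\<epsilon>. 0 < \<epsilon> \<Longrightarrow> \<exists>R. \<forall>y\<ge>R. 0 < y \<longrightarrow> exp (- \<epsilon> * y) \<le> cmod (E (\<i> * complex_of_real y))"
  proof (rule remove_exponential_type[OF G])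
    fix E assume "E holomorphic_on {z. -1 < Im z}" "\<And>z. 0 \<le> Im z \<Longrightarrow> cmod (E z) \<le> 1"
      "\<And>x. cmod (E (complex_of_real x)) = cmod (G (complex_of_real x + \<i>))"
      "\<And>\<epsilon>. 0 < \<epsilon> \<Longrightarrow> \<exists>R. \<forall>y\<ge>R. 0 < y \<longrightarrow> exp (- \<epsilon> * y) \<le> cmod (E (\<i> * complex_of_real y))"
    then show thesis by (rule that)
  qed
  \<comment> \<open>\<open>1 + z^2\<close> clears the denominator of \<open>g - p n\<close>: on the
    real line \<open>q n\<close> has the zeros of the error, and at \<open>\<i>\<close> it reduces
    to \<open>a\<close>, of modulus 1 whatever \<open>p n\<close> is.\<close>
  define q where "q n = cpoly a - [:1, 0, 1:] * cpoly (p n)" for n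
  have qz: "poly (q n) z = poly (cpoly a) z - (1 + z\<^sup>2) * poly (cpoly (p n)) z" for n z
    by (simp add: q_def power2_eq_square algebra_simps)
  have az: "poly (cpoly a) z = (if a = 1 then 1 else z)" for z
    using a by (auto simp: cpoly_def map_poly_pCons)
  define \<P> where "\<P> = range (\<lambda>n. (cpoly (p n), q n))"
  have p3: "\<bar>poly (p n) x\<bar> \<le> 3 * w x" if "x \<in> D" for n x
    using near[OF that, of n] g1[of x] w[OF that] by linarith
  \<comment> \<open>On the real axis \<open>\<bar>E x\<bar> = \<bar>G (x + \<i>)\<bar>\<close>, so
    the bound by \<open>3 / Im\<close> applies with \<open>Im = 1\<close>. Inside, where
    \<open>E\<close> also carries the exponential, it follows by Phragmen-Lindelof, as
    \<open>p n\<close> has polynomial growth.\<close>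
  have PE: "cmod (poly (cpoly (p n)) (z + \<i>)) * cmod (E z) \<le> 3" if z: "0 \<le> Im z" for n z
  proof -
    define h where "h = cpoly (p n) \<circ>\<^sub>p [:\<i>, 1:]"
    have h: "poly h z = poly (cpoly (p n)) (z + \<i>)" for z by (simp add: h_def poly_pcompose add.commute)
    obtain K m where K: "0 \<le> K" "\<And>z. cmod (poly h z) \<le> K * (1 + cmod z) ^ m" using poly_growth[of h] by blast
    have "cmod (poly h z * E z) \<le> 3"
    proof (rule halfplane_max_modulus[of "\<lambda>z. poly h z * E z" K m])
      show "(\<lambda>z. poly h z * E z) holomorphic_on {z. 0 < Im z}"
        by (intro holomorphic_intros holomorphic_on_subset[OF E(1)]) auto
      show "continuous_on {z. 0 \<le> Im z} (\<lambda>z. poly h z * E z)"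
        by (intro continuous_intros continuous_on_subset[OF holomorphic_on_imp_continuous_on[OF E(1)]]) auto
      show "cmod (poly h z * E z) \<le> K * (1 + cmod z) ^ m" if "0 \<le> Im z" for z
        using mult_mono[OF K(2)[of z] E(2)[OF that]] K(1) by (simp add: norm_mult)
      show "cmod (poly h (of_real x) * E (of_real x)) \<le> 3" for x
        using PG[of "p n" 3 "of_real x + \<i>"] p3 by (simp add: norm_mult EG h)
    qed (rule z)
    then show ?thesis by (simp add: h norm_mult)
  qed
  have count: "\<exists>K. \<forall>n. \<forall>r\<ge>0. real (card {y\<in>Y n. \<bar>y\<bar> < r}) \<le> e * r + K" if e: "0 < e" for e
  proof -
    have "\<exists>K. \<forall>(P, q)\<in>\<P>. \<forall>r\<ge>0. real (card {x. \<bar>x\<bar> < r \<and> poly q (complex_of_real x) = 0}) \<le> e * r + K"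
    proof (rule real_zeros_sublinear[OF E Elow _ e])
      fix P Q assume "(P, Q) \<in> \<P>"
      then obtain n where n: "P = cpoly (p n)" "Q = q n" by (auto simp: \<P>_def)
      show "cmod (poly P (z + \<i>)) * cmod (E z) \<le> 3" if "0 \<le> Im z" for z using PE[OF that] n by simp
      show "cmod (poly Q z) \<le> (1 + cmod z)\<^sup>2 * (1 + cmod (poly P z))" for z
      proof -
        have "cmod (poly Q z) \<le> cmod (poly (cpoly a) z) + cmod (1 + z\<^sup>2) * cmod (poly P z)"
          unfolding n qz norm_mult[symmetric] by (rule norm_triangle_ineq4)
        also have "\<dots> \<le> (1 + cmod z)\<^sup>2 + (1 + cmod z)\<^sup>2 * cmod (poly P z)"
        proof (intro add_mono mult_right_mono)
          show "cmod (poly (cpoly a) z) \<le> (1 + cmod z)\<^sup>2" unfolding az by (simp add: power2_eq_square algebra_simps)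
          have "cmod (1 + z\<^sup>2) \<le> 1 + (cmod z)\<^sup>2" using norm_triangle_ineq[of 1 "z\<^sup>2"] by (simp add: norm_power)
          moreover have "(1 + cmod z)\<^sup>2 = 1 + 2 * cmod z + (cmod z)\<^sup>2" by (simp add: power2_sum)
          ultimately show "cmod (1 + z\<^sup>2) \<le> (1 + cmod z)\<^sup>2" using norm_ge_zero[of z] by linarith
        qed auto
        finally show ?thesis by (simp add: algebra_simps)
      qed
      show "cmod (poly Q (cnj z)) = cmod (poly Q z)" for z
      proof -
        have "poly Q (cnj z) = cnj (poly Q z)" unfolding n qz poly_cpoly_cnj by simp
        then show ?thesis by simp
      qed
      show "cmod (poly Q \<i>) = 1" unfolding n qz az by simp
    qed auto
    then obtain K where K: "\<And>n r. 0 \<le> r \<Longrightarrow> real (card {x. \<bar>x\<bar> < r \<and> poly (q n) (complex_of_real x) = 0}) \<le> e * r + K"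
      by (auto simp: \<P>_def)
    have "real (card {y\<in>Y n. \<bar>y\<bar> < r}) \<le> e * r + (K + 1)" if r: "0 \<le> r" for n r
    proof -
      define h where "h x = g x - poly (p n) x" for x
      have nz: "1 + x\<^sup>2 \<noteq> 0" for x :: real using pos[of x] by linarith
      have "(1 + x\<^sup>2) * h x = poly a x - (1 + x\<^sup>2) * poly (p n) x" for x
        using nz[of x] by (simp add: h_def g_def right_diff_distrib)
      then have "poly (q n) (complex_of_real x) = of_real ((1 + x\<^sup>2) * h x)" for x
        unfolding qz poly_cpoly_of_real by simp
      then have "poly (q n) (complex_of_real x) = 0 \<longleftrightarrow> h x = 0" for x
        using nz[of x] by (simp only: of_real_eq_0_iff mult_eq_0_iff) simp
      then have zeros: "{x. \<bar>x\<bar> < r \<and> poly (q n) (complex_of_real x) = 0} = {x. \<bar>x\<bar> < r \<and> h x = 0}"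
        by simp
      have "poly (q n) \<i> \<noteq> 0" unfolding qz az by simp
      then have "q n \<noteq> 0" by auto
      then have "finite {z. poly (q n) z = 0}" by (rule poly_roots_finite)
      then have "finite (complex_of_real -` {z. poly (q n) z = 0})"
        by (rule finite_vimageI) (simp add: inj_on_def)
      then have "finite {x. \<bar>x\<bar> < r \<and> poly (q n) (complex_of_real x) = 0}" by (rule rev_finite_subset) auto
      then have fin: "finite {x. \<bar>x\<bar> < r \<and> h x = 0}" by (simp only: zeros)
      have "card {y\<in>Y n. \<bar>y\<bar> < r} \<le> card {x. \<bar>x\<bar> < r \<and> h x = 0} + 1"
      proof (rule card_alternation_le_zeros[OF Y(1) alt(1,2) _ _ _ fin])
        show "0 < w x" if "x \<in> Y n" for x using w[of x] Y(2)[of n] that by force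
        show "continuous_on UNIV h" unfolding h_def by (intro continuous_intros gcont)
        show "h x = \<tau> n * \<rho> n * sgn (nodal_deriv (Y n) x) * w x" if "x \<in> Y n" for x
          using alt(3)[OF that] by (simp add: h_def)
      qed
      then show ?thesis using K[OF r, of n] unfolding zeros by linarith
    qed
    then show ?thesis by blast
  qed
  show thesis by (rule that[OF Y(1,3,2) \<kappa>_def M count])
qed

section \<open>Uniform tail estimates\<close>

text \<open>Dyadic blocks: the block starting at \<open>2^j\<close> has at most
  \<open>2 * e * 2^j + K\<close> nodes, each contributing at most \<open>1 / 4^j\<close>. The
  induction runs downwards from a block beyond all nodes; the constants 4 and 2 are large enough to
  reproduce themselves.\<close>

lemma inverse_square_tail:
  fixes Y :: "real set"
  assumes Y: "finite Y" and N: "\<And>r. 0 \<le> r \<Longrightarrow> real (card {y\<in>Y. \<bar>y\<bar> < r}) \<le> e * r + K"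
    and e: "0 \<le> e" "0 \<le> K"
  shows "(\<Sum>y\<in>{y\<in>Y. 2 ^ J \<le> \<bar>y\<bar>}. 1 / (1 + y\<^sup>2)) \<le> 4 * e / 2 ^ J + 2 * K / 4 ^ J"
proof -
  obtain J1 where J1: "\<And>y. y \<in> Y \<Longrightarrow> \<bar>y\<bar> < 2 ^ J1"
  proof -
    obtain B where B: "\<And>y. y \<in> Y \<Longrightarrow> \<bar>y\<bar> \<le> B"
      using finite_imp_bounded[OF Y] by (auto simp: bounded_iff)
    obtain J1 where "B < 2 ^ J1" using real_arch_pow[of 2 B] by auto
    then show thesis using that B by (meson le_less_trans)
  qed
  have empty: "{y\<in>Y. 2 ^ j \<le> \<bar>y\<bar>} = {}" if "J1 \<le> j" for j
  proof -
    have "(2::real) ^ J1 \<le> 2 ^ j" using that by (intro power_increasing) auto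
    then show ?thesis by (auto simp: not_le intro: less_le_trans[OF J1])
  qed
  show ?thesis
  proof (cases "J1 \<le> J")
    case True
    then show ?thesis using e by (simp only: empty sum.empty) simp
  next
    case False
    then have "J \<le> J1" by simp
    then show ?thesis
    proof (induction J rule: inc_induct)
      case base
      show ?case using e by (simp only: empty[of J1] sum.empty) simp
    next
      case (step j)
      let ?A = "\<lambda>j. {y\<in>Y. 2 ^ j \<le> \<bar>y\<bar>}"
      define S where "S = {y\<in>Y. 2 ^ j \<le> \<bar>y\<bar> \<and> \<bar>y\<bar> < 2 ^ Suc j}"
      have "?A j = S \<union> ?A (Suc j)" "S \<inter> ?A (Suc j) = {}" "finite S" "finite (?A (Suc j))"
        using Y by (auto simp: S_def)
      then have "(\<Sum>y\<in>?A j. 1 / (1 + y\<^sup>2)) = (\<Sum>y\<in>S. 1 / (1 + y\<^sup>2)) + (\<Sum>y\<in>?A (Suc j). 1 / (1 + y\<^sup>2))"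
        by (simp only: sum.union_disjoint)
      also have "(\<Sum>y\<in>S. 1 / (1 + y\<^sup>2)) \<le> (\<Sum>y\<in>S. 1 / 4 ^ j)"
      proof (intro sum_mono divide_left_mono)
        fix y assume "y \<in> S"
        then have "(2 ^ j)\<^sup>2 \<le> \<bar>y\<bar>\<^sup>2" unfolding S_def by (intro power_mono) auto
        also have "((2::real) ^ j)\<^sup>2 = 4 ^ j" by (simp add: power2_eq_square power_mult_distrib[symmetric])
        finally show "4 ^ j \<le> 1 + y\<^sup>2" by simp
      qed (auto simp: add_pos_nonneg)
      also have "\<dots> = real (card S) / 4 ^ j" by simp
      also have "\<dots> \<le> (2 * e * 2 ^ j + K) / 4 ^ j"
      proof (rule divide_right_mono)
        have "card S \<le> card {y\<in>Y. \<bar>y\<bar> < 2 ^ Suc j}" using Y by (intro card_mono) (auto simp: S_def)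
        also have "real \<dots> \<le> e * 2 ^ Suc j + K" by (intro N) simp
        finally show "real (card S) \<le> 2 * e * 2 ^ j + K" by simp
      qed simp
      also have "\<dots> = 2 * e / 2 ^ j + K / 4 ^ j"
      proof -
        have "(4::real) ^ j = 2 ^ j * 2 ^ j" by (simp add: power_mult_distrib[symmetric])
        then show ?thesis by (simp add: add_divide_distrib)
      qed
      finally have "(\<Sum>y\<in>?A j. 1 / (1 + y\<^sup>2)) \<le> 2 * e / 2 ^ j + K / 4 ^ j + (4 * e / 2 ^ Suc j + 2 * K / 4 ^ Suc j)"
        using step.IH by linarith
      also have "\<dots> = 4 * e / 2 ^ j + (3 / 2) * K / 4 ^ j" by (simp add: field_simps)
      also have "\<dots> \<le> 4 * e / 2 ^ j + 2 * K / 4 ^ j"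
        using e by (intro add_left_mono divide_right_mono) auto
      finally show ?case .
    qed
  qed
qed

text \<open>Seen from a point \<open>x\<close> of modulus \<open>2^J\<close>, a node
  \<open>y\<close> with \<open>\<bar>y\<bar> < 2^J\<close> has
  \<open>1 + (x - y)^2 \<le> 5 * 4^J\<close>, which explains the summand. Raising \<open>J\<close>
  by one adds \<open>ln 4\<close> to the old terms, and the new terms are at most
  \<open>ln 20\<close>; so each level costs at most \<open>ln 20\<close> per node, and the counts
  form a geometric sum.\<close>

lemma log_inner_sum:
  fixes Y :: "real set"
  assumes Y: "finite Y" and N: "\<And>r. 0 \<le> r \<Longrightarrow> real (card {y\<in>Y. \<bar>y\<bar> < r}) \<le> e * r + K"
    and e: "0 \<le> e" "0 \<le> K"
  shows "(\<Sum>y\<in>{y\<in>Y. \<bar>y\<bar> < 2 ^ J}. ln 5 + real J * ln 4 - ln (1 + y\<^sup>2))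
    \<le> ln 20 * (2 * e * 2 ^ J + K * (real J + 1))"
proof (induction J)
  case 0
  have "(\<Sum>y\<in>{y\<in>Y. \<bar>y\<bar> < 2 ^ 0}. ln 5 + real 0 * ln 4 - ln (1 + y\<^sup>2)) \<le> (\<Sum>y\<in>{y\<in>Y. \<bar>y\<bar> < 2 ^ 0}. ln 20)"
  proof (rule sum_mono)
    fix y :: real
    have "0 \<le> ln (1 + y\<^sup>2)" by simp
    moreover have "ln 5 \<le> ln (20::real)" by simp
    ultimately have "ln 5 - ln (1 + y\<^sup>2) \<le> ln 20" by linarith
    then show "ln 5 + real 0 * ln 4 - ln (1 + y\<^sup>2) \<le> ln 20" by (simp only: of_nat_0 mult_zero_left add_0_right)
  qed
  also have "\<dots> = ln 20 * real (card {y\<in>Y. \<bar>y\<bar> < 1})" by simp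
  also have "\<dots> \<le> ln 20 * (e * 1 + K)" by (intro mult_left_mono N) auto
  also have "\<dots> \<le> ln 20 * (2 * e * 2 ^ 0 + K * (real 0 + 1))" using e by (intro mult_left_mono) auto
  finally show ?case .
next
  case (Suc j)
  let ?A = "\<lambda>j. {y\<in>Y. \<bar>y\<bar> < 2 ^ j}"
  define S where "S = {y\<in>Y. 2 ^ j \<le> \<bar>y\<bar> \<and> \<bar>y\<bar> < 2 ^ Suc j}"
  define f where "f j y = ln 5 + real j * ln 4 - ln (1 + y\<^sup>2)" for j and y :: real
  have sub: "?A j \<subseteq> ?A (Suc j)" by auto
  then have "?A (Suc j) = S \<union> ?A j" "S \<inter> ?A j = {}" "finite S" "finite (?A j)"
    using Y by (auto simp: S_def)
  then have U: "sum h (?A (Suc j)) = sum h S + sum h (?A j)" for h :: "real \<Rightarrow> real"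
    by (simp only: sum.union_disjoint)
  have l20: "ln (20::real) = ln 5 + ln 4" using ln_mult[of 5 "4::real"] by simp
  have "sum (f (Suc j)) S \<le> (\<Sum>y\<in>S. ln 20)"
  proof (rule sum_mono)
    fix y assume "y \<in> S"
    then have "(2 ^ j)\<^sup>2 \<le> \<bar>y\<bar>\<^sup>2" unfolding S_def by (intro power_mono) auto
    also have "((2::real) ^ j)\<^sup>2 = 4 ^ j" by (simp add: power2_eq_square power_mult_distrib[symmetric])
    finally have "4 ^ j \<le> 1 + y\<^sup>2" by simp
    then have "ln (4 ^ j) \<le> ln (1 + y\<^sup>2)" using ln_mono[of "4 ^ j" "1 + y\<^sup>2"] by simp
    then have "real j * ln 4 \<le> ln (1 + y\<^sup>2)" by (simp add: ln_realpow)
    then show "f (Suc j) y \<le> ln 20" unfolding f_def l20 by (simp add: algebra_simps)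
  qed
  moreover have "sum (f (Suc j)) (?A j) \<le> sum (f j) (?A j) + (\<Sum>y\<in>?A j. ln 20)"
    unfolding sum.distrib[symmetric]
    by (rule sum_mono) (simp add: f_def l20 algebra_simps)
  ultimately have "sum (f (Suc j)) (?A (Suc j)) \<le> sum (f j) (?A j) + (\<Sum>y\<in>?A (Suc j). ln 20)"
    unfolding U by simp
  also have "(\<Sum>y\<in>?A (Suc j). ln 20) = ln 20 * real (card (?A (Suc j)))" by simp
  also have "\<dots> \<le> ln 20 * (e * 2 ^ Suc j + K)" by (intro mult_left_mono N) auto
  finally have "sum (f (Suc j)) (?A (Suc j)) \<le> ln 20 * (2 * e * 2 ^ j + K * (real j + 1)) + ln 20 * (e * 2 ^ Suc j + K)"
    using Suc.IH unfolding f_def by linarith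
  also have "\<dots> = ln 20 * (2 * e * 2 ^ Suc j + K * (real (Suc j) + 1))" by (simp add: algebra_simps)
  finally show ?case unfolding f_def .
qed

text \<open>The lower bound for the product at the two points \<open>\<plusminus>2 ^ J\<close> is what balances the nodes.\<close>
lemma balance_tail:
  fixes Y :: "real set"
  assumes Y: "finite Y" and N: "\<And>r. 0 \<le> r \<Longrightarrow> real (card {y\<in>Y. \<bar>y\<bar> < r}) \<le> e * r + K"
    and e: "0 \<le> e" "0 \<le> K" and \<kappa>: "0 < \<kappa>"
    and M: "\<kappa> * (\<Prod>y\<in>Y. 1 + y\<^sup>2) \<le> M" and low: "\<And>x. 1 \<le> \<kappa> * (\<Prod>y\<in>Y. 1 + (x - y)\<^sup>2)"
  shows "\<bar>\<Sum>y\<in>{y\<in>Y. 2 ^ J \<le> \<bar>y\<bar>}. y / (1 + y\<^sup>2)\<bar>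
    \<le> (ln M + 4 * e * 2 ^ J + 2 * K + ln 20 * (2 * e * 2 ^ J + K * (real J + 1))) / (2 * 2 ^ J)"
proof -
  define O' where "O' = {y\<in>Y. 2 ^ J \<le> \<bar>y\<bar>}"
  define I where "I = {y\<in>Y. \<bar>y\<bar> < 2 ^ J}"
  have part: "Y = I \<union> O'" "I \<inter> O' = {}" "finite I" "finite O'" using Y by (auto simp: I_def O'_def)
  define B where "B = (\<Sum>y\<in>O'. y / (1 + y\<^sup>2))"
  define Q where "Q = ln M + 4 * e * 2 ^ J + 2 * K + ln 20 * (2 * e * 2 ^ J + K * (real J + 1))"
  have p1: "0 < 1 + y\<^sup>2" for y :: real by (simp add: add_pos_nonneg)
  have pos: "0 < (\<Prod>y\<in>Y. 1 + (x - y)\<^sup>2)" for x by (intro prod_pos) (simp add: p1)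
  have pos0: "0 < \<kappa> * (\<Prod>y\<in>Y. 1 + y\<^sup>2)" using \<kappa> by (intro mult_pos_pos prod_pos) (auto simp: p1)
  have Mpos: "0 < M" using M pos0 by linarith
  \<comment> \<open>For the nodes beyond \<open>2^J\<close>, \<open>ln t \<le> t - 1\<close> with
    \<open>t = (1 + (x - y)^2) / (1 + y^2)\<close> leaves the linear term
    \<open>- 2 * x * B\<close>; all other contributions are collected in \<open>Q\<close>. The two
    signs of \<open>x\<close> together bound \<open>\<bar>B\<bar>\<close>.\<close>
  have key: "2 * x * B \<le> Q" if x: "\<bar>x\<bar> = 2 ^ J" for x
  proof -
    have x2: "x\<^sup>2 = 4 ^ J"
    proof -
      have "x\<^sup>2 = (2 ^ J)\<^sup>2" using x by (metis power2_abs)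
      then show ?thesis by (simp add: power2_eq_square power_mult_distrib[symmetric])
    qed
    have "ln (\<kappa> * (\<Prod>y\<in>Y. 1 + y\<^sup>2)) \<le> ln M" by (rule ln_mono[OF M pos0])
    moreover have "0 \<le> ln (\<kappa> * (\<Prod>y\<in>Y. 1 + (x - y)\<^sup>2))" using low[of x] by simp
    moreover have "ln (\<kappa> * (\<Prod>y\<in>Y. 1 + (x - y)\<^sup>2)) = ln \<kappa> + (\<Sum>y\<in>Y. ln (1 + (x - y)\<^sup>2))" for x
    proof -
      have "1 + (x - y)\<^sup>2 \<noteq> 0" for y using p1[of "x - y"] by linarith
      then have "ln (\<Prod>y\<in>Y. 1 + (x - y)\<^sup>2) = (\<Sum>y\<in>Y. ln (1 + (x - y)\<^sup>2))"
        using Y p1 by (subst ln_prod) auto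
      then show ?thesis using ln_mult[of \<kappa> "\<Prod>y\<in>Y. 1 + (x - y)\<^sup>2"] \<kappa> pos[of x] by simp
    qed
    note this[of x] this[of 0]
    ultimately have "0 \<le> ln M + (\<Sum>y\<in>Y. ln (1 + (x - y)\<^sup>2) - ln (1 + y\<^sup>2))"
      by (simp add: sum_subtractf)
    also have "(\<Sum>y\<in>Y. ln (1 + (x - y)\<^sup>2) - ln (1 + y\<^sup>2))
      = (\<Sum>y\<in>I. ln (1 + (x - y)\<^sup>2) - ln (1 + y\<^sup>2)) + (\<Sum>y\<in>O'. ln (1 + (x - y)\<^sup>2) - ln (1 + y\<^sup>2))"
      by (subst part(1)) (simp only: sum.union_disjoint[OF part(3,4,2)])
    also have "(\<Sum>y\<in>I. ln (1 + (x - y)\<^sup>2) - ln (1 + y\<^sup>2)) \<le> (\<Sum>y\<in>I. ln 5 + real J * ln 4 - ln (1 + y\<^sup>2))"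
    proof (intro sum_mono diff_right_mono)
      fix y assume "y \<in> I"
      then have "\<bar>x - y\<bar> \<le> 2 * 2 ^ J" using x by (auto simp: I_def)
      then have "\<bar>x - y\<bar>\<^sup>2 \<le> (2 * 2 ^ J)\<^sup>2" by (intro power_mono) auto
      also have "\<dots> = 4 * 4 ^ J" by (simp add: power_mult_distrib power2_eq_square flip: power_mult_distrib)
      finally have "1 + (x - y)\<^sup>2 \<le> 1 + 4 * 4 ^ J" by simp
      also have "\<dots> \<le> 5 * 4 ^ J" by simp
      finally have "ln (1 + (x - y)\<^sup>2) \<le> ln (5 * 4 ^ J)" using p1 by (intro ln_mono) auto
      then show "ln (1 + (x - y)\<^sup>2) \<le> ln 5 + real J * ln 4" by (simp add: ln_mult ln_realpow)
    qed
    also have "\<dots> \<le> ln 20 * (2 * e * 2 ^ J + K * (real J + 1))"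
      unfolding I_def by (rule log_inner_sum[OF Y N e])
    also have "(\<Sum>y\<in>O'. ln (1 + (x - y)\<^sup>2) - ln (1 + y\<^sup>2)) \<le> (\<Sum>y\<in>O'. x\<^sup>2 * (1 / (1 + y\<^sup>2)) - 2 * x * (y / (1 + y\<^sup>2)))"
    proof (rule sum_mono)
      fix y
      have "ln (1 + (x - y)\<^sup>2) - ln (1 + y\<^sup>2) = ln ((1 + (x - y)\<^sup>2) / (1 + y\<^sup>2))"
        using ln_divide_pos[OF p1[of "x - y"] p1[of y]] by simp
      also have "\<dots> \<le> (1 + (x - y)\<^sup>2) / (1 + y\<^sup>2) - 1" using p1 by (intro ln_le_minus_one divide_pos_pos) auto
      also have "\<dots> = (x\<^sup>2 - 2 * x * y) / (1 + y\<^sup>2)"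
      proof -
        have "1 + y\<^sup>2 \<noteq> 0" using p1[of y] by linarith
        then have "(1 + y\<^sup>2) / (1 + y\<^sup>2) = 1" by (rule divide_self)
        then have "(1 + (x - y)\<^sup>2) / (1 + y\<^sup>2) - 1 = ((1 + (x - y)\<^sup>2) - (1 + y\<^sup>2)) / (1 + y\<^sup>2)"
          by (simp only: diff_divide_distrib)
        then show ?thesis by (simp add: power2_diff)
      qed
      finally show "ln (1 + (x - y)\<^sup>2) - ln (1 + y\<^sup>2) \<le> x\<^sup>2 * (1 / (1 + y\<^sup>2)) - 2 * x * (y / (1 + y\<^sup>2))"
        by (simp add: diff_divide_distrib)
    qed
    also have "\<dots> = x\<^sup>2 * (\<Sum>y\<in>O'. 1 / (1 + y\<^sup>2)) - 2 * x * B"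
      by (simp add: sum_subtractf sum_distrib_left B_def)
    also have "\<dots> \<le> x\<^sup>2 * (4 * e / 2 ^ J + 2 * K / 4 ^ J) - 2 * x * B"
      unfolding O'_def by (intro diff_right_mono mult_left_mono inverse_square_tail[OF Y N e]) auto
    also have "x\<^sup>2 * (4 * e / 2 ^ J + 2 * K / 4 ^ J) = 4 * e * 2 ^ J + 2 * K"
    proof -
      have "(4::real) ^ J = 2 ^ J * 2 ^ J" by (simp add: power_mult_distrib[symmetric])
      then show ?thesis unfolding x2 by (simp add: distrib_left)
    qed
    finally show ?thesis unfolding Q_def by linarith
  qed
  have "\<bar>B\<bar> * (2 * 2 ^ J) \<le> Q" using key[of "2 ^ J"] key[of "- (2 ^ J)"] by (simp add: abs_if mult_ac)
  then show ?thesis unfolding B_def O'_def Q_def by (simp add: le_divide_eq)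
qed

text \<open>Extends the dyadic tails to complements of arbitrary sets \<open>E\<close> that contain
  the nodes in \<open>(-R, R)\<close> and have few elements: with
  \<open>2^J \<le> R < 2^(J + 1)\<close>, those of \<open>E\<close> beyond \<open>2^J\<close> number
  at most \<open>2 * \<delta> * 2^J\<close> and contribute at most \<open>1 / 2^J\<close> each. This
  freedom is needed because the final windows are cut by index, not by modulus.\<close>

lemma uniform_window_tails:
  fixes Y :: "nat \<Rightarrow> real set"
  assumes Y: "\<And>n. finite (Y n)"
    and N: "\<And>e. 0 < e \<Longrightarrow> \<exists>K. \<forall>n. \<forall>r\<ge>0. real (card {y\<in>Y n. \<bar>y\<bar> < r}) \<le> e * r + K"
    and \<kappa>: "\<And>n. 0 < \<kappa> n" and M: "\<And>n. \<kappa> n * (\<Prod>y\<in>Y n. 1 + y\<^sup>2) \<le> M"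
    and low: "\<And>n x. 1 \<le> \<kappa> n * (\<Prod>y\<in>Y n. 1 + (x - y)\<^sup>2)" and \<delta>: "0 < \<delta>"
  shows "\<exists>R0. \<forall>n. \<forall>R\<ge>R0. \<forall>E\<subseteq>Y n. {y\<in>Y n. \<bar>y\<bar> < R} \<subseteq> E \<longrightarrow> real (card E) \<le> \<delta> * R \<longrightarrow>
    \<bar>\<Sum>y\<in>Y n - E. y / (1 + y\<^sup>2)\<bar> \<le> 3 * \<delta> \<and> (\<Sum>y\<in>Y n - E. 1 / (1 + y\<^sup>2)) \<le> \<delta>"
proof -
  \<comment> \<open>As \<open>J\<close> grows, the bound of \<open>balance_tail\<close> tends to
    \<open>(2 + ln 20) * e\<close>, which is below \<open>20 * e = \<delta>\<close>.\<close>
  define e where "e = \<delta> / 20"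
  have e: "0 < e" using \<delta> by (simp add: e_def)
  obtain K where K: "\<And>n r. 0 \<le> r \<Longrightarrow> real (card {y\<in>Y n. \<bar>y\<bar> < r}) \<le> e * r + K"
    using N[OF e] by blast
  have K0: "0 \<le> K" using K[of 0 0] by simp
  have "((\<lambda>J::nat. (ln M + 4 * e * 2 ^ J + 2 * K + ln 20 * (2 * e * 2 ^ J + K * (real J + 1))) / (2 * 2 ^ J))
     \<longlongrightarrow> (2 + ln 20) * e) sequentially"
    by (real_asymp simp: field_simps)
  moreover have "(2 + ln 20) * e < \<delta>"
  proof -
    have "ln (20::real) \<le> 20 - 1" by (rule ln_le_minus_one) simp
    moreover have "ln (20::real) < 18"
    proof -
      have "ln (20::real) = ln 5 + ln 4" using ln_mult[of 5 "4::real"] by simp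
      moreover have "ln (5::real) \<le> 4" "ln (4::real) \<le> 3" using ln_le_minus_one[of "5::real"] ln_le_minus_one[of "4::real"] by auto
      ultimately show ?thesis by linarith
    qed
    ultimately have "(2 + ln 20) * e < 20 * e" using e by (intro mult_strict_right_mono) auto
    then show ?thesis by (simp add: e_def)
  qed
  ultimately have "eventually (\<lambda>J::nat. (ln M + 4 * e * 2 ^ J + 2 * K + ln 20 * (2 * e * 2 ^ J + K * (real J + 1))) / (2 * 2 ^ J) < \<delta>) sequentially"
    by (rule order_tendstoD)
  moreover have "((\<lambda>J::nat. 4 * e / 2 ^ J + 2 * K / 4 ^ J) \<longlongrightarrow> 0) sequentially" by real_asymp
  then have "eventually (\<lambda>J::nat. 4 * e / 2 ^ J + 2 * K / 4 ^ J < \<delta>) sequentially"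
    using \<delta> by (rule order_tendstoD)
  ultimately have "eventually (\<lambda>J::nat. (ln M + 4 * e * 2 ^ J + 2 * K + ln 20 * (2 * e * 2 ^ J + K * (real J + 1))) / (2 * 2 ^ J) < \<delta>
     \<and> 4 * e / 2 ^ J + 2 * K / 4 ^ J < \<delta>) sequentially" by (rule eventually_conj)
  then obtain J0 where J0: "\<And>J. J0 \<le> J \<Longrightarrow> (ln M + 4 * e * 2 ^ J + 2 * K + ln 20 * (2 * e * 2 ^ J + K * (real J + 1))) / (2 * 2 ^ J) < \<delta>"
    "\<And>J. J0 \<le> J \<Longrightarrow> 4 * e / 2 ^ J + 2 * K / 4 ^ J < \<delta>"
    unfolding eventually_sequentially by blast
  show ?thesis
  proof (intro exI[of _ "2 ^ J0"] allI impI)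
    fix n R E
    assume R: "2 ^ J0 \<le> R" and E: "E \<subseteq> Y n" "{y\<in>Y n. \<bar>y\<bar> < R} \<subseteq> E" and cE: "real (card E) \<le> \<delta> * R"
    have R1: "1 \<le> R" using R one_le_power[of "2::real" J0] by linarith
    define J where "J = nat \<lfloor>log 2 R\<rfloor>"
    have J: "2 ^ J \<le> R" "R < 2 ^ Suc J" "J0 \<le> J"
    proof -
      have l0: "0 \<le> log 2 R" using R1 by simp
      have "real J \<le> log 2 R" "log 2 R < real (Suc J)" unfolding J_def using l0 by linarith+
      then show "2 ^ J \<le> R" "R < 2 ^ Suc J" using R1
        by (simp_all add: le_log_iff log_less_iff powr_realpow del: power_Suc of_nat_Suc)
      have "real J0 \<le> log 2 R" using R R1 by (simp add: le_log_iff powr_realpow)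
      then show "J0 \<le> J" unfolding J_def using l0 by linarith
    qed
    define A where "A = {y\<in>Y n. 2 ^ J \<le> \<bar>y\<bar>}"
    have YE: "Y n - E \<subseteq> A" using E J(1) by (force simp: A_def)
    have fin: "finite A" "finite E" using Y[of n] E(1) by (auto simp: A_def intro: finite_subset)
    have part: "A = (Y n - E) \<union> (E \<inter> A)" "(Y n - E) \<inter> (E \<inter> A) = {}" using YE by (auto simp: A_def)
    have BA: "\<bar>\<Sum>y\<in>A. y / (1 + y\<^sup>2)\<bar> \<le> \<delta>"
      using balance_tail[OF Y K less_imp_le[OF e] K0 \<kappa> M low, of n J] J0(1)[OF J(3)] unfolding A_def by linarith
    have TA: "(\<Sum>y\<in>A. 1 / (1 + y\<^sup>2)) \<le> \<delta>"
      using inverse_square_tail[OF Y K less_imp_le[OF e] K0, of n J] J0(2)[OF J(3)] unfolding A_def by linarith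
    have "\<bar>\<Sum>y\<in>E \<inter> A. y / (1 + y\<^sup>2)\<bar> \<le> (\<Sum>y\<in>E \<inter> A. 1 / 2 ^ J)"
    proof (rule order.trans[OF sum_abs sum_mono])
      fix y assume "y \<in> E \<inter> A"
      then have y: "2 ^ J \<le> \<bar>y\<bar>" by (simp add: A_def)
      have p: "0 < 1 + y\<^sup>2" by (simp add: add_pos_nonneg)
      have "\<bar>y\<bar> * 2 ^ J \<le> \<bar>y\<bar> * \<bar>y\<bar>" using y by (intro mult_left_mono) auto
      also have "\<dots> \<le> 1 + y\<^sup>2" by (simp add: power2_eq_square)
      finally show "\<bar>y / (1 + y\<^sup>2)\<bar> \<le> 1 / 2 ^ J" using p by (simp add: abs_divide divide_le_eq le_divide_eq)
    qed
    also have "\<dots> = real (card (E \<inter> A)) / 2 ^ J" by simp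
    also have "\<dots> \<le> real (card E) / 2 ^ J" using fin by (intro divide_right_mono) (auto intro: card_mono)
    also have "\<dots> \<le> \<delta> * (2 * 2 ^ J) / 2 ^ J"
      using cE J(2) \<delta> by (intro divide_right_mono order.trans[OF cE] mult_left_mono) auto
    finally have EA: "\<bar>\<Sum>y\<in>E \<inter> A. y / (1 + y\<^sup>2)\<bar> \<le> 2 * \<delta>" by simp
    have "(\<Sum>y\<in>A. y / (1 + y\<^sup>2)) = (\<Sum>y\<in>Y n - E. y / (1 + y\<^sup>2)) + (\<Sum>y\<in>E \<inter> A. y / (1 + y\<^sup>2))"
      by (subst part(1)) (rule sum.union_disjoint, use fin Y part in auto)
    then have "\<bar>\<Sum>y\<in>Y n - E. y / (1 + y\<^sup>2)\<bar> \<le> 3 * \<delta>" using BA EA by linarith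
    moreover have "(\<Sum>y\<in>Y n - E. 1 / (1 + y\<^sup>2)) \<le> (\<Sum>y\<in>A. 1 / (1 + y\<^sup>2))"
      using fin YE by (intro sum_mono2) (auto simp: add_nonneg_nonneg)
    ultimately show "\<bar>\<Sum>y\<in>Y n - E. y / (1 + y\<^sup>2)\<bar> \<le> 3 * \<delta> \<and> (\<Sum>y\<in>Y n - E. 1 / (1 + y\<^sup>2)) \<le> \<delta>"
      using TA by linarith
  qed
qed

section \<open>Passing to the limit in the nodes\<close>

text \<open>The nodes in \<open>Y n\<close> are enumerated by \<open>e n\<close> in order of increasing modulus; \<open>S\<close> consists of
  the indices whose nodes stay bounded, and \<open>\<kappa> n\<close> is the square of the factor that
  normalizes the polynomial with zeros \<open>Y n\<close>.\<close>
locale node_limit =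
  fixes Y :: "nat \<Rightarrow> real set" and e :: "nat \<Rightarrow> nat \<Rightarrow> real" and m :: "nat \<Rightarrow> nat"
    and \<kappa> :: "nat \<Rightarrow> real" and M :: real and S :: "nat set" and \<mu> :: "nat \<Rightarrow> real"
  assumes bij: "\<And>n. bij_betw (e n) {..<m n} (Y n)" and m: "\<And>n. n \<le> m n"
    and \<kappa>: "\<And>n. 0 < \<kappa> n"
    and upper: "\<And>n. \<kappa> n * (\<Prod>y\<in>Y n. 1 + y\<^sup>2) \<le> M"
    and lower: "\<And>n x. 1 \<le> \<kappa> n * (\<Prod>y\<in>Y n. 1 + (x - y)\<^sup>2)"
    and count: "\<And>\<delta>. 0 < \<delta> \<Longrightarrow> \<exists>K. \<forall>n. \<forall>r\<ge>0. real (card {y\<in>Y n. \<bar>y\<bar> < r}) \<le> \<delta> * r + K"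
    and conv: "\<And>k. k \<in> S \<Longrightarrow> (\<lambda>n. e n k) \<longlonglongrightarrow> \<mu> k"
    and div: "\<And>k. k \<notin> S \<Longrightarrow> filterlim (\<lambda>n. \<bar>e n k\<bar>) at_top sequentially"
    and mod_order: "\<And>n k. k < m n \<Longrightarrow> k < card {y\<in>Y n. \<bar>y\<bar> \<le> \<bar>e n k\<bar>}"
    and deriv: "\<And>n y. y \<in> Y n \<Longrightarrow> 1 \<le> \<kappa> n * (\<Prod>z\<in>Y n - {y}. (y - z)\<^sup>2)"
    and growth: "\<And>j. \<exists>C. \<forall>n\<ge>j. \<forall>t>0. t ^ (2 * j + 2) \<le> C * (\<kappa> n * (\<Prod>y\<in>Y n. t\<^sup>2 + y\<^sup>2))"
begin

lemma finite_Y: "finite (Y n)"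
  using bij_betw_finite[OF bij[of n]] by simp

lemma M_pos: "0 < M"
proof -
  have "0 < \<kappa> 0 * (\<Prod>y\<in>Y 0. 1 + y\<^sup>2)" using \<kappa> by (intro mult_pos_pos prod_pos) (auto simp: add_pos_nonneg)
  then show ?thesis using upper[of 0] by linarith
qed

text \<open>By the ordering, more than \<open>k\<close> nodes have modulus at most that of the node
  with index \<open>k\<close>; so the uniform count bounds the index of a node in a bounded region,
  independently of \<open>n\<close>.\<close>

lemma index_bound: "\<exists>k0. \<forall>n k. k < m n \<longrightarrow> \<bar>e n k\<bar> < r \<longrightarrow> k < k0"
proof -
  obtain K where K: "\<And>n r. 0 \<le> r \<Longrightarrow> real (card {y\<in>Y n. \<bar>y\<bar> < r}) \<le> 1 * r + K"
    using count[of 1] by auto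
  have "k < nat \<lceil>\<bar>r\<bar> + K\<rceil>" if k: "k < m n" "\<bar>e n k\<bar> < r" for n k
  proof -
    have "k < card {y\<in>Y n. \<bar>y\<bar> \<le> \<bar>e n k\<bar>}" by (rule mod_order[OF k(1)])
    also have "\<dots> \<le> card {y\<in>Y n. \<bar>y\<bar> < r}" using k(2) finite_Y by (intro card_mono) auto
    finally have "real k < real (card {y\<in>Y n. \<bar>y\<bar> < r})" by simp
    also have "\<dots> \<le> \<bar>r\<bar> + K" using K[of r n] k(2) by auto
    finally show ?thesis by linarith
  qed
  then show ?thesis by blast
qed

lemma eventually_e_in: "eventually (\<lambda>n. k < m n \<and> e n k \<in> Y n) sequentially"
proof (rule eventually_sequentiallyI)
  fix n assume "Suc k \<le> n"
  then have "k < m n" using m[of n] by simp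
  then show "k < m n \<and> e n k \<in> Y n" using bij[of n] by (auto simp: bij_betw_def)
qed

lemma eventually_ball: "finite A \<Longrightarrow> (\<And>k. k \<in> A \<Longrightarrow> eventually (P k) sequentially) \<Longrightarrow>
    eventually (\<lambda>n. \<forall>k\<in>A. P k n) sequentially"
  by (simp add: eventually_ball_finite)

lemma finite_window: "finite {k\<in>S. \<bar>\<mu> k\<bar> < r}"
proof -
  obtain k0 where k0: "\<And>n k. k < m n \<Longrightarrow> \<bar>e n k\<bar> < r \<Longrightarrow> k < k0" using index_bound by blast
  have "k < k0" if k: "k \<in> S" "\<bar>\<mu> k\<bar> < r" for k
  proof -
    have "(\<lambda>n. \<bar>e n k\<bar>) \<longlonglongrightarrow> \<bar>\<mu> k\<bar>" by (intro tendsto_rabs conv k)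
    then have "eventually (\<lambda>n. \<bar>e n k\<bar> < r) sequentially" using k(2) by (rule order_tendstoD)
    then have "eventually (\<lambda>n. \<bar>e n k\<bar> < r \<and> (k < m n \<and> e n k \<in> Y n)) sequentially"
      using eventually_e_in by (rule eventually_conj)
    then obtain n where "\<bar>e n k\<bar> < r" "k < m n" using eventually_happens by force
    then show ?thesis using k0 by blast
  qed
  then have "{k\<in>S. \<bar>\<mu> k\<bar> < r} \<subseteq> {..<k0}" by auto
  then show ?thesis by (rule finite_subset) simp
qed

lemma card_window:
  assumes \<delta>: "0 < \<delta>"
  shows "\<exists>K. \<forall>r\<ge>0. real (card {k\<in>S. \<bar>\<mu> k\<bar> < r}) \<le> \<delta> * r + K"
proof -
  obtain K where K: "\<And>n r. 0 \<le> r \<Longrightarrow> real (card {y\<in>Y n. \<bar>y\<bar> < r}) \<le> \<delta> * r + K"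
    using count[OF \<delta>] by blast
  have "real (card {k\<in>S. \<bar>\<mu> k\<bar> < r}) \<le> \<delta> * r + K" if r: "0 \<le> r" for r
  proof -
    define A where "A = {k\<in>S. \<bar>\<mu> k\<bar> < r}"
    have A: "finite A" unfolding A_def by (rule finite_window)
    have "eventually (\<lambda>n. \<bar>e n k\<bar> < r \<and> (k < m n \<and> e n k \<in> Y n)) sequentially" if k: "k \<in> A" for k
    proof (rule eventually_conj[OF _ eventually_e_in])
      have "(\<lambda>n. \<bar>e n k\<bar>) \<longlonglongrightarrow> \<bar>\<mu> k\<bar>" using k by (intro tendsto_rabs conv) (auto simp: A_def)
      then show "eventually (\<lambda>n. \<bar>e n k\<bar> < r) sequentially" using k by (intro order_tendstoD) (auto simp: A_def)
    qed
    then have "eventually (\<lambda>n. \<forall>k\<in>A. \<bar>e n k\<bar> < r \<and> (k < m n \<and> e n k \<in> Y n)) sequentially"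
      by (rule eventually_ball[OF A])
    then obtain n where n: "\<forall>k\<in>A. \<bar>e n k\<bar> < r \<and> (k < m n \<and> e n k \<in> Y n)" using eventually_happens by force
    have "inj_on (e n) A" using bij[of n] n by (auto simp: bij_betw_def intro: inj_on_subset)
    then have "card A \<le> card {y\<in>Y n. \<bar>y\<bar> < r}"
      by (rule card_inj_on_le) (use n finite_Y in auto)
    then show ?thesis using K[OF r, of n] by (simp add: A_def)
  qed
  then show ?thesis by blast
qed

text \<open>Only finitely many indices can have nodes in \<open>(-R/2, R/2)\<close>. Those outside
  \<open>E\<close> have limits of modulus at least \<open>R\<close> or escape to infinity, so they
  leave the smaller interval; halving \<open>R\<close> gives the necessary room.\<close>

lemma eventually_window:
  assumes E: "finite E" "E \<subseteq> S" "{k\<in>S. \<bar>\<mu> k\<bar> < R} \<subseteq> E" and R: "0 < R"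
  shows "eventually (\<lambda>n. e n ` E \<subseteq> Y n \<and> inj_on (e n) E \<and> {y\<in>Y n. \<bar>y\<bar> < R / 2} \<subseteq> e n ` E) sequentially"
proof -
  obtain k0 where k0: "\<And>n k. k < m n \<Longrightarrow> \<bar>e n k\<bar> < R / 2 \<Longrightarrow> k < k0" using index_bound by blast
  have "eventually (\<lambda>n. \<forall>k\<in>E. k < m n \<and> e n k \<in> Y n) sequentially"
    by (rule eventually_ball[OF E(1) eventually_e_in])
  moreover have "eventually (\<lambda>n. \<forall>k\<in>{..<k0} - E. R / 2 \<le> \<bar>e n k\<bar>) sequentially"
  proof (rule eventually_ball)
    fix k assume k: "k \<in> {..<k0} - E"
    show "eventually (\<lambda>n. R / 2 \<le> \<bar>e n k\<bar>) sequentially"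
    proof (cases "k \<in> S")
      case True
      then have "R \<le> \<bar>\<mu> k\<bar>" using k E by (auto simp: not_less[symmetric])
      then have "R / 2 < \<bar>\<mu> k\<bar>" using R by simp
      then have "eventually (\<lambda>n. R / 2 < \<bar>e n k\<bar>) sequentially"
        by (intro order_tendstoD(1)[OF tendsto_rabs[OF conv[OF True]]])
      then show ?thesis by eventually_elim simp
    next
      case False
      then show ?thesis using div[OF False] unfolding filterlim_at_top by blast
    qed
  qed simp
  ultimately show ?thesis
  proof eventually_elim
    case (elim n)
    have "inj_on (e n) E" using bij[of n] elim(1) by (auto simp: bij_betw_def intro: inj_on_subset)
    moreover have "{y\<in>Y n. \<bar>y\<bar> < R / 2} \<subseteq> e n ` E"
    proof
      fix y assume y: "y \<in> {y\<in>Y n. \<bar>y\<bar> < R / 2}"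
      then obtain k where k: "k < m n" "y = e n k" using bij[of n] by (auto simp: bij_betw_def)
      then have "k < k0" using k0 y by auto
      then have "k \<in> E" using elim(2) y k by force
      then show "y \<in> e n ` E" using k by simp
    qed
    ultimately show ?case using elim(1) by auto
  qed
qed

text \<open>The slack beyond the labels with \<open>\<bar>\<mu> k\<bar> < R\<close> admits sets cut
  by the index in the final enumeration instead of by modulus.\<close>

definition window :: "real \<Rightarrow> real \<Rightarrow> nat set \<Rightarrow> bool" where
  "window \<delta> R E \<longleftrightarrow> finite E \<and> E \<subseteq> S \<and> {k\<in>S. \<bar>\<mu> k\<bar> < R} \<subseteq> E \<and> real (card E) \<le> \<delta> * R"

definition small_tails :: "real \<Rightarrow> nat set \<Rightarrow> nat \<Rightarrow> bool" where
  "small_tails \<delta> E n \<longleftrightarrow> e n ` E \<subseteq> Y n \<and> inj_on (e n) E \<and> \<bar>\<Sum>y\<in>Y n - e n ` E. y / (1 + y\<^sup>2)\<bar> \<le> 6 * \<delta> \<and>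
      (\<Sum>y\<in>Y n - e n ` E. 1 / (1 + y\<^sup>2)) \<le> 2 * \<delta>"

lemma window_tails:
  assumes \<delta>: "0 < \<delta>"
  shows "\<exists>R0>0. \<forall>R\<ge>R0. \<forall>E. window \<delta> R E \<longrightarrow> eventually (small_tails \<delta> E) sequentially"
proof -
  \<comment> \<open>A window for \<open>R\<close> is sure to contain the nodes only up to
    \<open>R / 2\<close>, so the bound \<open>\<delta> * R\<close> on its size is read as
    \<open>(2 * \<delta>) * (R / 2)\<close>; hence the constants 6 and 2 in
    \<open>small_tails\<close>.\<close>
  have "0 < 2 * \<delta>" using \<delta> by simp
  from uniform_window_tails[OF finite_Y count \<kappa> upper lower this] obtain R0 where
    R0': "\<forall>n. \<forall>R\<ge>R0. \<forall>E\<subseteq>Y n. {y\<in>Y n. \<bar>y\<bar> < R} \<subseteq> E \<longrightarrow> real (card E) \<le> (2 * \<delta>) * R \<longrightarrow>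
      \<bar>\<Sum>y\<in>Y n - E. y / (1 + y\<^sup>2)\<bar> \<le> 3 * (2 * \<delta>) \<and> (\<Sum>y\<in>Y n - E. 1 / (1 + y\<^sup>2)) \<le> 2 * \<delta>" ..
  have R0: "\<bar>\<Sum>y\<in>Y n - E. y / (1 + y\<^sup>2)\<bar> \<le> 3 * (2 * \<delta>) \<and> (\<Sum>y\<in>Y n - E. 1 / (1 + y\<^sup>2)) \<le> 2 * \<delta>"
    if "R0 \<le> R" "E \<subseteq> Y n" "{y\<in>Y n. \<bar>y\<bar> < R} \<subseteq> E" "real (card E) \<le> (2 * \<delta>) * R" for n R E
    using R0' that by simp
  show ?thesis
  proof (intro exI[of _ "max 1 (2 * R0)"] conjI allI impI)
    fix R E assume R: "max 1 (2 * R0) \<le> R" and "window \<delta> R E"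
    then have E: "finite E" "E \<subseteq> S" "{k\<in>S. \<bar>\<mu> k\<bar> < R} \<subseteq> E" and c: "real (card E) \<le> \<delta> * R"
      by (auto simp: window_def)
    have "0 < R" using R by simp
    from eventually_window[OF E this]
    show "eventually (small_tails \<delta> E) sequentially"
    proof eventually_elim
      case (elim n)
      have "card (e n ` E) = card E" using elim by (simp add: card_image)
      then have c': "real (card (e n ` E)) \<le> (2 * \<delta>) * (R / 2)" using c by simp
      have "\<bar>\<Sum>y\<in>Y n - e n ` E. y / (1 + y\<^sup>2)\<bar> \<le> 3 * (2 * \<delta>) \<and> (\<Sum>y\<in>Y n - e n ` E. 1 / (1 + y\<^sup>2)) \<le> 2 * \<delta>"
        by (rule R0[OF _ _ _ c']) (use elim R in auto)
      then show ?case using elim by (simp add: small_tails_def)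
    qed
  qed simp
qed

text \<open>For large \<open>n\<close> each window sum differs from the sum over all of
  \<open>Y n\<close> by at most \<open>6 * \<delta>\<close>; the latter is not known to converge,
  but it cancels.\<close>

lemma balanced_limit:
  assumes \<delta>: "0 < \<delta>"
  shows "\<exists>R0>0. \<forall>R\<ge>R0. \<forall>R'\<ge>R0. \<forall>E E'. window \<delta> R E \<longrightarrow> window \<delta> R' E' \<longrightarrow>
    \<bar>(\<Sum>k\<in>E. \<mu> k / (1 + (\<mu> k)\<^sup>2)) - (\<Sum>k\<in>E'. \<mu> k / (1 + (\<mu> k)\<^sup>2))\<bar> \<le> 12 * \<delta>"
proof -
  obtain R0 where R0: "0 < R0" "\<forall>R\<ge>R0. \<forall>E. window \<delta> R E \<longrightarrow> eventually (small_tails \<delta> E) sequentially"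
    using window_tails[OF \<delta>] by blast
  show ?thesis
  proof (intro exI[of _ R0] conjI allI impI R0(1))
    fix R R' E E'
    assume R: "R0 \<le> R" "R0 \<le> R'" and w: "window \<delta> R E" "window \<delta> R' E'"
    then have ES: "E \<subseteq> S" "E' \<subseteq> S" and ev: "eventually (small_tails \<delta> E) sequentially" "eventually (small_tails \<delta> E') sequentially"
      using R0(2) by (auto simp: window_def)
    let ?f = "\<lambda>y::real. y / (1 + y\<^sup>2)"
    have p: "1 + y\<^sup>2 \<noteq> 0" for y :: real by (smt (verit) zero_le_power2)
    have lim: "(\<lambda>n. \<bar>(\<Sum>k\<in>E. ?f (e n k)) - (\<Sum>k\<in>E'. ?f (e n k))\<bar>) \<longlonglongrightarrow> \<bar>(\<Sum>k\<in>E. ?f (\<mu> k)) - (\<Sum>k\<in>E'. ?f (\<mu> k))\<bar>"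
      using ES by (intro tendsto_intros conv p) auto
    have "eventually (\<lambda>n. \<bar>(\<Sum>k\<in>E. ?f (e n k)) - (\<Sum>k\<in>E'. ?f (e n k))\<bar> \<le> 12 * \<delta>) sequentially"
      using ev
    proof eventually_elim
      case (elim n)
      note elim = elim[unfolded small_tails_def]
      have "(\<Sum>k\<in>E. ?f (e n k)) + (\<Sum>y\<in>Y n - e n ` E. ?f y) = (\<Sum>y\<in>Y n. ?f y)"
        "(\<Sum>k\<in>E'. ?f (e n k)) + (\<Sum>y\<in>Y n - e n ` E'. ?f y) = (\<Sum>y\<in>Y n. ?f y)"
        using elim finite_Y[of n] sum.subset_diff[of "e n ` E" "Y n" ?f] sum.subset_diff[of "e n ` E'" "Y n" ?f]
        by (simp_all add: sum.reindex)
      then show ?case using elim by linarith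
    qed
    then show "\<bar>(\<Sum>k\<in>E. ?f (\<mu> k)) - (\<Sum>k\<in>E'. ?f (\<mu> k))\<bar> \<le> 12 * \<delta>"
      using lim by (intro tendsto_upperbound[OF lim]) auto
  qed
qed

text \<open>With \<open>F'^2\<close> for \<open>\<kappa> n\<close> times the product over the other
  nodes, this bounds \<open>F'^2\<close> times the square of the finite-window version of
  \<open>exp (char_seq)\<close> by \<open>M\<close> and an exponential close to 1. It is cleared of
  denominators so that it makes sense before the limit points are known to be distinct.\<close>

definition deriv_bound :: "real \<Rightarrow> nat set \<Rightarrow> nat \<Rightarrow> nat \<Rightarrow> bool" where
  "deriv_bound \<delta> E k n \<longleftrightarrow>
    (1 + (e n k)\<^sup>2) * (\<Prod>l\<in>E - {k}. 1 + (e n l)\<^sup>2) * (\<kappa> n * (\<Prod>z\<in>Y n - {e n k}. (e n k - z)\<^sup>2))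
      \<le> M * exp (2 * \<delta> * (e n k)\<^sup>2 + 12 * \<delta> * \<bar>e n k\<bar>) * (\<Prod>l\<in>E - {k}. (e n k - e n l)\<^sup>2)"

text \<open>Split the product at the node into window and tail factors. For a tail node,
  \<open>t \<le> exp (t - 1)\<close> with \<open>t = (x - z)^2 / (1 + z^2)\<close> compares the
  factor with \<open>1 + z^2\<close>; the exponents add up to the two small tail sums, and
  \<open>upper\<close> bounds the product of all \<open>1 + y^2\<close>.\<close>

lemma deriv_upper_bound:
  assumes \<delta>: "0 < \<delta>"
  shows "\<exists>R0>0. \<forall>R\<ge>R0. \<forall>E. window \<delta> R E \<longrightarrow> (\<forall>k\<in>E. eventually (deriv_bound \<delta> E k) sequentially)"
proof -
  obtain R0 where R0: "0 < R0" "\<forall>R\<ge>R0. \<forall>E. window \<delta> R E \<longrightarrow> eventually (small_tails \<delta> E) sequentially"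
    using window_tails[OF \<delta>] by blast
  show ?thesis
  proof (intro exI[of _ R0] conjI allI impI ballI R0(1))
    fix R E k
    assume R: "R0 \<le> R" and w: "window \<delta> R E" and k: "k \<in> E"
    have fin: "finite E" using w by (simp add: window_def)
    have "eventually (small_tails \<delta> E) sequentially" using R0(2) R w by blast
    then show "eventually (deriv_bound \<delta> E k) sequentially"
    proof eventually_elim
      case (elim n)
      note elim = elim[unfolded small_tails_def]
      define x where "x = e n k"
      define Z where "Z = Y n - e n ` E"
      have fZ: "finite Z" "finite (E - {k})" using finite_Y fin by (auto simp: Z_def)
      have inj: "inj_on (e n) (E - {k})" using elim by (auto intro: inj_on_subset)
      have xi: "x \<notin> e n ` (E - {k})" using elim k by (auto simp: x_def inj_on_def)
      have Yx: "Y n - {x} = e n ` (E - {k}) \<union> Z" "e n ` (E - {k}) \<inter> Z = {}"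
        using elim k xi by (auto simp: Z_def x_def)
      have Y0: "Y n = insert x (e n ` (E - {k}) \<union> Z)" using elim k by (auto simp: Z_def x_def)
      have xZ: "x \<notin> e n ` (E - {k}) \<union> Z" using xi k by (auto simp: Z_def x_def)
      have p: "0 < 1 + y\<^sup>2" for y :: real by (simp add: add_pos_nonneg)
      define A where "A = (\<Prod>l\<in>E - {k}. 1 + (e n l)\<^sup>2)"
      define Q where "Q = (\<Prod>l\<in>E - {k}. (x - e n l)\<^sup>2)"
      define B where "B = (\<Prod>z\<in>Z. 1 + z\<^sup>2)"
      have A: "0 \<le> A" "0 \<le> Q" "0 \<le> B" unfolding A_def Q_def B_def by (auto intro!: prod_nonneg)
      have 1: "(\<Prod>z\<in>Y n - {x}. (x - z)\<^sup>2) = Q * (\<Prod>z\<in>Z. (x - z)\<^sup>2)"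
        unfolding Yx(1) Q_def using fZ Yx(2) by (subst prod.union_disjoint) (auto simp: prod.reindex[OF inj])
      have 2: "(\<Prod>y\<in>Y n. 1 + y\<^sup>2) = (1 + x\<^sup>2) * (A * B)"
        unfolding Y0 A_def B_def using fZ xZ Yx(2)
        by (subst prod.insert) (auto simp: prod.union_disjoint prod.reindex[OF inj])
      have "(\<Prod>z\<in>Z. (x - z)\<^sup>2) \<le> (\<Prod>z\<in>Z. (1 + z\<^sup>2) * exp (x\<^sup>2 * (1 / (1 + z\<^sup>2)) - 2 * x * (z / (1 + z\<^sup>2))))"
      proof (rule prod_mono, safe)
        fix z
        define t where "t = (x - z)\<^sup>2 / (1 + z\<^sup>2)"
        have "t \<le> exp (t - 1)" using exp_ge_add_one_self[of "t - 1"] by simp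
        also have "t - 1 = (x\<^sup>2 - 2 * x * z - 1) / (1 + z\<^sup>2)"
          using p[of z] less_imp_neq[OF p[of z]] by (simp add: t_def power2_diff divide_simps)
        also have "exp \<dots> \<le> exp ((x\<^sup>2 - 2 * x * z) / (1 + z\<^sup>2))" using p[of z] by (simp add: divide_right_mono)
        finally have "t * (1 + z\<^sup>2) \<le> exp ((x\<^sup>2 - 2 * x * z) / (1 + z\<^sup>2)) * (1 + z\<^sup>2)"
          using p[of z] by (intro mult_right_mono) auto
        moreover have "t * (1 + z\<^sup>2) = (x - z)\<^sup>2" using less_imp_neq[OF p[of z]] by (simp add: t_def)
        ultimately show "(x - z)\<^sup>2 \<le> (1 + z\<^sup>2) * exp (x\<^sup>2 * (1 / (1 + z\<^sup>2)) - 2 * x * (z / (1 + z\<^sup>2)))"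
          by (simp add: diff_divide_distrib mult.commute)
      qed auto
      also have "\<dots> = B * exp (x\<^sup>2 * (\<Sum>z\<in>Z. 1 / (1 + z\<^sup>2)) - 2 * x * (\<Sum>z\<in>Z. z / (1 + z\<^sup>2)))"
        by (simp add: prod.distrib B_def exp_sum[symmetric] fZ sum_subtractf sum_distrib_left)
      also have "\<dots> \<le> B * exp (2 * \<delta> * x\<^sup>2 + 12 * \<delta> * \<bar>x\<bar>)"
      proof -
        have "x\<^sup>2 * (\<Sum>z\<in>Z. 1 / (1 + z\<^sup>2)) \<le> x\<^sup>2 * (2 * \<delta>)" using elim by (intro mult_left_mono) (auto simp: Z_def)
        moreover have "\<bar>2 * x * (\<Sum>z\<in>Z. z / (1 + z\<^sup>2))\<bar> \<le> 2 * \<bar>x\<bar> * (6 * \<delta>)"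
          unfolding abs_mult using elim by (intro mult_mono) (auto simp: Z_def)
        ultimately have "x\<^sup>2 * (\<Sum>z\<in>Z. 1 / (1 + z\<^sup>2)) - 2 * x * (\<Sum>z\<in>Z. z / (1 + z\<^sup>2)) \<le> 2 * \<delta> * x\<^sup>2 + 12 * \<delta> * \<bar>x\<bar>"
          by (simp add: mult_ac)
        then show ?thesis using A by (intro mult_left_mono) auto
      qed
      finally have 3: "(\<Prod>z\<in>Z. (x - z)\<^sup>2) \<le> B * exp (2 * \<delta> * x\<^sup>2 + 12 * \<delta> * \<bar>x\<bar>)" .
      have "(1 + x\<^sup>2) * A * (\<kappa> n * (\<Prod>z\<in>Y n - {x}. (x - z)\<^sup>2)) = ((1 + x\<^sup>2) * A * \<kappa> n * Q) * (\<Prod>z\<in>Z. (x - z)\<^sup>2)"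
        unfolding 1 by (simp add: mult_ac)
      also have "\<dots> \<le> ((1 + x\<^sup>2) * A * \<kappa> n * Q) * (B * exp (2 * \<delta> * x\<^sup>2 + 12 * \<delta> * \<bar>x\<bar>))"
        using A \<kappa>[of n] p[of x] by (intro mult_left_mono[OF 3] mult_nonneg_nonneg) auto
      also have "\<dots> = (\<kappa> n * ((1 + x\<^sup>2) * (A * B))) * (exp (2 * \<delta> * x\<^sup>2 + 12 * \<delta> * \<bar>x\<bar>) * Q)"
        by (simp add: mult_ac)
      also have "\<dots> \<le> M * (exp (2 * \<delta> * x\<^sup>2 + 12 * \<delta> * \<bar>x\<bar>) * Q)"
        using upper[of n] A unfolding 2 by (intro mult_right_mono) auto
      finally show ?case unfolding deriv_bound_def x_def[symmetric] A_def Q_def by (simp add: mult.assoc)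
    qed
  qed
qed

lemma full_window:
  assumes "0 < \<delta>"
  shows "\<exists>R1. \<forall>R\<ge>R1. window \<delta> R {k\<in>S. \<bar>\<mu> k\<bar> < R}"
proof -
  obtain K where K: "\<forall>r\<ge>0. real (card {k\<in>S. \<bar>\<mu> k\<bar> < r}) \<le> \<delta> / 2 * r + K"
    using card_window[of "\<delta> / 2"] assms by auto
  have "window \<delta> R {k\<in>S. \<bar>\<mu> k\<bar> < R}" if R: "max 0 (2 * K / \<delta>) \<le> R" for R
  proof -
    have "2 * K / \<delta> \<le> R" "0 \<le> R" using R by auto
    then have "K \<le> \<delta> / 2 * R" using assms by (simp add: divide_le_eq mult_ac)
    moreover have "real (card {k\<in>S. \<bar>\<mu> k\<bar> < R}) \<le> \<delta> / 2 * R + K" using K \<open>0 \<le> R\<close> by blast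
    ultimately have "real (card {k\<in>S. \<bar>\<mu> k\<bar> < R}) \<le> \<delta> * R" by simp
    then show ?thesis using finite_window by (simp add: window_def)
  qed
  then show ?thesis by blast
qed

text \<open>Two nodes with a common limit would force the product of the
  \<open>(e n k - e n l)^2\<close> to 0, whereas \<open>deriv\<close> and \<open>deriv_bound\<close>
  keep it away from 0.\<close>

lemma inj_\<mu>: "inj_on \<mu> S"
proof (rule inj_onI, rule ccontr)
  fix k l assume kl: "k \<in> S" "l \<in> S" "\<mu> k = \<mu> l" "k \<noteq> l"
  obtain R0 where R0: "\<forall>R\<ge>R0. \<forall>E. window 1 R E \<longrightarrow> (\<forall>k\<in>E. eventually (deriv_bound 1 E k) sequentially)"
    using deriv_upper_bound[OF zero_less_one] by blast
  obtain R1 where R1: "\<forall>R\<ge>R1. window 1 R {k\<in>S. \<bar>\<mu> k\<bar> < R}"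
    using full_window[OF zero_less_one] by blast
  define R where "R = max (max R0 R1) (\<bar>\<mu> k\<bar> + 1)"
  define E where "E = {k\<in>S. \<bar>\<mu> k\<bar> < R}"
  have E: "finite E" "k \<in> E" "l \<in> E" using finite_window kl by (auto simp: E_def R_def)
  have "R0 \<le> R" "R1 \<le> R" by (auto simp: R_def)
  then have "eventually (deriv_bound 1 E k) sequentially" using R0 R1 E(2) unfolding E_def by blast
  then have "eventually (\<lambda>n. 1 \<le> M * exp (2 * 1 * (e n k)\<^sup>2 + 12 * 1 * \<bar>e n k\<bar>) * (\<Prod>l\<in>E - {k}. (e n k - e n l)\<^sup>2)) sequentially"
    using eventually_e_in[of k]
  proof eventually_elim
    case (elim n)
    note elim = elim[unfolded deriv_bound_def]
    have "1 * 1 * 1 \<le> (1 + (e n k)\<^sup>2) * (\<Prod>l\<in>E - {k}. 1 + (e n l)\<^sup>2) * (\<kappa> n * (\<Prod>z\<in>Y n - {e n k}. (e n k - z)\<^sup>2))"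
      using elim by (intro mult_mono deriv prod_ge_1) (auto intro!: prod_nonneg mult_nonneg_nonneg)
    then show ?case using elim by linarith
  qed
  moreover have "(\<lambda>n. M * exp (2 * 1 * (e n k)\<^sup>2 + 12 * 1 * \<bar>e n k\<bar>) * (\<Prod>l\<in>E - {k}. (e n k - e n l)\<^sup>2))
     \<longlonglongrightarrow> M * exp (2 * 1 * (\<mu> k)\<^sup>2 + 12 * 1 * \<bar>\<mu> k\<bar>) * (\<Prod>l\<in>E - {k}. (\<mu> k - \<mu> l)\<^sup>2)"
    by (intro tendsto_intros conv) (auto simp: E_def kl)
  ultimately have "1 \<le> M * exp (2 * 1 * (\<mu> k)\<^sup>2 + 12 * 1 * \<bar>\<mu> k\<bar>) * (\<Prod>l\<in>E - {k}. (\<mu> k - \<mu> l)\<^sup>2)"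
    by (intro tendsto_lowerbound) auto
  moreover have "(\<Prod>l\<in>E - {k}. (\<mu> k - \<mu> l)\<^sup>2) = 0" using E kl by auto
  ultimately show False by simp
qed

text \<open>If only \<open>p\<close> labels had bounded nodes, the square of the normalized
  polynomial at \<open>\<i> * t\<close> would be at most of order \<open>t^(2p)\<close>, up to
  \<open>M\<close> and a tail factor \<open>exp (2 * \<delta> * t^2)\<close>, which the choice of
  \<open>\<delta>\<close> makes equal to 2. The assumption \<open>growth\<close> for
  \<open>j = p\<close> demands \<open>t^(2p + 2)\<close>; this fails once
  \<open>t^2 > 2 * \<bar>C\<bar> * M\<close>.\<close>

lemma infinite_S: "infinite S"
proof
  assume fS: "finite S"
  define p where "p = card S"
  obtain C where C: "\<And>n t. p \<le> n \<Longrightarrow> 0 < t \<Longrightarrow> t ^ (2 * p + 2) \<le> C * (\<kappa> n * (\<Prod>y\<in>Y n. t\<^sup>2 + y\<^sup>2))"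
    using growth[of p] by blast
  define t where "t = 1 + sqrt (2 * \<bar>C\<bar> * M)"
  have CM: "0 \<le> 2 * \<bar>C\<bar> * M" using M_pos by simp
  have t1: "1 \<le> t" using CM by (simp add: t_def)
  have t2: "2 * \<bar>C\<bar> * M < t\<^sup>2"
  proof -
    have "(sqrt (2 * \<bar>C\<bar> * M))\<^sup>2 < t\<^sup>2" using CM by (intro power_strict_mono) (auto simp: t_def)
    then show ?thesis using CM by simp
  qed
  define \<delta> where "\<delta> = ln 2 / (2 * t\<^sup>2)"
  have \<delta>: "0 < \<delta>" using t1 by (simp add: \<delta>_def)
  obtain R0 where R0: "\<forall>R\<ge>R0. \<forall>E. window \<delta> R E \<longrightarrow> eventually (small_tails \<delta> E) sequentially"
    using window_tails[OF \<delta>] by blast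
  \<comment> \<open>Large enough for the whole finite set \<open>S\<close> to count as a
    window.\<close>
  define R where "R = max R0 (real p / \<delta>)"
  have "real p / \<delta> \<le> R" by (simp add: R_def)
  then have "real (card S) \<le> \<delta> * R" using \<delta> by (simp add: p_def divide_le_eq mult_ac)
  then have "window \<delta> R S" using fS by (auto simp: window_def)
  moreover have "R0 \<le> R" by (simp add: R_def)
  ultimately have "eventually (small_tails \<delta> S) sequentially" using R0 by blast
  then have "eventually (\<lambda>n. small_tails \<delta> S n \<and> p \<le> n) sequentially"
    using eventually_ge_at_top by (rule eventually_conj)
  then obtain n where "small_tails \<delta> S n" "p \<le> n" using eventually_happens by force
  then have n: "e n ` S \<subseteq> Y n" "inj_on (e n) S" "(\<Sum>y\<in>Y n - e n ` S. 1 / (1 + y\<^sup>2)) \<le> 2 * \<delta>" "p \<le> n"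
    by (auto simp: small_tails_def)
  define Z where "Z = Y n - e n ` S"
  have fZ: "finite Z" "finite (e n ` S)" using finite_Y fS by (auto simp: Z_def)
  have YZ: "Y n = e n ` S \<union> Z" "e n ` S \<inter> Z = {}" using n(1) by (auto simp: Z_def)
  have "t ^ (2 * p + 2) \<le> C * (\<kappa> n * (\<Prod>y\<in>Y n. t\<^sup>2 + y\<^sup>2))" using t1 n(4) by (intro C) auto
  also have "\<dots> \<le> \<bar>C\<bar> * (\<kappa> n * (\<Prod>y\<in>Y n. t\<^sup>2 + y\<^sup>2))"
    using \<kappa>[of n] by (intro mult_right_mono mult_nonneg_nonneg prod_nonneg) auto
  also have "(\<Prod>y\<in>Y n. t\<^sup>2 + y\<^sup>2) = (\<Prod>y\<in>e n ` S. t\<^sup>2 + y\<^sup>2) * (\<Prod>y\<in>Z. t\<^sup>2 + y\<^sup>2)"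
    unfolding YZ(1) by (rule prod.union_disjoint[OF fZ(2,1) YZ(2)])
  also have "\<bar>C\<bar> * (\<kappa> n * \<dots>) \<le> \<bar>C\<bar> * (\<kappa> n * ((t ^ (2 * p) * (\<Prod>y\<in>e n ` S. 1 + y\<^sup>2)) * ((\<Prod>y\<in>Z. 1 + y\<^sup>2) * 2)))"
  proof (intro mult_left_mono mult_mono)
    have "(\<Prod>y\<in>e n ` S. t\<^sup>2 + y\<^sup>2) \<le> (\<Prod>y\<in>e n ` S. t\<^sup>2 * (1 + y\<^sup>2))"
    proof (rule prod_mono, safe)
      fix y :: real
      have "1 * y\<^sup>2 \<le> t\<^sup>2 * y\<^sup>2" using t1 by (intro mult_right_mono) (auto simp: one_le_power)
      then show "t\<^sup>2 + y\<^sup>2 \<le> t\<^sup>2 * (1 + y\<^sup>2)" by (simp add: distrib_left)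
    qed auto
    also have "\<dots> = t ^ (2 * p) * (\<Prod>y\<in>e n ` S. 1 + y\<^sup>2)"
      using n(2) by (simp add: prod.distrib card_image p_def power_mult)
    finally show "(\<Prod>y\<in>e n ` S. t\<^sup>2 + y\<^sup>2) \<le> t ^ (2 * p) * (\<Prod>y\<in>e n ` S. 1 + y\<^sup>2)" .
    have "(\<Prod>y\<in>Z. t\<^sup>2 + y\<^sup>2) \<le> (\<Prod>y\<in>Z. (1 + y\<^sup>2) * exp (t\<^sup>2 * (1 / (1 + y\<^sup>2))))"
    proof (rule prod_mono, safe)
      fix y :: real
      have p1: "1 + y\<^sup>2 > 0" by (simp add: add_pos_nonneg)
      have "1 + t\<^sup>2 * (1 / (1 + y\<^sup>2)) \<le> exp (t\<^sup>2 * (1 / (1 + y\<^sup>2)))" by (rule exp_ge_add_one_self)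
      then have "(1 + y\<^sup>2) * (1 + t\<^sup>2 * (1 / (1 + y\<^sup>2))) \<le> (1 + y\<^sup>2) * exp (t\<^sup>2 * (1 / (1 + y\<^sup>2)))"
        using p1 by (intro mult_left_mono) auto
      moreover have "(1 + y\<^sup>2) * (1 + t\<^sup>2 * (1 / (1 + y\<^sup>2))) = 1 + y\<^sup>2 + t\<^sup>2"
        using less_imp_neq[OF p1] by (simp add: distrib_left)
      ultimately show "t\<^sup>2 + y\<^sup>2 \<le> (1 + y\<^sup>2) * exp (t\<^sup>2 * (1 / (1 + y\<^sup>2)))" by linarith
    qed auto
    also have "\<dots> = (\<Prod>y\<in>Z. 1 + y\<^sup>2) * exp (t\<^sup>2 * (\<Sum>y\<in>Z. 1 / (1 + y\<^sup>2)))"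
      by (simp add: prod.distrib exp_sum[symmetric] fZ sum_distrib_left)
    also have "\<dots> \<le> (\<Prod>y\<in>Z. 1 + y\<^sup>2) * exp (t\<^sup>2 * (2 * \<delta>))"
    proof -
      have "t\<^sup>2 * (\<Sum>y\<in>Z. 1 / (1 + y\<^sup>2)) \<le> t\<^sup>2 * (2 * \<delta>)"
        using n(3) unfolding Z_def[symmetric] by (intro mult_left_mono) auto
      then show ?thesis by (intro mult_left_mono prod_nonneg) auto
    qed
    also have "exp (t\<^sup>2 * (2 * \<delta>)) = 2" using t1 by (simp add: \<delta>_def)
    finally show "(\<Prod>y\<in>Z. t\<^sup>2 + y\<^sup>2) \<le> (\<Prod>y\<in>Z. 1 + y\<^sup>2) * 2" .
  qed (use \<kappa>[of n] t1 in \<open>auto intro!: prod_nonneg mult_nonneg_nonneg\<close>)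
  also have "\<dots> = 2 * \<bar>C\<bar> * t ^ (2 * p) * (\<kappa> n * ((\<Prod>y\<in>e n ` S. 1 + y\<^sup>2) * (\<Prod>y\<in>Z. 1 + y\<^sup>2)))"
    by (simp add: mult_ac)
  also have "(\<Prod>y\<in>e n ` S. 1 + y\<^sup>2) * (\<Prod>y\<in>Z. 1 + y\<^sup>2) = (\<Prod>y\<in>Y n. 1 + y\<^sup>2)"
    unfolding YZ(1) by (rule prod.union_disjoint[OF fZ(2,1) YZ(2), symmetric])
  also have "2 * \<bar>C\<bar> * t ^ (2 * p) * (\<kappa> n * \<dots>) \<le> 2 * \<bar>C\<bar> * t ^ (2 * p) * M"
    using upper[of n] t1 by (intro mult_left_mono) auto
  finally have "t ^ (2 * p) * t\<^sup>2 \<le> t ^ (2 * p) * (2 * \<bar>C\<bar> * M)" by (simp add: power_add mult_ac power2_eq_square)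
  moreover have "0 < t ^ (2 * p)" using t1 by simp
  ultimately show False using t2 by simp
qed

end

section \<open>Enumerating discrete sets\<close>

lemma downward_closed_nat:
  assumes dc: "\<And>j. Suc j \<in> D \<Longrightarrow> j \<in> D"
  shows "D = (if finite D then {..<card D} else UNIV)"
proof -
  have le: "i \<in> D" if "j \<in> D" "i \<le> j" for i j
    using that(2,1) by (induction rule: inc_induct) (auto intro: dc)
  show ?thesis
  proof (cases "finite D")
    case True
    show ?thesis
    proof (cases "D = {}")
      case False
      define m where "m = Max D"
      have "m \<in> D" "\<And>j. j \<in> D \<Longrightarrow> j \<le> m" using True False by (auto simp: m_def)
      then have "D = {..<Suc m}" using le[of m] by (auto simp: less_Suc_eq_le)
      moreover from this have "card D = Suc m" by simp
      ultimately show ?thesis using True by simp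
    qed simp
  next
    case False
    have "i \<in> D" for i
    proof -
      obtain j where "j \<in> D" "i < j" using False infinite_nat_iff_unbounded by blast
      then show ?thesis using le[of j i] by simp
    qed
    then show ?thesis using False by auto
  qed
qed

lemma rank_image:
  fixes A :: "real set"
  assumes fin: "\<And>x. finite {y\<in>A. y < x}"
  defines "f \<equiv> \<lambda>x. card {y\<in>A. y < x}"
  shows "f ` A = (if finite A then {..<card A} else UNIV)" "strict_mono_on A f"
proof -
  show mono: "strict_mono_on A f"
  proof (rule strict_mono_onI)
    fix x y assume "x \<in> A" "y \<in> A" "x < y"
    then have "{z\<in>A. z < x} \<subset> {z\<in>A. z < y}" by auto
    then show "f x < f y" unfolding f_def using fin by (intro psubset_card_mono)
  qed
  then have inj: "inj_on f A" by (rule strict_mono_on_imp_inj_on)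
  have "f ` A = (if finite (f ` A) then {..<card (f ` A)} else UNIV)"
  proof (rule downward_closed_nat)
    fix j assume "Suc j \<in> f ` A"
    then obtain x where x: "x \<in> A" "f x = Suc j" by force
    then have ne: "{y\<in>A. y < x} \<noteq> {}" unfolding f_def by (metis card.empty nat.distinct(1))
    define z where "z = Max {y\<in>A. y < x}"
    have "z \<in> {y\<in>A. y < x}" unfolding z_def using fin ne by (intro Max_in)
    then have z: "z \<in> A" "z < x" by auto
    have zm: "y \<le> z" if "y \<in> A" "y < x" for y unfolding z_def using fin that by (intro Max_ge) auto
    have "{y\<in>A. y < x} = insert z {y\<in>A. y < z}" using z zm by force
    then have "f x = Suc (f z)" unfolding f_def using fin by simp
    then show "j \<in> f ` A" using x z by auto
  qed
  then show "f ` A = (if finite A then {..<card A} else UNIV)"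
    unfolding finite_image_iff[OF inj] card_image[OF inj] .
qed

lemma enumerate_discrete_set:
  fixes L :: "real set"
  assumes inf: "infinite L" and fin: "\<And>r. finite {x\<in>L. \<bar>x\<bar> < r}"
  shows "\<exists>I lam. discrete_seq I lam \<and> lam ` I = L"
proof -
  define A where "A = {x\<in>L. 0 \<le> x}"
  define B where "B = {x. - x \<in> L \<and> 0 < x}"
  have finA: "finite {y\<in>A. y < x}" for x
    using fin[of x] by (rule rev_finite_subset) (auto simp: A_def)
  have finB: "finite {y\<in>B. y < x}" for x
  proof -
    have "{y\<in>B. y < x} \<subseteq> uminus ` {y\<in>L. \<bar>y\<bar> < x}" by (force simp: B_def)
    then show ?thesis by (rule finite_subset) (intro finite_imageI fin)
  qed
  define f where "f x = card {y\<in>A. y < x}" for x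
  define g where "g x = card {y\<in>B. y < x}" for x
  note A = rank_image[OF finA, folded f_def] and B = rank_image[OF finB, folded g_def]
  \<comment> \<open>The \<open>- 1\<close> gives the negative element nearest to 0 the index
    \<open>-1\<close>, so that the signs of index and value agree.\<close>
  define idx where "idx x = (if 0 \<le> x then int (f x) else - int (g (- x)) - 1)" for x
  have mono: "strict_mono_on L idx"
  proof (rule strict_mono_onI)
    fix x y assume xy: "x \<in> L" "y \<in> L" "x < y"
    show "idx x < idx y"
    proof (cases "0 \<le> x")
      case True
      then show ?thesis using xy strict_mono_onD[OF A(2), of x y] by (simp add: idx_def A_def)
    next
      case False
      then show ?thesis using xy strict_mono_onD[OF B(2), of "-y" "-x"] by (simp add: idx_def B_def)
    qed
  qed
  then have inj: "inj_on idx L" by (rule strict_mono_on_imp_inj_on)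
  define I where "I = idx ` L"
  define lam where "lam = inv_into L idx"
  have lamI: "lam ` I = L" unfolding lam_def I_def using inj by simp
  have lam: "lam n \<in> L" "idx (lam n) = n" if "n \<in> I" for n
    using that unfolding lam_def I_def by (auto simp: inv_into_into f_inv_into_f)
  have LAB: "L = A \<union> uminus ` B"
  proof
    show "L \<subseteq> A \<union> uminus ` B"
    proof
      fix x assume x: "x \<in> L"
      show "x \<in> A \<union> uminus ` B"
      proof (cases "0 \<le> x")
        case False
        then have "- x \<in> B" using x by (simp add: B_def)
        then have "- (- x) \<in> uminus ` B" by (rule imageI)
        then show ?thesis by simp
      qed (simp add: A_def x)
    qed
    show "A \<union> uminus ` B \<subseteq> L" by (auto simp: A_def B_def)
  qed
  have Ieq: "I = int ` (f ` A) \<union> (\<lambda>j. - int j - 1) ` (g ` B)"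
  proof -
    have "I = idx ` A \<union> idx ` (uminus ` B)" unfolding I_def by (subst LAB) (rule image_Un)
    also have "idx ` A = int ` (f ` A)" unfolding image_image by (rule image_cong) (auto simp: idx_def A_def)
    also have "idx ` (uminus ` B) = (\<lambda>j. - int j - 1) ` (g ` B)"
      unfolding image_image by (rule image_cong) (auto simp: idx_def B_def)
    finally show ?thesis .
  qed
  have nn: "int ` UNIV = {0..}"
  proof -
    have "x \<in> range int" if "0 \<le> x" for x using that by (intro range_eqI[of _ _ "nat x"]) auto
    then show ?thesis by auto
  qed
  have neg: "(\<lambda>j. - int j - 1) ` UNIV = {..<0}"
  proof -
    have "x \<in> range (\<lambda>j. - int j - 1)" if "x < 0" for x using that by (intro range_eqI[of _ _ "nat (- x - 1)"]) auto
    then show ?thesis by auto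
  qed
  have shape: "I = UNIV \<or> (\<exists>N::nat. I = {- int N..}) \<or> (\<exists>N::nat. I = {..<int N})"
  proof -
    have AB: "infinite A \<or> infinite B"
    proof (rule ccontr)
      assume "\<not> ?thesis"
      then have "finite (A \<union> uminus ` B)" by simp
      then show False using inf LAB by simp
    qed
    show ?thesis
    proof (cases "finite A")
      case True
      then have iB: "infinite B" using AB by simp
      have "I = int ` {..<card A} \<union> {..<0}" unfolding Ieq A(1) B(1) using True iB neg by simp
      also have "\<dots> = {..<int (card A)}"
      proof -
        have "x \<in> int ` {..<card A}" if "0 \<le> x" "x < int (card A)" for x
          using that by (intro image_eqI[of _ _ "nat x"]) auto
        then show ?thesis by (auto simp: not_less[symmetric])
      qed
      finally show ?thesis by blast
    next
      case False
      show ?thesis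
      proof (cases "finite B")
        case True
        have "I = {0..} \<union> (\<lambda>j. - int j - 1) ` {..<card B}" unfolding Ieq A(1) B(1) using True False nn by simp
        also have "\<dots> = {- int (card B)..}"
        proof -
          have "x \<in> (\<lambda>j. - int j - 1) ` {..<card B}" if "- int (card B) \<le> x" "\<not> 0 \<le> x" for x
            using that by (intro image_eqI[of _ _ "nat (- x - 1)"]) auto
          then show ?thesis by auto
        qed
        finally show ?thesis by blast
      next
        case iB: False
        have "I = {0..} \<union> {..<0}" unfolding Ieq A(1) B(1) using False iB nn neg by simp
        then have "I = UNIV" by auto
        then show ?thesis by simp
      qed
    qed
  qed
  have "strict_mono_on I lam"
  proof (rule strict_mono_onI)
    fix m n assume mn: "m \<in> I" "n \<in> I" "m < n"
    show "lam m < lam n"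
    proof (rule ccontr)
      assume "\<not> lam m < lam n"
      then consider "lam n < lam m" | "lam n = lam m" by linarith
      then have "idx (lam n) \<le> idx (lam m)"
      proof cases
        case 1
        then have "idx (lam n) < idx (lam m)" by (intro strict_mono_onD[OF mono] lam(1) mn)
        then show ?thesis by simp
      qed simp
      then show False using lam(2)[OF mn(1)] lam(2)[OF mn(2)] mn(3) by simp
    qed
  qed
  moreover have "\<forall>n\<in>I. 0 \<le> lam n \<longleftrightarrow> 0 \<le> n"
  proof
    fix n assume "n \<in> I"
    from lam(2)[OF this] show "0 \<le> lam n \<longleftrightarrow> 0 \<le> n" by (auto simp: idx_def split: if_splits)
  qed
  moreover have "\<not> x islimpt lam ` I" for x
  proof
    assume "x islimpt lam ` I"
    then have "infinite (lam ` I \<inter> ball x 1)"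
      unfolding islimpt_eq_infinite_ball by simp
    moreover have "L \<inter> ball x 1 \<subseteq> {y\<in>L. \<bar>y\<bar> < \<bar>x\<bar> + 1}" by (auto simp: dist_real_def)
    ultimately show False using fin[of "\<bar>x\<bar> + 1"] lamI finite_subset by auto
  qed
  ultimately have "discrete_seq I lam" using shape by (simp add: discrete_seq_def)
  then show ?thesis using lamI by blast
qed

text \<open>Local finiteness and zero upper density in a form valid for every radius: the additive
  constant absorbs the small ones.\<close>

definition sublinear_count :: "real set \<Rightarrow> bool" where
  "sublinear_count L \<longleftrightarrow> (\<forall>r. finite {x\<in>L. \<bar>x\<bar> < r}) \<and>
     (\<forall>\<delta>>0. \<exists>K. \<forall>r\<ge>0. real (card {x\<in>L. \<bar>x\<bar> < r}) \<le> \<delta> * r + K)"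

lemma window_eq_interval: "{x\<in>L. \<bar>x\<bar> < r} = L \<inter> {-r<..<r}" for r :: real
  by auto

lemma sublinear_count_imp_density_0:
  assumes "sublinear_count L"
  shows "upper_density L = 0"
proof -
  define h where "h A = real (card (L \<inter> {-A<..<A})) / (2 * A)" for A
  have "(h \<longlongrightarrow> 0) at_top"
  proof (rule tendstoI)
    fix \<epsilon> :: real assume \<epsilon>: "0 < \<epsilon>"
    obtain K where K: "\<And>r. 0 \<le> r \<Longrightarrow> real (card {x\<in>L. \<bar>x\<bar> < r}) \<le> \<epsilon> * r + K"
      using assms \<epsilon> unfolding sublinear_count_def by blast
    show "eventually (\<lambda>A. dist (h A) 0 < \<epsilon>) at_top"
    proof (rule eventually_at_top_linorderI[of "max 1 (\<bar>K\<bar> / \<epsilon> + 1)"])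
      fix A assume A: "max 1 (\<bar>K\<bar> / \<epsilon> + 1) \<le> A"
      then have A1: "1 \<le> A" "\<bar>K\<bar> / \<epsilon> < A" by auto
      then have "K < \<epsilon> * A" using \<epsilon> by (simp add: divide_less_eq mult_ac)
      moreover have "real (card (L \<inter> {-A<..<A})) \<le> \<epsilon> * A + K" using K[of A] A1 by (simp add: window_eq_interval)
      ultimately have "real (card (L \<inter> {-A<..<A})) < \<epsilon> * (2 * A)" by linarith
      then show "dist (h A) 0 < \<epsilon>" using A1 by (simp add: h_def divide_less_eq)
    qed
  qed
  then have "((\<lambda>A. ereal (h A)) \<longlongrightarrow> ereal 0) at_top" by (intro tendsto_intros)
  then have "Limsup at_top (\<lambda>A. ereal (h A)) = ereal 0" by (intro lim_imp_Limsup) auto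
  then show ?thesis by (simp add: upper_density_def h_def zero_ereal_def)
qed

lemma density_0_imp_sublinear_count:
  assumes lim: "\<And>x. \<not> x islimpt L" and d: "upper_density L = 0"
  shows "sublinear_count L"
  unfolding sublinear_count_def
proof (intro conjI allI impI)
  show fin: "finite {x\<in>L. \<bar>x\<bar> < r}" for r
  proof -
    have "finite ({-r..r} \<inter> L)" by (rule finite_not_islimpt_in_compact) (use lim in auto)
    then show ?thesis by (rule rev_finite_subset) auto
  qed
  fix \<delta> :: real assume \<delta>: "0 < \<delta>"
  have "Limsup at_top (\<lambda>A::real. ereal (real (card (L \<inter> {-A<..<A})) / (2 * A))) < ereal (\<delta> / 2)"
    using d \<delta> by (simp add: upper_density_def zero_ereal_def)
  then have "eventually (\<lambda>A. ereal (real (card (L \<inter> {-A<..<A})) / (2 * A)) < ereal (\<delta> / 2)) at_top"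
    by (rule Limsup_lessD)
  then obtain A0 where A0: "\<And>A. A0 \<le> A \<Longrightarrow> real (card (L \<inter> {-A<..<A})) / (2 * A) < \<delta> / 2"
    unfolding eventually_at_top_linorder by auto
  define A1 where "A1 = max 1 A0"
  have "real (card {x\<in>L. \<bar>x\<bar> < r}) \<le> \<delta> * r + \<delta> * A1" if r: "0 \<le> r" for r
  proof -
    define A where "A = max r A1"
    have A: "1 \<le> A" "A0 \<le> A" "r \<le> A" by (auto simp: A_def A1_def)
    have "card {x\<in>L. \<bar>x\<bar> < r} \<le> card {x\<in>L. \<bar>x\<bar> < A}" using A fin by (intro card_mono) auto
    also have "real \<dots> \<le> \<delta> * A" using A0[OF A(2)] A(1) by (simp add: window_eq_interval divide_less_eq)
    also have "\<dots> \<le> \<delta> * (r + A1)" using \<delta> r by (intro mult_left_mono) (auto simp: A_def A1_def)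
    finally show ?thesis by (simp add: algebra_simps)
  qed
  then show "\<exists>K. \<forall>r\<ge>0. real (card {x\<in>L. \<bar>x\<bar> < r}) \<le> \<delta> * r + K" by blast
qed

section \<open>The characteristic sequence\<close>

text \<open>Centred at index 0, as in \<open>balanced\<close>, whereas \<open>char_seq\<close> sums
  over windows centred at \<open>n\<close>.\<close>

definition Win :: "int set \<Rightarrow> nat \<Rightarrow> int set" where
  "Win I N = {k\<in>I. \<bar>k\<bar> < int N}"

lemma finite_Win [simp]: "finite (Win I N)"
  by (rule finite_subset[of _ "{- int N..int N}"]) (auto simp: Win_def)

text \<open>The elements with index from 0 (or \<open>-1\<close>) to \<open>k\<close> lie between 0
  and \<open>lam k\<close>, and there are at least \<open>\<bar>k\<bar>\<close> of them; so the
  counting function bounds the index.\<close>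

lemma index_le_modulus:
  assumes D: "discrete_seq I lam" and S: "sublinear_count (lam ` I)" and \<delta>: "0 < \<delta>"
  shows "\<exists>K. \<forall>k\<in>I. real_of_int \<bar>k\<bar> \<le> \<delta> * \<bar>lam k\<bar> + K"
proof -
  obtain K where K: "\<And>r. 0 \<le> r \<Longrightarrow> real (card {x\<in>lam ` I. \<bar>x\<bar> < r}) \<le> \<delta> * r + K"
    using S \<delta> unfolding sublinear_count_def by blast
  have mono: "strict_mono_on I lam" and sgn: "\<And>n. n \<in> I \<Longrightarrow> 0 \<le> lam n \<longleftrightarrow> 0 \<le> n"
    using D by (auto simp: discrete_seq_def)
  have inj: "inj_on lam I" using mono by (rule strict_mono_on_imp_inj_on)
  have le: "lam i \<le> lam j" if "i \<in> I" "j \<in> I" "i \<le> j" for i j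
    using strict_mono_onD[OF mono, of i j] that by (cases "i = j") auto
  have "real_of_int \<bar>k\<bar> \<le> \<delta> * \<bar>lam k\<bar> + (\<delta> + K)" if k: "k \<in> I" for k
  proof -
    define J where "J = (if 0 \<le> k then {0..k} else {k..-1})"
    have JI: "J \<subseteq> I" using D k unfolding discrete_seq_def J_def by (auto split: if_splits)
    have "\<bar>lam j\<bar> < \<bar>lam k\<bar> + 1" if "j \<in> J" for j
      using le[of j k] le[of k j] sgn[of j] sgn[of k] that JI k unfolding J_def by (auto split: if_splits)
    then have "lam ` J \<subseteq> {x\<in>lam ` I. \<bar>x\<bar> < \<bar>lam k\<bar> + 1}" using JI by auto
    then have "card (lam ` J) \<le> card {x\<in>lam ` I. \<bar>x\<bar> < \<bar>lam k\<bar> + 1}"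
      using S by (intro card_mono) (auto simp: sublinear_count_def)
    moreover have "card (lam ` J) = card J" using JI inj by (intro card_image) (auto intro: inj_on_subset)
    moreover have "real_of_int \<bar>k\<bar> \<le> real (card J)" by (auto simp: J_def)
    ultimately have "real_of_int \<bar>k\<bar> \<le> \<delta> * (\<bar>lam k\<bar> + 1) + K" using K[of "\<bar>lam k\<bar> + 1"] by simp
    then show ?thesis by (simp add: algebra_simps)
  qed
  then show ?thesis by blast
qed

lemma convergent_window_sum:
  fixes a :: "int \<Rightarrow> real"
  assumes a: "\<And>k. k \<in> I \<Longrightarrow> \<bar>a k\<bar> \<le> C / (1 + (real_of_int k)\<^sup>2)"
  shows "convergent (\<lambda>N. \<Sum>k\<in>Win I N. a k)"
proof -
  define b where "b j = (\<Sum>k\<in>{k\<in>I. \<bar>k\<bar> = int j}. a k)" for j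
  have sub: "{k\<in>I. \<bar>k\<bar> = int j} \<subseteq> {int j, - int j}" for j by auto
  have fin: "finite {k\<in>I. \<bar>k\<bar> = int j}" for j using sub by (rule finite_subset) simp
  have eq: "(\<Sum>k\<in>Win I N. a k) = (\<Sum>j<N. b j)" for N
  proof (induction N)
    case (Suc N)
    have "Win I (Suc N) = Win I N \<union> {k\<in>I. \<bar>k\<bar> = int N}" "Win I N \<inter> {k\<in>I. \<bar>k\<bar> = int N} = {}"
      by (auto simp: Win_def)
    then have "(\<Sum>k\<in>Win I (Suc N). a k) = (\<Sum>k\<in>Win I N. a k) + b N"
      unfolding b_def using fin by (simp add: sum.union_disjoint)
    then show ?case using Suc by simp
  qed (simp add: Win_def)
  have "summable b"
  proof (rule summable_comparison_test')
    show "summable (\<lambda>j. (2 * \<bar>C\<bar>) * (1 / real j ^ 2))"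
      by (intro summable_mult) (use inverse_power_summable[of 2, where 'a = real] in \<open>simp add: field_simps\<close>)
    show "norm (b j) \<le> (2 * \<bar>C\<bar>) * (1 / real j ^ 2)" if "1 \<le> j" for j
    proof -
      have "\<bar>b j\<bar> \<le> (\<Sum>k\<in>{k\<in>I. \<bar>k\<bar> = int j}. \<bar>C\<bar> / real j ^ 2)"
        unfolding b_def
      proof (rule order.trans[OF sum_abs sum_mono])
        fix k assume k: "k \<in> {k\<in>I. \<bar>k\<bar> = int j}"
        then have "(real_of_int k)\<^sup>2 = real j ^ 2" by (metis (mono_tags, lifting) mem_Collect_eq of_int_abs of_int_of_nat_eq power2_abs)
        then have "\<bar>a k\<bar> \<le> C / (1 + real j ^ 2)" using a[of k] k by simp
        also have "\<dots> \<le> \<bar>C\<bar> / real j ^ 2" using that by (intro frac_le) auto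
        finally show "\<bar>a k\<bar> \<le> \<bar>C\<bar> / real j ^ 2" .
      qed
      also have "\<dots> = real (card {k\<in>I. \<bar>k\<bar> = int j}) * (\<bar>C\<bar> / real j ^ 2)" by simp
      also have "\<dots> \<le> 2 * (\<bar>C\<bar> / real j ^ 2)"
      proof (rule mult_right_mono)
        have "card {k\<in>I. \<bar>k\<bar> = int j} \<le> card {int j, - int j}" using sub by (rule card_mono[rotated]) simp
        also have "\<dots> \<le> 2" by (simp add: card_insert_le_m1)
        finally show "real (card {k\<in>I. \<bar>k\<bar> = int j}) \<le> 2" by simp
      qed simp
      finally show ?thesis by simp
    qed
  qed
  then show ?thesis unfolding eq by (simp add: summable_iff_convergent)
qed

text \<open>Here \<open>(y - x)^2 / (1 + y^2) = 1 + u\<close> with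
  \<open>\<bar>u\<bar> \<le> c / sqrt (1 + y^2)\<close>. The hypothesis on \<open>y\<close> gives
  \<open>\<bar>u\<bar> \<le> 1 / 2\<close>, so that \<open>ln (1 + u) - u\<close> is at most
  \<open>2 * u^2\<close> in modulus. The linear part of \<open>- u\<close> is \<open>2 * x\<close>
  times a term of the balance sum.\<close>

lemma log_ratio_expansion:
  fixes x y :: real
  defines "c \<equiv> \<bar>x\<^sup>2 - 1\<bar> + 2 * \<bar>x\<bar>"
  assumes y: "4 * c\<^sup>2 \<le> 1 + y\<^sup>2"
  shows "\<bar>ln ((1 + y\<^sup>2) / (y - x)\<^sup>2) - 2 * x * (y / (1 + y\<^sup>2))\<bar> \<le> (2 * c\<^sup>2 + \<bar>x\<^sup>2 - 1\<bar>) / (1 + y\<^sup>2)"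
proof -
  have p: "0 < 1 + y\<^sup>2" by (simp add: add_pos_nonneg)
  define u where "u = (x\<^sup>2 - 1 - 2 * x * y) / (1 + y\<^sup>2)"
  have u1: "1 + u = (y - x)\<^sup>2 / (1 + y\<^sup>2)"
    using p by (simp add: u_def power2_diff divide_simps)
  define s where "s = sqrt (1 + y\<^sup>2)"
  have s: "1 \<le> s" "\<bar>y\<bar> \<le> s" "s\<^sup>2 = 1 + y\<^sup>2" "0 < s"
    using p by (auto simp: s_def real_le_rsqrt)
  have "\<bar>x\<^sup>2 - 1 - 2 * x * y\<bar> \<le> \<bar>x\<^sup>2 - 1\<bar> * s + 2 * \<bar>x\<bar> * s"
  proof -
    have "\<bar>x\<^sup>2 - 1 - 2 * x * y\<bar> \<le> \<bar>x\<^sup>2 - 1\<bar> + \<bar>2 * x * y\<bar>" by (rule abs_triangle_ineq4)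
    also have "\<bar>2 * x * y\<bar> = 2 * \<bar>x\<bar> * \<bar>y\<bar>" by (simp add: abs_mult)
    also have "\<bar>x\<^sup>2 - 1\<bar> + 2 * \<bar>x\<bar> * \<bar>y\<bar> \<le> \<bar>x\<^sup>2 - 1\<bar> * s + 2 * \<bar>x\<bar> * s"
      using s mult_left_mono[OF s(1), of "\<bar>x\<^sup>2 - 1\<bar>"] by (intro add_mono mult_left_mono) auto
    finally show ?thesis .
  qed
  then have "\<bar>u\<bar> \<le> c * s / s\<^sup>2" unfolding u_def abs_divide s(3) using p
    by (simp add: c_def distrib_right divide_right_mono)
  then have us: "\<bar>u\<bar> \<le> c / s" using s by (simp add: power2_eq_square)
  have c0: "0 \<le> c" by (simp add: c_def)
  have "\<bar>u\<bar>\<^sup>2 \<le> (c / s)\<^sup>2" using us by (intro power_mono) auto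
  then have u2: "u\<^sup>2 \<le> c\<^sup>2 / (1 + y\<^sup>2)" by (simp add: power_divide s(3))
  have "(2 * c)\<^sup>2 \<le> s\<^sup>2" using y s(3) by (simp add: power_mult_distrib)
  then have "2 * c \<le> s" by (rule power2_le_imp_le) (use s(1) in simp)
  then have "c / s \<le> 1 / 2" using s(4) by (simp add: divide_le_eq)
  then have uh: "\<bar>u\<bar> \<le> 1 / 2" using us by linarith
  have "ln ((1 + y\<^sup>2) / (y - x)\<^sup>2) = - ln (1 + u)"
  proof -
    have "(1 + y\<^sup>2) / (y - x)\<^sup>2 = inverse (1 + u)" unfolding u1 by simp
    then show ?thesis by (simp only: ln_inverse)
  qed
  then have "ln ((1 + y\<^sup>2) / (y - x)\<^sup>2) - 2 * x * (y / (1 + y\<^sup>2)) = - (ln (1 + u) - u) - (x\<^sup>2 - 1) / (1 + y\<^sup>2)"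
    by (simp add: u_def diff_divide_distrib)
  also have "\<bar>\<dots>\<bar> \<le> \<bar>ln (1 + u) - u\<bar> + \<bar>x\<^sup>2 - 1\<bar> / (1 + y\<^sup>2)"
    using abs_triangle_ineq4[of "- (ln (1 + u) - u)" "(x\<^sup>2 - 1) / (1 + y\<^sup>2)"] p by simp
  also have "\<dots> \<le> 2 * u\<^sup>2 + \<bar>x\<^sup>2 - 1\<bar> / (1 + y\<^sup>2)"
    using abs_ln_one_plus_x_minus_x_bound[OF uh] by simp
  also have "\<dots> \<le> 2 * (c\<^sup>2 / (1 + y\<^sup>2)) + \<bar>x\<^sup>2 - 1\<bar> / (1 + y\<^sup>2)" using u2 by simp
  finally show ?thesis by (simp add: add_divide_distrib)
qed

text \<open>By \<open>log_ratio_expansion\<close> the term at \<open>k\<close> is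
  \<open>2 * x\<close> times the term of the balance sum plus \<open>O(1 / (1 + k^2))\<close>, so
  the sums over windows centred at 0 converge. Those centred at \<open>n\<close>, which define
  \<open>char_seq\<close>, differ from them in boundedly many terms near \<open>- N\<close> and
  \<open>N\<close>, each \<open>O(1 / N)\<close>.\<close>

lemma char_seq_tendsto:
  assumes D: "discrete_seq I lam" and S: "sublinear_count (lam ` I)" and bal: "balanced I lam" and n: "n \<in> I"
  shows "(\<lambda>N. 1/2 * (ln (1 + (lam n)\<^sup>2) + (\<Sum>k\<in>Win I N - {n}. ln ((1 + (lam k)\<^sup>2) / (lam k - lam n)\<^sup>2))))
    \<longlonglongrightarrow> char_seq I lam n"
proof -
  define x where "x = lam n"
  define t where "t k = ln ((1 + (lam k)\<^sup>2) / (lam k - x)\<^sup>2)" for k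
  define \<tau> where "\<tau> k = lam k / (1 + (lam k)\<^sup>2)" for k
  define a where "a k = (if k = n then 0 else t k - 2 * x * \<tau> k)" for k
  have p: "0 < 1 + y\<^sup>2" for y :: real by (simp add: add_pos_nonneg)
  obtain K where K: "\<And>k. k \<in> I \<Longrightarrow> real_of_int \<bar>k\<bar> \<le> 1 * \<bar>lam k\<bar> + K"
    using index_le_modulus[OF D S, of 1] by auto
  define K1 where "K1 = \<bar>K\<bar>"
  have K1: "real_of_int \<bar>k\<bar> \<le> \<bar>lam k\<bar> + K1" "0 \<le> K1" if "k \<in> I" for k using K[OF that] by (auto simp: K1_def)
  have lam2: "1 + (real_of_int k)\<^sup>2 \<le> (2 + 2 * K1\<^sup>2) * (1 + (lam k)\<^sup>2)" if k: "k \<in> I" for k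
  proof -
    have "(real_of_int k)\<^sup>2 = (real_of_int \<bar>k\<bar>)\<^sup>2" by simp
    also have "\<dots> \<le> (\<bar>lam k\<bar> + K1)\<^sup>2" using K1[OF k] by (intro power_mono) auto
    also have "\<dots> \<le> 2 * (lam k)\<^sup>2 + 2 * K1\<^sup>2"
      using zero_le_power2[of "\<bar>lam k\<bar> - K1"] by (simp add: power2_sum power2_diff)
    finally have "(real_of_int k)\<^sup>2 \<le> 2 * (lam k)\<^sup>2 + 2 * K1\<^sup>2" .
    moreover have "(2 + 2 * K1\<^sup>2) * (1 + (lam k)\<^sup>2) = 2 + 2 * (lam k)\<^sup>2 + 2 * K1\<^sup>2 + 2 * (K1\<^sup>2 * (lam k)\<^sup>2)"
      by (simp add: algebra_simps)
    moreover have "0 \<le> K1\<^sup>2 * (lam k)\<^sup>2" by simp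
    ultimately show ?thesis by linarith
  qed
  have "\<exists>C. \<forall>k\<in>I. \<bar>a k\<bar> \<le> C / (1 + (real_of_int k)\<^sup>2)"
  proof -
    define c where "c = \<bar>x\<^sup>2 - 1\<bar> + 2 * \<bar>x\<bar>"
    define F where "F = {k\<in>I. 1 + (lam k)\<^sup>2 < 4 * c\<^sup>2}"
    have "F \<subseteq> Win I (nat \<lceil>2 * c + K1\<rceil> + 1)"
    proof
      fix k assume k: "k \<in> F"
      have "\<bar>lam k\<bar>\<^sup>2 \<le> (2 * c)\<^sup>2" using k by (simp add: F_def power_mult_distrib)
      then have "\<bar>lam k\<bar> \<le> 2 * c" by (rule power2_le_imp_le) (simp add: c_def)
      then have "real_of_int \<bar>k\<bar> \<le> 2 * c + K1" using K1[of k] k by (simp add: F_def)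
      then show "k \<in> Win I (nat \<lceil>2 * c + K1\<rceil> + 1)" using k by (simp add: Win_def F_def) linarith
    qed
    then have "finite F" by (rule finite_subset) simp
    define C1 where "C1 = (\<Sum>k\<in>F. \<bar>a k\<bar> * (1 + (real_of_int k)\<^sup>2))"
    define C2 where "C2 = (2 * c\<^sup>2 + \<bar>x\<^sup>2 - 1\<bar>) * (2 + 2 * K1\<^sup>2)"
    have C: "0 \<le> C1" "0 \<le> C2" unfolding C1_def C2_def by (auto intro!: sum_nonneg)
    have "\<bar>a k\<bar> \<le> (C1 + C2) / (1 + (real_of_int k)\<^sup>2)" if k: "k \<in> I" for k
    proof (cases "k \<in> F")
      case True
      have "\<bar>a k\<bar> * (1 + (real_of_int k)\<^sup>2) \<le> C1" unfolding C1_def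
        by (rule member_le_sum[OF True, of "\<lambda>k. \<bar>a k\<bar> * (1 + (real_of_int k)\<^sup>2)"]) (use \<open>finite F\<close> in auto)
      then show ?thesis using C p[of "real_of_int k"] by (simp add: le_divide_eq)
    next
      case False
      show ?thesis
      proof (cases "k = n")
        case True
        then show ?thesis using C p[of "real_of_int k"] by (simp add: a_def)
      next
        case neq: False
        have "4 * c\<^sup>2 \<le> 1 + (lam k)\<^sup>2" using False k by (simp add: F_def)
        then have "\<bar>a k\<bar> \<le> (2 * c\<^sup>2 + \<bar>x\<^sup>2 - 1\<bar>) / (1 + (lam k)\<^sup>2)"
          using log_ratio_expansion[of x "lam k"] neq by (simp add: a_def t_def \<tau>_def c_def)
        also have "\<dots> \<le> C2 / (1 + (real_of_int k)\<^sup>2)"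
        proof -
          have "(2 * c\<^sup>2 + \<bar>x\<^sup>2 - 1\<bar>) * (1 + (real_of_int k)\<^sup>2) \<le> C2 * (1 + (lam k)\<^sup>2)"
            unfolding C2_def mult.assoc using lam2[OF k] by (intro mult_left_mono) auto
          then show ?thesis using p[of "lam k"] p[of "real_of_int k"] by (simp add: frac_le_eq divide_le_eq le_divide_eq mult_ac)
        qed
        also have "\<dots> \<le> (C1 + C2) / (1 + (real_of_int k)\<^sup>2)" using C p[of "real_of_int k"] by (intro divide_right_mono) auto
        finally show ?thesis .
      qed
    qed
    then show ?thesis by blast
  qed
  then obtain C where C: "\<And>k. k \<in> I \<Longrightarrow> \<bar>a k\<bar> \<le> C / (1 + (real_of_int k)\<^sup>2)" by blast
  have C0: "0 \<le> C" using order.trans[OF abs_ge_zero C[OF n]] p[of "real_of_int n"] by (simp add: zero_le_divide_iff)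
  obtain A where A: "(\<lambda>N. \<Sum>k\<in>Win I N. a k) \<longlonglongrightarrow> A"
    using convergent_window_sum[OF C] by (auto simp: convergent_def)
  obtain B where B: "(\<lambda>N. \<Sum>k\<in>Win I N. \<tau> k) \<longlonglongrightarrow> B"
    using bal unfolding balanced_def Win_def[symmetric] \<tau>_def by (auto simp: convergent_def)
  define L where "L = A + 2 * x * (B - \<tau> n)"
  have ev: "eventually (\<lambda>N. n \<in> Win I N) sequentially"
    by (rule eventually_sequentiallyI[of "nat \<bar>n\<bar> + 1"]) (use n in \<open>auto simp: Win_def\<close>)
  have W: "(\<lambda>N. \<Sum>k\<in>Win I N - {n}. t k) \<longlonglongrightarrow> L"
  proof (rule Lim_transform_eventually)
    show "(\<lambda>N. (\<Sum>k\<in>Win I N. a k) + 2 * x * ((\<Sum>k\<in>Win I N. \<tau> k) - \<tau> n)) \<longlonglongrightarrow> L"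
      unfolding L_def by (intro tendsto_intros A B)
    show "eventually (\<lambda>N. (\<Sum>k\<in>Win I N. a k) + 2 * x * ((\<Sum>k\<in>Win I N. \<tau> k) - \<tau> n) = (\<Sum>k\<in>Win I N - {n}. t k)) sequentially"
      using ev
    proof eventually_elim
      case (elim N)
      have "(\<Sum>k\<in>Win I N - {n}. t k) = (\<Sum>k\<in>Win I N - {n}. a k + 2 * x * \<tau> k)"
        by (rule sum.cong) (auto simp: a_def)
      also have "\<dots> = (\<Sum>k\<in>Win I N - {n}. a k) + 2 * x * (\<Sum>k\<in>Win I N - {n}. \<tau> k)"
        by (simp add: sum.distrib sum_distrib_left)
      moreover have "sum a (Win I N) = a n + sum a (Win I N - {n})" "sum \<tau> (Win I N) = \<tau> n + sum \<tau> (Win I N - {n})"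
        by (simp_all only: sum.remove[OF finite_Win elim])
      moreover have "a n = 0" by (simp add: a_def)
      ultimately show ?case by simp
    qed
  qed
  define V where "V N = {k\<in>I. 0 < \<bar>n - k\<bar> \<and> \<bar>n - k\<bar> < int N}" for N :: nat
  have finV: "finite (V N)" for N
    by (rule finite_subset[of _ "{n - int N..n + int N}"]) (auto simp: V_def)
  obtain C' where C': "0 \<le> C'" "\<And>k. k \<in> I \<Longrightarrow> k \<noteq> n \<Longrightarrow> \<bar>t k\<bar> \<le> C' / (1 + real_of_int \<bar>k\<bar>)"
  proof
    show "0 \<le> 2 * C + 4 * \<bar>x\<bar> * (1 + K1)" using C0 by (simp add: K1_def)
    fix k assume k: "k \<in> I" "k \<noteq> n"
    define j where "j = real_of_int \<bar>k\<bar>"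
    have j: "0 \<le> j" "j \<le> \<bar>lam k\<bar> + K1" "(real_of_int k)\<^sup>2 = j\<^sup>2" using K1[OF k(1)] by (auto simp: j_def)
    have half: "2 * y \<le> 1 + y\<^sup>2" for y :: real using zero_le_power2[of "y - 1"] by (simp add: power2_diff)
    have "1 + j \<le> 2 * (1 + j\<^sup>2)" using half[of j] zero_le_power2[of j] unfolding distrib_left by linarith
    then have "C * (1 + j) \<le> C * (2 * (1 + j\<^sup>2))" using C0 by (rule mult_left_mono)
    then have 1: "C / (1 + j\<^sup>2) \<le> 2 * C / (1 + j)" using p[of j] j(1) by (simp add: divide_le_eq le_divide_eq mult_ac)
    have "(1 + j) * \<bar>lam k\<bar> \<le> ((1 + K1) * (1 + \<bar>lam k\<bar>)) * \<bar>lam k\<bar>"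
    proof (rule mult_right_mono)
      have "0 \<le> K1 * \<bar>lam k\<bar>" using K1(2)[OF k(1)] by simp
      moreover have "(1 + K1) * (1 + \<bar>lam k\<bar>) = 1 + K1 + \<bar>lam k\<bar> + K1 * \<bar>lam k\<bar>" by (simp add: algebra_simps)
      ultimately show "1 + j \<le> (1 + K1) * (1 + \<bar>lam k\<bar>)" using j(2) by linarith
    qed simp
    also have "\<dots> = (1 + K1) * ((1 + \<bar>lam k\<bar>) * \<bar>lam k\<bar>)" by simp
    also have "\<dots> \<le> (1 + K1) * (2 * (1 + (lam k)\<^sup>2))"
    proof (rule mult_left_mono)
      have "\<bar>lam k\<bar> * \<bar>lam k\<bar> = (lam k)\<^sup>2" by (simp add: power2_eq_square)
      then show "(1 + \<bar>lam k\<bar>) * \<bar>lam k\<bar> \<le> 2 * (1 + (lam k)\<^sup>2)"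
        using half[of "\<bar>lam k\<bar>"] zero_le_power2[of "lam k"] unfolding power2_abs distrib_left distrib_right by linarith
    qed (use K1(2)[OF k(1)] in simp)
    also have "\<dots> = 2 * (1 + K1) * (1 + (lam k)\<^sup>2)" by (simp only: mult_ac)
    finally have "\<bar>lam k\<bar> * (1 + j) \<le> 2 * (1 + K1) * (1 + (lam k)\<^sup>2)" by (simp only: mult.commute)
    moreover have "0 < 1 + j" using j(1) by simp
    ultimately have "\<bar>lam k\<bar> / (1 + (lam k)\<^sup>2) \<le> 2 * (1 + K1) / (1 + j)"
      using p[of "lam k"] by (simp only: pos_divide_le_eq times_divide_eq_left pos_le_divide_eq)
    then have "\<bar>\<tau> k\<bar> \<le> 2 * (1 + K1) / (1 + j)"
      using p[of "lam k"] by (simp add: \<tau>_def abs_divide)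
    then have "2 * \<bar>x\<bar> * \<bar>\<tau> k\<bar> \<le> 2 * \<bar>x\<bar> * (2 * (1 + K1) / (1 + j))" by (intro mult_left_mono) auto
    moreover have "\<bar>t k\<bar> \<le> \<bar>a k\<bar> + 2 * \<bar>x\<bar> * \<bar>\<tau> k\<bar>"
    proof -
      have "t k = a k + 2 * x * \<tau> k" using k by (simp add: a_def)
      then show ?thesis using abs_triangle_ineq[of "a k" "2 * x * \<tau> k"] by (simp add: abs_mult)
    qed
    moreover have "\<bar>a k\<bar> \<le> 2 * C / (1 + j)" using C[OF k(1)] 1 j(3) by simp
    ultimately have "\<bar>t k\<bar> \<le> 2 * C / (1 + j) + 2 * \<bar>x\<bar> * (2 * (1 + K1) / (1 + j))" by linarith
    also have "\<dots> = (2 * C + 4 * \<bar>x\<bar> * (1 + K1)) / (1 + j)"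
      unfolding times_divide_eq_right add_divide_distrib[symmetric] by (simp add: mult_ac)
    finally show "\<bar>t k\<bar> \<le> (2 * C + 4 * \<bar>x\<bar> * (1 + K1)) / (1 + real_of_int \<bar>k\<bar>)"
      unfolding j_def .
  qed
  have diff: "(\<lambda>N. (\<Sum>k\<in>V N. t k) - (\<Sum>k\<in>Win I N - {n}. t k)) \<longlonglongrightarrow> 0"
  proof (rule Lim_null_comparison)
    define q where "q = nat \<bar>n\<bar>"
    show "(\<lambda>N. (4 * real q + 2) * (C' / (1 + (real N - real q)))) \<longlonglongrightarrow> 0" by real_asymp
    show "eventually (\<lambda>N. norm ((\<Sum>k\<in>V N. t k) - (\<Sum>k\<in>Win I N - {n}. t k)) \<le> (4 * real q + 2) * (C' / (1 + (real N - real q)))) sequentially"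
    proof (rule eventually_sequentiallyI[of q])
      fix N assume N: "q \<le> N"
      define W' where "W' = Win I N - {n}"
      define D where "D = (V N - W') \<union> (W' - V N)"
      \<comment> \<open>The two windows differ only at indices within distance
        \<open>q = \<bar>n\<bar>\<close> of \<open>- N\<close> or \<open>N\<close>, hence in at most
        \<open>4 * q + 2\<close> places.\<close>
      define G where "G = {- int N - int q..- int N + int q} \<union> {int N - int q..int N + int q}"
      have DG: "D \<subseteq> G" by (auto simp: D_def V_def W'_def Win_def G_def q_def)
      have finD: "finite D" using finV by (auto simp: D_def W'_def)
      have "(\<Sum>k\<in>V N. t k) - (\<Sum>k\<in>W'. t k) = (\<Sum>k\<in>V N - W'. t k) - (\<Sum>k\<in>W' - V N. t k)"
        using sum.Int_Diff[of "V N" t W'] sum.Int_Diff[of W' t "V N"] finV by (simp add: W'_def Int_commute)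
      also have "\<bar>\<dots>\<bar> \<le> (\<Sum>k\<in>V N - W'. \<bar>t k\<bar>) + (\<Sum>k\<in>W' - V N. \<bar>t k\<bar>)"
        by (rule order.trans[OF abs_triangle_ineq4 add_mono[OF sum_abs sum_abs]])
      also have "\<dots> = (\<Sum>k\<in>D. \<bar>t k\<bar>)" unfolding D_def
        by (rule sum.union_disjoint[symmetric]) (use finV in \<open>auto simp: W'_def\<close>)
      also have "\<dots> \<le> (\<Sum>k\<in>D. C' / (1 + (real N - real q)))"
      proof (rule sum_mono)
        fix k assume k: "k \<in> D"
        then have kI: "k \<in> I" "k \<noteq> n" by (auto simp: D_def V_def W'_def Win_def)
        have "int N - int q \<le> \<bar>k\<bar>" using DG k N by (auto simp: G_def)
        then have "real N - real q \<le> real_of_int \<bar>k\<bar>" by linarith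
        then have "C' / (1 + real_of_int \<bar>k\<bar>) \<le> C' / (1 + (real N - real q))"
          using C'(1) N by (intro divide_left_mono mult_pos_pos) auto
        then show "\<bar>t k\<bar> \<le> C' / (1 + (real N - real q))" using C'(2)[OF kI] by linarith
      qed
      also have "\<dots> = real (card D) * (C' / (1 + (real N - real q)))" by simp
      also have "\<dots> \<le> (4 * real q + 2) * (C' / (1 + (real N - real q)))"
      proof (rule mult_right_mono)
        have "card D \<le> card G" using DG by (rule card_mono[rotated]) (simp add: G_def)
        also have "\<dots> \<le> card {- int N - int q..- int N + int q} + card {int N - int q..int N + int q}"
          unfolding G_def by (rule card_Un_le)
        also have "\<dots> = 4 * q + 2" by simp
        finally show "real (card D) \<le> 4 * real q + 2" by linarith
      qed (use C'(1) N in auto)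
      finally show "norm ((\<Sum>k\<in>V N. t k) - (\<Sum>k\<in>Win I N - {n}. t k)) \<le> (4 * real q + 2) * (C' / (1 + (real N - real q)))"
        by (simp add: W'_def)
    qed
  qed
  have "(\<lambda>N. \<Sum>k\<in>V N. t k) \<longlonglongrightarrow> L" using tendsto_add[OF diff W] by simp
  then have "lim (\<lambda>N. \<Sum>k\<in>V N. t k) = L" by (rule limI)
  then have eq: "char_seq I lam n = 1/2 * (ln (1 + x\<^sup>2) + L)"
    by (simp add: char_seq_def V_def t_def x_def)
  have "(\<lambda>N. 1/2 * (ln (1 + x\<^sup>2) + (\<Sum>k\<in>Win I N - {n}. t k))) \<longlonglongrightarrow> char_seq I lam n"
    unfolding eq by (intro tendsto_intros W)
  then show ?thesis unfolding t_def x_def .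
qed

section \<open>A summable characteristic sequence prevents density\<close>

text \<open>Remove the element with the largest \<open>f\<close> as long as its reciprocal fits into
  what is left of the budget \<open>s\<close>. When this stops, the reciprocals of all remaining
  elements exceed the rest of the budget, because the largest \<open>f\<close> has the smallest
  reciprocal.\<close>

lemma greedy_removal:
  fixes f :: "'a \<Rightarrow> real"
  assumes "finite A" "\<And>a. a \<in> A \<Longrightarrow> 0 < f a" "0 \<le> s"
  shows "\<exists>R\<subseteq>A. (\<Sum>r\<in>R. 1 / f r) \<le> s \<and> (\<forall>a\<in>A - R. (s - (\<Sum>r\<in>R. 1 / f r)) * f a \<le> 1) \<and> (\<forall>a\<in>A - R. \<forall>r\<in>R. f a \<le> f r)"
  using assms
proof (induction "card A" arbitrary: A s)
  case 0
  then show ?case by (intro exI[of _ "{}"]) auto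
next
  case (Suc n)
  then have ne: "A \<noteq> {}" by auto
  have "Max (f ` A) \<in> f ` A" using Suc.prems(1) ne by (intro Max_in) auto
  then obtain m where m: "m \<in> A" "f m = Max (f ` A)" by auto
  have mm: "f a \<le> f m" if "a \<in> A" for a unfolding m(2) using Suc.prems(1) that by auto
  show ?case
  proof (cases "1 / f m \<le> s")
    case True
    have "n = card (A - {m})" using Suc(2) m(1) Suc.prems(1) by simp
    then obtain R where R: "R \<subseteq> A - {m}" "(\<Sum>r\<in>R. 1 / f r) \<le> s - 1 / f m"
      "\<forall>a\<in>A - {m} - R. (s - 1 / f m - (\<Sum>r\<in>R. 1 / f r)) * f a \<le> 1" "\<forall>a\<in>A - {m} - R. \<forall>r\<in>R. f a \<le> f r"
      using Suc.hyps(1)[of "A - {m}" "s - 1 / f m"] Suc.prems True by auto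
    have fR: "finite R" "m \<notin> R" using R(1) Suc.prems(1) by (auto intro: finite_subset)
    have sum: "(\<Sum>r\<in>insert m R. 1 / f r) = 1 / f m + (\<Sum>r\<in>R. 1 / f r)" using fR by simp
    show ?thesis
    proof (intro exI[of _ "insert m R"] conjI)
      show "insert m R \<subseteq> A" using R(1) m(1) by auto
      show "(\<Sum>r\<in>insert m R. 1 / f r) \<le> s" unfolding sum using R(2) by linarith
      show "\<forall>a\<in>A - insert m R. (s - (\<Sum>r\<in>insert m R. 1 / f r)) * f a \<le> 1"
        unfolding sum using R(3) by (simp add: diff_diff_eq)
      show "\<forall>a\<in>A - insert m R. \<forall>r\<in>insert m R. f a \<le> f r" using R(4) mm by auto
    qed
  next
    case False
    have "s * f a \<le> 1" if a: "a \<in> A" for a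
    proof -
      have "s * f a \<le> (1 / f m) * f m" using False mm[OF a] Suc.prems(2)[OF a] Suc.prems(2)[OF m(1)] Suc.prems(3)
        by (intro mult_mono) auto
      then show ?thesis using Suc.prems(2)[OF m(1)] by simp
    qed
    then show ?thesis using Suc.prems(3) by (intro exI[of _ "{}"]) auto
  qed
qed

text \<open>This is \<open>ln (1 - u) \<le> - u\<close> for \<open>u = x / y\<close>, after dropping
  the 1 in \<open>1 + y^2\<close>. Being one-sided, it needs no smallness of \<open>u\<close> and is
  uniform over all nodes \<open>x\<close>.\<close>

lemma ln_ratio_lower:
  fixes x y :: real
  assumes y: "y \<noteq> 0" and xy: "x / y < 1"
  shows "2 * x / y \<le> ln ((1 + y\<^sup>2) / (y - x)\<^sup>2)"
proof -
  have y2: "0 < y\<^sup>2" using y by simp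
  have e: "(y - x)\<^sup>2 = y\<^sup>2 * (1 - x / y)\<^sup>2" using y by (simp add: power2_eq_square field_simps)
  have q: "0 < (1 - x / y)\<^sup>2" unfolding zero_less_power2 using xy by linarith
  have "1 / (1 - x / y)\<^sup>2 \<le> (1 + y\<^sup>2) / (y - x)\<^sup>2"
    unfolding e using y2 q by (simp add: divide_simps)
  then have "ln (1 / (1 - x / y)\<^sup>2) \<le> ln ((1 + y\<^sup>2) / (y - x)\<^sup>2)" using q by (intro ln_mono) auto
  moreover have "ln (1 / (1 - x / y)\<^sup>2) = - (2 * ln (1 - x / y))" using xy by (simp add: ln_div ln_realpow)
  moreover have "ln (1 - x / y) \<le> (1 - x / y) - 1" using xy by (intro ln_le_minus_one) simp
  ultimately show ?thesis by simp
qed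

lemma ln_ratio_upper:
  fixes x y :: real
  assumes y: "2 * \<bar>x\<bar> + 1 \<le> \<bar>y\<bar>"
  shows "ln ((1 + y\<^sup>2) / (y - x)\<^sup>2) \<le> 4 * (1 + 2 * \<bar>x\<bar>) * (1 / \<bar>y\<bar>)"
proof -
  have y1: "1 \<le> \<bar>y\<bar>" using y by linarith
  have "\<bar>y\<bar> / 2 \<le> \<bar>y - x\<bar>" using y by linarith
  then have "(\<bar>y\<bar> / 2)\<^sup>2 \<le> \<bar>y - x\<bar>\<^sup>2" using y1 by (intro power_mono) auto
  then have q: "\<bar>y\<bar> * \<bar>y\<bar> / 4 \<le> (y - x)\<^sup>2" by (simp add: power_divide power2_eq_square)
  have y2: "0 < \<bar>y\<bar> * \<bar>y\<bar> / 4" by (intro divide_pos_pos mult_pos_pos) (use y1 in linarith)+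
  have qp: "0 < (y - x)\<^sup>2" using q y2 by linarith
  have "(1 + y\<^sup>2) / (y - x)\<^sup>2 = 1 + (1 - x\<^sup>2 + 2 * x * y) / (y - x)\<^sup>2"
    using qp by (simp add: divide_simps) (simp add: power2_eq_square algebra_simps)
  also have "ln \<dots> \<le> (1 - x\<^sup>2 + 2 * x * y) / (y - x)\<^sup>2"
  proof (rule ln_add_one_self_le_self2)
    have "0 < (1 + y\<^sup>2) / (y - x)\<^sup>2" using qp by (intro divide_pos_pos) (auto simp: add_pos_nonneg)
    also have "\<dots> = 1 + (1 - x\<^sup>2 + 2 * x * y) / (y - x)\<^sup>2"
      using qp by (simp add: divide_simps) (simp add: power2_eq_square algebra_simps)
    finally show "- 1 < (1 - x\<^sup>2 + 2 * x * y) / (y - x)\<^sup>2" by linarith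
  qed
  also have "\<dots> \<le> ((1 + 2 * \<bar>x\<bar>) * \<bar>y\<bar>) / (\<bar>y\<bar> * \<bar>y\<bar> / 4)"
  proof (rule frac_le)
    have "2 * x * y \<le> 2 * \<bar>x\<bar> * \<bar>y\<bar>" using abs_ge_self[of "2 * x * y"] by (simp add: abs_mult)
    moreover have "1 - x\<^sup>2 \<le> 1 * \<bar>y\<bar>" using y1 zero_le_power2[of x] by linarith
    ultimately show "1 - x\<^sup>2 + 2 * x * y \<le> (1 + 2 * \<bar>x\<bar>) * \<bar>y\<bar>" unfolding distrib_right by linarith
  qed (use y1 y2 q in auto)
  also have "\<dots> = 4 * (1 + 2 * \<bar>x\<bar>) * (1 / \<bar>y\<bar>)"
  proof -
    have e: "((1 + 2 * \<bar>x\<bar>) * a) / (a * a / 4) = 4 * (1 + 2 * \<bar>x\<bar>) * (1 / a)" if "0 < a" for a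
      using that by (simp add: field_simps)
    show ?thesis by (rule e) (use y1 in linarith)
  qed
  finally show ?thesis .
qed

text \<open>The truncation of \<open>char_seq\<close> to the index set \<open>T\<close>; by
  \<open>exp_log_weight\<close> its exponential is the modulus of the coefficient of the node in the
  divided difference over \<open>T\<close>, times the product of all
  \<open>sqrt (1 + y^2)\<close>.\<close>

definition log_weight :: "(int \<Rightarrow> real) \<Rightarrow> int set \<Rightarrow> int \<Rightarrow> real" where
  "log_weight lam T n = 1/2 * (ln (1 + (lam n)\<^sup>2) + (\<Sum>k\<in>T - {n}. ln ((1 + (lam k)\<^sup>2) / (lam k - lam n)\<^sup>2)))"

lemma exp_log_weight:
  assumes T: "finite T" "n \<in> T" and inj: "inj_on lam T"
  shows "exp (log_weight lam T n) * \<bar>nodal_deriv (lam ` T) (lam n)\<bar> = (\<Prod>k\<in>T. sqrt (1 + (lam k)\<^sup>2))"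
proof -
  have p: "0 < 1 + y\<^sup>2" for y :: real by (simp add: add_pos_nonneg)
  have ne: "lam k - lam n \<noteq> 0" if "k \<in> T - {n}" for k using inj T(2) that by (auto simp: inj_on_def)
  have half: "exp (1/2 * ln a) = sqrt a" if "0 < a" for a :: real
    using that by (simp add: ln_sqrt[symmetric])
  have "exp (log_weight lam T n) = sqrt (1 + (lam n)\<^sup>2) * (\<Prod>k\<in>T - {n}. sqrt (1 + (lam k)\<^sup>2) / \<bar>lam k - lam n\<bar>)"
  proof -
    have "exp (log_weight lam T n) = exp (1/2 * ln (1 + (lam n)\<^sup>2)) * (\<Prod>k\<in>T - {n}. exp (1/2 * ln ((1 + (lam k)\<^sup>2) / (lam k - lam n)\<^sup>2)))"
      using T(1) unfolding log_weight_def distrib_left exp_add sum_distrib_left by (simp add: exp_sum)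
    also have "(\<Prod>k\<in>T - {n}. exp (1/2 * ln ((1 + (lam k)\<^sup>2) / (lam k - lam n)\<^sup>2))) = (\<Prod>k\<in>T - {n}. sqrt (1 + (lam k)\<^sup>2) / \<bar>lam k - lam n\<bar>)"
    proof (rule prod.cong[OF refl])
      fix k assume k: "k \<in> T - {n}"
      have "0 < (1 + (lam k)\<^sup>2) / (lam k - lam n)\<^sup>2" using p ne[OF k] by (intro divide_pos_pos) auto
      then show "exp (1/2 * ln ((1 + (lam k)\<^sup>2) / (lam k - lam n)\<^sup>2)) = sqrt (1 + (lam k)\<^sup>2) / \<bar>lam k - lam n\<bar>"
        by (simp only: half real_sqrt_divide real_sqrt_abs)
    qed
    finally show ?thesis using half[OF p] by simp
  qed
  moreover have "\<bar>nodal_deriv (lam ` T) (lam n)\<bar> = (\<Prod>k\<in>T - {n}. \<bar>lam k - lam n\<bar>)"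
  proof -
    have "lam ` T - {lam n} = lam ` (T - {n})" using inj T(2) by (auto simp: inj_on_def)
    moreover have "inj_on lam (T - {n})" using inj by (rule inj_on_subset) auto
    ultimately show ?thesis unfolding nodal_deriv_def by (simp add: prod.reindex abs_prod abs_minus_commute)
  qed
  moreover have "(\<Prod>k\<in>T - {n}. sqrt (1 + (lam k)\<^sup>2) / \<bar>lam k - lam n\<bar>) * (\<Prod>k\<in>T - {n}. \<bar>lam k - lam n\<bar>)
      = (\<Prod>k\<in>T - {n}. sqrt (1 + (lam k)\<^sup>2))"
    unfolding prod.distrib[symmetric] by (rule prod.cong) (use ne in auto)
  ultimately show ?thesis using T by (simp add: prod.remove[of T n] mult.assoc)
qed

text \<open>The truncations are chosen so that the tail of \<open>\<Sum> 1 / lam k\<close> has the right sign or is tiny;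
  then \<open>ln (1 - u) \<le> - u\<close> bounds the omitted factors uniformly.\<close>
lemma good_truncations:
  assumes D: "discrete_seq I lam" and S: "sublinear_count (lam ` I)" and bal: "balanced I lam" and n0: "n0 \<in> I"
  shows "\<exists>c. \<forall>F. finite F \<longrightarrow> F \<subseteq> I \<longrightarrow> (\<exists>T. finite T \<and> T \<subseteq> I \<and> F \<subseteq> T \<and>
     (\<forall>n\<in>T. log_weight lam T n \<le> char_seq I lam n + 1) \<and> c \<le> log_weight lam T n0)"
proof -
  have mono: "strict_mono_on I lam" using D by (simp add: discrete_seq_def)
  have inj: "inj_on lam I" using mono by (rule strict_mono_on_imp_inj_on)
  have lt: "lam i < lam j" if "i \<in> I" "j \<in> I" "i < j" for i j using strict_mono_onD[OF mono that] .
  obtain K where K: "\<And>k. k \<in> I \<Longrightarrow> real_of_int \<bar>k\<bar> \<le> 1 * \<bar>lam k\<bar> + K"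
    using index_le_modulus[OF D S, of 1] by auto
  define K1 where "K1 = \<bar>K\<bar>"
  have K1: "real_of_int \<bar>k\<bar> \<le> \<bar>lam k\<bar> + K1" "0 \<le> K1" if "k \<in> I" for k using K[OF that] by (auto simp: K1_def)
  have p: "0 < 1 + y\<^sup>2" for y :: real by (simp add: add_pos_nonneg)
  define \<tau> where "\<tau> k = lam k / (1 + (lam k)\<^sup>2)" for k
  \<comment> \<open>\<open>1 / lam k\<close> is the term that \<open>ln_ratio_lower\<close>
    produces. It differs from \<open>\<tau> k\<close> by \<open>O(1 / (1 + k^2))\<close>, so its
    window sums converge as well; the default near 0 avoids small denominators.\<close>
  define r where "r k = (if 1 \<le> \<bar>lam k\<bar> then 1 / lam k else \<tau> k)" for k
  have "\<bar>r k - \<tau> k\<bar> \<le> (2 + 2 * K1\<^sup>2) / (1 + (real_of_int k)\<^sup>2)" if k: "k \<in> I" for k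
  proof -
    have "(real_of_int k)\<^sup>2 = (real_of_int \<bar>k\<bar>)\<^sup>2" by simp
    also have "\<dots> \<le> (\<bar>lam k\<bar> + K1)\<^sup>2" using K1[OF k] by (intro power_mono) auto
    also have "\<dots> \<le> 2 * (lam k)\<^sup>2 + 2 * K1\<^sup>2"
      using zero_le_power2[of "\<bar>lam k\<bar> - K1"] by (simp add: power2_sum power2_diff)
    finally have "(real_of_int k)\<^sup>2 \<le> 2 * (lam k)\<^sup>2 + 2 * K1\<^sup>2" .
    moreover have "(2 + 2 * K1\<^sup>2) * (1 + (lam k)\<^sup>2) = 2 + 2 * (lam k)\<^sup>2 + 2 * K1\<^sup>2 + 2 * (K1\<^sup>2 * (lam k)\<^sup>2)"
      by (simp add: algebra_simps)
    moreover have "0 \<le> K1\<^sup>2 * (lam k)\<^sup>2" by simp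
    ultimately have lam2: "1 + (real_of_int k)\<^sup>2 \<le> (2 + 2 * K1\<^sup>2) * (1 + (lam k)\<^sup>2)" by linarith
    have "\<bar>r k - \<tau> k\<bar> \<le> 1 / (1 + (lam k)\<^sup>2)"
    proof (cases "1 \<le> \<bar>lam k\<bar>")
      case True
      then have l0: "lam k \<noteq> 0" by auto
      have "1 / lam k - \<tau> k = 1 / (lam k * (1 + (lam k)\<^sup>2))"
        unfolding \<tau>_def using l0 less_imp_neq[OF p[of "lam k"]] by (simp add: divide_simps) (simp add: power2_eq_square)
      then have "\<bar>r k - \<tau> k\<bar> = 1 / (\<bar>lam k\<bar> * (1 + (lam k)\<^sup>2))" using True p[of "lam k"] by (simp add: r_def abs_mult)
      also have "\<dots> \<le> 1 / (1 * (1 + (lam k)\<^sup>2))" using True p[of "lam k"] by (intro divide_left_mono mult_right_mono mult_pos_pos) auto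
      finally show ?thesis by simp
    qed (use p[of "lam k"] in \<open>simp add: r_def\<close>)
    also have "\<dots> \<le> (2 + 2 * K1\<^sup>2) / (1 + (real_of_int k)\<^sup>2)"
      using lam2 p[of "lam k"] p[of "real_of_int k"] by (simp add: divide_le_eq le_divide_eq mult_ac)
    finally show ?thesis .
  qed
  then have "convergent (\<lambda>N. \<Sum>k\<in>Win I N. r k - \<tau> k)" by (rule convergent_window_sum)
  moreover have "convergent (\<lambda>N. \<Sum>k\<in>Win I N. \<tau> k)"
    using bal unfolding balanced_def Win_def[symmetric] \<tau>_def .
  ultimately have "convergent (\<lambda>N. (\<Sum>k\<in>Win I N. r k - \<tau> k) + (\<Sum>k\<in>Win I N. \<tau> k))" by (rule convergent_add)
  then have "convergent (\<lambda>N. \<Sum>k\<in>Win I N. r k)" by (simp add: sum.distrib[symmetric])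
  then obtain B where B: "(\<lambda>N. \<Sum>k\<in>Win I N. r k) \<longlonglongrightarrow> B" by (auto simp: convergent_def)
  define s where "s N = B - (\<Sum>k\<in>Win I N. r k)" for N
  have s0: "s \<longlonglongrightarrow> 0" unfolding s_def using tendsto_diff[OF tendsto_const B, of B] by simp
  define x0 where "x0 = lam n0"
  have lw: "(\<lambda>N. log_weight lam (Win I N) n) \<longlonglongrightarrow> char_seq I lam n" if "n \<in> I" for n
    unfolding log_weight_def by (rule char_seq_tendsto[OF D S bal that])
  \<comment> \<open>The 1 covers the approximation of \<open>char_seq\<close> by a window; the last
    term is half of what the removed elements can contribute to the logarithms at \<open>n0\<close>,
    as their reciprocals sum to at most 1.\<close>
  define c where "c = char_seq I lam n0 - 1 - 2 * (1 + 2 * \<bar>x0\<bar>)"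
  have "\<exists>T. finite T \<and> T \<subseteq> I \<and> F \<subseteq> T \<and> (\<forall>n\<in>T. log_weight lam T n \<le> char_seq I lam n + 1) \<and> c \<le> log_weight lam T n0"
    if F0: "finite F0" "F0 \<subseteq> I" and "F \<subseteq> F0" "n0 \<in> F0" and small: "{k\<in>I. \<bar>lam k\<bar> < 1} \<subseteq> F0" for F F0
  proof -
    \<comment> \<open>Removed elements will have modulus above \<open>H\<close>, so they miss
      \<open>F0\<close> and are far enough from \<open>x0\<close> for
      \<open>ln_ratio_upper\<close>.\<close>
    define H where "H = (\<Sum>k\<in>F0. \<bar>lam k\<bar>) + 2 * \<bar>x0\<bar> + 2"
    have H: "\<bar>lam k\<bar> < H" if "k \<in> F0" for k
      using member_le_sum[OF that, of "\<lambda>k. \<bar>lam k\<bar>"] F0(1) by (auto simp: H_def)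
    have H2: "2 * \<bar>x0\<bar> + 1 \<le> H" "1 \<le> H" unfolding H_def by (auto intro: add_nonneg_nonneg sum_nonneg)
    have "eventually (\<lambda>N. dist (s N) 0 < 1 / H) sequentially" using s0 H2 by (intro tendstoD) auto
    moreover have "eventually (\<lambda>N. char_seq I lam n0 - 1 < log_weight lam (Win I N) n0) sequentially"
      using lw[OF n0] by (rule order_tendstoD) simp
    moreover have "eventually (\<lambda>N. \<forall>k\<in>F0. k \<in> Win I N) sequentially"
    proof -
      have "eventually (\<lambda>N. k \<in> Win I N) sequentially" if "k \<in> F0" for k
        by (rule eventually_sequentiallyI[of "nat \<bar>k\<bar> + 1"]) (use that F0 in \<open>auto simp: Win_def\<close>)
      then show ?thesis using F0(1) by (simp add: eventually_ball_finite)
    qed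
    ultimately have "eventually (\<lambda>N. dist (s N) 0 < 1 / H \<and> char_seq I lam n0 - 1 < log_weight lam (Win I N) n0 \<and> (\<forall>k\<in>F0. k \<in> Win I N)) sequentially"
      by (intro eventually_conj)
    then obtain N where N: "\<bar>s N\<bar> < 1 / H" "char_seq I lam n0 - 1 < log_weight lam (Win I N) n0" "F0 \<subseteq> Win I N"
      using eventually_happens by (force simp: dist_real_def)
    define \<sigma> where "\<sigma> = (if 0 \<le> s N then 1 else -1::real)"
    have \<sigma>: "\<sigma> \<in> {1, -1}" "\<sigma> * s N = \<bar>s N\<bar>" "\<sigma> * \<sigma> = 1" by (auto simp: \<sigma>_def)
    \<comment> \<open>The tail \<open>s N\<close> hurts only at nodes of the opposite sign, where
      \<open>lam n * s N\<close> is negative. Moving the farthest of these elements from the window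
      into the tail removes the worst nodes and shrinks the tail at the same time.\<close>
    define A where "A = {k\<in>Win I N. \<sigma> * lam k \<le> -1}"
    have finA: "finite A" by (simp add: A_def)
    have Aabs: "\<bar>lam k\<bar> = - (\<sigma> * lam k)" "1 \<le> \<bar>lam k\<bar>" if "k \<in> A" for k using that \<sigma>(1) by (auto simp: A_def)
    have "\<exists>R\<subseteq>A. (\<Sum>r\<in>R. 1 / \<bar>lam r\<bar>) \<le> \<bar>s N\<bar> \<and> (\<forall>a\<in>A - R. (\<bar>s N\<bar> - (\<Sum>r\<in>R. 1 / \<bar>lam r\<bar>)) * \<bar>lam a\<bar> \<le> 1) \<and> (\<forall>a\<in>A - R. \<forall>r\<in>R. \<bar>lam a\<bar> \<le> \<bar>lam r\<bar>)"
    proof (rule greedy_removal[OF finA])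
      show "0 < \<bar>lam k\<bar>" if "k \<in> A" for k using Aabs(2)[OF that] by linarith
    qed simp
    then obtain R where R': "R \<subseteq> A \<and> (\<Sum>r\<in>R. 1 / \<bar>lam r\<bar>) \<le> \<bar>s N\<bar> \<and> (\<forall>a\<in>A - R. (\<bar>s N\<bar> - (\<Sum>r\<in>R. 1 / \<bar>lam r\<bar>)) * \<bar>lam a\<bar> \<le> 1) \<and> (\<forall>a\<in>A - R. \<forall>r\<in>R. \<bar>lam a\<bar> \<le> \<bar>lam r\<bar>)" ..
    have R: "R \<subseteq> A" "(\<Sum>r\<in>R. 1 / \<bar>lam r\<bar>) \<le> \<bar>s N\<bar>" using R' by simp_all
    have R3: "(\<bar>s N\<bar> - (\<Sum>r\<in>R. 1 / \<bar>lam r\<bar>)) * \<bar>lam a\<bar> \<le> 1" if "a \<in> A - R" for a using R' that by simp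
    have R4: "\<bar>lam a\<bar> \<le> \<bar>lam r\<bar>" if "a \<in> A - R" "r \<in> R" for a r using R' that by simp
    have finR: "finite R" using R(1) finA by (rule finite_subset)
    have Rbig: "H < \<bar>lam k\<bar>" if k: "k \<in> R" for k
    proof -
      have "1 / \<bar>lam k\<bar> \<le> (\<Sum>r\<in>R. 1 / \<bar>lam r\<bar>)" by (rule member_le_sum[OF k]) (use finR in auto)
      then have "1 / \<bar>lam k\<bar> < 1 / H" using R(2) N(1) by linarith
      have "k \<in> A" using k R(1) by blast
      then have l1: "1 \<le> \<bar>lam k\<bar>" by (rule Aabs(2))
      show ?thesis
      proof (rule ccontr)
        assume "\<not> ?thesis"
        then have "1 / H \<le> 1 / \<bar>lam k\<bar>" using l1 H2(2) by (intro divide_left_mono mult_pos_pos) auto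
        then show False using \<open>1 / \<bar>lam k\<bar> < 1 / H\<close> by linarith
      qed
    qed
    define T where "T = Win I N - R"
    have "k \<in> T" if k: "k \<in> F0" for k
    proof -
      have "k \<notin> R" using Rbig[of k] H[OF k] by auto
      then show ?thesis using N(3) k unfolding T_def by blast
    qed
    then have T: "F0 \<subseteq> T" by blast
    have "finite T" "T \<subseteq> I" unfolding T_def by (simp, auto simp: Win_def)
    then have T: "finite T" "T \<subseteq> I" "F0 \<subseteq> T" using T by blast+
    define sT where "sT = B - (\<Sum>k\<in>T. r k)"
    have RW: "R \<subseteq> Win I N" using R(1) by (auto simp: A_def)
    have "(\<Sum>k\<in>R. r k) = - \<sigma> * (\<Sum>k\<in>R. 1 / \<bar>lam k\<bar>)"
      unfolding sum_distrib_left
    proof (rule sum.cong[OF refl])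
      fix k assume k: "k \<in> R"
      then have "k \<in> A" using R(1) by blast
      from Aabs[OF this] show "r k = - \<sigma> * (1 / \<bar>lam k\<bar>)" using \<sigma>(1) by (auto simp: r_def)
    qed
    then have "sT = s N - \<sigma> * (\<Sum>k\<in>R. 1 / \<bar>lam k\<bar>)"
      unfolding sT_def s_def T_def using sum.subset_diff[OF RW finite_Win, of r] by simp
    then have "\<sigma> * sT = \<sigma> * s N - (\<sigma> * \<sigma>) * (\<Sum>k\<in>R. 1 / \<bar>lam k\<bar>)" by (simp add: right_diff_distrib)
    then have \<sigma>sT: "\<sigma> * sT = \<bar>s N\<bar> - (\<Sum>k\<in>R. 1 / \<bar>lam k\<bar>)" using \<sigma> by simp
    then have sT0: "0 \<le> \<sigma> * sT" "\<sigma> * sT \<le> 1"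
    proof -
      show "0 \<le> \<sigma> * sT" using \<sigma>sT R(2) by simp
      have "0 \<le> (\<Sum>k\<in>R. 1 / \<bar>lam k\<bar>)" by (intro sum_nonneg) auto
      moreover have "1 / H \<le> 1" using H2 by simp
      ultimately show "\<sigma> * sT \<le> 1" using \<sigma>sT N(1) by linarith
    qed
    \<comment> \<open>The purpose of the removal: either \<open>lam n\<close> and the tail have
      compatible signs, or both are at most 1 in modulus, or the greedy choice bounds their
      product.\<close>
    have prodT: "-1 \<le> lam n * sT" if n: "n \<in> T" for n
    proof -
      have eq: "lam n * sT = (\<sigma> * lam n) * (\<sigma> * sT)" using \<sigma>(1) by auto
      consider "0 \<le> \<sigma> * lam n" | "-1 < \<sigma> * lam n" "\<sigma> * lam n < 0" | "\<sigma> * lam n \<le> -1" by linarith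
      then show ?thesis
      proof cases
        case 1
        then show ?thesis unfolding eq using mult_nonneg_nonneg[OF 1 sT0(1)] by linarith
      next
        case 2
        have "(-1) * (\<sigma> * sT) \<le> (\<sigma> * lam n) * (\<sigma> * sT)" using 2 sT0 by (intro mult_right_mono) auto
        then show ?thesis unfolding eq using sT0(2) by linarith
      next
        case 3
        then have "n \<in> A - R" using n by (auto simp: T_def A_def)
        then have "(\<sigma> * sT) * \<bar>lam n\<bar> \<le> 1" using R3 \<sigma>sT by simp
        moreover have "\<bar>lam n\<bar> = - (\<sigma> * lam n)" using Aabs(1) \<open>n \<in> A - R\<close> by blast
        ultimately have "(\<sigma> * sT) * (- (\<sigma> * lam n)) \<le> 1" by (simp only:)
        then show ?thesis unfolding eq by (simp add: mult.commute)
      qed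
    qed
    \<comment> \<open>Every omitted element lies beyond the retained ones on its side of the line,
      either by its index or because the removal took the farthest elements.\<close>
    have ratio: "lam k \<noteq> 0" "1 \<le> \<bar>lam k\<bar>" "lam n / lam k < 1" if n: "n \<in> T" and k: "k \<in> I" "k \<notin> T" for n k
    proof -
      show 1: "1 \<le> \<bar>lam k\<bar>" using small k T(3) by (auto simp: not_less[symmetric])
      then show "lam k \<noteq> 0" by auto
      have nI: "n \<in> I" using n T by auto
      have "(1 \<le> lam k \<and> lam n < lam k) \<or> (lam k \<le> -1 \<and> lam k < lam n)"
      proof (cases "k \<in> R")
        case True
        then have kA: "k \<in> A" using R(1) by blast
        have "\<sigma> * lam k < \<sigma> * lam n"
        proof (cases "\<sigma> * lam n \<le> -1")
          case True
          then have "n \<in> A - R" using n by (auto simp: T_def A_def)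
          then have "\<bar>lam n\<bar> \<le> \<bar>lam k\<bar>" using R4 \<open>k \<in> R\<close> by blast
          moreover have "\<bar>lam n\<bar> = - (\<sigma> * lam n)" "\<bar>lam k\<bar> = - (\<sigma> * lam k)" using Aabs(1) kA \<open>n \<in> A - R\<close> by blast+
          ultimately have "\<sigma> * lam k \<le> \<sigma> * lam n" by linarith
          moreover have "lam k \<noteq> lam n" using inj k nI n by (auto simp: inj_on_def)
          then have "\<sigma> * lam k \<noteq> \<sigma> * lam n" using \<sigma>(1) by auto
          ultimately show ?thesis by linarith
        next
          case False
          then show ?thesis using kA by (auto simp: A_def)
        qed
        then show ?thesis using \<sigma>(1) kA by (auto simp: A_def)
      next
        case False
        then have "int N \<le> \<bar>k\<bar>" using k by (auto simp: T_def Win_def)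
        moreover have "\<bar>n\<bar> < int N" using n by (auto simp: T_def Win_def)
        ultimately have "(0 \<le> k \<and> n < k) \<or> (k < 0 \<and> k < n)" by linarith
        moreover have "0 \<le> lam k \<longleftrightarrow> 0 \<le> k" using D k by (auto simp: discrete_seq_def)
        ultimately show ?thesis using lt[OF nI k(1)] lt[OF k(1) nI] 1 by auto
      qed
      then show "lam n / lam k < 1" by (auto simp: divide_less_eq)
    qed
    have upper: "log_weight lam T n \<le> char_seq I lam n + 1" if n: "n \<in> T" for n
    proof -
      have nI: "n \<in> I" using n T by auto
      define t where "t k = ln ((1 + (lam k)\<^sup>2) / (lam k - lam n)\<^sup>2)" for k
      \<comment> \<open>In the limit this becomes
        \<open>log_weight lam T n + lam n * sT \<le> char_seq I lam n\<close>, where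
        \<open>prodT\<close> takes over.\<close>
      have "eventually (\<lambda>N'. log_weight lam T n + lam n * (\<Sum>k\<in>Win I N' - T. r k) \<le> log_weight lam (Win I N') n) sequentially"
      proof (rule eventually_sequentiallyI[of N])
        fix N' assume "N \<le> N'"
        then have sub: "T \<subseteq> Win I N'" by (auto simp: T_def Win_def)
        have "(\<Sum>k\<in>Win I N' - {n}. t k) = (\<Sum>k\<in>T - {n}. t k) + (\<Sum>k\<in>Win I N' - T. t k)"
        proof -
          have "Win I N' - {n} = (T - {n}) \<union> (Win I N' - T)" "(T - {n}) \<inter> (Win I N' - T) = {}" using sub n by auto
          then show ?thesis using T(1) by (simp add: sum.union_disjoint)
        qed
        moreover have "2 * (lam n * (\<Sum>k\<in>Win I N' - T. r k)) \<le> (\<Sum>k\<in>Win I N' - T. t k)"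
          unfolding sum_distrib_left
        proof (rule sum_mono)
          fix k assume "k \<in> Win I N' - T"
          then have k: "k \<in> I" "k \<notin> T" by (auto simp: Win_def)
          show "2 * (lam n * r k) \<le> t k"
            using ln_ratio_lower[OF ratio(1)[OF n k] ratio(3)[OF n k]] ratio(2)[OF n k] by (simp add: t_def r_def)
        qed
        ultimately show "log_weight lam T n + lam n * (\<Sum>k\<in>Win I N' - T. r k) \<le> log_weight lam (Win I N') n"
          unfolding log_weight_def t_def[symmetric] by (simp add: field_simps)
      qed
      moreover have "(\<lambda>N'. log_weight lam T n + lam n * (\<Sum>k\<in>Win I N' - T. r k)) \<longlonglongrightarrow> log_weight lam T n + lam n * sT"
      proof (intro tendsto_intros)
        have "eventually (\<lambda>N'. (\<Sum>k\<in>Win I N'. r k) - (\<Sum>k\<in>T. r k) = (\<Sum>k\<in>Win I N' - T. r k)) sequentially"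
        proof (rule eventually_sequentiallyI[of N])
          fix N' assume "N \<le> N'"
          then have "T \<subseteq> Win I N'" by (auto simp: T_def Win_def)
          then show "(\<Sum>k\<in>Win I N'. r k) - (\<Sum>k\<in>T. r k) = (\<Sum>k\<in>Win I N' - T. r k)"
            using sum.subset_diff[of T "Win I N'" r] by simp
        qed
        moreover have "(\<lambda>N'. (\<Sum>k\<in>Win I N'. r k) - (\<Sum>k\<in>T. r k)) \<longlonglongrightarrow> sT" unfolding sT_def by (intro tendsto_intros B)
        ultimately show "(\<lambda>N'. \<Sum>k\<in>Win I N' - T. r k) \<longlonglongrightarrow> sT" by (rule Lim_transform_eventually[rotated])
      qed
      ultimately have "log_weight lam T n + lam n * sT \<le> char_seq I lam n"
        using lw[OF nI] by (intro tendsto_le[OF _ lw[OF nI]]) auto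
      then show ?thesis using prodT[OF n] by linarith
    qed
    have "c \<le> log_weight lam T n0"
    proof -
      define t where "t k = ln ((1 + (lam k)\<^sup>2) / (lam k - lam n0)\<^sup>2)" for k
      have n0T: "n0 \<in> T" using T(3) \<open>n0 \<in> F0\<close> by blast
      have "(\<Sum>k\<in>Win I N - {n0}. t k) = (\<Sum>k\<in>T - {n0}. t k) + (\<Sum>k\<in>R. t k)"
      proof -
        have "Win I N - {n0} = (T - {n0}) \<union> R" "(T - {n0}) \<inter> R = {}" using RW n0T by (auto simp: T_def)
        then show ?thesis using T(1) finR by (simp add: sum.union_disjoint)
      qed
      moreover have "(\<Sum>k\<in>R. t k) \<le> 4 * (1 + 2 * \<bar>x0\<bar>)"
      proof -
        have "(\<Sum>k\<in>R. t k) \<le> (\<Sum>k\<in>R. 4 * (1 + 2 * \<bar>x0\<bar>) * (1 / \<bar>lam k\<bar>))"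
        proof (rule sum_mono)
          fix k assume "k \<in> R"
          then have "2 * \<bar>x0\<bar> + 1 \<le> \<bar>lam k\<bar>" using Rbig H2(1) by force
          then show "t k \<le> 4 * (1 + 2 * \<bar>x0\<bar>) * (1 / \<bar>lam k\<bar>)" unfolding t_def x0_def by (rule ln_ratio_upper)
        qed
        also have "\<dots> = 4 * (1 + 2 * \<bar>x0\<bar>) * (\<Sum>k\<in>R. 1 / \<bar>lam k\<bar>)" by (simp add: sum_distrib_left)
        also have "\<dots> \<le> 4 * (1 + 2 * \<bar>x0\<bar>) * 1"
        proof (rule mult_left_mono)
          have "1 / H \<le> 1" using H2 by simp
          then show "(\<Sum>k\<in>R. 1 / \<bar>lam k\<bar>) \<le> 1" using R(2) N(1) by linarith
        qed simp
        finally show ?thesis by simp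
      qed
      ultimately have "log_weight lam (Win I N) n0 \<le> log_weight lam T n0 + 2 * (1 + 2 * \<bar>x0\<bar>)"
        unfolding log_weight_def t_def[symmetric] distrib_left by linarith
      then show ?thesis using N(2) by (simp add: c_def)
    qed
    then show ?thesis using T upper \<open>F \<subseteq> F0\<close> by blast
  qed
  note key = this
  have fin1: "finite {k\<in>I. \<bar>lam k\<bar> < 1}"
  proof -
    have "finite {x\<in>lam ` I. \<bar>x\<bar> < 1}" using S by (simp add: sublinear_count_def)
    moreover have "lam ` {k\<in>I. \<bar>lam k\<bar> < 1} \<subseteq> {x\<in>lam ` I. \<bar>x\<bar> < 1}" by auto
    moreover have "inj_on lam {k\<in>I. \<bar>lam k\<bar> < 1}" using inj by (rule inj_on_subset) auto
    ultimately show ?thesis using inj_on_finite by blast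
  qed
  show ?thesis
  proof (intro exI[of _ c] allI impI)
    fix F assume F: "finite F" "F \<subseteq> I"
    show "\<exists>T. finite T \<and> T \<subseteq> I \<and> F \<subseteq> T \<and> (\<forall>n\<in>T. log_weight lam T n \<le> char_seq I lam n + 1) \<and> c \<le> log_weight lam T n0"
      by (rule key[of "F \<union> {n0} \<union> {k\<in>I. \<bar>lam k\<bar> < 1}"]) (use F n0 fin1 in auto)
  qed
qed


lemma not_dense_if_summable:
  assumes W: "weight W" and D: "discrete_seq I lam" and bal: "balanced I lam"
    and dens: "upper_density (lam ` I) = 0"
    and sm: "(\<Sum>\<^sub>\<infinity>n\<in>I. W (lam n) * ennreal (exp (char_seq I lam n))) < \<infinity>"
  shows "\<not> polys_dense W"
proof
  assume dense: "polys_dense W"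
  have lim: "\<not> x islimpt lam ` I" for x using D by (simp add: discrete_seq_def)
  have S: "sublinear_count (lam ` I)" by (rule density_0_imp_sublinear_count[OF lim dens])
  have mono: "strict_mono_on I lam" using D by (simp add: discrete_seq_def)
  have inj: "inj_on lam I" using mono by (rule strict_mono_on_imp_inj_on)
  have infI: "infinite I"
    using D unfolding discrete_seq_def by (auto simp: infinite_Ici infinite_Iio)
  then obtain n0 where n0: "n0 \<in> I" using not_finite_existsD by fastforce
  define P where "P n = W (lam n) * ennreal (exp (char_seq I lam n))" for n
  define Q where "Q = (\<Sum>\<^sub>\<infinity>n\<in>I. P n)"
  have Q: "Q < \<infinity>" using sm by (simp add: Q_def P_def)
  have fin_le: "sum P T \<le> Q" if "finite T" "T \<subseteq> I" for T
    unfolding Q_def by (subst nonneg_infsum_complete) (use that in \<open>auto intro!: SUP_upper\<close>)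
  have Wfin: "W (lam n) < \<infinity>" if n: "n \<in> I" for n
  proof (rule ccontr)
    assume "\<not> ?thesis"
    then have "P n = \<infinity>" by (simp add: P_def ennreal_top_mult less_top[symmetric])
    then show False using fin_le[of "{n}"] n Q by (simp add: top.extremum_uniqueI)
  qed
  define w where "w n = enn2real (W (lam n))" for n
  have w: "W (lam n) = ennreal (w n)" "0 \<le> w n" if "n \<in> I" for n
    using Wfin[OF that] by (auto simp: w_def)
  define q where "q = enn2real Q"
  have q: "(\<Sum>n\<in>T. w n * exp (char_seq I lam n)) \<le> q" "0 \<le> q" if T: "finite T" "T \<subseteq> I" for T
  proof -
    have "ennreal (\<Sum>n\<in>T. w n * exp (char_seq I lam n)) = sum P T"
    proof -
      have "sum P T = (\<Sum>n\<in>T. ennreal (w n * exp (char_seq I lam n)))"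
        by (rule sum.cong) (use T w in \<open>auto simp: P_def ennreal_mult subset_iff\<close>)
      also have "\<dots> = ennreal (\<Sum>n\<in>T. w n * exp (char_seq I lam n))"
        by (rule sum_ennreal) (use T w in \<open>auto intro!: mult_nonneg_nonneg\<close>)
      finally show ?thesis by simp
    qed
    also have "\<dots> \<le> ennreal q" using fin_le[OF T] Q by (simp add: q_def)
    finally show "(\<Sum>n\<in>T. w n * exp (char_seq I lam n)) \<le> q" by (simp add: q_def)
    show "0 \<le> q" by (simp add: q_def)
  qed
  obtain c where c: "\<And>F. finite F \<Longrightarrow> F \<subseteq> I \<Longrightarrow> \<exists>T. finite T \<and> T \<subseteq> I \<and> F \<subseteq> T \<and>
     (\<forall>n\<in>T. log_weight lam T n \<le> char_seq I lam n + 1) \<and> c \<le> log_weight lam T n0"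
    using good_truncations[OF D S bal n0] by blast
  define x0 where "x0 = lam n0"
  obtain \<eta> where \<eta>: "0 < \<eta>" "\<And>n. n \<in> I \<Longrightarrow> n \<noteq> n0 \<Longrightarrow> \<eta> \<le> \<bar>lam n - x0\<bar>"
  proof -
    have "\<not> x0 islimpt lam ` I" by (rule lim)
    then obtain \<eta> where "0 < \<eta>" "\<forall>y\<in>lam ` I. y \<noteq> x0 \<longrightarrow> \<not> dist y x0 < \<eta>"
      unfolding islimpt_approachable by auto
    moreover have "lam n \<noteq> x0" if "n \<in> I" "n \<noteq> n0" for n
      using inj n0 that by (auto simp: inj_on_def x0_def)
    ultimately show thesis using that by (auto simp: dist_real_def not_less)
  qed
  \<comment> \<open>A tent at \<open>x0\<close> whose half-width \<open>\<eta>\<close> is at most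
    the distance to the other elements, so only one term of its divided difference over
    \<open>T\<close> survives.\<close>
  define g where "g x = complex_of_real (max 0 (1 - \<bar>x - x0\<bar> / \<eta>))" for x :: real
  have g_in: "g \<in> CW_fun W"
  proof -
    have "eventually (\<lambda>x. ennreal (cmod (g x)) / W x = 0) at_infinity"
      unfolding eventually_at_infinity
    proof (intro exI allI impI)
      fix x :: real assume "\<bar>x0\<bar> + \<eta> \<le> norm x"
      then have "\<eta> \<le> \<bar>x - x0\<bar>" by (simp add: abs_if split: if_splits)
      then have "g x = 0" using \<eta>(1) by (simp add: g_def le_divide_eq max_def)
      then show "ennreal (cmod (g x)) / W x = 0" by (simp add: divide_ennreal_def)
    qed
    then have "((\<lambda>x. ennreal (cmod (g x)) / W x) \<longlongrightarrow> 0) at_infinity" by (rule tendsto_eventually)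
    moreover have "continuous_on UNIV g" unfolding g_def using \<eta>(1) by (intro continuous_intros) auto
    ultimately show ?thesis by (simp add: CW_fun_def)
  qed
  \<comment> \<open>Chosen to refute the outcome \<open>exp c \<le> \<epsilon> * exp 1 * q\<close>
    of the estimate: \<open>exp 1\<close> is the price of the truncation, and \<open>q + 1\<close>
    makes the refutation strict even if \<open>q = 0\<close>.\<close>
  define \<epsilon> where "\<epsilon> = exp c / (exp 1 * (q + 1))"
  have q0: "0 \<le> q" by (simp add: q_def)
  have \<epsilon>: "0 < \<epsilon>" using q0 by (simp add: \<epsilon>_def)
  have "\<forall>g\<in>CW_fun W. \<forall>e>0. \<exists>p. Wnorm W (\<lambda>x. g x - poly_fun p x) < ennreal e"
    using dense polys_dense_iff[OF W] by simp
  then obtain p where p: "Wnorm W (\<lambda>x. g x - poly_fun p x) < ennreal \<epsilon>" using g_in \<epsilon> by blast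
  have near: "cmod (g (lam n) - poly_fun p (lam n)) \<le> \<epsilon> * w n" if n: "n \<in> I" for n
  proof -
    have "ennreal (cmod (g (lam n) - poly_fun p (lam n))) / W (lam n) \<le> Wnorm W (\<lambda>x. g x - poly_fun p x)"
      unfolding Wnorm_def by (rule SUP_upper) simp
    then have "ennreal (cmod (g (lam n) - poly_fun p (lam n))) / W (lam n) \<le> ennreal \<epsilon>" using p by simp
    moreover have W1: "1 \<le> W (lam n)" using W by (simp add: weight_def)
    then have w1: "1 \<le> w n" using w[OF n] by simp
    moreover have "ennreal (cmod (g (lam n) - poly_fun p (lam n))) / ennreal (w n) = ennreal (cmod (g (lam n) - poly_fun p (lam n)) / w n)"
      using w1 by (intro divide_ennreal) auto
    ultimately have "cmod (g (lam n) - poly_fun p (lam n)) / w n \<le> \<epsilon>" using w[OF n] \<epsilon> by simp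
    then show ?thesis using w1 by (simp add: divide_le_eq)
  qed
  \<comment> \<open>Forces \<open>T\<close> to have at least \<open>degree p + 2\<close> elements,
    as the annihilation of \<open>p\<close> requires.\<close>
  obtain F0 where F0: "finite F0" "card F0 = degree p + 2" "F0 \<subseteq> I"
    using infinite_arbitrarily_large[OF infI, of "degree p + 2"] by blast
  have "finite (insert n0 F0)" "insert n0 F0 \<subseteq> I" using F0 n0 by auto
  from c[OF this] obtain T where T: "finite T" "T \<subseteq> I" "insert n0 F0 \<subseteq> T"
     and up: "\<And>n. n \<in> T \<Longrightarrow> log_weight lam T n \<le> char_seq I lam n + 1" and lo: "c \<le> log_weight lam T n0"
    by blast
  have injT: "inj_on lam T" using inj T(2) by (rule inj_on_subset)
  define Y where "Y = lam ` T"
  have Y: "finite Y" "degree p + 2 \<le> card Y"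
    using T F0 card_mono[of T F0] by (auto simp: Y_def card_image[OF injT])
  define \<Delta> where "\<Delta> = (\<Prod>k\<in>T. sqrt (1 + (lam k)\<^sup>2))"
  have \<Delta>: "0 < \<Delta>" unfolding \<Delta>_def by (intro prod_pos) (auto simp: add_pos_nonneg)
  have nd: "inverse \<bar>nodal_deriv Y (lam n)\<bar> = exp (log_weight lam T n) / \<Delta>" if "n \<in> T" for n
  proof -
    have "exp (log_weight lam T n) * \<bar>nodal_deriv Y (lam n)\<bar> = \<Delta>"
      unfolding Y_def \<Delta>_def by (rule exp_log_weight[OF T(1) that injT])
    moreover have "nodal_deriv Y (lam n) \<noteq> 0" using Y(1) by (rule nodal_deriv_nonzero)
    ultimately show ?thesis using \<Delta> by (simp add: field_simps)
  qed
  have "(\<Sum>x\<in>complex_of_real ` Y. poly p x / nodal_deriv (complex_of_real ` Y) x) = 0"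
    by (rule divided_difference_eq_0) (use Y in \<open>simp_all add: card_image inj_on_def\<close>)
  then have "(\<Sum>x\<in>Y. poly_fun p x / of_real (nodal_deriv Y x)) = 0"
    by (simp add: sum.reindex inj_on_def nodal_deriv_of_real poly_fun_def)
  then have zero: "(\<Sum>n\<in>T. poly_fun p (lam n) / of_real (nodal_deriv Y (lam n))) = 0"
    unfolding Y_def by (simp add: sum.reindex[OF injT])
  have "(\<Sum>n\<in>T. g (lam n) / of_real (nodal_deriv Y (lam n))) = (\<Sum>n\<in>T. if n = n0 then 1 / of_real (nodal_deriv Y x0) else 0)"
  proof (rule sum.cong[OF refl])
    fix n assume n: "n \<in> T"
    show "g (lam n) / of_real (nodal_deriv Y (lam n)) = (if n = n0 then 1 / of_real (nodal_deriv Y x0) else 0)"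
    proof (cases "n = n0")
      case False
      then have "\<eta> \<le> \<bar>lam n - x0\<bar>" using \<eta>(2) n T(2) by blast
      then show ?thesis using False \<eta>(1) by (simp add: g_def le_divide_eq max_def)
    qed (simp add: g_def x0_def)
  qed
  also have "\<dots> = 1 / of_real (nodal_deriv Y x0)" using T by simp
  finally have gsum: "(\<Sum>n\<in>T. g (lam n) / of_real (nodal_deriv Y (lam n))) = 1 / of_real (nodal_deriv Y x0)" .
  have "exp c / \<Delta> \<le> exp (log_weight lam T n0) / \<Delta>" using lo \<Delta> by (intro divide_right_mono) auto
  also have "\<dots> = cmod (1 / of_real (nodal_deriv Y x0))"
    using nd[of n0] T(3) by (simp add: x0_def norm_divide inverse_eq_divide)
  also have "1 / of_real (nodal_deriv Y x0) = (\<Sum>n\<in>T. (g (lam n) - poly_fun p (lam n)) / complex_of_real (nodal_deriv Y (lam n)))"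
    using gsum zero by (simp add: diff_divide_distrib sum_subtractf)
  also have "cmod \<dots> \<le> (\<Sum>n\<in>T. \<epsilon> * w n * (exp 1 * exp (char_seq I lam n)) / \<Delta>)"
  proof (rule order.trans[OF norm_sum sum_mono])
    fix n assume n: "n \<in> T"
    have "cmod ((g (lam n) - poly_fun p (lam n)) / complex_of_real (nodal_deriv Y (lam n)))
      = cmod (g (lam n) - poly_fun p (lam n)) * (exp (log_weight lam T n) / \<Delta>)"
      unfolding nd[OF n, symmetric] by (simp add: divide_inverse norm_mult norm_inverse)
    also have "\<dots> \<le> (\<epsilon> * w n) * (exp (char_seq I lam n + 1) / \<Delta>)"
      using near[of n] up[OF n] n T(2) \<Delta> \<epsilon> w(2)[of n] by (intro mult_mono divide_right_mono) auto
    finally show "cmod ((g (lam n) - poly_fun p (lam n)) / complex_of_real (nodal_deriv Y (lam n)))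
       \<le> \<epsilon> * w n * (exp 1 * exp (char_seq I lam n)) / \<Delta>" by (simp add: exp_add mult_ac)
  qed
  also have "\<dots> = \<epsilon> * exp 1 * (\<Sum>n\<in>T. w n * exp (char_seq I lam n)) / \<Delta>"
    by (simp add: sum_distrib_left sum_divide_distrib mult_ac)
  also have "\<dots> \<le> \<epsilon> * exp 1 * q / \<Delta>"
    using q[OF T(1,2)] \<epsilon> \<Delta> by (intro divide_right_mono mult_left_mono) auto
  finally have "exp c \<le> \<epsilon> * exp 1 * q" using \<Delta> by (simp add: divide_le_cancel)
  also have "\<dots> < \<epsilon> * exp 1 * (q + 1)" using \<epsilon> by simp
  also have "\<dots> = exp c" using q0 by (simp add: \<epsilon>_def)
  finally show False by simp
qed

section \<open>Approximating continuous functions through two resolvents\<close>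

definition poly_approx :: "real set \<Rightarrow> (real \<Rightarrow> real) \<Rightarrow> (real \<Rightarrow> real) \<Rightarrow> bool" where
  "poly_approx D w f \<longleftrightarrow> (\<forall>\<epsilon>>0. \<exists>p. \<forall>x\<in>D. \<bar>f x - poly p x\<bar> \<le> \<epsilon> * w x)"

text \<open>Approximability alone need not pass to products, but the functions that preserve it form
  an algebra, to which Stone-Weierstrass can be applied; acting on the constant 1, they are
  approximable themselves.\<close>

definition poly_multiplier :: "real set \<Rightarrow> (real \<Rightarrow> real) \<Rightarrow> (real \<Rightarrow> real) \<Rightarrow> bool" where
  "poly_multiplier D w h \<longleftrightarrow> (\<forall>f. poly_approx D w f \<longrightarrow> poly_approx D w (\<lambda>x. h x * f x))"

lemma poly_approx_poly: "(\<And>x. x \<in> D \<Longrightarrow> 0 \<le> w x) \<Longrightarrow> poly_approx D w (poly p)"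
  unfolding poly_approx_def by (intro allI impI exI[of _ p]) simp

lemma abs_diff_le_halves:
  fixes a b c e w :: real
  assumes "\<bar>a - b\<bar> \<le> e / 2 * w" "\<bar>b - c\<bar> \<le> e / 2 * w"
  shows "\<bar>a - c\<bar> \<le> e * w"
proof -
  have "\<bar>a - c\<bar> \<le> \<bar>a - b\<bar> + \<bar>b - c\<bar>" by linarith
  also have "\<dots> \<le> e / 2 * w + e / 2 * w" by (rule add_mono[OF assms])
  finally show ?thesis by simp
qed

lemma poly_approx_add:
  assumes "poly_approx D w f" "poly_approx D w g"
  shows "poly_approx D w (\<lambda>x. f x + g x)"
  unfolding poly_approx_def
proof (intro allI impI)
  fix \<epsilon> :: real assume "0 < \<epsilon>"
  then have e: "0 < \<epsilon> / 2" by simp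
  obtain p where p: "\<forall>x\<in>D. \<bar>f x - poly p x\<bar> \<le> \<epsilon> / 2 * w x" using assms(1) e unfolding poly_approx_def by blast
  obtain q where q: "\<forall>x\<in>D. \<bar>g x - poly q x\<bar> \<le> \<epsilon> / 2 * w x" using assms(2) e unfolding poly_approx_def by blast
  have "\<bar>f x + g x - poly (p + q) x\<bar> \<le> \<epsilon> * w x" if "x \<in> D" for x
    by (rule abs_diff_le_halves[where b = "poly p x + g x"]) (use p q that in simp_all)
  then show "\<exists>p. \<forall>x\<in>D. \<bar>f x + g x - poly p x\<bar> \<le> \<epsilon> * w x" by blast
qed

lemma poly_approx_cmult:
  assumes "poly_approx D w f"
  shows "poly_approx D w (\<lambda>x. c * f x)"
  unfolding poly_approx_def
proof (intro allI impI)
  fix \<epsilon> :: real assume e: "0 < \<epsilon>"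
  have c: "0 < \<bar>c\<bar> + 1" by linarith
  have "0 < \<epsilon> / (\<bar>c\<bar> + 1)" using e c by simp
  then obtain p where p: "\<forall>x\<in>D. \<bar>f x - poly p x\<bar> \<le> \<epsilon> / (\<bar>c\<bar> + 1) * w x"
    using assms unfolding poly_approx_def by blast
  have "\<bar>c * f x - poly (smult c p) x\<bar> \<le> \<epsilon> * w x" if "x \<in> D" for x
  proof -
    have "\<bar>c * f x - poly (smult c p) x\<bar> = \<bar>c\<bar> * \<bar>f x - poly p x\<bar>"
      by (simp add: right_diff_distrib[symmetric] abs_mult)
    also have "\<dots> \<le> (\<bar>c\<bar> + 1) * \<bar>f x - poly p x\<bar>" by (intro mult_right_mono) auto
    also have "\<dots> \<le> (\<bar>c\<bar> + 1) * (\<epsilon> / (\<bar>c\<bar> + 1) * w x)"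
      by (rule mult_left_mono[OF p[rule_format, OF that]]) (use c in simp)
    also have "\<dots> = \<epsilon> * w x" using c by simp
    finally show ?thesis .
  qed
  then show "\<exists>p. \<forall>x\<in>D. \<bar>c * f x - poly p x\<bar> \<le> \<epsilon> * w x" by blast
qed

lemma poly_approx_limit:
  assumes "\<And>\<epsilon>. 0 < \<epsilon> \<Longrightarrow> \<exists>g. poly_approx D w g \<and> (\<forall>x\<in>D. \<bar>f x - g x\<bar> \<le> \<epsilon> * w x)"
  shows "poly_approx D w f"
  unfolding poly_approx_def
proof (intro allI impI)
  fix \<epsilon> :: real assume "0 < \<epsilon>"
  then have e: "0 < \<epsilon> / 2" by simp
  obtain g where g: "poly_approx D w g" "\<forall>x\<in>D. \<bar>f x - g x\<bar> \<le> \<epsilon> / 2 * w x" using assms[OF e] by blast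
  obtain p where p: "\<forall>x\<in>D. \<bar>g x - poly p x\<bar> \<le> \<epsilon> / 2 * w x" using g(1) e unfolding poly_approx_def by blast
  have "\<bar>f x - poly p x\<bar> \<le> \<epsilon> * w x" if "x \<in> D" for x
    by (rule abs_diff_le_halves[OF g(2)[rule_format, OF that] p[rule_format, OF that]])
  then show "\<exists>p. \<forall>x\<in>D. \<bar>f x - poly p x\<bar> \<le> \<epsilon> * w x" by blast
qed

text \<open>A factor bounded by 1 does not enlarge the weighted error, so only polynomials have to
  be tested.\<close>

lemma poly_multiplier_bounded:
  assumes h: "\<And>x. \<bar>h x\<bar> \<le> 1" and P: "\<And>p. poly_approx D w (\<lambda>x. h x * poly p x)"
  shows "poly_multiplier D w h"
  unfolding poly_multiplier_def
proof (intro allI impI)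
  fix f assume f: "poly_approx D w f"
  show "poly_approx D w (\<lambda>x. h x * f x)"
  proof (rule poly_approx_limit)
    fix \<epsilon> :: real assume e: "0 < \<epsilon>"
    obtain p where p: "\<forall>x\<in>D. \<bar>f x - poly p x\<bar> \<le> \<epsilon> * w x" using f e unfolding poly_approx_def by blast
    have "\<bar>h x * f x - h x * poly p x\<bar> \<le> \<epsilon> * w x" if "x \<in> D" for x
    proof -
      have "\<bar>h x * f x - h x * poly p x\<bar> = \<bar>h x\<bar> * \<bar>f x - poly p x\<bar>"
        by (simp add: right_diff_distrib[symmetric] abs_mult)
      also have "\<dots> \<le> 1 * \<bar>f x - poly p x\<bar>" by (intro mult_right_mono h) simp
      also have "\<dots> \<le> \<epsilon> * w x" using p that by simp
      finally show ?thesis .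
    qed
    then show "\<exists>g. poly_approx D w g \<and> (\<forall>x\<in>D. \<bar>h x * f x - g x\<bar> \<le> \<epsilon> * w x)" using P by blast
  qed
qed

lemma poly_multiplier_ring:
  assumes "poly_multiplier D w g" "poly_multiplier D w h"
  shows "poly_multiplier D w (\<lambda>x. g x + h x)" "poly_multiplier D w (\<lambda>x. g x * h x)" "poly_multiplier D w (\<lambda>x. c * g x)"
    "poly_multiplier D w (\<lambda>x. c)"
proof -
  have g: "poly_approx D w (\<lambda>x. g x * f x)" and h: "poly_approx D w (\<lambda>x. h x * f x)" if "poly_approx D w f" for f
    using assms that unfolding poly_multiplier_def by blast+
  show "poly_multiplier D w (\<lambda>x. g x + h x)"
    unfolding poly_multiplier_def using poly_approx_add[OF g h] by (simp add: distrib_right)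
  show "poly_multiplier D w (\<lambda>x. g x * h x)"
    unfolding poly_multiplier_def using g[OF h] by (simp add: mult.assoc)
  show "poly_multiplier D w (\<lambda>x. c * g x)"
    unfolding poly_multiplier_def using poly_approx_cmult[OF g] by (simp add: mult.assoc)
  show "poly_multiplier D w (\<lambda>x. c)"
    unfolding poly_multiplier_def using poly_approx_cmult by blast
qed

text \<open>Dividing \<open>p\<close> by \<open>1 + x\<^sup>2\<close> leaves a remainder of degree at most 1, so \<open>p / (1 + x\<^sup>2)\<close> is a
  polynomial plus a combination of the two functions assumed approximable.\<close>
lemma poly_multiplier_resolvent:
  assumes w: "\<And>x. x \<in> D \<Longrightarrow> 0 \<le> w x"
    and u: "poly_approx D w (\<lambda>x. 1 / (1 + x\<^sup>2))" and v: "poly_approx D w (\<lambda>x. x / (1 + x\<^sup>2))"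
  shows "poly_multiplier D w (\<lambda>x. 1 / (1 + x\<^sup>2))" "poly_multiplier D w (\<lambda>x. x / (1 + x\<^sup>2))"
proof -
  have pos: "0 < 1 + x\<^sup>2" for x :: real by (simp add: add_pos_nonneg)
  have main: "poly_approx D w (\<lambda>x. 1 / (1 + x\<^sup>2) * poly p x)" for p
  proof -
    define q where "q = p div [:1, 0, 1:]"
    define r where "r = p mod [:1, 0, 1:]"
    have dr: "degree r < 2"
    proof -
      have "r = 0 \<or> degree r < degree [:1, 0, 1 :: real:]" unfolding r_def by (rule degree_mod_less) simp
      then show ?thesis by auto
    qed
    have r: "poly r x = coeff r 0 + coeff r 1 * x" for x
    proof -
      have "r = [:coeff r 0, coeff r 1:]"
      proof (rule poly_eqI)
        fix i :: nat
        consider "i = 0" | "i = 1" | "2 \<le> i" by linarith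
        then show "coeff r i = coeff [:coeff r 0, coeff r 1:] i"
        proof cases
          case 3
          then have "degree r < i" using dr by linarith
          moreover have "degree [:coeff r 0, coeff r 1:] < i" using 3 by (simp add: degree_pCons_eq_if)
          ultimately show ?thesis by (simp only: coeff_eq_0)
        qed simp_all
      qed
      then have "poly r x = poly [:coeff r 0, coeff r 1:] x" by (rule arg_cong)
      also have "\<dots> = coeff r 0 + coeff r 1 * x" by (simp add: mult.commute)
      finally show ?thesis .
    qed
    have "1 / (1 + x\<^sup>2) * poly p x = poly q x + (coeff r 0 * (1 / (1 + x\<^sup>2)) + coeff r 1 * (x / (1 + x\<^sup>2)))" for x
    proof -
      have "p = q * [:1, 0, 1:] + r" unfolding q_def r_def by (rule div_mult_mod_eq[symmetric])
      then have "poly p x = poly (q * [:1, 0, 1:] + r) x" by (rule arg_cong)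
      also have "\<dots> = poly q x * (1 + x\<^sup>2) + (coeff r 0 + coeff r 1 * x)"
        by (simp only: poly_add poly_mult r) (simp add: power2_eq_square)
      finally show ?thesis using pos[of x] by (simp add: add_divide_distrib)
    qed
    then show ?thesis
      by (simp only:) (intro poly_approx_add poly_approx_cmult poly_approx_poly u v w)
  qed
  show "poly_multiplier D w (\<lambda>x. 1 / (1 + x\<^sup>2))"
  proof (rule poly_multiplier_bounded[OF _ main])
    show "\<bar>1 / (1 + x\<^sup>2)\<bar> \<le> 1" for x :: real using pos[of x] by (simp add: abs_divide divide_le_eq)
  qed
  show "poly_multiplier D w (\<lambda>x. x / (1 + x\<^sup>2))"
  proof (rule poly_multiplier_bounded)
    show "\<bar>x / (1 + x\<^sup>2)\<bar> \<le> 1" for x :: real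
    proof -
      have "\<bar>x\<bar> \<le> 1 + x\<^sup>2" using zero_le_power2[of "\<bar>x\<bar> - 1"] by (simp add: power2_diff)
      then show ?thesis using pos[of x] by (simp add: abs_divide divide_le_eq)
    qed
    show "poly_approx D w (\<lambda>x. x / (1 + x\<^sup>2) * poly p x)" for p
      using main[of "[:0, 1:] * p"] by (simp add: mult.assoc)
  qed
qed

section \<open>Stone-Weierstrass approximation in the two resolvents\<close>

lemma poly_multiplier_polynomial_function:
  fixes P :: "real \<times> real \<Rightarrow> real"
  assumes "real_polynomial_function P" "poly_multiplier D w u" "poly_multiplier D w v"
  shows "poly_multiplier D w (\<lambda>x. P (u x, v x))"
  using assms(1)
proof induction
  case (linear f)
  have "f (u x, v x) = f (1, 0) * u x + f (0, 1) * v x" for x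
  proof -
    have "(u x, v x) = u x *\<^sub>R (1, 0) + v x *\<^sub>R (0, 1)" by simp
    then have "f (u x, v x) = f (u x *\<^sub>R (1, 0) + v x *\<^sub>R (0, 1))" by (rule arg_cong)
    also have "\<dots> = u x *\<^sub>R f (1, 0) + v x *\<^sub>R f (0, 1)"
      using linear by (simp only: linear_add[OF bounded_linear.linear] linear_cmul[OF bounded_linear.linear])
    finally show ?thesis by (simp add: mult.commute)
  qed
  moreover have "poly_multiplier D w (\<lambda>x. f (1, 0) * u x + f (0, 1) * v x)"
    using poly_multiplier_ring(3)[OF assms(2,3)] poly_multiplier_ring(3)[OF assms(3,2)] by (rule poly_multiplier_ring(1))
  ultimately show ?case by simp
next
  case (const c)
  show ?case by (rule poly_multiplier_ring(4)[OF assms(2,3)])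
next
  case (add f g)
  from poly_multiplier_ring(1)[OF add.IH] show ?case .
next
  case (mult f g)
  from poly_multiplier_ring(2)[OF mult.IH] show ?case .
qed

text \<open>On the curve \<open>(u, v) = (1 / (1 + x^2), x / (1 + x^2))\<close> the point is
  recovered as \<open>x = v / u\<close>. Since \<open>u\<close> tends to 0 at infinity, it is cut
  off below at \<open>c\<close>, and a ramp from \<open>c\<close> to \<open>d\<close> is inserted;
  these are the values of \<open>u\<close> at \<open>\<bar>x\<bar> = R + 1\<close> and
  \<open>\<bar>x\<bar> = R\<close>. The ramp equals 1 wherever \<open>f\<close> can be
  nonzero.\<close>

lemma compactly_supported_factor:
  fixes f :: "real \<Rightarrow> real"
  assumes f: "continuous_on UNIV f" and R: "0 < R" and supp: "\<And>x. R \<le> \<bar>x\<bar> \<Longrightarrow> f x = 0"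
  shows "\<exists>G :: real \<times> real \<Rightarrow> real. continuous_on UNIV G \<and> (\<forall>x. G (1 / (1 + x\<^sup>2), x / (1 + x\<^sup>2)) = f x)"
proof -
  define c where "c = 1 / (1 + (R + 1)\<^sup>2)"
  define d where "d = 1 / (1 + R\<^sup>2)"
  have pos: "0 < 1 + x\<^sup>2" for x :: real by (simp add: add_pos_nonneg)
  have c: "0 < c" unfolding c_def using pos[of "R + 1"] by simp
  have cd: "c < d"
  proof -
    have "R\<^sup>2 < (R + 1)\<^sup>2" using R by (intro power_strict_mono) auto
    then show ?thesis unfolding c_def d_def using pos[of R] by (intro divide_strict_left_mono) (auto simp: pos intro: mult_pos_pos)
  qed
  define G where "G q = f (snd q / max (fst q) c) * max 0 (min 1 ((fst q - c) / (d - c)))" for q :: "real \<times> real"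
  have "continuous_on UNIV G"
  proof -
    have "continuous_on UNIV (\<lambda>q :: real \<times> real. snd q / max (fst q) c)"
      using c by (intro continuous_intros) auto
    then have "continuous_on UNIV (\<lambda>q :: real \<times> real. f (snd q / max (fst q) c))"
      by (rule continuous_on_compose2[OF f]) simp
    then show ?thesis unfolding G_def using cd by (intro continuous_intros) auto
  qed
  moreover have "G (1 / (1 + x\<^sup>2), x / (1 + x\<^sup>2)) = f x" for x
  proof -
    define u where "u = 1 / (1 + x\<^sup>2)"
    consider (in1) "\<bar>x\<bar> < R" | (mid) "R \<le> \<bar>x\<bar>" "c \<le> u" | (out) "u < c" by linarith
    then show ?thesis
    proof cases
      case in1
      have "x\<^sup>2 < R\<^sup>2" using power_strict_mono[OF in1, of 2] by simp
      then have du: "d < u" unfolding d_def u_def using pos[of x] pos[of R] by (intro divide_strict_left_mono) (auto intro: mult_pos_pos)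
      then have "1 \<le> (u - c) / (d - c)" using cd by (simp add: le_divide_eq)
      moreover have "max u c = u" using du cd by simp
      moreover have "x / (1 + x\<^sup>2) / u = x" using pos[of x] by (simp add: u_def)
      ultimately show ?thesis by (simp add: G_def u_def[symmetric])
    next
      case mid
      have "x / (1 + x\<^sup>2) / u = x" using pos[of x] by (simp add: u_def)
      then show ?thesis using mid supp[of x] by (simp add: G_def u_def[symmetric] max_absorb1)
    next
      case out
      have "R \<le> \<bar>x\<bar>"
      proof (rule ccontr)
        assume "\<not> ?thesis"
        then have "x\<^sup>2 < R\<^sup>2" using power_strict_mono[of "\<bar>x\<bar>" R 2] by simp
        then have "d < u" unfolding d_def u_def using pos[of x] pos[of R] by (intro divide_strict_left_mono) (auto intro: mult_pos_pos)
        then show False using out cd by linarith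
      qed
      moreover have "(u - c) / (d - c) \<le> 0" using out cd by (simp add: divide_le_0_iff)
      ultimately show ?thesis using supp[of x] by (simp add: G_def u_def[symmetric])
    qed
  qed
  ultimately show ?thesis by blast
qed

text \<open>Cut \<open>f\<close> off, write the result as \<open>G (u, v)\<close> in the two
  resolvents and approximate \<open>G\<close> uniformly on a compact rectangle by a polynomial in
  two variables. This polynomial in \<open>u\<close> and \<open>v\<close> is a multiplier, applied
  to 1. A uniform error is a weighted one because \<open>w \<ge> 1\<close>.\<close>

lemma poly_approx_continuous:
  assumes w: "\<And>x. x \<in> D \<Longrightarrow> 1 \<le> w x"
    and u: "poly_approx D w (\<lambda>x. 1 / (1 + x\<^sup>2))" and v: "poly_approx D w (\<lambda>x. x / (1 + x\<^sup>2))"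
    and f: "continuous_on UNIV f" and small: "\<And>\<epsilon>. 0 < \<epsilon> \<Longrightarrow> \<exists>R. \<forall>x\<in>D. R \<le> \<bar>x\<bar> \<longrightarrow> \<bar>f x\<bar> \<le> \<epsilon> * w x"
  shows "poly_approx D w f"
proof (rule poly_approx_limit)
  fix \<epsilon> :: real assume "0 < \<epsilon>"
  then have e: "0 < \<epsilon> / 2" by simp
  have w0: "0 \<le> w x" if "x \<in> D" for x using w[OF that] by linarith
  have pos: "0 < 1 + x\<^sup>2" for x :: real by (simp add: add_pos_nonneg)
  from small[OF e] obtain R where R: "\<forall>x\<in>D. R \<le> \<bar>x\<bar> \<longrightarrow> \<bar>f x\<bar> \<le> \<epsilon> / 2 * w x" ..
  define h where "h x = max 0 (min 1 (\<bar>R\<bar> + 1 - \<bar>x\<bar>))" for x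
  have h: "0 \<le> h x" "h x \<le> 1" for x by (auto simp: h_def)
  have h1: "h x = 1" if "\<bar>x\<bar> \<le> \<bar>R\<bar>" for x using that by (simp add: h_def)
  have "continuous_on UNIV (\<lambda>x. f x * h x)"
    unfolding h_def using f by (intro continuous_intros)
  moreover have "0 < \<bar>R\<bar> + 1" by linarith
  moreover have "f x * h x = 0" if "\<bar>R\<bar> + 1 \<le> \<bar>x\<bar>" for x using that by (simp add: h_def)
  ultimately have "\<exists>G :: real \<times> real \<Rightarrow> real. continuous_on UNIV G \<and> (\<forall>x. G (1 / (1 + x\<^sup>2), x / (1 + x\<^sup>2)) = f x * h x)"
    by (rule compactly_supported_factor)
  then obtain G :: "real \<times> real \<Rightarrow> real" where G: "continuous_on UNIV G"
    and Gf: "\<And>x. G (1 / (1 + x\<^sup>2), x / (1 + x\<^sup>2)) = f x * h x" by blast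
  have "compact ({0..1} \<times> {-1..1} :: (real \<times> real) set)" by (intro compact_Times compact_Icc)
  then obtain P where P: "real_polynomial_function P" and GP: "\<And>q. q \<in> {0..1} \<times> {-1..1} \<Longrightarrow> \<bar>G q - P q\<bar> < \<epsilon> / 2"
    by (rule Stone_Weierstrass_real_polynomial_function[OF _ continuous_on_subset[OF G subset_UNIV] e]) blast
  have "poly_multiplier D w (\<lambda>x. P (1 / (1 + x\<^sup>2), x / (1 + x\<^sup>2)))"
    by (intro poly_multiplier_polynomial_function[OF P] poly_multiplier_resolvent u v w0)
  moreover have "poly_approx D w (\<lambda>x. 1)"
  proof -
    have "poly (1 :: real poly) = (\<lambda>x. 1)" by (rule ext) simp
    then show ?thesis using poly_approx_poly[OF w0, where p = 1] by simp
  qed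
  ultimately have "poly_approx D w (\<lambda>x. P (1 / (1 + x\<^sup>2), x / (1 + x\<^sup>2)) * 1)"
    unfolding poly_multiplier_def by blast
  then have "poly_approx D w (\<lambda>x. P (1 / (1 + x\<^sup>2), x / (1 + x\<^sup>2)))" by simp
  moreover have "\<bar>f x - P (1 / (1 + x\<^sup>2), x / (1 + x\<^sup>2))\<bar> \<le> \<epsilon> * w x" if x: "x \<in> D" for x
  proof -
    have "\<bar>x\<bar> \<le> 1 + x\<^sup>2" using zero_le_power2[of "\<bar>x\<bar> - 1"] by (simp add: power2_diff)
    then have "\<bar>x / (1 + x\<^sup>2)\<bar> \<le> 1" using pos[of x] by (simp add: abs_divide divide_le_eq)
    then have "-1 \<le> x / (1 + x\<^sup>2)" "x / (1 + x\<^sup>2) \<le> 1" by (simp_all only: abs_le_iff) linarith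
    moreover have "0 \<le> 1 / (1 + x\<^sup>2)" "1 / (1 + x\<^sup>2) \<le> 1" using pos[of x] by (simp_all add: divide_le_eq)
    ultimately have "\<bar>f x * h x - P (1 / (1 + x\<^sup>2), x / (1 + x\<^sup>2))\<bar> < \<epsilon> / 2"
      using GP[of "(1 / (1 + x\<^sup>2), x / (1 + x\<^sup>2))"] unfolding Gf by simp
    moreover have "\<epsilon> / 2 \<le> \<epsilon> / 2 * w x" using mult_left_mono[OF w[OF x], of "\<epsilon> / 2"] e by simp
    ultimately have "\<bar>f x * h x - P (1 / (1 + x\<^sup>2), x / (1 + x\<^sup>2))\<bar> \<le> \<epsilon> / 2 * w x" by linarith
    moreover have "\<bar>f x - f x * h x\<bar> \<le> \<epsilon> / 2 * w x"
    proof (cases "\<bar>x\<bar> \<le> \<bar>R\<bar>")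
      case True
      then show ?thesis using h1[OF True] e w0[OF x] by simp
    next
      case False
      have "\<bar>f x - f x * h x\<bar> = \<bar>f x\<bar> * \<bar>1 - h x\<bar>" by (simp add: abs_mult[symmetric] right_diff_distrib)
      also have "\<dots> \<le> \<bar>f x\<bar> * 1" using h[of x] by (intro mult_left_mono) auto
      also have "\<dots> \<le> \<epsilon> / 2 * w x" using R x False by simp
      finally show ?thesis .
    qed
    ultimately show ?thesis by (rule abs_diff_le_halves[rotated])
  qed
  ultimately show "\<exists>g. poly_approx D w g \<and> (\<forall>x\<in>D. \<bar>f x - g x\<bar> \<le> \<epsilon> * w x)" by blast
qed

section \<open>The limit sequence\<close>

text \<open>The exponential bound takes three limits in \<open>deriv_bound\<close>: the nodes
  converge for a fixed finite window, then the window exhausts \<open>I\<close> and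
  \<open>log_weight\<close> tends to \<open>char_seq\<close>, and finally \<open>\<delta>\<close>
  tends to 0 and the error factor disappears.\<close>

lemma (in node_limit) limit_sequence:
  obtains I lam where "discrete_seq I lam" "lam ` I = \<mu> ` S" "upper_density (lam ` I) = 0" "balanced I lam"
    "\<And>n k c. n \<in> I \<Longrightarrow> k \<in> S \<Longrightarrow> \<mu> k = lam n \<Longrightarrow>
      (\<lambda>j. 1 / (\<kappa> j * (\<Prod>z\<in>Y j - {e j k}. (e j k - z)\<^sup>2))) \<longlonglongrightarrow> c \<Longrightarrow> exp (2 * char_seq I lam n) \<le> c * M"
proof -
  define L where "L = \<mu> ` S"
  have Lwin: "{x\<in>L. \<bar>x\<bar> < r} = \<mu> ` {k\<in>S. \<bar>\<mu> k\<bar> < r}" for r by (auto simp: L_def)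
  have cardL: "card {x\<in>L. \<bar>x\<bar> < r} = card {k\<in>S. \<bar>\<mu> k\<bar> < r}" for r
    unfolding Lwin by (intro card_image inj_on_subset[OF inj_\<mu>]) auto
  have subL: "sublinear_count L"
    unfolding sublinear_count_def cardL using finite_window card_window by (simp add: Lwin)
  have finL: "finite {x\<in>L. \<bar>x\<bar> < r}" for r unfolding Lwin by (intro finite_imageI finite_window)
  have infL: "infinite L" unfolding L_def using infinite_S inj_\<mu> by (simp add: finite_image_iff)
  from enumerate_discrete_set[OF infL finL] obtain I lam where D: "discrete_seq I lam" and lamI: "lam ` I = L"
    by blast
  have mono: "strict_mono_on I lam" using D by (simp add: discrete_seq_def)
  have inj: "inj_on lam I" using mono by (rule strict_mono_on_imp_inj_on)
  have subI: "sublinear_count (lam ` I)" using subL lamI by simp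
  \<comment> \<open>Balance and characteristic sums are cut by index, whereas the nodes are
    controlled by modulus; \<open>E N\<close> is the index window translated into labels from
    \<open>S\<close>.\<close>
  define E where "E N = {k\<in>S. \<mu> k \<in> lam ` Win I N}" for N
  have \<mu>E: "\<mu> ` E N = lam ` Win I N" for N
  proof
    show "lam ` Win I N \<subseteq> \<mu> ` E N"
    proof
      fix x assume x: "x \<in> lam ` Win I N"
      then have "x \<in> L" using lamI by (auto simp: Win_def)
      then obtain k where "k \<in> S" "x = \<mu> k" by (auto simp: L_def)
      then show "x \<in> \<mu> ` E N" using x by (auto simp: E_def)
    qed
  qed (auto simp: E_def)
  have injE: "inj_on \<mu> (E N)" for N by (rule inj_on_subset[OF inj_\<mu>]) (auto simp: E_def)
  have injW: "inj_on lam (Win I N)" for N by (rule inj_on_subset[OF inj]) (auto simp: Win_def)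
  have sumE: "(\<Sum>k\<in>E N. f (\<mu> k)) = (\<Sum>i\<in>Win I N. f (lam i))" for f :: "real \<Rightarrow> real" and N
    using sum.reindex[OF injE, of f N] sum.reindex[OF injW, of f N] by (simp add: \<mu>E)
  have finE: "finite (E N)" for N
    using finite_imageD[of \<mu> "E N"] injE by (simp add: \<mu>E)
  have cardE: "card (E N) \<le> 2 * N" for N
  proof -
    have "card (E N) = card (Win I N)" using card_image[OF injE, of N] card_image[OF injW, of N] by (simp add: \<mu>E)
    also have "\<dots> \<le> card {- int N<..<int N}" by (rule card_mono) (auto simp: Win_def)
    also have "\<dots> \<le> 2 * N" by simp
    finally show ?thesis .
  qed
  have ev_window: "eventually (\<lambda>N. \<exists>R\<ge>R0. window \<delta> R (E N)) sequentially" if \<delta>: "0 < \<delta>" for \<delta> R0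
  proof -
    obtain K where K: "\<And>k. k \<in> I \<Longrightarrow> real_of_int \<bar>k\<bar> \<le> \<delta> / 4 * \<bar>lam k\<bar> + K"
      using index_le_modulus[OF D subI, of "\<delta> / 4"] \<delta> by auto
    show ?thesis
    proof (rule eventually_sequentiallyI[of "nat \<lceil>max (2 * K) (K + \<delta> / 4 * R0)\<rceil>"])
      fix N assume "nat \<lceil>max (2 * K) (K + \<delta> / 4 * R0)\<rceil> \<le> N"
      then have N: "2 * K \<le> real N" "K + \<delta> / 4 * R0 \<le> real N" by linarith+
      \<comment> \<open>By the choice of \<open>K\<close>, elements of modulus below
        \<open>R\<close> have index below \<open>N\<close> in modulus; and
        \<open>2 * N \<le> 4 * (N - K) = \<delta> * R\<close> since
        \<open>2 * K \<le> N\<close>.\<close>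
      define R where "R = (real N - K) / (\<delta> / 4)"
      have "R0 \<le> R" using N(2) \<delta> by (simp add: R_def le_divide_eq mult_ac)
      moreover have "window \<delta> R (E N)"
        unfolding window_def
      proof (intro conjI finE)
        show "E N \<subseteq> S" by (auto simp: E_def)
        show "{k\<in>S. \<bar>\<mu> k\<bar> < R} \<subseteq> E N"
        proof
          fix k assume k: "k \<in> {k\<in>S. \<bar>\<mu> k\<bar> < R}"
          then have "\<mu> k \<in> lam ` I" using lamI by (auto simp: L_def)
          then obtain i where i: "i \<in> I" "\<mu> k = lam i" by auto
          have "\<delta> / 4 * \<bar>lam i\<bar> < real N - K" using k i \<delta> by (simp add: R_def less_divide_eq mult_ac)
          then have "real_of_int \<bar>i\<bar> < real N" using K[OF i(1)] by linarith
          then have "i \<in> Win I N" using i(1) by (simp add: Win_def)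
          then show "k \<in> E N" using k i by (auto simp: E_def)
        qed
        have "real (card (E N)) \<le> 2 * real N" using cardE[of N] by linarith
        also have "\<dots> \<le> 4 * (real N - K)" using N(1) by simp
        also have "\<dots> = \<delta> * R" using \<delta> by (simp add: R_def)
        finally show "real (card (E N)) \<le> \<delta> * R" .
      qed
      ultimately show "\<exists>R\<ge>R0. window \<delta> R (E N)" by blast
    qed
  qed
  have bal: "balanced I lam"
  proof -
    have "Cauchy (\<lambda>N. \<Sum>i\<in>Win I N. lam i / (1 + (lam i)\<^sup>2))"
    proof (rule metric_CauchyI)
      fix \<epsilon> :: real assume \<epsilon>: "0 < \<epsilon>"
      define \<delta> where "\<delta> = \<epsilon> / 24"
      have \<delta>: "0 < \<delta>" using \<epsilon> by (simp add: \<delta>_def)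
      obtain R0 where R0: "\<forall>R\<ge>R0. \<forall>R'\<ge>R0. \<forall>E E'. window \<delta> R E \<longrightarrow> window \<delta> R' E' \<longrightarrow>
        \<bar>(\<Sum>k\<in>E. \<mu> k / (1 + (\<mu> k)\<^sup>2)) - (\<Sum>k\<in>E'. \<mu> k / (1 + (\<mu> k)\<^sup>2))\<bar> \<le> 12 * \<delta>"
        using balanced_limit[OF \<delta>] by blast
      obtain N0 where N0: "\<forall>N\<ge>N0. \<exists>R\<ge>R0. window \<delta> R (E N)"
        using ev_window[OF \<delta>, of R0] unfolding eventually_sequentially ..
      have "dist (\<Sum>i\<in>Win I N. lam i / (1 + (lam i)\<^sup>2)) (\<Sum>i\<in>Win I N'. lam i / (1 + (lam i)\<^sup>2)) < \<epsilon>"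
        if "N0 \<le> N" "N0 \<le> N'" for N N'
      proof -
        from N0[rule_format, OF that(1)] obtain R where "R0 \<le> R \<and> window \<delta> R (E N)" ..
        then have R: "R0 \<le> R" "window \<delta> R (E N)" by simp_all
        from N0[rule_format, OF that(2)] obtain R' where "R0 \<le> R' \<and> window \<delta> R' (E N')" ..
        then have R': "R0 \<le> R'" "window \<delta> R' (E N')" by simp_all
        have "\<bar>(\<Sum>k\<in>E N. \<mu> k / (1 + (\<mu> k)\<^sup>2)) - (\<Sum>k\<in>E N'. \<mu> k / (1 + (\<mu> k)\<^sup>2))\<bar> \<le> 12 * \<delta>"
          by (rule R0[rule_format, OF R(1) R'(1) R(2) R'(2)])
        also have "12 * \<delta> < \<epsilon>" using \<epsilon> by (simp add: \<delta>_def)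
        finally show ?thesis
          using sumE[of "\<lambda>x. x / (1 + x\<^sup>2)" N] sumE[of "\<lambda>x. x / (1 + x\<^sup>2)" N'] by (simp add: dist_real_def)
      qed
      then show "\<exists>M. \<forall>m\<ge>M. \<forall>n\<ge>M. dist (\<Sum>i\<in>Win I m. lam i / (1 + (lam i)\<^sup>2)) (\<Sum>i\<in>Win I n. lam i / (1 + (lam i)\<^sup>2)) < \<epsilon>"
        by blast
    qed
    then show ?thesis unfolding balanced_def Win_def[symmetric] by (simp add: Cauchy_convergent_iff)
  qed
  have char: "exp (2 * char_seq I lam n) \<le> c * M"
    if n: "n \<in> I" and k: "k \<in> S" "\<mu> k = lam n"
      and c: "(\<lambda>j. 1 / (\<kappa> j * (\<Prod>z\<in>Y j - {e j k}. (e j k - z)\<^sup>2))) \<longlonglongrightarrow> c" for n k c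
  proof -
    define x where "x = lam n"
    have lw: "(\<lambda>N. log_weight lam (Win I N) n) \<longlonglongrightarrow> char_seq I lam n"
      unfolding log_weight_def by (rule char_seq_tendsto[OF D subI bal n])
    have le: "exp (2 * char_seq I lam n) \<le> c * (M * exp (2 * \<delta> * x\<^sup>2 + 12 * \<delta> * \<bar>x\<bar>))" if \<delta>: "0 < \<delta>" for \<delta>
    proof -
      obtain R0 where R0: "\<forall>R\<ge>R0. \<forall>E. window \<delta> R E \<longrightarrow> (\<forall>k\<in>E. eventually (deriv_bound \<delta> E k) sequentially)"
        using deriv_upper_bound[OF \<delta>] by blast
      have evn: "eventually (\<lambda>N. n \<in> Win I N) sequentially"
        by (rule eventually_sequentiallyI[of "nat \<bar>n\<bar> + 1"]) (use n in \<open>auto simp: Win_def\<close>)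
      have "eventually (\<lambda>N. exp (2 * log_weight lam (Win I N) n) \<le> c * (M * exp (2 * \<delta> * x\<^sup>2 + 12 * \<delta> * \<bar>x\<bar>))) sequentially"
        using ev_window[OF \<delta>, of R0] evn
      proof eventually_elim
        case (elim N)
        then obtain R where R: "R0 \<le> R" "window \<delta> R (E N)" by blast
        have kE: "k \<in> E N" using k elim by (auto simp: E_def)
        define \<theta> where "\<theta> y = 2 * \<delta> * y\<^sup>2 + 12 * \<delta> * \<bar>y\<bar>" for y :: real
        define q where "q j = 1 / (\<kappa> j * (\<Prod>z\<in>Y j - {e j k}. (e j k - z)\<^sup>2))" for j
        have "eventually (deriv_bound \<delta> (E N) k) sequentially" using R0 R kE by blast
        then have "eventually (\<lambda>j. (1 + (e j k)\<^sup>2) * (\<Prod>l\<in>E N - {k}. 1 + (e j l)\<^sup>2)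
          \<le> q j * (M * exp (\<theta> (e j k)) * (\<Prod>l\<in>E N - {k}. (e j k - e j l)\<^sup>2))) sequentially"
          using eventually_e_in[of k]
        proof eventually_elim
          case (elim j)
          define d where "d = \<kappa> j * (\<Prod>z\<in>Y j - {e j k}. (e j k - z)\<^sup>2)"
          have d: "1 \<le> d" unfolding d_def using elim by (intro deriv) auto
          have "(1 + (e j k)\<^sup>2) * (\<Prod>l\<in>E N - {k}. 1 + (e j l)\<^sup>2) * d
            \<le> M * exp (\<theta> (e j k)) * (\<Prod>l\<in>E N - {k}. (e j k - e j l)\<^sup>2)"
            using elim unfolding deriv_bound_def d_def \<theta>_def by blast
          then have "(1 + (e j k)\<^sup>2) * (\<Prod>l\<in>E N - {k}. 1 + (e j l)\<^sup>2)
            \<le> M * exp (\<theta> (e j k)) * (\<Prod>l\<in>E N - {k}. (e j k - e j l)\<^sup>2) / d"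
            using d by (simp add: le_divide_eq)
          then show ?case by (simp add: q_def d_def)
        qed
        moreover have "(\<lambda>j. (1 + (e j k)\<^sup>2) * (\<Prod>l\<in>E N - {k}. 1 + (e j l)\<^sup>2)) \<longlonglongrightarrow> (1 + (\<mu> k)\<^sup>2) * (\<Prod>l\<in>E N - {k}. 1 + (\<mu> l)\<^sup>2)"
          by (intro tendsto_intros conv) (auto simp: E_def k)
        moreover have "(\<lambda>j. q j * (M * exp (\<theta> (e j k)) * (\<Prod>l\<in>E N - {k}. (e j k - e j l)\<^sup>2)))
          \<longlonglongrightarrow> c * (M * exp (\<theta> (\<mu> k)) * (\<Prod>l\<in>E N - {k}. (\<mu> k - \<mu> l)\<^sup>2))"
          unfolding \<theta>_def using c[folded q_def] by (intro tendsto_intros conv) (auto simp: E_def k)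
        ultimately have main: "(1 + (\<mu> k)\<^sup>2) * (\<Prod>l\<in>E N - {k}. 1 + (\<mu> l)\<^sup>2) \<le> c * (M * exp (\<theta> (\<mu> k)) * (\<Prod>l\<in>E N - {k}. (\<mu> k - \<mu> l)\<^sup>2))"
          by (intro tendsto_le[of sequentially]) auto
        define Q where "Q = (\<Prod>l\<in>E N - {k}. (\<mu> k - \<mu> l)\<^sup>2)"
        have Q: "0 < Q" unfolding Q_def
        proof (rule prod_pos)
          fix l assume "l \<in> E N - {k}"
          then have "\<mu> k \<noteq> \<mu> l" using inj_\<mu> k by (auto simp: E_def inj_on_def)
          then show "0 < (\<mu> k - \<mu> l)\<^sup>2" by simp
        qed
        have p: "0 < 1 + y\<^sup>2" for y :: real by (simp add: add_pos_nonneg)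
        have "exp (2 * log_weight lam (Win I N) n) = (1 + x\<^sup>2) * ((\<Prod>l\<in>E N - {k}. 1 + (\<mu> l)\<^sup>2) / Q)"
        proof -
          have "\<mu> ` (E N - {k}) = \<mu> ` E N - {\<mu> k}" using inj_on_image_set_diff[OF injE[of N], of "E N" "{k}"] kE by simp
          moreover have "lam ` (Win I N - {n}) = lam ` Win I N - {lam n}" using inj_on_image_set_diff[OF injW[of N], of "Win I N" "{n}"] elim by simp
          ultimately have im: "\<mu> ` (E N - {k}) = lam ` (Win I N - {n})" using \<mu>E k by simp
          have i1: "inj_on \<mu> (E N - {k})" using injE by (rule inj_on_subset) auto
          have i2: "inj_on lam (Win I N - {n})" using injW by (rule inj_on_subset) auto
          have tr: "(\<Prod>l\<in>E N - {k}. f (\<mu> l)) = (\<Prod>i\<in>Win I N - {n}. f (lam i))" for f :: "real \<Rightarrow> real"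
            using prod.reindex[OF i1, of f] prod.reindex[OF i2, of f] by (simp add: im)
          have "exp (2 * log_weight lam (Win I N) n) = exp (ln (1 + x\<^sup>2)) * (\<Prod>i\<in>Win I N - {n}. exp (ln ((1 + (lam i)\<^sup>2) / (lam i - x)\<^sup>2)))"
          proof -
            have two: "2 * (1/2 * z) = z" for z :: real by simp
            have fin: "finite (Win I N - {n})" by simp
            show ?thesis unfolding log_weight_def two exp_add exp_sum[OF fin] x_def ..
          qed
          also have "(\<Prod>i\<in>Win I N - {n}. exp (ln ((1 + (lam i)\<^sup>2) / (lam i - x)\<^sup>2))) = (\<Prod>i\<in>Win I N - {n}. (1 + (lam i)\<^sup>2) / (x - lam i)\<^sup>2)"
          proof (rule prod.cong[OF refl])
            fix i assume i: "i \<in> Win I N - {n}"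
            then have "lam i \<noteq> x" using inj n by (auto simp: inj_on_def x_def Win_def)
            then have "0 < (1 + (lam i)\<^sup>2) / (lam i - x)\<^sup>2" using p by (intro divide_pos_pos) auto
            then show "exp (ln ((1 + (lam i)\<^sup>2) / (lam i - x)\<^sup>2)) = (1 + (lam i)\<^sup>2) / (x - lam i)\<^sup>2"
              by (simp add: power2_commute)
          qed
          also have "\<dots> = (\<Prod>l\<in>E N - {k}. (1 + (\<mu> l)\<^sup>2) / (x - \<mu> l)\<^sup>2)" by (rule tr[symmetric])
          also have "\<dots> = (\<Prod>l\<in>E N - {k}. 1 + (\<mu> l)\<^sup>2) / Q" unfolding prod_dividef Q_def k(2) x_def ..
          finally show ?thesis using p[of x] by simp
        qed
        also have "\<dots> = (1 + x\<^sup>2) * (\<Prod>l\<in>E N - {k}. 1 + (\<mu> l)\<^sup>2) / Q" by simp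
        also have "\<dots> \<le> c * (M * exp (\<theta> x) * Q) / Q"
        proof (rule divide_right_mono)
          have kx: "\<mu> k = x" by (simp add: k(2) x_def)
          show "(1 + x\<^sup>2) * (\<Prod>l\<in>E N - {k}. 1 + (\<mu> l)\<^sup>2) \<le> c * (M * exp (\<theta> x) * Q)"
            by (rule main[folded Q_def, unfolded kx])
          show "0 \<le> Q" using Q by (rule less_imp_le)
        qed
        also have "\<dots> = c * (M * exp (\<theta> x))" using Q by simp
        finally show ?case by (simp add: \<theta>_def)
      qed
      moreover have "(\<lambda>N. exp (2 * log_weight lam (Win I N) n)) \<longlonglongrightarrow> exp (2 * char_seq I lam n)"
        by (intro tendsto_intros lw)
      ultimately show ?thesis by (intro tendsto_upperbound) auto
    qed
    have "((\<lambda>\<delta>. c * (M * exp (2 * \<delta> * x\<^sup>2 + 12 * \<delta> * \<bar>x\<bar>))) \<longlongrightarrow> c * (M * exp (2 * 0 * x\<^sup>2 + 12 * 0 * \<bar>x\<bar>))) (at_right 0)"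
      by (intro tendsto_intros)
    moreover have "eventually (\<lambda>\<delta>. exp (2 * char_seq I lam n) \<le> c * (M * exp (2 * \<delta> * x\<^sup>2 + 12 * \<delta> * \<bar>x\<bar>))) (at_right 0)"
      unfolding eventually_at_right_field using le by (intro exI[of _ 1]) auto
    ultimately have "exp (2 * char_seq I lam n) \<le> c * (M * exp (2 * 0 * x\<^sup>2 + 12 * 0 * \<bar>x\<bar>))"
      by (intro tendsto_lowerbound) auto
    then show ?thesis by simp
  qed
  show thesis
    by (rule that[OF D _ _ bal char]) (use lamI subI sublinear_count_imp_density_0 in \<open>auto simp: L_def\<close>)
qed


section \<open>From non-density to a sequence\<close>

lemma enumerate_by_modulus:
  fixes Y :: "real set"
  assumes "finite Y"
  shows "\<exists>e. bij_betw e {..<card Y} Y \<and> (\<forall>k<card Y. k < card {y\<in>Y. \<bar>y\<bar> \<le> \<bar>e k\<bar>})"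
proof -
  define l where "l = sort_key abs (sorted_list_of_set Y)"
  have l: "distinct l" "set l = Y" "length l = card Y" "sorted (map abs l)"
    using assms by (auto simp: l_def)
  define e where "e k = l ! k" for k
  have bij: "bij_betw e {..<card Y} Y"
    unfolding e_def[abs_def] by (rule bij_betw_nth[OF l(1)]) (simp_all only: l)
  moreover have "\<forall>k<card Y. k < card {y\<in>Y. \<bar>y\<bar> \<le> \<bar>e k\<bar>}"
  proof (intro allI impI)
    fix k assume k: "k < card Y"
    have "e ` {..k} \<subseteq> {y\<in>Y. \<bar>y\<bar> \<le> \<bar>e k\<bar>}"
    proof (rule image_subsetI, rule CollectI, rule conjI)
      fix j assume "j \<in> {..k}"
      then have j: "j \<le> k" by simp
      then have jl: "j < length l" "k < length l" unfolding l(3) using k by linarith+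
      show "e j \<in> Y" unfolding e_def l(2)[symmetric] by (rule nth_mem[OF jl(1)])
      have "map abs l ! j \<le> map abs l ! k"
        by (rule sorted_nth_mono[OF l(4) j]) (simp only: length_map jl(2))
      then show "\<bar>e j\<bar> \<le> \<bar>e k\<bar>" unfolding e_def nth_map[OF jl(1)] nth_map[OF jl(2)] .
    qed
    then have "card (e ` {..k}) \<le> card {y\<in>Y. \<bar>y\<bar> \<le> \<bar>e k\<bar>}" using assms by (intro card_mono) auto
    moreover have "inj_on e {..k}"
      by (rule inj_on_subset[OF bij_betw_imp_inj_on[OF bij]]) (use k in auto)
    ultimately show "k < card {y\<in>Y. \<bar>y\<bar> \<le> \<bar>e k\<bar>}" by (simp add: card_image)
  qed
  ultimately show ?thesis by blast
qed

text \<open>\<open>x / (1 + \<bar>x\<bar>)\<close> maps the line onto \<open>(-1, 1)\<close>, so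
  convergent subsequences always exist, and limits of modulus 1 stand for nodes that escape to
  infinity.\<close>

lemma compactify_tendsto:
  fixes x :: "nat \<Rightarrow> real"
  assumes t: "(\<lambda>n. x n / (1 + \<bar>x n\<bar>)) \<longlonglongrightarrow> T"
  shows "\<bar>T\<bar> < 1 \<Longrightarrow> x \<longlonglongrightarrow> T / (1 - \<bar>T\<bar>)"
    and "\<not> \<bar>T\<bar> < 1 \<Longrightarrow> filterlim (\<lambda>n. \<bar>x n\<bar>) at_top sequentially"
proof -
  define s where "s n = x n / (1 + \<bar>x n\<bar>)" for n
  have abs_s: "\<bar>s n\<bar> = \<bar>x n\<bar> / (1 + \<bar>x n\<bar>)" for n by (simp add: s_def abs_divide)
  have "1 - \<bar>s n\<bar> = 1 / (1 + \<bar>x n\<bar>)" for n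
  proof -
    have "1 + \<bar>x n\<bar> \<noteq> 0" by linarith
    then show ?thesis unfolding abs_s by (simp add: field_simps)
  qed
  then have x: "x n = s n / (1 - \<bar>s n\<bar>)" for n
    using abs_ge_zero[of "x n"] by (simp add: s_def)
  show "x \<longlonglongrightarrow> T / (1 - \<bar>T\<bar>)" if "\<bar>T\<bar> < 1"
  proof -
    have "(\<lambda>n. s n / (1 - \<bar>s n\<bar>)) \<longlonglongrightarrow> T / (1 - \<bar>T\<bar>)"
      using t[folded s_def] that by (intro tendsto_intros) auto
    then show ?thesis by (simp add: x[symmetric])
  qed
  show "filterlim (\<lambda>n. \<bar>x n\<bar>) at_top sequentially" if "\<not> \<bar>T\<bar> < 1"
    unfolding filterlim_at_top_ge[of _ _ 0]
  proof (intro allI impI)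
    fix Z :: real assume Z: "0 \<le> Z"
    have "Z / (1 + Z) < \<bar>T\<bar>"
    proof -
      have "Z / (1 + Z) < 1" using Z by simp
      then show ?thesis using that by linarith
    qed
    then have "eventually (\<lambda>n. Z / (1 + Z) < \<bar>s n\<bar>) sequentially"
      using order_tendstoD(1)[OF tendsto_rabs[OF t[folded s_def]]] by blast
    then show "eventually (\<lambda>n. Z \<le> \<bar>x n\<bar>) sequentially"
    proof eventually_elim
      case (elim n)
      have "0 < 1 + Z" "0 < 1 + \<bar>x n\<bar>" using Z by linarith+
      then have "Z * (1 + \<bar>x n\<bar>) < \<bar>x n\<bar> * (1 + Z)"
        using elim unfolding abs_s by (simp add: divide_less_eq less_divide_eq mult_ac)
      then show ?case by (simp add: algebra_simps)
    qed
  qed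
qed

lemma limit_weight_sum:
  fixes W :: "real \<Rightarrow> ennreal" and w :: "real \<Rightarrow> real"
  assumes lsc: "\<And>a. open {x. a < W x}" and W1: "\<And>x. 1 \<le> W x"
    and A: "finite A" and e: "\<And>k. k \<in> A \<Longrightarrow> (\<lambda>n. e n k) \<longlonglongrightarrow> \<mu> k"
    and c: "\<And>k. k \<in> A \<Longrightarrow> (\<lambda>n. c n k) \<longlonglongrightarrow> c0 k" and c0: "\<And>k. k \<in> A \<Longrightarrow> 0 < c0 k"
    and cn: "\<And>n k. k \<in> A \<Longrightarrow> 0 \<le> c n k"
    and fin: "eventually (\<lambda>n. \<forall>k\<in>A. W (e n k) = ennreal (w (e n k))) sequentially"
    and le: "eventually (\<lambda>n. (\<Sum>k\<in>A. w (e n k) * c n k) \<le> 1) sequentially"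
    and w0: "\<And>x. 0 \<le> w x"
  shows "(\<Sum>k\<in>A. W (\<mu> k) * ennreal (c0 k)) \<le> 1"
proof -
  have key: "(\<Sum>k\<in>A. a k * c0 k) \<le> 1" if a: "\<And>k. k \<in> A \<Longrightarrow> 0 \<le> a k \<and> (a k = 0 \<or> ennreal (a k) < W (\<mu> k))" for a
  proof -
    have "eventually (\<lambda>n. \<forall>k\<in>A. a k = 0 \<or> ennreal (a k) < W (e n k)) sequentially"
      unfolding eventually_ball_finite_distrib[OF A]
    proof
      fix k assume k: "k \<in> A"
      show "eventually (\<lambda>n. a k = 0 \<or> ennreal (a k) < W (e n k)) sequentially"
      proof (cases "a k = 0")
        case False
        then have "\<mu> k \<in> {x. ennreal (a k) < W x}" using a[OF k] by simp
        then have "eventually (\<lambda>n. e n k \<in> {x. ennreal (a k) < W x}) sequentially"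
          by (rule topological_tendstoD[OF e[OF k] lsc])
        then show ?thesis by eventually_elim simp
      qed simp
    qed
    then have "eventually (\<lambda>n. (\<Sum>k\<in>A. a k * c n k) \<le> 1) sequentially" using fin le
    proof eventually_elim
      case (elim n)
      have "(\<Sum>k\<in>A. a k * c n k) \<le> (\<Sum>k\<in>A. w (e n k) * c n k)"
      proof (intro sum_mono mult_right_mono cn)
        fix k assume k: "k \<in> A"
        show "a k \<le> w (e n k)"
        proof (cases "a k = 0")
          case False
          moreover have "a k = 0 \<or> ennreal (a k) < W (e n k)" using elim(1) k by (rule bspec)
          moreover have "W (e n k) = ennreal (w (e n k))" using elim(2) k by (rule bspec)
          ultimately have "ennreal (a k) < ennreal (w (e n k))" by simp
          then show ?thesis using a[OF k] by (simp add: ennreal_less_iff)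
        qed (simp add: w0)
      qed
      then show ?case using elim(3) by linarith
    qed
    moreover have "(\<lambda>n. \<Sum>k\<in>A. a k * c n k) \<longlonglongrightarrow> (\<Sum>k\<in>A. a k * c0 k)" by (intro tendsto_intros c)
    ultimately show ?thesis by (intro tendsto_upperbound) auto
  qed
  \<comment> \<open>Under an infinite weight the number \<open>2 / c0 k\<close> would be admissible
    and contribute 2 on its own.\<close>
  have Wfin: "W (\<mu> k) < \<infinity>" if k: "k \<in> A" for k
  proof (rule ccontr)
    assume "\<not> ?thesis"
    then have top: "W (\<mu> k) = \<infinity>" by (simp add: less_top[symmetric])
    have "(\<Sum>j\<in>A. (if j = k then 2 / c0 k else 0) * c0 j) \<le> 1"
      by (rule key) (use c0[OF k] top in auto)
    moreover have "(\<Sum>j\<in>A. (if j = k then 2 / c0 k else 0) * c0 j) = 2 / c0 k * c0 k"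
      using A k by (simp add: if_distrib[of "\<lambda>x. x * _"] cong: if_cong)
    ultimately show False using c0[OF k] by simp
  qed
  define v where "v k = enn2real (W (\<mu> k))" for k
  have v: "W (\<mu> k) = ennreal (v k)" "1 \<le> v k" if "k \<in> A" for k
  proof -
    show 1: "W (\<mu> k) = ennreal (v k)" using Wfin[OF that] by (simp add: v_def)
    show "1 \<le> v k" using W1[of "\<mu> k"] unfolding 1 by simp
  qed
  \<comment> \<open>\<open>t * v k\<close> is strictly below the weight because \<open>v k\<close>
    is positive; then \<open>t\<close> tends to 1.\<close>
  have "t * (\<Sum>k\<in>A. v k * c0 k) \<le> 1" if t: "0 < t" "t < 1" for t
  proof -
    have "(\<Sum>k\<in>A. (t * v k) * c0 k) \<le> 1"
    proof (rule key)
      fix k assume k: "k \<in> A"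
      have "t * v k < 1 * v k" using t v(2)[OF k] by (intro mult_strict_right_mono) auto
      moreover have "0 \<le> t * v k" using t v(2)[OF k] by simp
      ultimately show "0 \<le> t * v k \<and> (t * v k = 0 \<or> ennreal (t * v k) < W (\<mu> k))"
        by (simp add: v(1)[OF k] ennreal_less_iff)
    qed
    then show ?thesis by (simp add: sum_distrib_left mult.assoc)
  qed
  then have "(\<Sum>k\<in>A. v k * c0 k) \<le> 1" by (rule field_le_mult_one_interval)
  moreover have "(\<Sum>k\<in>A. W (\<mu> k) * ennreal (c0 k)) = ennreal (\<Sum>k\<in>A. v k * c0 k)"
  proof -
    have "(\<Sum>k\<in>A. W (\<mu> k) * ennreal (c0 k)) = (\<Sum>k\<in>A. ennreal (v k * c0 k))"
    proof (rule sum.cong[OF refl])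
      fix k assume k: "k \<in> A"
      then show "W (\<mu> k) * ennreal (c0 k) = ennreal (v k * c0 k)"
        using v[OF k] c0[OF k] by (simp add: ennreal_mult)
    qed
    also have "\<dots> = ennreal (\<Sum>k\<in>A. v k * c0 k)"
    proof (rule sum_ennreal)
      fix k assume k: "k \<in> A"
      then show "0 \<le> v k * c0 k" using v(2)[OF k] c0[OF k] by simp
    qed
    finally show ?thesis .
  qed
  ultimately show ?thesis by simp
qed

lemma sequence_if_far:
  fixes W :: "real \<Rightarrow> ennreal" and w :: "real \<Rightarrow> real" and a :: "real poly"
  assumes lsc: "\<And>b. open {x. b < W x}" and W1: "\<And>x. 1 \<le> W x"
    and Ww: "\<And>x. x \<in> D \<Longrightarrow> W x = ennreal (w x)" and w0: "\<And>x. 0 \<le> w x"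
    and w: "\<And>x. x \<in> D \<Longrightarrow> 1 \<le> w x" and mom: "\<And>k::nat. \<exists>C. \<forall>x\<in>D. \<bar>x\<bar> ^ k \<le> C * w x"
    and a: "a = 1 \<or> a = [:0, 1:]"
    and \<epsilon>: "0 < \<epsilon>" and far: "\<And>p. \<exists>x\<in>D. \<epsilon> * w x < \<bar>poly a x / (1 + x\<^sup>2) - poly p x\<bar>"
  shows "\<exists>I lam. discrete_seq I lam \<and> balanced I lam \<and> upper_density (lam ` I) = 0 \<and>
    (\<Sum>\<^sub>\<infinity>n\<in>I. W (lam n) * ennreal (exp (char_seq I lam n))) < \<infinity>"
proof -
  obtain Y \<kappa> where Y: "\<And>n::nat. finite (Y n)" "\<And>n. card (Y n) = n + 2" "\<And>n. Y n \<subseteq> D"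
    and \<kappa>_def: "\<And>n. \<kappa> n = (\<Sum>x\<in>Y n. w x / \<bar>nodal_deriv (Y n) x\<bar>)"
    and upper: "\<And>n. \<kappa> n * (\<Prod>y\<in>Y n. sqrt (1 + y\<^sup>2)) \<le> 2 / \<epsilon>"
    and count: "\<And>e. 0 < e \<Longrightarrow> \<exists>K. \<forall>n. \<forall>r\<ge>0. real (card {y\<in>Y n. \<bar>y\<bar> < r}) \<le> e * r + K"
    by (rule extremal_nodes[OF w mom a \<epsilon> far]) blast+
  have nd: "0 < \<bar>nodal_deriv (Y n) y\<bar>" if "y \<in> Y n" for n y
    using Y(1) by (auto simp: nodal_deriv_def)
  have le\<kappa>: "w y / \<bar>nodal_deriv (Y n) y\<bar> \<le> \<kappa> n" if y: "y \<in> Y n" for n y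
    unfolding \<kappa>_def by (rule member_le_sum[OF y _ Y(1)]) (use w0 in simp)
  have \<kappa>1: "1 / \<bar>nodal_deriv (Y n) y\<bar> \<le> \<kappa> n" if y: "y \<in> Y n" for n y
  proof -
    have "1 \<le> w y" using w Y(3) y by blast
    then have "1 / \<bar>nodal_deriv (Y n) y\<bar> \<le> w y / \<bar>nodal_deriv (Y n) y\<bar>" by (intro divide_right_mono) auto
    then show ?thesis using le\<kappa>[OF y] by linarith
  qed
  have \<kappa>_pos: "0 < \<kappa> n" for n
  proof -
    have "Y n \<noteq> {}" using Y(2)[of n] by auto
    then obtain y where y: "y \<in> Y n" by blast
    have "0 < 1 / \<bar>nodal_deriv (Y n) y\<bar>" using nd[OF y] by simp
    then show ?thesis using \<kappa>1[OF y] by linarith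
  qed
  have upper2: "(\<kappa> n)\<^sup>2 * (\<Prod>y\<in>Y n. 1 + y\<^sup>2) \<le> (2 / \<epsilon>)\<^sup>2" for n
  proof -
    have "(\<kappa> n * (\<Prod>y\<in>Y n. sqrt (1 + y\<^sup>2)))\<^sup>2 \<le> (2 / \<epsilon>)\<^sup>2"
      by (rule power_mono[OF upper]) (use \<kappa>_pos[of n] in \<open>simp add: prod_nonneg\<close>)
    moreover have "(\<Prod>y\<in>Y n. sqrt (1 + y\<^sup>2))\<^sup>2 = (\<Prod>y\<in>Y n. 1 + y\<^sup>2)"
      unfolding prod_power_distrib by (rule prod.cong[OF refl]) (simp add: add_nonneg_nonneg)
    ultimately show ?thesis by (simp add: power_mult_distrib)
  qed
  have lower2: "(cmod (poly (cpoly p) z) * \<bar>Im z\<bar>)\<^sup>2 \<le> A\<^sup>2 * ((\<kappa> n)\<^sup>2 * (\<Prod>y\<in>Y n. (cmod (z - of_real y))\<^sup>2))"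
    if p: "degree p < n + 2" "Im z \<noteq> 0" and A: "\<And>x. x \<in> D \<Longrightarrow> \<bar>poly p x\<bar> \<le> A * w x" for p z A n
  proof -
    have "cmod (poly (cpoly p) z) * \<bar>Im z\<bar> \<le> A * \<kappa> n * (\<Prod>y\<in>Y n. cmod (z - of_real y))"
      unfolding \<kappa>_def
    proof (rule node_poly_lower_bound[OF Y(1)])
      show "\<bar>poly p x\<bar> \<le> A * w x" if "x \<in> Y n" for x by (rule A[OF subsetD[OF Y(3) that]])
    qed (use p Y(2) in simp_all)
    then have "(cmod (poly (cpoly p) z) * \<bar>Im z\<bar>)\<^sup>2 \<le> (A * \<kappa> n * (\<Prod>y\<in>Y n. cmod (z - of_real y)))\<^sup>2"
      by (rule power_mono) simp
    then show ?thesis by (simp only: power_mult_distrib prod_power_distrib mult.assoc)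
  qed
  have lower: "1 \<le> (\<kappa> n)\<^sup>2 * (\<Prod>y\<in>Y n. 1 + (x - y)\<^sup>2)" for n x
  proof -
    have "(cmod (poly (cpoly 1) (Complex x 1)) * \<bar>Im (Complex x 1)\<bar>)\<^sup>2
      \<le> 1\<^sup>2 * ((\<kappa> n)\<^sup>2 * (\<Prod>y\<in>Y n. (cmod (Complex x 1 - of_real y))\<^sup>2))"
      by (rule lower2) (use w in auto)
    moreover have "(cmod (Complex x 1 - of_real y))\<^sup>2 = 1 + (x - y)\<^sup>2" for y by (simp add: cmod_power2)
    ultimately show ?thesis by (simp add: cpoly_def)
  qed
  have growth: "\<exists>C. \<forall>n\<ge>j. \<forall>t>0. t ^ (2 * j + 2) \<le> C * ((\<kappa> n)\<^sup>2 * (\<Prod>y\<in>Y n. t\<^sup>2 + y\<^sup>2))" for j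
  proof -
    from mom[of j] obtain C where C: "\<forall>x\<in>D. \<bar>x\<bar> ^ j \<le> C * w x" ..
    have "t ^ (2 * j + 2) \<le> C\<^sup>2 * ((\<kappa> n)\<^sup>2 * (\<Prod>y\<in>Y n. t\<^sup>2 + y\<^sup>2))" if n: "j \<le> n" and t: "0 < t" for n t
    proof -
      have "(cmod (poly (cpoly (monom 1 j)) (Complex 0 t)) * \<bar>Im (Complex 0 t)\<bar>)\<^sup>2
        \<le> C\<^sup>2 * ((\<kappa> n)\<^sup>2 * (\<Prod>y\<in>Y n. (cmod (Complex 0 t - of_real y))\<^sup>2))"
      proof (rule lower2)
        have "degree (monom (1::real) j) \<le> j" by (rule degree_monom_le)
        then show "degree (monom (1::real) j) < n + 2" using n by linarith
        show "\<bar>poly (monom 1 j) x\<bar> \<le> C * w x" if "x \<in> D" for x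
          using C that by (simp add: poly_monom power_abs)
      qed (use t in simp)
      moreover have "(cmod (Complex 0 t - of_real y))\<^sup>2 = t\<^sup>2 + y\<^sup>2" for y by (simp add: cmod_power2)
      moreover have "cmod (poly (cpoly (monom 1 j)) (Complex 0 t)) = t ^ j"
      proof -
        have "cpoly (monom 1 j) = monom 1 j" unfolding cpoly_def by (simp add: map_poly_monom)
        moreover have "cmod (Complex 0 t) = t" using t by (simp add: cmod_def)
        ultimately show ?thesis by (simp add: poly_monom norm_power)
      qed
      moreover have "(t ^ j * t)\<^sup>2 = t ^ (2 * j + 2)"
      proof -
        have "t ^ (2 * j + 2) = t ^ (Suc j * 2)" by (simp add: mult.commute)
        then show ?thesis by (simp only: power_mult power_Suc2)
      qed
      ultimately show ?thesis using t by simp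
    qed
    then show ?thesis by blast
  qed
  have deriv_sq: "(\<kappa> n)\<^sup>2 * (\<Prod>z\<in>Y n - {y}. (y - z)\<^sup>2) = (\<kappa> n * \<bar>nodal_deriv (Y n) y\<bar>)\<^sup>2" for n y
    by (simp add: nodal_deriv_def prod_power_distrib power_mult_distrib)
  have deriv1: "1 \<le> \<kappa> n * \<bar>nodal_deriv (Y n) y\<bar>" if y: "y \<in> Y n" for n y
    using \<kappa>1[OF y] nd[OF y] by (simp add: divide_le_eq)
  have "\<forall>n. \<exists>f. bij_betw f {..<card (Y n)} (Y n) \<and> (\<forall>k<card (Y n). k < card {y\<in>Y n. \<bar>y\<bar> \<le> \<bar>f k\<bar>})"
    using enumerate_by_modulus[OF Y(1)] by blast
  from choice[OF this] obtain e where "\<forall>n. bij_betw (e n) {..<card (Y n)} (Y n) \<and> (\<forall>k<card (Y n). k < card {y\<in>Y n. \<bar>y\<bar> \<le> \<bar>e n k\<bar>})" ..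
  then have e: "\<And>n. bij_betw (e n) {..<n + 2} (Y n)" "\<And>n k. k < n + 2 \<Longrightarrow> k < card {y\<in>Y n. \<bar>y\<bar> \<le> \<bar>e n k\<bar>}"
    unfolding Y(2) by simp_all
  have eY: "e n k \<in> Y n" if "k < n + 2" for n k using bij_betwE[OF e(1)] that by blast
  define d where "d n k = 1 / (\<kappa> n * \<bar>nodal_deriv (Y n) (e n k)\<bar>)" for n k
  have d01: "0 \<le> d n k" "d n k \<le> 1" if "k < n + 2" for n k
    using deriv1[OF eY[OF that]] by (simp_all add: d_def)
  \<comment> \<open>One extraction for two families: the flag selects the compactified node or the
    weight \<open>d\<close>, both of modulus at most 1. Missing indices get 0, but each index is
    present for all large \<open>n\<close>.\<close>
  define f where "f n q = (if fst q < n + 2 then (if snd q then e n (fst q) / (1 + \<bar>e n (fst q)\<bar>) else d n (fst q)) else 0)"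
    for n and q :: "nat \<times> bool"
  have "norm (f n q) \<le> 1" for n q
    using d01[of "fst q" n] by (auto simp: f_def abs_divide)
  then obtain r where r: "strict_mono (r :: nat \<Rightarrow> nat)" and lim: "\<And>q. q \<in> UNIV \<Longrightarrow> \<exists>l. (\<lambda>n. f (r n) q) \<longlonglongrightarrow> l"
    by (rule function_convergent_subsequence[of UNIV f 1, rotated]) simp_all
  have "\<forall>q. \<exists>l. (\<lambda>n. f (r n) q) \<longlonglongrightarrow> l" using lim[OF UNIV_I] ..
  from choice[OF this] obtain g where "\<forall>q. (\<lambda>n. f (r n) q) \<longlonglongrightarrow> g q" ..
  then have g: "(\<lambda>n. f (r n) q) \<longlonglongrightarrow> g q" for q ..
  have rn: "n \<le> r n" for n by (rule seq_suble[OF r])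
  have ev: "eventually (\<lambda>n. k < r n + 2) sequentially" for k
  proof (rule eventually_sequentiallyI[of k])
    show "k < r n + 2" if "k \<le> n" for n using that rn[of n] by linarith
  qed
  have T: "(\<lambda>n. e (r n) k / (1 + \<bar>e (r n) k\<bar>)) \<longlonglongrightarrow> g (k, True)" for k
    by (rule Lim_transform_eventually[OF g]) (use ev[of k] in eventually_elim, simp add: f_def)
  have c: "(\<lambda>n. d (r n) k) \<longlonglongrightarrow> g (k, False)" for k
    by (rule Lim_transform_eventually[OF g]) (use ev[of k] in eventually_elim, simp add: f_def)
  define S where "S = {k. \<bar>g (k, True)\<bar> < 1}"
  define \<mu> where "\<mu> k = g (k, True) / (1 - \<bar>g (k, True)\<bar>)" for k
  define c0 where "c0 k = g (k, False)" for k
  have conv: "(\<lambda>n. e (r n) k) \<longlonglongrightarrow> \<mu> k" if "k \<in> S" for k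
    unfolding \<mu>_def by (rule compactify_tendsto(1)[OF T]) (use that in \<open>simp add: S_def\<close>)
  interpret node_limit "\<lambda>n. Y (r n)" "\<lambda>n. e (r n)" "\<lambda>n. r n + 2" "\<lambda>n. (\<kappa> (r n))\<^sup>2" "(2 / \<epsilon>)\<^sup>2" S \<mu>
  proof
    show "n \<le> r n + 2" for n using rn[of n] by linarith
    show "0 < (\<kappa> (r n))\<^sup>2" for n using \<kappa>_pos[of "r n"] by simp
    show "\<exists>K. \<forall>n. \<forall>ra\<ge>0. real (card {y\<in>Y (r n). \<bar>y\<bar> < ra}) \<le> \<delta> * ra + K" if "0 < \<delta>" for \<delta>
    proof -
      from count[OF that] obtain K where "\<forall>n. \<forall>r\<ge>0. real (card {y\<in>Y n. \<bar>y\<bar> < r}) \<le> \<delta> * r + K" ..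
      then show ?thesis by blast
    qed
    show "filterlim (\<lambda>n. \<bar>e (r n) k\<bar>) at_top sequentially" if "k \<notin> S" for k
      by (rule compactify_tendsto(2)[OF T]) (use that in \<open>simp add: S_def\<close>)
    show "1 \<le> (\<kappa> (r n))\<^sup>2 * (\<Prod>z\<in>Y (r n) - {y}. (y - z)\<^sup>2)" if "y \<in> Y (r n)" for n y
      unfolding deriv_sq by (rule one_le_power[OF deriv1[OF that]])
    show "\<exists>C. \<forall>n\<ge>j. \<forall>t>0. t ^ (2 * j + 2) \<le> C * ((\<kappa> (r n))\<^sup>2 * (\<Prod>y\<in>Y (r n). t\<^sup>2 + y\<^sup>2))" for j
    proof -
      from growth[of j] obtain C where C: "\<forall>n\<ge>j. \<forall>t>0. t ^ (2 * j + 2) \<le> C * ((\<kappa> n)\<^sup>2 * (\<Prod>y\<in>Y n. t\<^sup>2 + y\<^sup>2))" ..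
      have "\<forall>n\<ge>j. \<forall>t>0. t ^ (2 * j + 2) \<le> C * ((\<kappa> (r n))\<^sup>2 * (\<Prod>y\<in>Y (r n). t\<^sup>2 + y\<^sup>2))"
        by (intro allI impI C[rule_format] order_trans[OF _ rn])
      then show ?thesis ..
    qed
  qed (rule e upper2 lower conv; assumption?)+
  obtain I lam where D: "discrete_seq I lam" and im: "lam ` I = \<mu> ` S" and dens: "upper_density (lam ` I) = 0"
    and bal: "balanced I lam"
    and char: "\<And>n k c. n \<in> I \<Longrightarrow> k \<in> S \<Longrightarrow> \<mu> k = lam n \<Longrightarrow>
      (\<lambda>j. 1 / ((\<kappa> (r j))\<^sup>2 * (\<Prod>z\<in>Y (r j) - {e (r j) k}. (e (r j) k - z)\<^sup>2))) \<longlonglongrightarrow> c \<Longrightarrow>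
      exp (2 * char_seq I lam n) \<le> c * (2 / \<epsilon>)\<^sup>2"
    by (rule limit_sequence) blast
  have "\<forall>n\<in>I. \<exists>k\<in>S. \<mu> k = lam n"
  proof
    fix n assume "n \<in> I"
    then have "lam n \<in> \<mu> ` S" using im by blast
    then show "\<exists>k\<in>S. \<mu> k = lam n" by auto
  qed
  from bchoice[OF this[unfolded Bex_def]] obtain \<pi> where "\<forall>n\<in>I. \<pi> n \<in> S \<and> \<mu> (\<pi> n) = lam n" ..
  then have \<pi>: "\<pi> n \<in> S" "\<mu> (\<pi> n) = lam n" if "n \<in> I" for n using that by simp_all
  have exp_le: "exp (2 * char_seq I lam n) \<le> (c0 (\<pi> n))\<^sup>2 * (2 / \<epsilon>)\<^sup>2" if n: "n \<in> I" for n
  proof (rule char[OF n \<pi>(1)[OF n] \<pi>(2)[OF n]])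
    have "1 / ((\<kappa> (r j))\<^sup>2 * (\<Prod>z\<in>Y (r j) - {e (r j) k}. (e (r j) k - z)\<^sup>2)) = (d (r j) k)\<^sup>2" for j k
      unfolding deriv_sq d_def by (simp add: power_divide)
    then show "(\<lambda>j. 1 / ((\<kappa> (r j))\<^sup>2 * (\<Prod>z\<in>Y (r j) - {e (r j) (\<pi> n)}. (e (r j) (\<pi> n) - z)\<^sup>2))) \<longlonglongrightarrow> (c0 (\<pi> n))\<^sup>2"
      unfolding c0_def using c by (simp only:) (intro tendsto_power c)
  qed
  have c0nn: "0 \<le> c0 k" for k
    unfolding c0_def
  proof (rule tendsto_lowerbound[OF c])
    show "eventually (\<lambda>n. 0 \<le> d (r n) k) sequentially" using ev[of k] by (rule eventually_mono) (rule d01)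
  qed simp
  \<comment> \<open>A vanishing limit weight is impossible, since up to a constant it dominates
    \<open>exp (char_seq)\<close>. This positivity is what \<open>limit_weight_sum\<close>
    requires.\<close>
  have c0pos: "0 < c0 (\<pi> n)" if n: "n \<in> I" for n
  proof (rule ccontr)
    assume "\<not> ?thesis"
    then have "c0 (\<pi> n) = 0" using c0nn[of "\<pi> n"] by linarith
    then have "exp (2 * char_seq I lam n) \<le> 0" using exp_le[OF n] by simp
    then show False using exp_gt_zero[of "2 * char_seq I lam n"] by linarith
  qed
  have exp_le1: "exp (char_seq I lam n) \<le> 2 / \<epsilon> * c0 (\<pi> n)" if n: "n \<in> I" for n
  proof -
    have "(exp (char_seq I lam n))\<^sup>2 = exp (2 * char_seq I lam n)"
      using exp_double[of "char_seq I lam n"] by simp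
    also have "\<dots> \<le> (2 / \<epsilon> * c0 (\<pi> n))\<^sup>2" using exp_le[OF n] by (simp only: power_mult_distrib mult.commute)
    finally show ?thesis by (rule power2_le_imp_le) (use \<epsilon> c0pos[OF n] in simp)
  qed
  have fin_sum: "(\<Sum>k\<in>A. W (\<mu> k) * ennreal (c0 k)) \<le> 1"
    if A: "finite A" "A \<subseteq> S" and pos: "\<And>k. k \<in> A \<Longrightarrow> 0 < c0 k" for A
  proof (rule limit_weight_sum[where W = W and w = w and e = "\<lambda>n. e (r n)" and c = "\<lambda>n k. \<bar>d (r n) k\<bar>"])
    show "(\<lambda>n. e (r n) k) \<longlonglongrightarrow> \<mu> k" if "k \<in> A" for k using A that by (intro conv) auto
    show "(\<lambda>n. \<bar>d (r n) k\<bar>) \<longlonglongrightarrow> c0 k" if "k \<in> A" for k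
      using tendsto_rabs[OF c[of k]] pos[OF that] by (simp add: c0_def)
    have evA: "eventually (\<lambda>n. \<forall>k\<in>A. k < r n + 2) sequentially"
      unfolding eventually_ball_finite_distrib[OF A(1)] using ev by blast
    then show "eventually (\<lambda>n. \<forall>k\<in>A. W (e (r n) k) = ennreal (w (e (r n) k))) sequentially"
    proof eventually_elim
      case (elim n)
      show ?case
      proof
        fix k assume "k \<in> A"
        then have "k < r n + 2" using elim by blast
        from eY[OF this] Y(3) have "e (r n) k \<in> D" by blast
        then show "W (e (r n) k) = ennreal (w (e (r n) k))" by (rule Ww)
      qed
    qed
    show "eventually (\<lambda>n. (\<Sum>k\<in>A. w (e (r n) k) * \<bar>d (r n) k\<bar>) \<le> 1) sequentially"
      using evA
    proof eventually_elim
      case (elim n)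
      let ?n = "r n"
      have sub: "A \<subseteq> {..<?n + 2}" using elim by blast
      have "(\<Sum>k\<in>A. w (e ?n k) * \<bar>d ?n k\<bar>) \<le> (\<Sum>k\<in>{..<?n + 2}. w (e ?n k) * \<bar>d ?n k\<bar>)"
        by (rule sum_mono2[OF _ sub]) (use w0 in simp_all)
      also have "\<dots> = (\<Sum>k\<in>{..<?n + 2}. (\<lambda>y. w y / \<bar>nodal_deriv (Y ?n) y\<bar> / \<kappa> ?n) (e ?n k))"
        using \<kappa>_pos[of ?n] by (intro sum.cong[OF refl]) (simp add: d_def abs_mult mult.commute)
      also have "\<dots> = (\<Sum>y\<in>Y ?n. w y / \<bar>nodal_deriv (Y ?n) y\<bar> / \<kappa> ?n)"
        by (rule sum.reindex_bij_betw[OF e(1)])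
      also have "\<dots> = \<kappa> ?n / \<kappa> ?n" unfolding sum_divide_distrib[symmetric] \<kappa>_def[symmetric] ..
      also have "\<dots> = 1" using \<kappa>_pos[of ?n] by simp
      finally show ?case .
    qed
  qed (use lsc W1 A pos w0 in auto)
  have inj: "inj_on \<pi> I"
  proof (rule inj_onI)
    fix i j assume ij: "i \<in> I" "j \<in> I" "\<pi> i = \<pi> j"
    then have "lam i = lam j" using \<pi>(2)[OF ij(1)] \<pi>(2)[OF ij(2)] by simp
    moreover have "inj_on lam I" using D by (auto simp: discrete_seq_def intro: strict_mono_on_imp_inj_on)
    ultimately show "i = j" using ij by (auto dest: inj_onD)
  qed
  have "(\<Sum>n\<in>F. W (lam n) * ennreal (exp (char_seq I lam n))) \<le> ennreal (2 / \<epsilon>)" if F: "finite F" "F \<subseteq> I" for F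
  proof -
    have "(\<Sum>n\<in>F. W (lam n) * ennreal (exp (char_seq I lam n)))
      \<le> (\<Sum>n\<in>F. ennreal (2 / \<epsilon>) * (W (\<mu> (\<pi> n)) * ennreal (c0 (\<pi> n))))"
    proof (rule sum_mono)
      fix n assume "n \<in> F"
      then have n: "n \<in> I" using F by blast
      have "ennreal (exp (char_seq I lam n)) \<le> ennreal (2 / \<epsilon>) * ennreal (c0 (\<pi> n))"
        using exp_le1[OF n] \<epsilon> c0pos[OF n] by (subst ennreal_mult[symmetric]) (auto intro: ennreal_leI)
      then have "W (lam n) * ennreal (exp (char_seq I lam n)) \<le> W (lam n) * (ennreal (2 / \<epsilon>) * ennreal (c0 (\<pi> n)))"
        by (intro mult_left_mono) auto
      then show "W (lam n) * ennreal (exp (char_seq I lam n)) \<le> ennreal (2 / \<epsilon>) * (W (\<mu> (\<pi> n)) * ennreal (c0 (\<pi> n)))"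
        unfolding \<pi>(2)[OF n] by (simp only: mult_ac)
    qed
    also have "\<dots> = ennreal (2 / \<epsilon>) * (\<Sum>n\<in>F. W (\<mu> (\<pi> n)) * ennreal (c0 (\<pi> n)))"
      by (rule sum_distrib_left[symmetric])
    also have "(\<Sum>n\<in>F. W (\<mu> (\<pi> n)) * ennreal (c0 (\<pi> n))) = (\<Sum>k\<in>\<pi> ` F. W (\<mu> k) * ennreal (c0 k))"
      using inj_on_subset[OF inj F(2)] by (simp add: sum.reindex)
    also have "ennreal (2 / \<epsilon>) * (\<Sum>k\<in>\<pi> ` F. W (\<mu> k) * ennreal (c0 k)) \<le> ennreal (2 / \<epsilon>) * 1"
    proof (rule mult_left_mono[OF fin_sum])
      show "\<pi> ` F \<subseteq> S" using F \<pi>(1) by blast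
      show "0 < c0 k" if "k \<in> \<pi> ` F" for k using that F c0pos by blast
    qed (use F in simp_all)
    finally show ?thesis by simp
  qed
  then have "(\<Sum>\<^sub>\<infinity>n\<in>I. W (lam n) * ennreal (exp (char_seq I lam n))) \<le> ennreal (2 / \<epsilon>)"
    by (subst nonneg_infsum_complete) (auto intro!: SUP_least)
  also have "\<dots> < \<infinity>" by simp
  finally show ?thesis using D bal dens by blast
qed

section \<open>The weight on the set where it is finite, and the return to density in the weighted
  space\<close>

lemma weight_real_part:
  assumes "weight W" "W x < \<infinity>"
  shows "W x = ennreal (enn2real (W x))" "1 \<le> enn2real (W x)"
proof -
  show 1: "W x = ennreal (enn2real (W x))" using assms(2) by simp
  have "1 \<le> W x" using assms(1) by (simp add: weight_def)
  then have "1 \<le> ennreal (enn2real (W x))" using 1 by (rule subst[rotated])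
  then show "1 \<le> enn2real (W x)" by simp
qed

lemma weight_dominates_small:
  assumes W: "weight W" and f: "((\<lambda>x. ennreal (f x) / W x) \<longlongrightarrow> 0) at_infinity" and f0: "\<And>x. 0 \<le> f x" and \<epsilon>: "0 < \<epsilon>"
  shows "\<exists>R. \<forall>x\<in>{x. W x < \<infinity>}. R \<le> \<bar>x\<bar> \<longrightarrow> f x \<le> \<epsilon> * enn2real (W x)"
proof -
  have "eventually (\<lambda>x. ennreal (f x) / W x < ennreal \<epsilon>) at_infinity"
    using order_tendstoD(2)[OF f] \<epsilon> by simp
  then obtain R where R: "\<forall>x. R \<le> norm x \<longrightarrow> ennreal (f x) / W x < ennreal \<epsilon>"
    unfolding eventually_at_infinity ..
  have "f x \<le> \<epsilon> * enn2real (W x)" if x: "W x < \<infinity>" "R \<le> \<bar>x\<bar>" for x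
  proof -
    define w where "w = enn2real (W x)"
    have w: "W x = ennreal w" "1 \<le> w" unfolding w_def by (rule weight_real_part[OF W x(1)])+
    have "ennreal (f x) / ennreal w < ennreal \<epsilon>" unfolding w(1)[symmetric] using R x(2) by simp
    then have "ennreal (f x / w) < ennreal \<epsilon>" using w(2) f0[of x] by (simp add: divide_ennreal)
    then have "f x / w < \<epsilon>" using \<epsilon> f0[of x] w(2) by (simp add: ennreal_less_iff)
    then have "f x \<le> \<epsilon> * w" using w(2) by (simp add: divide_less_eq)
    then show ?thesis by (simp add: w_def)
  qed
  then show ?thesis by blast
qed

lemma weight_dominates_powers:
  assumes W: "weight W"
  shows "\<exists>C. \<forall>x\<in>{x. W x < \<infinity>}. \<bar>x\<bar> ^ k \<le> C * enn2real (W x)"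
proof -
  have "((\<lambda>x. ennreal (\<bar>x\<bar> ^ k) / W x) \<longlongrightarrow> 0) at_infinity" using W by (simp add: weight_def)
  from weight_dominates_small[OF W this, of 1] obtain R
    where R: "\<forall>x\<in>{x. W x < \<infinity>}. R \<le> \<bar>x\<bar> \<longrightarrow> \<bar>x\<bar> ^ k \<le> 1 * enn2real (W x)" by auto
  define C where "C = max 1 (\<bar>R\<bar> ^ k)"
  have "\<bar>x\<bar> ^ k \<le> C * enn2real (W x)" if x: "W x < \<infinity>" for x
  proof (cases "R \<le> \<bar>x\<bar>")
    case True
    have "1 * enn2real (W x) \<le> C * enn2real (W x)" by (intro mult_right_mono) (auto simp: C_def)
    moreover have "\<bar>x\<bar> ^ k \<le> 1 * enn2real (W x)" using R x True by blast
    ultimately show ?thesis by linarith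
  next
    case False
    have "\<bar>x\<bar> ^ k \<le> \<bar>R\<bar> ^ k" using False by (intro power_mono) auto
    also have "\<dots> \<le> C * 1" by (simp add: C_def)
    also have "\<dots> \<le> C * enn2real (W x)" using weight_real_part(2)[OF W x] by (intro mult_left_mono) (auto simp: C_def)
    finally show ?thesis .
  qed
  then show ?thesis by blast
qed

lemma dense_if_resolvents_approximable:
  assumes W: "weight W"
    and u: "poly_approx {x. W x < \<infinity>} (\<lambda>x. enn2real (W x)) (\<lambda>x. 1 / (1 + x\<^sup>2))"
    and v: "poly_approx {x. W x < \<infinity>} (\<lambda>x. enn2real (W x)) (\<lambda>x. x / (1 + x\<^sup>2))"
  shows "polys_dense W"
  unfolding polys_dense_iff[OF W]
proof (intro ballI allI impI)
  fix g and e :: real assume g: "g \<in> CW_fun W" and e: "0 < e"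
  define w where "w x = enn2real (W x)" for x
  define D where "D = {x. W x < \<infinity>}"
  have w: "W x = ennreal (w x)" "1 \<le> w x" if "x \<in> D" for x
    using weight_real_part[OF W, of x] that by (simp_all add: w_def D_def)
  have cont: "continuous_on UNIV g" and lim: "((\<lambda>x. ennreal (cmod (g x)) / W x) \<longlongrightarrow> 0) at_infinity"
    using g by (simp_all add: CW_fun_def)
  have small: "\<exists>R. \<forall>x\<in>D. R \<le> \<bar>x\<bar> \<longrightarrow> cmod (g x) \<le> \<epsilon> * w x" if "0 < \<epsilon>" for \<epsilon>
    unfolding D_def w_def by (rule weight_dominates_small[OF W lim _ that]) simp
  have approx: "poly_approx D w f" if f: "continuous_on UNIV f" "\<And>x. \<bar>f x\<bar> \<le> cmod (g x)" for f
  proof (rule poly_approx_continuous[OF w(2) u[folded D_def w_def] v[folded D_def w_def] f(1)])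
    fix \<epsilon> :: real assume "0 < \<epsilon>"
    from small[OF this] obtain R where R: "\<forall>x\<in>D. R \<le> \<bar>x\<bar> \<longrightarrow> cmod (g x) \<le> \<epsilon> * w x" ..
    have "\<bar>f x\<bar> \<le> \<epsilon> * w x" if "x \<in> D" "R \<le> \<bar>x\<bar>" for x
      using order_trans[OF f(2) R[rule_format, OF that]] .
    then show "\<exists>R. \<forall>x\<in>D. R \<le> \<bar>x\<bar> \<longrightarrow> \<bar>f x\<bar> \<le> \<epsilon> * w x" by blast
  qed
  have "poly_approx D w (\<lambda>x. Re (g x))" "poly_approx D w (\<lambda>x. Im (g x))"
    using cont by (auto intro!: approx continuous_intros abs_Re_le_cmod abs_Im_le_cmod)
  moreover have e4: "0 < e / 4" using e by simp
  ultimately obtain p q where p: "\<forall>x\<in>D. \<bar>Re (g x) - poly p x\<bar> \<le> e / 4 * w x"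
    and q: "\<forall>x\<in>D. \<bar>Im (g x) - poly q x\<bar> \<le> e / 4 * w x"
    unfolding poly_approx_def by blast
  define P where "P = cpoly p + smult \<i> (cpoly q)"
  have P: "poly_fun P x = Complex (poly p x) (poly q x)" for x
    by (simp add: P_def poly_fun_def poly_cpoly_of_real complex_eq_iff)
  have "ennreal (cmod (g x - poly_fun P x)) / W x \<le> ennreal (e / 2)" for x
  proof (cases "x \<in> D")
    case True
    have "cmod (g x - poly_fun P x) \<le> \<bar>Re (g x) - poly p x\<bar> + \<bar>Im (g x) - poly q x\<bar>"
      using cmod_le[of "g x - poly_fun P x"] by (simp add: P)
    also have "\<dots> \<le> e / 4 * w x + e / 4 * w x" using p q True by (intro add_mono) auto
    also have "\<dots> = e / 2 * w x" by simp
    finally have "cmod (g x - poly_fun P x) / w x \<le> e / 2" using w(2)[OF True] by (simp add: divide_le_eq)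
    then have "ennreal (cmod (g x - poly_fun P x) / w x) \<le> ennreal (e / 2)" by (rule ennreal_leI)
    then show ?thesis using w(2)[OF True] unfolding w(1)[OF True] by (subst divide_ennreal) auto
  next
    case False
    then have "W x = \<infinity>" by (simp add: D_def less_top[symmetric])
    then show ?thesis by (simp add: divide_ennreal_def)
  qed
  then have "Wnorm W (\<lambda>x. g x - poly_fun P x) \<le> ennreal (e / 2)"
    unfolding Wnorm_def by (intro SUP_least)
  also have "\<dots> < ennreal e" using e by (simp add: ennreal_less_iff)
  finally show "\<exists>p. Wnorm W (\<lambda>x. g x - poly_fun p x) < ennreal e" by blast
qed

lemma sequence_if_not_dense:
  assumes W: "weight W" and nd: "\<not> polys_dense W"
  shows "\<exists>I lam. discrete_seq I lam \<and> balanced I lam \<and> upper_density (lam ` I) = 0 \<and>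
    (\<Sum>\<^sub>\<infinity>n\<in>I. W (lam n) * ennreal (exp (char_seq I lam n))) < \<infinity>"
proof -
  define D where "D = {x. W x < \<infinity>}"
  define w where "w x = enn2real (W x)" for x
  have "\<exists>a \<epsilon>. (a = 1 \<or> a = [:0, 1:]) \<and> 0 < \<epsilon> \<and>
    (\<forall>p. \<exists>x\<in>D. \<epsilon> * w x < \<bar>poly a x / (1 + x\<^sup>2) - poly p x\<bar>)"
  proof (rule ccontr)
    assume neg: "\<not> ?thesis"
    have "poly_approx D w (\<lambda>x. poly a x / (1 + x\<^sup>2))" if "a = 1 \<or> a = [:0, 1:]" for a
      unfolding poly_approx_def
    proof (intro allI impI)
      fix \<epsilon> :: real assume "0 < \<epsilon>"
      with neg that have "\<not> (\<forall>p. \<exists>x\<in>D. \<epsilon> * w x < \<bar>poly a x / (1 + x\<^sup>2) - poly p x\<bar>)" by blast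
      then show "\<exists>p. \<forall>x\<in>D. \<bar>poly a x / (1 + x\<^sup>2) - poly p x\<bar> \<le> \<epsilon> * w x" by (simp add: not_less)
    qed
    from this[of 1] this[of "[:0, 1:]"] have "polys_dense W"
      unfolding D_def w_def by (intro dense_if_resolvents_approximable[OF W]) simp_all
    with nd show False ..
  qed
  then obtain a \<epsilon> where a: "a = 1 \<or> a = [:0, 1:]" and \<epsilon>: "0 < \<epsilon>"
    and far: "\<And>p. \<exists>x\<in>D. \<epsilon> * w x < \<bar>poly a x / (1 + x\<^sup>2) - poly p x\<bar>" by blast
  show ?thesis
  proof (rule sequence_if_far[OF _ _ _ _ _ _ a \<epsilon> far])
    show "open {x. b < W x}" for b using W by (simp add: weight_def)
    show "1 \<le> W x" for x using W by (simp add: weight_def)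
    show "0 \<le> w x" for x by (simp add: w_def)
    show "W x = ennreal (w x)" "1 \<le> w x" if "x \<in> D" for x
      using weight_real_part[OF W, of x] that by (simp_all add: w_def D_def)
    show "\<exists>C. \<forall>x\<in>D. \<bar>x\<bar> ^ k \<le> C * w x" for k
      unfolding D_def w_def by (rule weight_dominates_powers[OF W])
  qed
qed

theorem theorem3p2:
  fixes W :: "real \<Rightarrow> ennreal"
  assumes "weight W"
  shows "\<not> polys_dense W \<longleftrightarrow>
    (\<exists>(I :: int set) (lam :: int \<Rightarrow> real).
       discrete_seq I lam \<and> balanced I lam \<and> upper_density (lam ` I) = 0 \<and>
       (\<Sum>\<^sub>\<infinity>n\<in>I. W (lam n) * ennreal (exp (char_seq I lam n))) < \<infinity>)"
proof
  show "\<exists>I lam. discrete_seq I lam \<and> balanced I lam \<and> upper_density (lam ` I) = 0 \<and>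
    (\<Sum>\<^sub>\<infinity>n\<in>I. W (lam n) * ennreal (exp (char_seq I lam n))) < \<infinity>" if "\<not> polys_dense W"
    by (rule sequence_if_not_dense[OF assms that])
qed (auto dest: not_dense_if_summable[OF assms])

end
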